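(* Let $\alpha\in(-\gamma,1)$, and set $v_\alpha:=\frac{\gamma+\alpha}{\sqrt2}\in(0,1)$ and $C^{(1)}:=\frac12\int_{\mathbb R}e^{-\sqrt2\gamma z}w(z)^2\,dz\in(0,\infty)$. Then, as $t\to\infty$, $$\mathbb P(M_t\le\sqrt2\alpha t)\sim C^{(1)}(v_\alpha t)^{\frac{3\gamma}{2}}e^{-2\gamma(1-\alpha)t}.$$ Furthermore, conditioned on $\{M_t\le\sqrt2\alpha t\}$, as $t\to\infty$, $$\left(\frac{\tau-\frac{1-\alpha}{\sqrt2}t}{\sqrt{t\,\frac{1-\alpha}{4\sqrt2}}},\ X_\emptyset(\tau)-(\sqrt2\alpha t-m_{t-\tau}),\ M_t-\sqrt2\alpha t\right)\Longrightarrow(\xi,-\chi,-E),$$ where $\xi$ and $(\chi,E)$ are independent, $\xi$ is a standard Gaussian random variable, $E$ is an exponential random variable with parameter $\sqrt2\gamma$, and the joint distribution of $(\chi,E)$ is given by $$\mathbb P(\chi\le x,E\ge y)=\frac{1}{2C^{(1)}}e^{-\sqrt2\gamma y}\int_{-\infty}^{x-y}e^{-\sqrt2\gamma z}w(z)^2\,dz,\qquad x\in\mathbb R,\ y\in\mathbb R_+.$$ Moreover, jointly with the preceding convergence (and still conditionally on $\{M_t\le\sqrt2\alpha t\}$), $$\mathcal E_t(\alpha)\Longrightarrow\mathcal E^-:=\sum_{x\in\mathcal E_1\cup\mathcal E_2}\delta_{x-\chi},$$ where, given $\chi$, $\mathcal E_1$ and $\mathcal E_2$ are i.i.d. point processes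 distributed as $\mathcal E$ conditioned on $\{\max\mathcal E\le\chi\}$. (In the joint limit, $\xi$ is independent of $(\chi,E,\mathcal E^-)$ and $E=-\max\mathcal E^-$.)
   Context: Standard binary branching Brownian motion on $\mathbb R$: at time $0$ there is one particle $\emptyset$ at the origin, moving as a standard Brownian motion; after an independent exponential time of parameter $1$ it dies and gives birth to $2$ children at its current position, which move and reproduce independently in the same way. $N(t)$ is the set of particles alive at time $t$; for $u\in N(t)$ and $s\le t$, $X_u(s)$ is the position at time $s$ of $u$ or of its ancestor alive at time $s$. $M_t:=\max\{X_u(t):u\in N(t)\}$. $\tau:=\inf\{t\ge0:\#N(t)\ge2\}$ is the first branching time and $X_\emptyset(\tau)$ is the position of the initial particle at that time. Constants and functions: $\gamma:=\sqrt2-1$; $m_t:=\sqrt2t-\frac{3}{2\sqrt2}\log t$ for $t>0$ (the value assigned to $m_{t-\tau}$ on $\{\tau\ge t\}$ is arbitrary); $w(z):=\lim_{t\to\infty}\mathbb P(M_t\le m_t+z)$ for $z\in\mathbb R$ (the limit exists by Bramson's theorem). Point processes: $\mathcal E_t(\alpha):=\sum_{u\in N(t)}\delta_{X_u(t)-\sqrt2\alpha t}$. $\mathcal E$ is the limiting extremal process of the unconditioned branching Brownian motion, i.e. the point process such that $\left(\sum_{u\in N(t)}\delta_{X_u(t)-m_t},\,M_t-m_t\right)$ converges in law to $(\mathcal E,\max\mathcal E)$ as $t\to\infty$ (existence is known); in particular $\mathbb P(\max\mathcal E\le z)=w(z)$. Here $\max$ of a point process is the position of its largest atom, $\mathcal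 E_1\cup\mathcal E_2$ is taken with multiplicity, point processes carry the vague topology, $\Longrightarrow$ is convergence in distribution, $f(t)\sim g(t)$ means $f(t)/g(t)\to1$, and $\mathbb R_+=[0,\infty)$. *)

theory Defs
  imports "HOL-Probability.Probability"
begin

section \<open>Point measures on the line and convergence in law\<close>

text \<open>A locally finite integer-valued measure on the real line is encoded by the multiplicities of
  its atoms.\<close>

typedef point_measure = "{\<mu> :: real \<Rightarrow> nat. \<forall>a b. finite {x \<in> {a..b}. \<mu> x \<noteq> 0}}"
  morphisms mult Abs_point_measure
  by (rule exI[of _ "\<lambda>_. 0"]) simp

setup_lifting type_definition_point_measure

lift_definition point_sum :: "'i set \<Rightarrow> ('i \<Rightarrow> real) \<Rightarrow> point_measure"
    \<comment> \<open>the sum of the Dirac masses at \<open>f i\<close>, \<open>i \<in> I\<close>; meant for finite \<open>I\<close>\<close>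
  is "\<lambda>I f x. if finite I then card {i \<in> I. f i = x} else 0"
  subgoal for I f a b
    by (rule finite_subset[of _ "if finite I then f ` I else {}"]) (auto simp: card_gt_0_iff)
  done

lift_definition point_union :: "point_measure \<Rightarrow> point_measure \<Rightarrow> point_measure"
  is "\<lambda>\<mu> \<nu> x. \<mu> x + \<nu> x"
  subgoal for \<mu> \<nu> a b
    by (rule finite_subset[of _ "{x \<in> {a..b}. \<mu> x \<noteq> 0} \<union> {x \<in> {a..b}. \<nu> x \<noteq> 0}"]) auto
  done

lift_definition point_shift :: "real \<Rightarrow> point_measure \<Rightarrow> point_measure"
    \<comment> \<open>moves every atom \<open>x\<close> to \<open>x + c\<close>\<close>
  is "\<lambda>c \<mu> x. \<mu> (x - c)"
  subgoal for c \<mu> a b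
    by (rule finite_subset[of _ "(\<lambda>x. x + c) ` {x \<in> {a-c..b-c}. \<mu> x \<noteq> 0}"])
      (auto simp: image_iff intro!: exI[of _ "_ - c"])
  done

definition point_max :: "point_measure \<Rightarrow> real" where
  "point_max \<mu> = (GREATEST x. mult \<mu> x \<noteq> 0)"

definition point_integral :: "point_measure \<Rightarrow> (real \<Rightarrow> real) \<Rightarrow> real" where
  "point_integral \<mu> f = (\<Sum>x | mult \<mu> x \<noteq> 0 \<and> f x \<noteq> 0. real (mult \<mu> x) * f x)"

text \<open>The vague topology: the coarsest one for which the integrals of continuous compactly
  supported functions are continuous.\<close>

instantiation point_measure :: topological_space
begin

definition open_point_measure :: "point_measure set \<Rightarrow> bool" where
  "open_point_measure = generate_topology
     {(\<lambda>\<mu>. point_integral \<mu> f) -` V | f V.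
        continuous_on UNIV f \<and> compact (closure {x. f x \<noteq> 0}) \<and> open V}"

instance
  by standard (auto simp: open_point_measure_def intro: generate_topology.intros)

end

definition converges_in_law ::
  "(real \<Rightarrow> 'a measure) \<Rightarrow> (real \<Rightarrow> 'a \<Rightarrow> 'c::topological_space) \<Rightarrow>
   'b measure \<Rightarrow> ('b \<Rightarrow> 'c) \<Rightarrow> bool" where
  "converges_in_law P Y Q Z \<longleftrightarrow>
     (\<forall>\<^sub>F t in at_top. Y t \<in> P t \<rightarrow>\<^sub>M borel) \<and> Z \<in> Q \<rightarrow>\<^sub>M borel \<and>
     (\<forall>f :: 'c \<Rightarrow> real. continuous_on UNIV f \<longrightarrow> bounded (range f) \<longrightarrow>
        ((\<lambda>t. \<integral>\<omega>. f (Y t \<omega>) \<partial>P t) \<longlongrightarrow> (\<integral>\<omega>. f (Z \<omega>) \<partial>Q)) at_top)"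

text \<open>Independence of two random elements whose values may have different types, which
  \<open>prob_space.indep_var\<close> does not allow.\<close>

definition independent_rvs ::
  "'a measure \<Rightarrow> 'b measure \<Rightarrow> ('a \<Rightarrow> 'b) \<Rightarrow> 'c measure \<Rightarrow> ('a \<Rightarrow> 'c) \<Rightarrow> bool" where
  "independent_rvs P M X N Y \<longleftrightarrow>
     X \<in> P \<rightarrow>\<^sub>M M \<and> Y \<in> P \<rightarrow>\<^sub>M N \<and>
     prob_space.indep_set P {X -` A \<inter> space P | A. A \<in> sets M} {Y -` A \<inter> space P | A. A \<in> sets N}"

section \<open>Branching Brownian motion\<close>

definition brownian_motion :: "'a measure \<Rightarrow> (real \<Rightarrow> 'a \<Rightarrow> real) \<Rightarrow> bool" where
  "brownian_motion P B \<longleftrightarrow>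
     prob_space P \<and>
     (\<forall>t\<ge>0. B t \<in> borel_measurable P) \<and>
     (\<forall>\<omega>\<in>space P. B 0 \<omega> = 0 \<and> continuous_on {0..} (\<lambda>t. B t \<omega>)) \<and>
     (\<forall>s t. 0 \<le> s \<and> s < t \<longrightarrow>
        distributed P lborel (\<lambda>\<omega>. B t \<omega> - B s \<omega>) (normal_density 0 (sqrt (t - s)))) \<and>
     (\<forall>n (s :: nat \<Rightarrow> real). 0 \<le> s 0 \<and> (\<forall>i<n. s i < s (Suc i)) \<longrightarrow>
        prob_space.indep_vars P (\<lambda>_. borel) (\<lambda>i \<omega>. B (s (Suc i)) \<omega> - B (s i) \<omega>) {..<n})"

text \<open>Particles are labelled by finite binary words: the initial particle is the empty word, and the
  children of \<open>u\<close> are \<open>u @ [False]\<close> and \<open>u @ [True]\<close>. The particle \<open>u\<close> lives for the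
  time \<open>T u\<close>, and \<open>B u s\<close> is its displacement since birth when it has age \<open>s\<close>.\<close>

definition birth :: "(bool list \<Rightarrow> 'a \<Rightarrow> real) \<Rightarrow> bool list \<Rightarrow> 'a \<Rightarrow> real" where
  "birth T u \<omega> = (\<Sum>k<length u. T (take k u) \<omega>)"

definition alive :: "(bool list \<Rightarrow> 'a \<Rightarrow> real) \<Rightarrow> real \<Rightarrow> 'a \<Rightarrow> bool list set" where
  "alive T t \<omega> = {u. birth T u \<omega> \<le> t \<and> t < birth T u \<omega> + T u \<omega>}"

text \<open>Position at time \<open>t\<close> of \<open>u\<close>, or of its ancestor alive at time \<open>t\<close>: the ancestor
  \<open>take k u\<close> contributes its displacement up to time \<open>t\<close>, which is \<open>0\<close> before its birth and
  is frozen after its death.\<close>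

definition position ::
  "(bool list \<Rightarrow> 'a \<Rightarrow> real) \<Rightarrow> (bool list \<Rightarrow> real \<Rightarrow> 'a \<Rightarrow> real) \<Rightarrow> bool list \<Rightarrow> real \<Rightarrow> 'a \<Rightarrow> real" where
  "position T B u t \<omega> =
     (\<Sum>k\<le>length u. B (take k u)
        (max 0 (min (t - birth T (take k u) \<omega>) (T (take k u) \<omega>))) \<omega>)"

text \<open>Positivity of the lifetimes and absence of explosion hold almost surely for independent
  exponential lifetimes; as for the continuity of Brownian paths, the version is chosen such
  that they hold surely.\<close>

definition binary_bbm ::
  "'a measure \<Rightarrow> (bool list \<Rightarrow> 'a \<Rightarrow> real) \<Rightarrow> (bool list \<Rightarrow> real \<Rightarrow> 'a \<Rightarrow> real) \<Rightarrow> bool" where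
  "binary_bbm P T B \<longleftrightarrow>
     prob_space P \<and>
     (\<forall>u. distributed P lborel (T u) (exponential_density 1)) \<and>
     (\<forall>u. brownian_motion P (B u)) \<and>
     (\<forall>u. independent_rvs P borel (T u)
            (PiM {0..} (\<lambda>_. borel)) (\<lambda>\<omega>. \<lambda>s\<in>{0..}. B u s \<omega>)) \<and>
     prob_space.indep_vars P (\<lambda>_. borel \<Otimes>\<^sub>M PiM {0..} (\<lambda>_. borel))
       (\<lambda>u \<omega>. (T u \<omega>, \<lambda>s\<in>{0..}. B u s \<omega>)) UNIV \<and>
     (\<forall>\<omega>\<in>space P. (\<forall>u. 0 < T u \<omega>) \<and> (\<forall>t. finite {u. birth T u \<omega> \<le> t}))"

definition max_position ::
  "(bool list \<Rightarrow> 'a \<Rightarrow> real) \<Rightarrow> (bool list \<Rightarrow> real \<Rightarrow> 'a \<Rightarrow> real) \<Rightarrow> real \<Rightarrow> 'a \<Rightarrow> real" where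
  "max_position T B t \<omega> = Max ((\<lambda>u. position T B u t \<omega>) ` alive T t \<omega>)"

definition first_branching :: "(bool list \<Rightarrow> 'a \<Rightarrow> real) \<Rightarrow> 'a \<Rightarrow> real" where
  "first_branching T \<omega> = Inf {t. 0 \<le> t \<and> card (alive T t \<omega>) \<ge> 2}"

text \<open>The point process of the particles alive at time \<open>t\<close>, seen from \<open>c\<close>.\<close>

definition particles ::
  "(bool list \<Rightarrow> 'a \<Rightarrow> real) \<Rightarrow> (bool list \<Rightarrow> real \<Rightarrow> 'a \<Rightarrow> real) \<Rightarrow> real \<Rightarrow> real \<Rightarrow> 'a \<Rightarrow> point_measure" where
  "particles T B t c \<omega> = point_sum (alive T t \<omega>) (\<lambda>u. position T B u t \<omega> - c)"

section \<open>Constants and limit objects\<close>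

definition gam :: real where
  "gam = sqrt 2 - 1"

definition centering :: "real \<Rightarrow> real" where
  "centering t = sqrt 2 * t - 3 / (2 * sqrt 2) * ln t"

definition wave ::
  "'a measure \<Rightarrow> (bool list \<Rightarrow> 'a \<Rightarrow> real) \<Rightarrow> (bool list \<Rightarrow> real \<Rightarrow> 'a \<Rightarrow> real) \<Rightarrow> real \<Rightarrow> real" where
  "wave P T B z = Lim at_top (\<lambda>t. \<P>(\<omega> in P. max_position T B t \<omega> \<le> centering t + z))"

definition v_coeff :: "real \<Rightarrow> real" where
  "v_coeff \<alpha> = (gam + \<alpha>) / sqrt 2"

definition C1 :: "(real \<Rightarrow> real) \<Rightarrow> real" where
  "C1 w = 1 / 2 * (\<integral>z. exp (- (sqrt 2 * gam * z)) * (w z)\<^sup>2 \<partial>lborel)"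

definition is_extremal_process ::
  "'a measure \<Rightarrow> (bool list \<Rightarrow> 'a \<Rightarrow> real) \<Rightarrow> (bool list \<Rightarrow> real \<Rightarrow> 'a \<Rightarrow> real) \<Rightarrow>
   point_measure measure \<Rightarrow> bool" where
  "is_extremal_process P T B L \<longleftrightarrow>
     prob_space L \<and> sets L = sets borel \<and>
     converges_in_law (\<lambda>_. P) (\<lambda>t \<omega>. (particles T B t (centering t) \<omega>, max_position T B t \<omega> - centering t))
       L (\<lambda>\<mu>. (\<mu>, point_max \<mu>))"

text \<open>Given \<open>chi\<close>, the point processes \<open>\<E>\<^sub>1\<close> and \<open>\<E>\<^sub>2\<close> are independent with law \<open>L\<close>
  conditioned on the maximum being at most \<open>chi\<close>.\<close>

definition iid_conditioned_below ::
  "'b measure \<Rightarrow> ('b \<Rightarrow> real) \<Rightarrow> ('b \<Rightarrow> point_measure) \<Rightarrow> ('b \<Rightarrow> point_measure) \<Rightarrow>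
   point_measure measure \<Rightarrow> bool" where
  "iid_conditioned_below Q chi \<E>\<^sub>1 \<E>\<^sub>2 L \<longleftrightarrow>
     chi \<in> borel_measurable Q \<and> \<E>\<^sub>1 \<in> borel_measurable Q \<and> \<E>\<^sub>2 \<in> borel_measurable Q \<and>
     (let K = (\<lambda>z. uniform_measure L {\<mu> \<in> space L. point_max \<mu> \<le> z}) in
      \<forall>A\<in>sets borel. \<forall>A\<^sub>1\<in>sets borel. \<forall>A\<^sub>2\<in>sets borel.
        \<P>(\<omega> in Q. chi \<omega> \<in> A \<and> \<E>\<^sub>1 \<omega> \<in> A\<^sub>1 \<and> \<E>\<^sub>2 \<omega> \<in> A\<^sub>2) =
        (\<integral>\<omega>. indicator A (chi \<omega>) * (measure (K (chi \<omega>)) A\<^sub>1 * measure (K (chi \<omega>)) A\<^sub>2) \<partial>Q))"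

end

theory Submission imports Defs "HOL-Real_Asymp.Real_Asymp"
begin

text \<open>Decompose at the first branching: given \<open>\<tau> = s\<close> and \<open>X\<^sub>\<emptyset>(\<tau>) = y\<close>, the event says that two independent
  copies stay below \<open>\<surd>2 \<alpha> t - y\<close> at time \<open>t - s\<close>. In the variable
  \<open>z = \<surd>2 \<alpha> t - m\<^bsub>t-s\<^esub> - y\<close> this has probability close to \<open>w(z)\<^sup>2\<close>, while, because
  \<open>(1 + \<gamma>)\<^sup>2 = 2\<close>, \<open>e\<^bsup>-s\<^esup>\<close> times the Gaussian density of \<open>y\<close> factors exactly into the claimed rate, the
  tilt \<open>exp (- \<surd>2 \<gamma> z)\<close> and a Gaussian in \<open>s\<close> around \<open>(1 - \<alpha>) t / \<surd>2\<close>. Dominated convergence then gives the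
  limit; the domination is an exponential lower tail of \<open>M\<^sub>r - m\<^sub>r\<close>, uniform in \<open>r\<close>, which follows from
  tightness by iterating the integrated F-KPP equation. The same computation applies with
  \<open>\<one>{M\<^sub>t \<le> \<surd>2 \<alpha> t}\<close> replaced by \<open>\<one>{M\<^sub>t \<le> \<surd>2 \<alpha> t + q} exp (- \<integral>\<phi> d\<E>\<^sub>t(\<alpha>))\<close>, \<open>q \<le> 0\<close>, weighted by functions of \<open>\<tau>\<close> and
  \<open>X\<^sub>\<emptyset>(\<tau>)\<close>, since this also splits as a product over the two subtrees. These functionals form a
  multiplicative class whose uniform closure contains bump functions for all open sets, so that their
  convergence implies convergence in law.\<close>

section \<open>Point measures and test functions\<close>

text \<open>The vague topology is used without a metric. Second countability turns Borel sets of
  tuples into product sets, and convergence in law is reduced to lower bounds for open sets, which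
  bump functions provide. The maximum is not vaguely continuous, so it is carried as a coordinate of
  its own, and the assumed convergence of the pair (process, maximum) is the only source of
  information on the front: it gives the existence of \<open>wave\<close> and tightness. Indicators
  of half-lines then have to pass to the limit, which requires a law of the maximum without atoms;
  this comes from the smoothing by the heat kernel in the integrated F-KPP equation. For the
  branching property, an arbitrary space \<open>P\<close> offers no subtrees to integrate over, so
  trees are moved to a product space indexed by words, where splitting off the root is an identity
  of laws. The case of no branching before \<open>t\<close> is estimated with the same exponential
  rate as the main term and loses to it only by the power of \<open>t\<close>.\<close>

definition test_fun :: "(real \<Rightarrow> real) \<Rightarrow> bool" where
  "test_fun f \<longleftrightarrow> continuous_on UNIV f \<and> (\<exists>R. \<forall>x. f x \<noteq> 0 \<longrightarrow> \<bar>x\<bar> \<le> R)"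

lemma test_fun_iff: "test_fun f \<longleftrightarrow> continuous_on UNIV f \<and> compact (closure {x. f x \<noteq> 0})"
proof -
  have "compact (closure {x. f x \<noteq> 0}) \<longleftrightarrow> bounded {x. f x \<noteq> 0}"
    by (meson bounded_closure bounded_subset closed_closure closure_subset compact_eq_bounded_closed)
  then show ?thesis
    by (auto simp: test_fun_def bounded_iff)
qed

lemma test_funI:
  "continuous_on UNIV f \<Longrightarrow> (\<And>x. f x \<noteq> 0 \<Longrightarrow> \<bar>x\<bar> \<le> R) \<Longrightarrow> test_fun f"
  by (auto simp: test_fun_def)

lemma test_fun_support:
  assumes "test_fun f"
  obtains R :: nat where "\<And>x. f x \<noteq> 0 \<Longrightarrow> \<bar>x\<bar> \<le> real R"
proof -
  obtain R where R: "\<And>x. f x \<noteq> 0 \<Longrightarrow> \<bar>x\<bar> \<le> R"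
    using assms by (auto simp: test_fun_def)
  obtain n :: nat where "R \<le> real n"
    using real_arch_simple by blast
  then show ?thesis
    using R by (intro that[of n]) (meson order_trans)
qed

lemma test_fun_measurable: "test_fun f \<Longrightarrow> f \<in> borel_measurable borel"
  by (auto simp: test_fun_def intro: borel_measurable_continuous_onI)

lemma test_fun_add: 
  assumes f: "test_fun f" and g: "test_fun g"
  shows "test_fun (\<lambda>x. f x + g x)"
proof -
  obtain R1 R2 where R: "\<And>x. f x \<noteq> 0 \<Longrightarrow> \<bar>x\<bar> \<le> R1" "\<And>x. g x \<noteq> 0 \<Longrightarrow> \<bar>x\<bar> \<le> R2"
    using f g by (metis test_fun_def)
  show ?thesis
  proof (rule test_funI)
    show "continuous_on UNIV (\<lambda>x. f x + g x)"
      using f g by (intro continuous_on_add) (auto simp: test_fun_def)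
    fix x assume "f x + g x \<noteq> 0"
    then have "f x \<noteq> 0 \<or> g x \<noteq> 0" by auto
    then show "\<bar>x\<bar> \<le> max R1 R2" using R[of x] by (auto simp: le_max_iff_disj)
  qed
qed

lemma test_fun_shift:
  assumes f: "test_fun f"
  shows "test_fun (\<lambda>x. f (x + c))"
proof -
  obtain R where R: "\<And>x. f x \<noteq> 0 \<Longrightarrow> \<bar>x\<bar> \<le> R"
    using f by (metis test_fun_def)
  show ?thesis
  proof (rule test_funI)
    show "continuous_on UNIV (\<lambda>x. f (x + c))"
      by (rule continuous_on_compose2[of UNIV f])
        (use f in \<open>auto simp: test_fun_def intro: continuous_on_add continuous_on_id continuous_on_const\<close>)
    fix x assume "f (x + c) \<noteq> 0"
    then show "\<bar>x\<bar> \<le> R + \<bar>c\<bar>" using R[of "x + c"] by linarith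
  qed
qed

lemma test_fun_support2:
  assumes "test_fun f" "test_fun g"
  obtains R where "\<forall>x. f x \<noteq> 0 \<longrightarrow> \<bar>x\<bar> \<le> R" "\<forall>x. g x \<noteq> 0 \<longrightarrow> \<bar>x\<bar> \<le> R"
proof -
  obtain R1 R2 where "\<And>x. f x \<noteq> 0 \<Longrightarrow> \<bar>x\<bar> \<le> R1" "\<And>x. g x \<noteq> 0 \<Longrightarrow> \<bar>x\<bar> \<le> R2"
    using assms by (metis test_fun_def)
  then show ?thesis
    by (intro that[of "max R1 R2"]) (auto simp: le_max_iff_disj)
qed

lemma finite_atoms: "finite {x. mult \<mu> x \<noteq> 0 \<and> \<bar>x\<bar> \<le> R}"
proof -
  have "finite {x \<in> {-R..R}. mult \<mu> x \<noteq> 0}"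
    using mult[of \<mu>] by blast
  then show ?thesis
    by (rule rev_finite_subset) auto
qed

text \<open>The sum in \<open>point_integral_def\<close> runs over a set depending on
  \<open>f\<close>. A window containing the support gives one finite index set for several
  functions, so that additivity and monotonicity become facts on finite sums.\<close>

lemma point_integral_eq:
  assumes "\<forall>x. f x \<noteq> 0 \<longrightarrow> \<bar>x\<bar> \<le> R"
  shows "point_integral \<mu> f = (\<Sum>x | mult \<mu> x \<noteq> 0 \<and> \<bar>x\<bar> \<le> R. real (mult \<mu> x) * f x)"
  unfolding point_integral_def
  by (rule sum.mono_neutral_left) (use assms finite_atoms in auto)

lemma point_integral_add:
  assumes "test_fun f" "test_fun g"
  shows "point_integral \<mu> (\<lambda>x. f x + g x) = point_integral \<mu> f + point_integral \<mu> g"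
proof -
  obtain R where R: "\<forall>x. f x \<noteq> 0 \<longrightarrow> \<bar>x\<bar> \<le> R" "\<forall>x. g x \<noteq> 0 \<longrightarrow> \<bar>x\<bar> \<le> R"
    using assms test_fun_support2 by blast
  then have "\<forall>x. f x + g x \<noteq> 0 \<longrightarrow> \<bar>x\<bar> \<le> R"
    by (metis add_0)
  then show ?thesis
    using R by (simp add: point_integral_eq[of _ R] sum.distrib distrib_left)
qed

lemma point_integral_mono:
  assumes "test_fun f" "test_fun g" "\<And>x. f x \<le> g x"
  shows "point_integral \<mu> f \<le> point_integral \<mu> g"
proof -
  obtain R where "\<forall>x. f x \<noteq> 0 \<longrightarrow> \<bar>x\<bar> \<le> R" "\<forall>x. g x \<noteq> 0 \<longrightarrow> \<bar>x\<bar> \<le> R"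
    using assms test_fun_support2 by blast
  then show ?thesis
    using assms(3) by (simp add: point_integral_eq[of _ R] sum_mono mult_left_mono)
qed

lemma point_integral_scale:
  "point_integral \<mu> (\<lambda>x. c * f x) = c * point_integral \<mu> f"
proof (cases "c = 0")
  case False
  then show ?thesis
    by (simp add: point_integral_def sum_distrib_left mult.assoc mult.left_commute)
qed (simp add: point_integral_def)

lemma point_integral_nonneg: "(\<And>x. 0 \<le> f x) \<Longrightarrow> 0 \<le> point_integral \<mu> f"
  unfolding point_integral_def by (intro sum_nonneg) auto

text \<open>A multiplicity is a natural number, so an atom contributes at least \<open>f a\<close>.
  This is how a vaguely continuous functional detects an atom.\<close>

lemma point_integral_ge_atom:
  assumes "test_fun f" "\<And>x. 0 \<le> f x" "mult \<mu> a \<noteq> 0"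
  shows "f a \<le> point_integral \<mu> f"
proof -
  obtain R1 :: nat where R: "\<And>x. f x \<noteq> 0 \<Longrightarrow> \<bar>x\<bar> \<le> real R1"
    using assms test_fun_support by metis
  define R where "R = max (real R1) \<bar>a\<bar>"
  have 1: "\<forall>x. f x \<noteq> 0 \<longrightarrow> \<bar>x\<bar> \<le> R"
    using R unfolding R_def by force
  have "f a \<le> real (mult \<mu> a) * f a"
    using assms by (simp add: mult_le_cancel_right1 leD Suc_leI not_less_eq_eq le_imp_less_Suc)
  also have "\<dots> \<le> point_integral \<mu> f"
    unfolding point_integral_eq[of f R, OF 1]
    by (rule member_le_sum) (use assms finite_atoms in \<open>auto simp: R_def\<close>)
  finally show ?thesis .
qed

lemma point_integral_union:
  assumes "test_fun f"
  shows "point_integral (point_union \<mu> \<nu>) f = point_integral \<mu> f + point_integral \<nu> f"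
proof -
  obtain R :: nat where R: "\<forall>x. f x \<noteq> 0 \<longrightarrow> \<bar>x\<bar> \<le> real R"
    using assms test_fun_support by metis
  let ?S = "{x. mult \<mu> x \<noteq> 0 \<and> \<bar>x\<bar> \<le> real R} \<union> {x. mult \<nu> x \<noteq> 0 \<and> \<bar>x\<bar> \<le> real R}"
  have fin: "finite ?S"
    using finite_atoms by auto
  have "point_integral (point_union \<mu> \<nu>) f = (\<Sum>x\<in>?S. real (mult \<mu> x + mult \<nu> x) * f x)"
    unfolding point_integral_eq[OF R]
    by (rule sum.mono_neutral_cong_left) (use fin in \<open>auto simp: point_union.rep_eq\<close>)
  also have "\<dots> = (\<Sum>x\<in>?S. real (mult \<mu> x) * f x) + (\<Sum>x\<in>?S. real (mult \<nu> x) * f x)"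
    by (simp add: sum.distrib distrib_right)
  also have "(\<Sum>x\<in>?S. real (mult \<mu> x) * f x) = point_integral \<mu> f"
    unfolding point_integral_eq[OF R]
    by (rule sum.mono_neutral_right) (use fin in auto)
  also have "(\<Sum>x\<in>?S. real (mult \<nu> x) * f x) = point_integral \<nu> f"
    unfolding point_integral_eq[OF R]
    by (rule sum.mono_neutral_right) (use fin in auto)
  finally show ?thesis .
qed

lemma point_integral_shift:
  "point_integral (point_shift c \<mu>) f = point_integral \<mu> (\<lambda>x. f (x + c))"
  unfolding point_integral_def
  by (rule sum.reindex_bij_witness[of _ "\<lambda>x. x + c" "\<lambda>x. x - c"]) (auto simp: point_shift.rep_eq)

lemma point_integral_sum:
  assumes "finite I"
  shows "point_integral (point_sum I p) f = (\<Sum>i\<in>I. f (p i))"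
proof -
  have "(\<Sum>i\<in>I. f (p i)) = (\<Sum>x\<in>p ` I. real (card {i \<in> I. p i = x}) * f x)"
  proof -
    have "(\<Sum>i\<in>I. f (p i)) = (\<Sum>x\<in>p ` I. sum (\<lambda>i. f (p i)) {i \<in> I. p i = x})"
      by (rule sum.image_gen[OF assms])
    then show ?thesis
      by simp
  qed
  also have "\<dots> = point_integral (point_sum I p) f"
    unfolding point_integral_def
    by (rule sum.mono_neutral_cong_right)
      (use assms in \<open>auto simp: point_sum.rep_eq card_gt_0_iff\<close>)
  finally show ?thesis by simp
qed

section \<open>A countable subbasis of the vague topology\<close>

definition tent :: "nat \<Rightarrow> real \<Rightarrow> real" where
  "tent R x = max 0 (min 1 (real R + 1 - \<bar>x\<bar>))"

text \<open>A countable family: Bernstein polynomials with rational coefficients on the interval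
  from \<open>- R - 1\<close> to \<open>R + 1\<close>, cut off by the tent. The absolute values keep
  it nonnegative for every list \<open>qs\<close>, so that all Laplace functionals built on it lie
  between 0 and 1.\<close>

definition bern_fun :: "nat \<times> nat \<times> rat list \<Rightarrow> real \<Rightarrow> real" where
  "bern_fun = (\<lambda>(R, n, qs) x. tent R x *
     (\<Sum>k\<le>n. of_rat \<bar>qs ! k\<bar> * Bernstein n k ((x + real R + 1) / (2 * real R + 2))))"

lemma test_fun_tent: "test_fun (tent R)"
  by (rule test_funI[of _ "real R + 1"]) (auto simp: tent_def intro!: continuous_intros)

lemma tent_nonneg: "0 \<le> tent R x"
  by (simp add: tent_def)

lemma bern_fun_nonneg: "0 \<le> bern_fun i x"
proof -
  obtain R n qs where i: "i = (R, n, qs)"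
    by (cases i) auto
  show ?thesis
  proof (cases "\<bar>x\<bar> \<le> real R + 1")
    case True
    then have "0 \<le> (x + real R + 1) / (2 * real R + 2)" "(x + real R + 1) / (2 * real R + 2) \<le> 1"
      by (auto simp: field_simps)
    then show ?thesis
      unfolding i bern_fun_def
      by (auto intro!: mult_nonneg_nonneg sum_nonneg Bernstein_nonneg simp: tent_nonneg)
  qed (simp add: i bern_fun_def tent_def)
qed

lemma test_fun_bern_fun: "test_fun (bern_fun i)"
proof -
  obtain R n qs where i: "i = (R, n, qs)"
    by (cases i) auto
  show ?thesis
    unfolding i bern_fun_def Bernstein_def tent_def
    by (rule test_funI[of _ "real R + 1"]) (auto intro!: continuous_intros)
qed

text \<open>The tents are members of the family, so the same subbasis controls the mass of a window,
  and with it the error made in replacing a test function by an approximant.\<close>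

lemma bern_fun_tent: "bern_fun (R, 0, [1]) = tent R"
  by (rule ext) (simp add: bern_fun_def Bernstein_def)

text \<open>The error is a multiple of \<open>tent R\<close> instead of a constant, because a point
  measure may be infinite and only errors of bounded support can be integrated against it.\<close>

lemma bern_fun_approx:
  assumes f: "continuous_on UNIV f" "\<And>x. 0 \<le> f x" "\<And>x. f x \<noteq> 0 \<Longrightarrow> \<bar>x\<bar> \<le> real R" and e: "0 < e"
  obtains i where "\<And>x. \<bar>f x - bern_fun i x\<bar> \<le> e * tent R x"
proof -
  define f' where "f' y = f ((2 * real R + 2) * y - real R - 1)" for y
  have c: "continuous_on {0..1} f'"
    unfolding f'_def
    by (rule continuous_on_compose2[OF f(1)]) (auto intro!: continuous_intros)
  have "0 < e / 2" using e by simp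
  from Bernstein_Weierstrass[OF c this]
  obtain n where n: "\<And>y. y \<in> {0..1} \<Longrightarrow> \<bar>f' y - (\<Sum>k\<le>n. f' (k / n) * Bernstein n k y)\<bar> < e / 2"
    by (meson order_refl)
  \<comment> \<open>The rational coefficients lie strictly above \<open>f' (k / n)\<close>, hence
    are positive, and the absolute value in \<open>bern_fun\<close> leaves them unchanged.\<close>
  have "\<exists>q. f' (k / n) < real_of_rat q \<and> real_of_rat q < f' (k / n) + e / 2" for k
    using of_rat_dense[of "f' (k / n)" "f' (k / n) + e / 2"] e by auto
  then obtain q where q: "\<And>k. f' (k / n) < real_of_rat (q k)" "\<And>k. real_of_rat (q k) < f' (k / n) + e / 2"
    by metis
  have qabs: "real_of_rat \<bar>q k\<bar> = real_of_rat (q k)" for k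
  proof -
    have "0 \<le> f' (k / n)" using f(2) by (simp add: f'_def)
    then have "0 < real_of_rat (q k)" using q(1)[of k] by linarith
    then show ?thesis by simp
  qed
  define qs where "qs = map q [0..<Suc n]"
  have *: "\<bar>f x - bern_fun (R, n, qs) x\<bar> \<le> e * tent R x" for x
  proof (cases "\<bar>x\<bar> \<le> real R + 1")
    case True
    define y where "y = (x + real R + 1) / (2 * real R + 2)"
    have y: "0 \<le> y" "y \<le> 1" using True by (auto simp: y_def field_simps)
    have fx: "f' y = f x"
    proof -
      have "(2 * real R + 2) * y - real R - 1 = x"
        unfolding y_def by (simp add: add_pos_nonneg less_imp_neq[symmetric])
      then show ?thesis by (simp add: f'_def)
    qed
    have ft: "f x = tent R x * f x"
      using f(3)[of x] by (cases "f x = 0") (auto simp: tent_def)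
    define S where "S = (\<Sum>k\<le>n. real_of_rat (q k) * Bernstein n k y)"
    have bx: "bern_fun (R, n, qs) x = tent R x * S"
      by (auto simp: bern_fun_def S_def y_def qs_def nth_append simp del: upt_Suc simp flip: qabs intro!: sum.cong)
    have "\<bar>(\<Sum>k\<le>n. f' (k / n) * Bernstein n k y) - S\<bar> \<le> (\<Sum>k\<le>n. e / 2 * Bernstein n k y)"
      unfolding S_def sum_subtractf[symmetric]
    proof (rule order_trans[OF sum_abs sum_mono])
      fix k
      have "\<bar>f' (k / n) * Bernstein n k y - real_of_rat (q k) * Bernstein n k y\<bar>
          = \<bar>f' (k / n) - real_of_rat (q k)\<bar> * Bernstein n k y"
        using Bernstein_nonneg[OF y] by (simp add: left_diff_distrib[symmetric] abs_mult)
      also have "\<dots> \<le> e / 2 * Bernstein n k y"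
        using q[of k] Bernstein_nonneg[OF y] by (intro mult_right_mono) auto
      finally show "\<bar>f' (k / n) * Bernstein n k y - real_of_rat (q k) * Bernstein n k y\<bar> \<le> e / 2 * Bernstein n k y" .
    qed
    also have "\<dots> = e / 2"
      using sum_distrib_left[of "e / 2" "\<lambda>k. Bernstein n k y" "{..n}"] by simp
    finally have "\<bar>f x - S\<bar> \<le> e"
      using n[of y] y fx unfolding atLeastAtMost_iff by argo
    then have "\<bar>tent R x * (f x - S)\<bar> \<le> tent R x * e"
      by (simp add: abs_mult tent_nonneg mult_left_mono)
    then show ?thesis
      using ft bx by (metis right_diff_distrib mult.commute)
  next
    case False
    then show ?thesis
      using f(3)[of x] by (cases "f x = 0") (auto simp: bern_fun_def tent_def)
  qed
  show ?thesis
    by (rule that[of "(R, n, qs)"]) (rule *)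
qed

definition pm_basis :: "point_measure set set" where
  "pm_basis = (\<lambda>(i, a, b). (\<lambda>\<mu>. point_integral \<mu> (bern_fun i)) -` {real_of_rat a<..<real_of_rat b}) ` UNIV"

text \<open>Two subbasic conditions are combined: \<open>V\<close> fixes the integral of an
  approximant of \<open>f\<close>, and \<open>V'\<close> bounds the mass of the window by
  \<open>N\<close>, so that the approximation error is at most \<open>e / 4\<close> at the centre
  and at every point of the neighbourhood.\<close>

lemma pm_basis_approx_nonneg:
  assumes f: "test_fun f" "\<And>x. 0 \<le> f x" and e: "0 < e"
  obtains U where "generate_topology pm_basis U" "\<mu> \<in> U"
    "\<And>\<nu>. \<nu> \<in> U \<Longrightarrow> \<bar>point_integral \<nu> f - point_integral \<mu> f\<bar> < e"
proof -
  have fc: "continuous_on UNIV f" using f by (auto simp: test_fun_def)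
  obtain R :: nat where R: "\<And>x. f x \<noteq> 0 \<Longrightarrow> \<bar>x\<bar> \<le> real R"
    using f(1) test_fun_support by metis
  define N where "N = point_integral \<mu> (tent R) + 1"
  have N: "1 \<le> N" by (simp add: N_def point_integral_nonneg tent_nonneg)
  have "0 < e / (4 * N)" using e N by simp
  from bern_fun_approx[OF fc f(2) R this]
  obtain i where i: "\<And>x. \<bar>f x - bern_fun i x\<bar> \<le> e / (4 * N) * tent R x" by blast
  have close: "\<bar>point_integral \<nu> f - point_integral \<nu> (bern_fun i)\<bar> \<le> e / (4 * N) * point_integral \<nu> (tent R)" for \<nu>
  proof -
    have ct: "test_fun (\<lambda>x. e / (4 * N) * tent R x)"
      unfolding test_fun_def
    proof
      show "continuous_on UNIV (\<lambda>x. e / (4 * N) * tent R x)"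
        using test_fun_tent[of R] by (intro continuous_on_mult_left) (auto simp: test_fun_def)
    qed (use test_fun_tent[of R] in \<open>auto simp: test_fun_def\<close>)
    have "point_integral \<nu> f \<le> point_integral \<nu> (\<lambda>x. bern_fun i x + e / (4 * N) * tent R x)"
      by (rule point_integral_mono[OF f(1) test_fun_add[OF test_fun_bern_fun ct]])
        (use i in \<open>auto simp: abs_le_iff algebra_simps\<close>)
    moreover have "point_integral \<nu> (bern_fun i) \<le> point_integral \<nu> (\<lambda>x. f x + e / (4 * N) * tent R x)"
      by (rule point_integral_mono[OF test_fun_bern_fun test_fun_add[OF f(1) ct]])
        (use i in \<open>auto simp: abs_le_iff algebra_simps\<close>)
    ultimately show ?thesis
      by (simp only: point_integral_add[OF test_fun_bern_fun ct] point_integral_add[OF f(1) ct]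
          point_integral_scale abs_le_iff) linarith
  qed
  have nb: "\<exists>V. V \<in> pm_basis \<and> \<mu> \<in> V \<and> (\<forall>\<nu>\<in>V. \<bar>point_integral \<nu> (bern_fun j) - point_integral \<mu> (bern_fun j)\<bar> < d)"
    if "0 < d" for j d
  proof -
    obtain a where a: "point_integral \<mu> (bern_fun j) - d < real_of_rat a" "real_of_rat a < point_integral \<mu> (bern_fun j)"
      using of_rat_dense[of "point_integral \<mu> (bern_fun j) - d" "point_integral \<mu> (bern_fun j)"] \<open>0 < d\<close> by auto
    obtain b where b: "point_integral \<mu> (bern_fun j) < real_of_rat b" "real_of_rat b < point_integral \<mu> (bern_fun j) + d"
      using of_rat_dense[of "point_integral \<mu> (bern_fun j)" "point_integral \<mu> (bern_fun j) + d"] \<open>0 < d\<close> by auto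
    show ?thesis
      by (rule exI[of _ "(\<lambda>\<mu>. point_integral \<mu> (bern_fun j)) -` {real_of_rat a<..<real_of_rat b}"])
        (use a b in \<open>auto simp: pm_basis_def\<close>)
  qed
  obtain V where V: "V \<in> pm_basis" "\<mu> \<in> V"
    "\<And>\<nu>. \<nu> \<in> V \<Longrightarrow> \<bar>point_integral \<nu> (bern_fun i) - point_integral \<mu> (bern_fun i)\<bar> < e / 4"
    using nb[of "e / 4" i] e by auto
  obtain V' where V': "V' \<in> pm_basis" "\<mu> \<in> V'"
    "\<And>\<nu>. \<nu> \<in> V' \<Longrightarrow> \<bar>point_integral \<nu> (tent R) - point_integral \<mu> (tent R)\<bar> < 1"
    using nb[of 1 "(R, 0, [1])"] by (auto simp: bern_fun_tent)
  show ?thesis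
  proof (rule that[of "V \<inter> V'"])
    show "generate_topology pm_basis (V \<inter> V')"
      using V(1) V'(1) by (intro generate_topology.intros)
    show "\<mu> \<in> V \<inter> V'" using V V' by simp
    fix \<nu> assume \<nu>: "\<nu> \<in> V \<inter> V'"
    have le: "e / (4 * N) * point_integral \<kappa> (tent R) \<le> e / 4" if "point_integral \<kappa> (tent R) \<le> N" for \<kappa>
    proof -
      have "e / (4 * N) * point_integral \<kappa> (tent R) \<le> e / (4 * N) * N"
        using that e N by (intro mult_left_mono) auto
      also have "\<dots> = e / 4" using N by simp
      finally show ?thesis .
    qed
    have "point_integral \<nu> (tent R) \<le> N" "point_integral \<mu> (tent R) \<le> N"
      using V'(3)[of \<nu>] \<nu> by (auto simp: N_def)
    from le[OF this(1)] le[OF this(2)]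
    show "\<bar>point_integral \<nu> f - point_integral \<mu> f\<bar> < e"
      using close[of \<nu>] close[of \<mu>] V(3)[of \<nu>] \<nu> unfolding Int_iff by argo
  qed
qed

lemma pm_basis_approx:
  assumes f: "test_fun f" and e: "0 < e"
  obtains U where "generate_topology pm_basis U" "\<mu> \<in> U"
    "\<And>\<nu>. \<nu> \<in> U \<Longrightarrow> \<bar>point_integral \<nu> f - point_integral \<mu> f\<bar> < e"
proof -
  have t: "test_fun (\<lambda>x. max 0 (f x))" "test_fun (\<lambda>x. max 0 (- f x))"
    using f by (auto simp: test_fun_def intro!: continuous_intros) (metis max.idem neg_equal_0_iff_equal)+
  have t': "test_fun (\<lambda>x. -1 * max 0 (- f x))"
    using t(2) by (auto simp: test_fun_def intro!: continuous_intros)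
  have eq: "point_integral \<nu> f = point_integral \<nu> (\<lambda>x. max 0 (f x)) - point_integral \<nu> (\<lambda>x. max 0 (- f x))" for \<nu>
  proof -
    have "f = (\<lambda>x. max 0 (f x) + -1 * max 0 (- f x))" by auto
    then have "point_integral \<nu> f = point_integral \<nu> (\<lambda>x. max 0 (f x) + -1 * max 0 (- f x))" by simp
    then show ?thesis
      unfolding point_integral_add[OF t(1) t'] point_integral_scale by simp
  qed
  have "0 < e / 2" using e by simp
  obtain U where U: "generate_topology pm_basis U" "\<mu> \<in> U"
    "\<And>\<nu>. \<nu> \<in> U \<Longrightarrow> \<bar>point_integral \<nu> (\<lambda>x. max 0 (f x)) - point_integral \<mu> (\<lambda>x. max 0 (f x))\<bar> < e / 2"
    using pm_basis_approx_nonneg[OF t(1) _ \<open>0 < e / 2\<close>, of \<mu>] by auto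
  obtain U' where U': "generate_topology pm_basis U'" "\<mu> \<in> U'"
    "\<And>\<nu>. \<nu> \<in> U' \<Longrightarrow> \<bar>point_integral \<nu> (\<lambda>x. max 0 (- f x)) - point_integral \<mu> (\<lambda>x. max 0 (- f x))\<bar> < e / 2"
    using pm_basis_approx_nonneg[OF t(2) _ \<open>0 < e / 2\<close>, of \<mu>] by auto
  show ?thesis
  proof (rule that[of "U \<inter> U'"])
    fix \<nu> assume \<nu>: "\<nu> \<in> U \<inter> U'"
    have "\<bar>point_integral \<nu> (\<lambda>x. max 0 (f x)) - point_integral \<mu> (\<lambda>x. max 0 (f x))\<bar> < e / 2"
      "\<bar>point_integral \<nu> (\<lambda>x. max 0 (- f x)) - point_integral \<mu> (\<lambda>x. max 0 (- f x))\<bar> < e / 2"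
      using U(3) U'(3) \<nu> by auto
    then show "\<bar>point_integral \<nu> f - point_integral \<mu> f\<bar> < e"
      unfolding eq[of \<nu>] eq[of \<mu>] by linarith
  qed (use U U' in \<open>auto intro: generate_topology.intros\<close>)
qed

text \<open>By \<open>pm_basis_approx\<close> every vague subbasic condition contains, around each
  of its points, a set generated by the countable family. Conversely the family consists of vague
  subbasic sets.\<close>

lemma open_point_measure_basis: "(open :: point_measure set \<Rightarrow> bool) = generate_topology pm_basis"
proof (rule ext, rule iffI)
  fix W :: "point_measure set"
  assume "open W"
  then have "generate_topology {(\<lambda>\<mu>. point_integral \<mu> f) -` V | f V.
        continuous_on UNIV f \<and> compact (closure {x. f x \<noteq> 0}) \<and> open V} W"
    by (simp add: open_point_measure_def)
  then show "generate_topology pm_basis W"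
  proof induction
    case (Basis s)
    then obtain f V where s: "s = (\<lambda>\<mu>. point_integral \<mu> f) -` V" and f: "test_fun f" and V: "open V"
      by (auto simp: test_fun_iff)
    have "\<exists>U. generate_topology pm_basis U \<and> \<mu> \<in> U \<and> U \<subseteq> s" if "\<mu> \<in> s" for \<mu>
    proof -
      have "point_integral \<mu> f \<in> V" using that by (simp add: s)
      then have "\<exists>e>0. \<forall>y. \<bar>y - point_integral \<mu> f\<bar> < e \<longrightarrow> y \<in> V"
        using V unfolding open_real by blast
      then obtain e where e: "0 < e" "\<And>y. \<bar>y - point_integral \<mu> f\<bar> < e \<Longrightarrow> y \<in> V"
        by blast
      obtain U where "generate_topology pm_basis U" "\<mu> \<in> U"
        "\<And>\<nu>. \<nu> \<in> U \<Longrightarrow> \<bar>point_integral \<nu> f - point_integral \<mu> f\<bar> < e"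
        using pm_basis_approx[OF f e(1), of \<mu>] by blast
      then show ?thesis
        using e(2) unfolding s by blast
    qed
    then have "s = \<Union>{U. generate_topology pm_basis U \<and> U \<subseteq> s}"
      by auto
    also have "generate_topology pm_basis \<dots>"
      by (rule generate_topology.UN) auto
    finally show ?case .
  qed (auto intro: generate_topology.intros)
next
  fix W :: "point_measure set"
  assume "generate_topology pm_basis W"
  then show "open W"
  proof induction
    case (Basis s)
    then obtain i a b where s: "s = (\<lambda>\<mu>. point_integral \<mu> (bern_fun i)) -` {real_of_rat a<..<real_of_rat b}"
      by (auto simp: pm_basis_def)
    show ?case
      unfolding open_point_measure_def s using test_fun_bern_fun[of i]
      by (intro generate_topology.Basis CollectI exI conjI refl) (auto simp: test_fun_iff)
  qed auto
qed

text \<open>Second countability is used throughout: it makes the Borel sets of a product the product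
  sets, so that maps into tuples are measurable coordinate by coordinate.\<close>

instance point_measure :: second_countable_topology
proof
  show "\<exists>B :: point_measure set set. countable B \<and> open = generate_topology B"
    by (rule exI[of _ pm_basis]) (auto simp: open_point_measure_basis pm_basis_def)
qed

lemma continuous_on_point_integral:
  assumes "test_fun f"
  shows "continuous_on UNIV (\<lambda>\<mu>. point_integral \<mu> f)"
  unfolding continuous_on_open_vimage[OF open_UNIV]
proof (intro allI impI)
  fix V :: "real set" assume "open V"
  then show "open ((\<lambda>\<mu>. point_integral \<mu> f) -` V \<inter> UNIV)"
    using assms unfolding open_point_measure_def
    by (intro generate_topology.Basis) (auto simp: test_fun_iff)
qed

lemma measurable_point_integral:
  assumes "test_fun f"
  shows "(\<lambda>\<mu>. point_integral \<mu> f) \<in> borel_measurable borel"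
  by (intro borel_measurable_continuous_onI continuous_on_point_integral assms)

text \<open>The Borel sets are generated by the countable subbasis, whose members involve
  nonnegative test functions only; hence \<open>X\<close> may be tested on those alone.\<close>

lemma measurable_point_measureI:
  assumes "\<And>f. test_fun f \<Longrightarrow> (\<And>x. 0 \<le> f x) \<Longrightarrow> (\<lambda>\<omega>. point_integral (X \<omega>) f) \<in> borel_measurable M"
  shows "X \<in> M \<rightarrow>\<^sub>M (borel :: point_measure measure)"
proof -
  have b: "(borel :: point_measure measure) = sigma UNIV pm_basis"
    by (rule second_countable_borel_measurable[OF open_point_measure_basis])
  show ?thesis
    unfolding b
  proof (rule measurable_measure_of)
    fix y assume "y \<in> pm_basis"
    then obtain i a b where y: "y = (\<lambda>\<mu>. point_integral \<mu> (bern_fun i)) -` {a<..<b}"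
      by (auto simp: pm_basis_def)
    have [measurable]: "(\<lambda>\<omega>. point_integral (X \<omega>) (bern_fun i)) \<in> borel_measurable M"
      by (rule assms[OF test_fun_bern_fun bern_fun_nonneg])
    have "X -` y \<inter> space M = (\<lambda>\<omega>. point_integral (X \<omega>) (bern_fun i)) -` {a<..<b} \<inter> space M"
      by (auto simp: y)
    then show "X -` y \<inter> space M \<in> sets M" by simp
  qed auto
qed

section \<open>Convergence in law from a multiplicative class\<close>

text \<open>The uniformly closed linear span of \<open>C\<close>. For a class of bounded functions
  stable under products it is an algebra, stable under composition with continuous
  functions.\<close>

inductive_set fun_closure :: "('c \<Rightarrow> real) set \<Rightarrow> ('c \<Rightarrow> real) set" for C where
  base: "g \<in> C \<Longrightarrow> g \<in> fun_closure C"
| lin: "f \<in> fun_closure C \<Longrightarrow> g \<in> fun_closure C \<Longrightarrow> (\<lambda>x. a * f x + b * g x) \<in> fun_closure C"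
| ulim: "\<forall>e>0. \<exists>g. g \<in> fun_closure C \<and> (\<forall>x. \<bar>f x - g x\<bar> \<le> e) \<Longrightarrow> f \<in> fun_closure C"

lemma fun_closure_bounded:
  assumes "f \<in> fun_closure C" "\<And>g. g \<in> C \<Longrightarrow> \<exists>K. \<forall>x. \<bar>g x\<bar> \<le> K"
  shows "\<exists>K\<ge>0. \<forall>x. \<bar>f x\<bar> \<le> K"
  using assms(1)
proof induction
  case (base g)
  then obtain K where "\<forall>x. \<bar>g x\<bar> \<le> K" using assms(2) by blast
  then show ?case by (meson abs_ge_zero order_trans)
next
  case (lin f g a b)
  then obtain K1 K2 where K: "0 \<le> K1" "0 \<le> K2" "\<forall>x. \<bar>f x\<bar> \<le> K1" "\<forall>x. \<bar>g x\<bar> \<le> K2" by blast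
  have "\<bar>a * f x + b * g x\<bar> \<le> \<bar>a\<bar> * K1 + \<bar>b\<bar> * K2" for x
    by (rule order_trans[OF abs_triangle_ineq])
      (use K in \<open>auto simp: abs_mult intro!: add_mono mult_left_mono\<close>)
  then show ?case using K by (intro exI[of _ "\<bar>a\<bar> * K1 + \<bar>b\<bar> * K2"]) auto
next
  case (ulim f)
  then obtain g K where g: "\<forall>x. \<bar>f x - g x\<bar> \<le> 1" "0 \<le> K" "\<forall>x. \<bar>g x\<bar> \<le> K"
    by (meson zero_less_one)
  have "\<bar>f x\<bar> \<le> K + 1" for x
    using g(1)[rule_format, of x] g(3)[rule_format, of x] by linarith
  then show ?case using g by (intro exI[of _ "K + 1"]) auto
qed

text \<open>Multiplication by a fixed bounded function is linear and continuous for uniform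
  convergence, so it preserves the closure once it maps the generators into it. It serves twice in
  \<open>fun_closure_mult\<close>: with \<open>h\<close> in the class, then with \<open>h\<close> in
  the closure.\<close>

lemma fun_closure_mult_bounded:
  assumes h: "\<And>x. \<bar>h x\<bar> \<le> K" "0 < K"
    and D: "\<And>g. g \<in> C \<Longrightarrow> (\<lambda>x. h x * g x) \<in> fun_closure C"
    and f: "f \<in> fun_closure C"
  shows "(\<lambda>x. h x * f x) \<in> fun_closure C"
  using f
proof induction
  case (lin f g a b)
  have "(\<lambda>x. h x * (a * f x + b * g x)) = (\<lambda>x. a * (h x * f x) + b * (h x * g x))"
    by (auto simp: algebra_simps)
  then show ?case
    using fun_closure.lin[OF lin(3,4), of a b] by simp
next
  case (ulim f)
  show ?case
  proof (rule fun_closure.ulim, intro allI impI)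
    fix e :: real assume "0 < e"
    then have "0 < e / K" using h(2) by simp
    then obtain g where g: "(\<lambda>x. h x * g x) \<in> fun_closure C" "\<forall>x. \<bar>f x - g x\<bar> \<le> e / K"
      using ulim by meson
    have "\<bar>h x * f x - h x * g x\<bar> \<le> e" for x
    proof -
      have "\<bar>h x * f x - h x * g x\<bar> = \<bar>h x\<bar> * \<bar>f x - g x\<bar>"
        by (simp flip: abs_mult right_diff_distrib)
      also have "\<dots> \<le> K * (e / K)"
        using h g by (intro mult_mono) auto
      finally show ?thesis using h(2) by simp
    qed
    then show "\<exists>g. g \<in> fun_closure C \<and> (\<forall>x. \<bar>h x * f x - g x\<bar> \<le> e)"
      using g(1) by blast
  qed
qed (use D in blast)

lemma fun_closure_mult:
  assumes C: "\<And>g. g \<in> C \<Longrightarrow> \<exists>K. \<forall>x. \<bar>g x\<bar> \<le> K"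
    "\<And>f g. f \<in> C \<Longrightarrow> g \<in> C \<Longrightarrow> (\<lambda>x. f x * g x) \<in> C"
    and f: "f \<in> fun_closure C" and g: "g \<in> fun_closure C"
  shows "(\<lambda>x. f x * g x) \<in> fun_closure C"
proof -
  obtain K where "0 \<le> K" "\<forall>x. \<bar>f x\<bar> \<le> K" using fun_closure_bounded[OF f C(1)] by blast
  then have K: "\<And>x. \<bar>f x\<bar> \<le> K + 1" "0 < K + 1" by (auto intro: order_trans)
  have 1: "(\<lambda>x. f x * h x) \<in> fun_closure C" if h: "h \<in> C" for h
  proof -
    obtain L where "\<forall>x. \<bar>h x\<bar> \<le> L" using C(1)[OF h] by blast
    then have L: "\<And>x. \<bar>h x\<bar> \<le> \<bar>L\<bar> + 1" "0 < \<bar>L\<bar> + 1" by (auto intro: order_trans)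
    have "(\<lambda>x. h x * f x) \<in> fun_closure C"
      by (rule fun_closure_mult_bounded[OF L _ f]) (use C(2) h in \<open>auto intro: fun_closure.base\<close>)
    then show ?thesis by (simp add: mult.commute)
  qed
  show ?thesis
    by (rule fun_closure_mult_bounded[OF K 1 g])
qed

lemma fun_closure_sum:
  assumes "finite I" "I \<noteq> {}" "\<And>i. i \<in> I \<Longrightarrow> f i \<in> fun_closure C"
  shows "(\<lambda>x. \<Sum>i\<in>I. a i * f i x) \<in> fun_closure C"
  using assms
proof (induction I rule: finite_ne_induct)
  case (singleton i)
  then show ?case using fun_closure.lin[of "f i" C "f i" "a i" 0] by simp
next
  case (insert i F)
  then show ?case using fun_closure.lin[of "f i" C "\<lambda>x. \<Sum>i\<in>F. a i * f i x" "a i" 1] by simp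
qed

text \<open>Bernstein approximation of \<open>\<psi>\<close> on the range of \<open>f\<close>. The
  factor \<open>g\<close> is kept in every term, so that each term is built from products of members
  of the closure even when the constants are not among them.\<close>

lemma fun_closure_compose:
  assumes C: "\<And>g. g \<in> C \<Longrightarrow> \<exists>K. \<forall>x. \<bar>g x\<bar> \<le> K"
    "\<And>f g. f \<in> C \<Longrightarrow> g \<in> C \<Longrightarrow> (\<lambda>x. f x * g x) \<in> C"
    and f: "f \<in> fun_closure C" "\<And>x. 0 \<le> f x" "\<And>x. f x \<le> 1"
    and g: "g \<in> fun_closure C"
    and \<psi>: "continuous_on {0..1} \<psi>"
  shows "(\<lambda>x. g x * \<psi> (f x)) \<in> fun_closure C"
proof (rule fun_closure.ulim, intro allI impI)
  fix e :: real assume e: "0 < e"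
  have mult: "(\<lambda>x. f x * g x) \<in> fun_closure C" if "f \<in> fun_closure C" "g \<in> fun_closure C" for f g
    by (rule fun_closure_mult[OF C that])
  obtain K where "0 \<le> K" "\<forall>x. \<bar>g x\<bar> \<le> K" using fun_closure_bounded[OF g C(1)] by blast
  then have K: "\<And>x. \<bar>g x\<bar> \<le> K + 1" "0 < K + 1" by (auto intro: order_trans)
  have pw: "(\<lambda>x. g x * f x ^ k * (1 - f x) ^ j) \<in> fun_closure C" for k j
  proof (induction j)
    case 0
    show ?case
    proof (induction k)
      case (Suc k)
      then show ?case
        using mult[OF Suc f(1)] by (simp add: mult_ac)
    qed (use g in simp)
  next
    case (Suc j)
    have "(\<lambda>x. 1 * (g x * f x ^ k * (1 - f x) ^ j) + (-1) * ((g x * f x ^ k * (1 - f x) ^ j) * f x)) \<in> fun_closure C"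
      by (rule fun_closure.lin[OF Suc mult[OF Suc f(1)]])
    then show ?case by (simp add: algebra_simps)
  qed
  have "0 < e / (K + 1)" using e K by simp
  from Bernstein_Weierstrass[OF \<psi> this]
  obtain n where "\<forall>m y. n \<le> m \<and> y \<in> {0..1} \<longrightarrow> \<bar>\<psi> y - (\<Sum>k\<le>m. \<psi> (k / m) * Bernstein m k y)\<bar> < e / (K + 1)"
    by blast
  then have n: "\<bar>\<psi> y - (\<Sum>k\<le>n. \<psi> (k / n) * Bernstein n k y)\<bar> < e / (K + 1)" if "y \<in> {0..1}" for y
    using that by blast
  define h where "h x = (\<Sum>k\<le>n. \<psi> (k / n) * real (n choose k) * (g x * f x ^ k * (1 - f x) ^ (n - k)))" for x
  have "h \<in> fun_closure C"
    unfolding h_def by (rule fun_closure_sum) (use pw in auto)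
  moreover have "\<bar>g x * \<psi> (f x) - h x\<bar> \<le> e" for x
  proof -
    have "h x = g x * (\<Sum>k\<le>n. \<psi> (k / n) * Bernstein n k (f x))"
      by (simp add: h_def sum_distrib_left Bernstein_def mult_ac)
    then have "\<bar>g x * \<psi> (f x) - h x\<bar> = \<bar>g x\<bar> * \<bar>\<psi> (f x) - (\<Sum>k\<le>n. \<psi> (k / n) * Bernstein n k (f x))\<bar>"
      by (simp flip: abs_mult right_diff_distrib)
    also have "\<dots> \<le> (K + 1) * (e / (K + 1))"
      using K n[of "f x"] f(2,3) by (intro mult_mono) auto
    finally show ?thesis using K by simp
  qed
  ultimately show "\<exists>h. h \<in> fun_closure C \<and> (\<forall>x. \<bar>g x * \<psi> (f x) - h x\<bar> \<le> e)"
    by blast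
qed

lemma borel_measurable_fun_closure:
  assumes f: "f \<in> fun_closure C" and "\<And>g. g \<in> C \<Longrightarrow> g \<in> borel_measurable M"
  shows "f \<in> borel_measurable M"
  using f
proof induction
  case (ulim f)
  have "\<forall>n::nat. \<exists>g. g \<in> borel_measurable M \<and> (\<forall>x. \<bar>f x - g x\<bar> \<le> 1 / real (Suc n))"
    using ulim by (meson of_nat_0_less_iff zero_less_Suc zero_less_divide_1_iff)
  then obtain g where g: "\<And>n. g n \<in> borel_measurable M" "\<And>n x. \<bar>f x - g n x\<bar> \<le> 1 / real (Suc n)"
    by metis
  show ?case
  proof (rule borel_measurable_LIMSEQ_real[OF _ g(1)])
    fix x
    have "(\<lambda>n. g n x - f x) \<longlonglongrightarrow> 0"
      by (rule tendsto_rabs_zero_cancel, rule tendsto_sandwich[OF _ _ tendsto_const LIMSEQ_inverse_real_of_nat])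
        (use g(2)[of x] in \<open>auto simp: abs_minus_commute inverse_eq_divide\<close>)
    then show "(\<lambda>n. g n x) \<longlonglongrightarrow> f x" by (simp add: LIM_zero_iff)
  qed
qed (use assms(2) in auto)

section \<open>Convergence of integrals and the portmanteau argument\<close>

lemma prob_integrable_bounded:
  fixes f :: "'c \<Rightarrow> real"
  assumes "prob_space M" "f \<in> borel_measurable M" "\<And>x. \<bar>f x\<bar> \<le> K"
  shows "integrable M f"
proof -
  interpret prob_space M by fact
  show ?thesis
    by (rule integrable_const_bound[where B = K]) (use assms in auto)
qed

lemma prob_integral_diff_le:
  fixes f g :: "'c \<Rightarrow> real"
  assumes M: "prob_space M" and m: "f \<in> borel_measurable M" "g \<in> borel_measurable M"
    and b: "\<And>x. \<bar>f x\<bar> \<le> K" "\<And>x. \<bar>g x\<bar> \<le> L" "\<And>x. \<bar>f x - g x\<bar> \<le> e"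
  shows "\<bar>(\<integral>x. f x \<partial>M) - (\<integral>x. g x \<partial>M)\<bar> \<le> e"
proof -
  interpret prob_space M by fact
  have i: "integrable M f" "integrable M g"
    by (rule prob_integrable_bounded[OF M m(1) b(1)], rule prob_integrable_bounded[OF M m(2) b(2)])
  have "\<bar>(\<integral>x. f x \<partial>M) - (\<integral>x. g x \<partial>M)\<bar> = \<bar>\<integral>x. f x - g x \<partial>M\<bar>"
    using i by simp
  also have "\<dots> \<le> (\<integral>x. \<bar>f x - g x\<bar> \<partial>M)"
    by (rule integral_abs_bound)
  also have "\<dots> \<le> (\<integral>x. e \<partial>M)"
    using i b by (intro integral_mono) auto
  finally show ?thesis by (simp add: prob_space)
qed

text \<open>An \<open>e / 3\<close> argument along the closure. The laws are asked to be probability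
  measures only eventually, since conditional laws make sense only once the event has positive
  probability.\<close>

lemma fun_closure_converges:
  fixes M :: "'t \<Rightarrow> 'c measure" and N :: "'c measure"
  assumes M: "\<forall>\<^sub>F t in F. prob_space (M t) \<and> sets (M t) = sets N" and N: "prob_space N"
    and C: "\<And>g. g \<in> C \<Longrightarrow> \<exists>K. \<forall>x. \<bar>g x\<bar> \<le> K" "\<And>g. g \<in> C \<Longrightarrow> g \<in> borel_measurable N"
      "\<And>g. g \<in> C \<Longrightarrow> ((\<lambda>t. \<integral>x. g x \<partial>M t) \<longlongrightarrow> (\<integral>x. g x \<partial>N)) F"
    and f: "f \<in> fun_closure C"
  shows "((\<lambda>t. \<integral>x. f x \<partial>M t) \<longlongrightarrow> (\<integral>x. f x \<partial>N)) F"
  using f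
proof induction
  case (lin f g a b)
  note meas = borel_measurable_fun_closure[OF _ C(2)]
  obtain K where K: "\<forall>x. \<bar>f x\<bar> \<le> K"
    using fun_closure_bounded[OF lin(1) C(1)] by blast
  obtain L where L: "\<forall>x. \<bar>g x\<bar> \<le> L"
    using fun_closure_bounded[OF lin(2) C(1)] by blast
  have eq: "(\<integral>x. a * f x + b * g x \<partial>M') = a * (\<integral>x. f x \<partial>M') + b * (\<integral>x. g x \<partial>M')"
    if "prob_space M'" "sets M' = sets N" for M'
  proof -
    have "f \<in> borel_measurable M'" "g \<in> borel_measurable M'"
      using meas[OF lin(1)] meas[OF lin(2)] measurable_cong_sets[OF that(2) refl] by auto
    then have "integrable M' f" "integrable M' g"
      using prob_integrable_bounded[OF that(1)] K L by blast+
    then show ?thesis by simp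
  qed
  have "((\<lambda>t. a * (\<integral>x. f x \<partial>M t) + b * (\<integral>x. g x \<partial>M t)) \<longlongrightarrow> a * (\<integral>x. f x \<partial>N) + b * (\<integral>x. g x \<partial>N)) F"
    using lin by (intro tendsto_intros)
  then show ?case
    unfolding eq[OF N refl]
    by (rule Lim_transform_eventually) (use M eq in \<open>auto elim!: eventually_mono\<close>)
next
  case (ulim f)
  have fcl: "f \<in> fun_closure C"
    using ulim by (intro fun_closure.ulim) blast
  show ?case
  proof (rule tendstoI)
    fix e :: real assume e: "0 < e"
    then have "0 < e / 3" by simp
    then obtain g where g: "g \<in> fun_closure C" "\<forall>x. \<bar>f x - g x\<bar> \<le> e / 3"
      "((\<lambda>t. \<integral>x. g x \<partial>M t) \<longlongrightarrow> (\<integral>x. g x \<partial>N)) F"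
      using ulim by meson
    obtain K where K: "\<forall>x. \<bar>f x\<bar> \<le> K"
      using fun_closure_bounded[OF fcl C(1)] by blast
    obtain L where L: "\<forall>x. \<bar>g x\<bar> \<le> L"
      using fun_closure_bounded[OF g(1) C(1)] by blast
    have d: "\<bar>(\<integral>x. f x \<partial>M') - (\<integral>x. g x \<partial>M')\<bar> \<le> e / 3" if "prob_space M'" "sets M' = sets N" for M'
    proof (rule prob_integral_diff_le[OF that(1), where K = K and L = L])
      show "f \<in> borel_measurable M'" "g \<in> borel_measurable M'"
        using borel_measurable_fun_closure[OF fcl C(2)] borel_measurable_fun_closure[OF g(1) C(2)]
          measurable_cong_sets[OF that(2) refl] by auto
    qed (use K L g in auto)
    have "\<forall>\<^sub>F t in F. \<bar>(\<integral>x. g x \<partial>M t) - (\<integral>x. g x \<partial>N)\<bar> < e / 3"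
      using tendstoD[OF g(3) \<open>0 < e / 3\<close>] by (simp add: dist_real_def)
    then show "\<forall>\<^sub>F t in F. dist (\<integral>x. f x \<partial>M t) (\<integral>x. f x \<partial>N) < e"
      using M
    proof eventually_elim
      case (elim t)
      then show ?case
        using d[of "M t"] d[OF N refl] unfolding dist_real_def by linarith
    qed
  qed
qed (use C in blast)

text \<open>The functions \<open>s n\<close>, equal to one minus the product of the
  \<open>1 - g k\<close>, stay below the indicator of \<open>G\<close> and converge to it. Dominated
  convergence under \<open>N\<close> brings the integral of one of them within \<open>e / 2\<close>
  of the measure of \<open>G\<close>, and for that one the integrals along \<open>M t\<close>
  converge.\<close>

lemma portmanteau_open:
  fixes M :: "'t \<Rightarrow> 'c measure" and N :: "'c measure"
  assumes M: "\<forall>\<^sub>F t in F. prob_space (M t) \<and> sets (M t) = sets N" and N: "prob_space N"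
    and C: "\<And>g. g \<in> C \<Longrightarrow> \<exists>K. \<forall>x. \<bar>g x\<bar> \<le> K" "\<And>g. g \<in> C \<Longrightarrow> g \<in> borel_measurable N"
      "\<And>g. g \<in> C \<Longrightarrow> ((\<lambda>t. \<integral>x. g x \<partial>M t) \<longlongrightarrow> (\<integral>x. g x \<partial>N)) F"
      "\<And>f g. f \<in> C \<Longrightarrow> g \<in> C \<Longrightarrow> (\<lambda>x. f x * g x) \<in> C"
    and g: "\<And>n::nat. g n \<in> fun_closure C" "\<And>n x. 0 \<le> g n x" "\<And>n x. g n x \<le> 1"
      "\<And>n x. g n x \<noteq> 0 \<Longrightarrow> x \<in> G" "\<And>x. x \<in> G \<Longrightarrow> \<exists>n. g n x = 1"
    and G: "G \<in> sets N" and e: "0 < e"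
  shows "\<forall>\<^sub>F t in F. measure N G - e < measure (M t) G"
proof -
  interpret N: prob_space N by fact
  \<comment> \<open>The recursion is inclusion-exclusion: it uses sums and products of members of
    the closure, where the product formula \<open>seq\<close> would involve the constant 1.\<close>
  define s where "s = rec_nat (g 0) (\<lambda>n h x. h x + g (Suc n) x - h x * g (Suc n) x)"
  have s0: "s 0 = g 0" and sS: "s (Suc n) = (\<lambda>x. s n x + g (Suc n) x - s n x * g (Suc n) x)" for n
    by (simp_all add: s_def)
  have scl: "s n \<in> fun_closure C" for n
  proof (induction n)
    case (Suc n)
    have "(\<lambda>x. 1 * (1 * s n x + 1 * g (Suc n) x) + (-1) * (s n x * g (Suc n) x)) \<in> fun_closure C"
      by (rule fun_closure.lin[OF fun_closure.lin[OF Suc g(1)] fun_closure_mult[OF C(1,4) Suc g(1)]])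
    then show ?case by (simp add: sS)
  qed (simp add: s0 g)
  have seq: "1 - s n x = (\<Prod>k\<le>n. 1 - g k x)" for n x
  proof (induction n)
    case (Suc n)
    have "1 - s (Suc n) x = (1 - s n x) * (1 - g (Suc n) x)"
      by (simp add: sS algebra_simps)
    then show ?case using Suc by simp
  qed (simp add: s0)
  have s01: "0 \<le> s n x" "s n x \<le> 1" for n x
  proof -
    have "0 \<le> (\<Prod>k\<le>n. 1 - g k x)" "(\<Prod>k\<le>n. 1 - g k x) \<le> 1"
      using g(2,3) by (auto intro!: prod_nonneg prod_le_1)
    then show "0 \<le> s n x" "s n x \<le> 1" using seq[of n x] by auto
  qed
  have s_out: "s n x = 0" if "x \<notin> G" for n x
    using that g(4)[of _ x] seq[of n x] by fastforce
  have lim: "(\<lambda>n. s n x) \<longlonglongrightarrow> indicator G x" for x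
  proof (cases "x \<in> G")
    case True
    then obtain m where m: "g m x = 1" using g(5) by blast
    have "s n x = 1" if "m \<le> n" for n
    proof -
      have "(\<Prod>k\<le>n. 1 - g k x) = 0" using that m by (auto simp: prod_zero_iff)
      then show ?thesis using seq[of n x] by linarith
    qed
    then have "\<forall>\<^sub>F n in sequentially. s n x = indicator G x"
      using True by (auto simp: eventually_sequentially)
    then show ?thesis by (rule tendsto_eventually)
  qed (simp add: s_out)
  have meas: "s n \<in> borel_measurable N" for n
    by (rule borel_measurable_fun_closure[OF scl C(2)])
  have "(\<lambda>n. \<integral>x. s n x \<partial>N) \<longlonglongrightarrow> (\<integral>x. indicator G x \<partial>N)"
    by (rule integral_dominated_convergence[where w = "\<lambda>_. 1"]) (use meas lim s01 G in auto)
  then have "(\<lambda>n. \<integral>x. s n x \<partial>N) \<longlonglongrightarrow> measure N G"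
    using G by simp
  then have "\<forall>\<^sub>F n in sequentially. measure N G - e / 2 < (\<integral>x. s n x \<partial>N)"
    using order_tendstoD(1) e by fastforce
  then obtain n where n: "measure N G - e / 2 < (\<integral>x. s n x \<partial>N)"
    by (auto simp: eventually_sequentially)
  have "((\<lambda>t. \<integral>x. s n x \<partial>M t) \<longlongrightarrow> (\<integral>x. s n x \<partial>N)) F"
    by (rule fun_closure_converges[OF M N C(1-3) scl])
  then have "\<forall>\<^sub>F t in F. measure N G - e < (\<integral>x. s n x \<partial>M t)"
    using n e by (intro order_tendstoD(1)) auto
  then show ?thesis
    using M
  proof eventually_elim
    case (elim t)
    interpret Mt: prob_space "M t" using elim by simp
    have sm: "s n \<in> borel_measurable (M t)"
      using meas[of n] elim measurable_cong_sets[of "M t" N borel borel] by auto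
    have Gt: "G \<in> sets (M t)" using G elim by simp
    have "(\<integral>x. s n x \<partial>M t) \<le> (\<integral>x. indicator G x \<partial>M t)"
    proof (rule integral_mono)
      show "integrable (M t) (s n)"
        by (rule prob_integrable_bounded[where K = 1]) (use sm s01 Mt.prob_space_axioms in \<open>auto simp: abs_le_iff intro: order_trans[of _ 0]\<close>)
      show "integrable (M t) (indicator G :: _ \<Rightarrow> real)"
        using Gt by (intro integrable_real_indicator) (auto simp: Mt.emeasure_eq_measure)
      show "s n x \<le> indicator G x" for x
        using s01 s_out by (cases "x \<in> G") auto
    qed
    then show ?case using elim Gt by simp
  qed
qed

text \<open>A layer-cake argument: a function with values between 0 and 1 exceeds the average of the
  indicators of its level sets by at most \<open>1 / n\<close>. These are finitely many open sets,
  so their lower bounds can be added.\<close>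

lemma portmanteau_lower:
  fixes M :: "'t \<Rightarrow> 'c::topological_space measure" and N :: "'c measure"
  assumes M: "\<forall>\<^sub>F t in F. prob_space (M t) \<and> sets (M t) = sets borel"
    and N: "prob_space N" "sets N = sets borel"
    and op: "\<And>G e. open G \<Longrightarrow> 0 < e \<Longrightarrow> \<forall>\<^sub>F t in F. measure N G - e < measure (M t) G"
    and f: "continuous_on UNIV f" "\<And>x. 0 \<le> f x" "\<And>x. f x \<le> (1::real)" and e: "0 < e"
  shows "\<forall>\<^sub>F t in F. (\<integral>x. f x \<partial>N) - e < (\<integral>x. f x \<partial>M t)"
proof -
  obtain m where "1 / real (Suc m) < e / 2"
    using e nat_approx_posE[of "e / 2"] by auto
  define n where "n = Suc m"
  have n: "0 < real n" "1 / real n < e / 2" using \<open>1 / real (Suc m) < e / 2\<close> by (auto simp: n_def)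
  define G where "G i = {x. real (Suc i) / real n < f x}" for i
  define h where "h x = (1 / real n) * (\<Sum>i<n. indicator (G i) x)" for x
  have G: "open (G i)" for i
  proof -
    have "G i = f -` {real (Suc i) / real n<..} \<inter> UNIV" by (auto simp: G_def)
    then show ?thesis
      using f(1) unfolding continuous_on_open_vimage[OF open_UNIV] by simp
  qed
  have hf: "h x \<le> f x \<and> f x \<le> h x + 1 / real n" for x
  proof -
    define k where "k = card {i. i < n \<and> real (Suc i) / real n < f x}"
    have hk: "h x = real k / real n"
    proof -
      have "(\<Sum>i<n. indicator (G i) x) = (\<Sum>i<n. if real (Suc i) / real n < f x then 1 else (0::real))"
        by (intro sum.cong) (auto simp: G_def indicator_def)
      also have "\<dots> = real (card {i. i < n \<and> real (Suc i) / real n < f x})"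
        by (subst sum.If_cases) (auto simp: Int_def)
      finally show ?thesis by (simp add: h_def k_def)
    qed
    \<comment> \<open>The number of positive integers strictly below \<open>real n * f x\<close>:
      ceiling minus one rather than floor, because the levels in \<open>G\<close> are strict;
      \<open>nat\<close> covers the case where \<open>f x\<close> is 0.\<close>
    define j where "j = nat (\<lceil>real n * f x\<rceil> - 1)"
    have "{i. i < n \<and> real (Suc i) / real n < f x} = {..<j}"
    proof -
      have "i < n \<and> real (Suc i) / real n < f x \<longleftrightarrow> i < j" for i
      proof -
        have "real (Suc i) / real n < f x \<longleftrightarrow> real (Suc i) < real n * f x"
          using n by (simp add: field_simps)
        also have "\<dots> \<longleftrightarrow> int (Suc i) < \<lceil>real n * f x\<rceil>"
          by (simp add: less_ceiling_iff)
        also have "\<dots> \<longleftrightarrow> i < j" unfolding j_def by linarith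
        finally have *: "real (Suc i) / real n < f x \<longleftrightarrow> i < j" .
        have "i < n" if "real (Suc i) / real n < f x"
        proof -
          have "real (Suc i) / real n < 1" using that f(3)[of x] by linarith
          then show ?thesis using n by (simp add: field_simps)
        qed
        then show ?thesis using * by blast
      qed
      then show ?thesis by auto
    qed
    then have "k = j" by (simp add: k_def)
    have "0 \<le> real n * f x" using f(2) n by simp
    then have "real j \<le> real n * f x" "real n * f x \<le> real j + 1"
      unfolding j_def by linarith+
    then show ?thesis
      unfolding hk \<open>k = j\<close> using n(1) by (simp add: field_simps)
  qed
  have eqh: "(\<integral>x. h x \<partial>M') = (1 / real n) * (\<Sum>i<n. measure M' (G i))"
    and le1: "(\<integral>x. f x \<partial>M') \<le> (\<integral>x. h x \<partial>M') + 1 / real n"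
    and le2: "(\<integral>x. h x \<partial>M') \<le> (\<integral>x. f x \<partial>M')"
    if M': "prob_space M'" "sets M' = sets borel" for M'
  proof -
    interpret prob_space M' by fact
    have Gs: "G i \<in> sets M'" for i using G M' by simp
    have fi: "integrable M' f"
      by (rule prob_integrable_bounded[where K = 1])
        (use M' f borel_measurable_continuous_onI[OF f(1)] measurable_cong_sets[OF M'(2) refl] in
          \<open>auto simp: abs_le_iff intro: order_trans[of _ 0]\<close>)
    have hi: "integrable M' h"
      unfolding h_def using Gs by (intro integrable_mult_right Bochner_Integration.integrable_sum integrable_real_indicator)
        (auto simp: emeasure_eq_measure)
    show "(\<integral>x. h x \<partial>M') = (1 / real n) * (\<Sum>i<n. measure M' (G i))"
      unfolding h_def using Gs
      by (simp add: Bochner_Integration.integral_sum integrable_real_indicator emeasure_eq_measure)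
    have "(\<integral>x. f x \<partial>M') \<le> (\<integral>x. h x + 1 / real n \<partial>M')"
      using fi hi hf by (intro integral_mono) auto
    then show "(\<integral>x. f x \<partial>M') \<le> (\<integral>x. h x \<partial>M') + 1 / real n"
      using hi by (simp add: prob_space)
    show "(\<integral>x. h x \<partial>M') \<le> (\<integral>x. f x \<partial>M')"
      using fi hi hf by (intro integral_mono) auto
  qed
  have "\<forall>\<^sub>F t in F. \<forall>i\<in>{..<n}. measure N (G i) - e / 2 < measure (M t) (G i)"
    using op[OF G, of "e / 2"] e by (intro eventually_ball_finite) auto
  then show ?thesis
    using M
  proof eventually_elim
    case (elim t)
    have "(\<Sum>i<n. measure N (G i) - e / 2) \<le> (\<Sum>i<n. measure (M t) (G i))"
      using elim by (intro sum_mono) (auto intro: less_imp_le)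
    then have "(1 / real n) * ((\<Sum>i<n. measure N (G i)) - real n * (e / 2)) \<le> (1 / real n) * (\<Sum>i<n. measure (M t) (G i))"
      by (intro mult_left_mono) (auto simp: sum_subtractf)
    then have "(1 / real n) * (\<Sum>i<n. measure N (G i)) - e / 2 \<le> (1 / real n) * (\<Sum>i<n. measure (M t) (G i))"
      using n(1) by (simp add: right_diff_distrib)
    then show ?case
      using eqh[OF N] eqh[of "M t"] le1[OF N] le2[of "M t"] elim n(2) by linarith
  qed
qed

theorem portmanteau:
  fixes M :: "'t \<Rightarrow> 'c::topological_space measure" and N :: "'c measure"
  assumes M: "\<forall>\<^sub>F t in F. prob_space (M t) \<and> sets (M t) = sets borel"
    and N: "prob_space N" "sets N = sets borel"
    and C: "\<And>g. g \<in> C \<Longrightarrow> \<exists>K. \<forall>x. \<bar>g x\<bar> \<le> K" "\<And>g. g \<in> C \<Longrightarrow> g \<in> borel_measurable borel"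
      "\<And>g. g \<in> C \<Longrightarrow> ((\<lambda>t. \<integral>x. g x \<partial>M t) \<longlongrightarrow> (\<integral>x. g x \<partial>N)) F"
      "\<And>f g. f \<in> C \<Longrightarrow> g \<in> C \<Longrightarrow> (\<lambda>x. f x * g x) \<in> C"
    and bump: "\<And>G. open G \<Longrightarrow> \<exists>g :: nat \<Rightarrow> 'c \<Rightarrow> real. \<forall>n. g n \<in> fun_closure C \<and> (\<forall>x. 0 \<le> g n x \<and> g n x \<le> 1 \<and>
      (g n x \<noteq> 0 \<longrightarrow> x \<in> G)) \<and> (\<forall>x\<in>G. \<exists>n. g n x = 1)"
    and f: "continuous_on UNIV f" "bounded (range f)"
  shows "((\<lambda>t. \<integral>x. f x \<partial>M t) \<longlongrightarrow> (\<integral>x. (f x :: real) \<partial>N)) F"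
proof -
  have op: "\<forall>\<^sub>F t in F. measure N G - e < measure (M t) G" if G: "open G" and e: "0 < e" for G e
  proof -
    obtain g :: "nat \<Rightarrow> 'c \<Rightarrow> real" where g: "\<And>n. g n \<in> fun_closure C" "\<And>n x. 0 \<le> g n x" "\<And>n x. g n x \<le> 1"
      "\<And>n x. g n x \<noteq> 0 \<Longrightarrow> x \<in> G" "\<And>x. x \<in> G \<Longrightarrow> \<exists>n. g n x = 1"
      using bump[OF G] by metis
    show ?thesis
      by (rule portmanteau_open[OF _ N(1) C(1) _ C(3,4) g _ e])
        (use M N C(2) G measurable_cong_sets[OF N(2) refl] in auto)
  qed
  obtain K where K: "\<And>x. \<bar>f x\<bar> \<le> K" "0 < K"
    using f(2) by (auto simp: bounded_pos)
  have fm: "f \<in> borel_measurable borel"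
    using f(1) by (rule borel_measurable_continuous_onI)
  \<comment> \<open>The choices \<open>s = 1\<close> and \<open>s = -1\<close> map the range of
    \<open>f\<close> into the unit interval with opposite orientations, so that lower bounds alone
    give two-sided ones.\<close>
  define h where "h s x = (s * f x / K + 1) / 2" for s x
  have h: "continuous_on UNIV (h s)" "0 \<le> h s x" "h s x \<le> 1" if "\<bar>s\<bar> = 1" for s x
  proof -
    show "continuous_on UNIV (h s)"
      unfolding h_def using f(1) K(2) by (intro continuous_intros) auto
    have "\<bar>s * f x / K\<bar> \<le> 1"
      using that K(1)[of x] K(2) by (simp add: abs_mult)
    then have "-1 \<le> s * f x / K" "s * f x / K \<le> 1" by linarith+
    then show "0 \<le> h s x" "h s x \<le> 1" unfolding h_def by simp_all
  qed
  have eqh: "(\<integral>x. h s x \<partial>M') = (s * (\<integral>x. f x \<partial>M') / K + 1) / 2"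
    if "prob_space M'" "sets M' = sets borel" for M' s
  proof -
    interpret prob_space M' by fact
    have "integrable M' f"
      using K(1) fm measurable_cong_sets[OF that(2) refl] by (intro prob_integrable_bounded[OF that(1)]) auto
    then show ?thesis by (simp add: h_def prob_space)
  qed
  show ?thesis
  proof (rule tendstoI)
    fix e :: real assume e: "0 < e"
    then have e': "0 < e / (2 * K)" using K by simp
    have "\<forall>\<^sub>F t in F. (\<integral>x. h 1 x \<partial>N) - e / (2 * K) < (\<integral>x. h 1 x \<partial>M t)"
      "\<forall>\<^sub>F t in F. (\<integral>x. h (-1) x \<partial>N) - e / (2 * K) < (\<integral>x. h (-1) x \<partial>M t)"
      by (rule portmanteau_lower[OF M N op]; use h e' in auto)+
    then show "\<forall>\<^sub>F t in F. dist (\<integral>x. f x \<partial>M t) (\<integral>x. f x \<partial>N) < e"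
      using M
    proof eventually_elim
      case (elim t)
      define a b c where "a = (\<integral>x. f x \<partial>N) / K" and "b = (\<integral>x. f x \<partial>M t) / K" and "c = e / K"
      have "e / (2 * K) = c / 2" by (simp add: c_def)
      then have "a - c < b" "- a - c < - b"
        using elim by (simp_all add: eqh[OF N] eqh[of "M t"] add_divide_distrib diff_divide_distrib flip: a_def b_def)
      then have "((\<integral>x. f x \<partial>N) - e) / K < (\<integral>x. f x \<partial>M t) / K"
        "(- (\<integral>x. f x \<partial>N) - e) / K < (- (\<integral>x. f x \<partial>M t)) / K"
        unfolding a_def b_def c_def by (simp_all add: diff_divide_distrib)
      then show ?case
        unfolding divide_less_cancel using K(2) by (auto simp: dist_real_def abs_less_iff)
    qed
  qed
qed

section \<open>Functionals of the branching particle system\<close>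

text \<open>Multiplicative over particles, hence over the two subtrees of the first branching.
  Values in \<open>ennreal\<close> let every expectation be formed without integrability, and the
  centre \<open>c\<close> absorbs the displacement of the root.\<close>

definition tree_prod :: "(real \<Rightarrow> ennreal) \<Rightarrow> (bool list \<Rightarrow> 'a \<Rightarrow> real) \<Rightarrow>
    (bool list \<Rightarrow> real \<Rightarrow> 'a \<Rightarrow> real) \<Rightarrow> real \<Rightarrow> real \<Rightarrow> 'a \<Rightarrow> ennreal" where
  "tree_prod g T B t c \<omega> = (\<Prod>u\<in>alive T t \<omega>. g (position T B u t \<omega> - c))"

lemma birth_cong:
  assumes "\<And>u. T u \<omega> = T' u \<omega>'"
  shows "birth T u \<omega> = birth T' u \<omega>'"
  by (simp add: birth_def assms)

lemma alive_cong:
  assumes "\<And>u. T u \<omega> = T' u \<omega>'"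
  shows "alive T t \<omega> = alive T' t \<omega>'"
  by (simp add: alive_def assms birth_cong[of T \<omega> T' \<omega>', OF assms])

lemma position_cong:
  assumes "\<And>u. T u \<omega> = T' u \<omega>'" "\<And>u s. 0 \<le> s \<Longrightarrow> B u s \<omega> = B' u s \<omega>'"
  shows "position T B u t \<omega> = position T' B' u t \<omega>'"
  by (simp add: position_def assms birth_cong[of T \<omega> T' \<omega>', OF assms(1)])

lemma tree_prod_cong:
  assumes "\<And>u. T u \<omega> = T' u \<omega>'" "\<And>u s. 0 \<le> s \<Longrightarrow> B u s \<omega> = B' u s \<omega>'"
  shows "tree_prod g T B t c \<omega> = tree_prod g T' B' t c \<omega>'"
  unfolding tree_prod_def
  by (simp only: alive_cong[of T \<omega> T' \<omega>', OF assms(1)] position_cong[of T \<omega> T' \<omega>' B B', OF assms])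

lemma birth_Nil [simp]: "birth T [] \<omega> = 0"
  by (simp add: birth_def)

lemma birth_Cons: "birth T (b # u) \<omega> = T [] \<omega> + birth (\<lambda>u. T (b # u)) u \<omega>"
  by (simp add: birth_def sum.lessThan_Suc_shift del: sum.lessThan_Suc)

lemma birth_nonneg: "(\<And>u. 0 < T u \<omega>) \<Longrightarrow> 0 \<le> birth T u \<omega>"
  unfolding birth_def by (intro sum_nonneg) (auto intro: less_imp_le)

lemma alive_Nil: "[] \<in> alive T t \<omega> \<longleftrightarrow> 0 \<le> t \<and> t < T [] \<omega>"
  by (simp add: alive_def)

lemma alive_Cons: "b # u \<in> alive T t \<omega> \<longleftrightarrow> u \<in> alive (\<lambda>u. T (b # u)) (t - T [] \<omega>) \<omega>"
  by (auto simp: alive_def birth_Cons)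

lemma position_Cons:
  "position T B (b # u) t \<omega> = B [] (max 0 (min t (T [] \<omega>))) \<omega>
     + position (\<lambda>u. T (b # u)) (\<lambda>u. B (b # u)) u (t - T [] \<omega>) \<omega>"
proof -
  have "position T B (b # u) t \<omega> = B [] (max 0 (min t (T [] \<omega>))) \<omega> +
     (\<Sum>k\<le>length u. B (b # take k u) (max 0 (min (t - birth T (b # take k u) \<omega>) (T (b # take k u) \<omega>))) \<omega>)"
    by (simp add: position_def sum.atMost_Suc_shift del: sum.atMost_Suc)
  then show ?thesis
    by (simp add: position_def birth_Cons diff_diff_eq)
qed

lemma alive_early:
  assumes "\<And>u. 0 < T u \<omega>" "0 \<le> t" "t < T [] \<omega>"
  shows "alive T t \<omega> = {[]}"
proof (rule set_eqI)
  fix u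
  show "u \<in> alive T t \<omega> \<longleftrightarrow> u \<in> {[]}"
  proof (cases u)
    case (Cons b v)
    have "0 \<le> birth (\<lambda>u. T (b # u)) v \<omega>"
      by (rule birth_nonneg) (use assms in auto)
    then show ?thesis
      using assms Cons by (auto simp: alive_def birth_Cons)
  qed (use assms in \<open>auto simp: alive_Nil\<close>)
qed

lemma alive_late:
  assumes "T [] \<omega> \<le> t"
  shows "alive T t \<omega> = (\<Union>b. (#) b ` alive (\<lambda>u. T (b # u)) (t - T [] \<omega>) \<omega>)"
proof (rule set_eqI)
  fix u
  show "u \<in> alive T t \<omega> \<longleftrightarrow> u \<in> (\<Union>b. (#) b ` alive (\<lambda>u. T (b # u)) (t - T [] \<omega>) \<omega>)"
    using assms by (cases u) (auto simp: alive_Nil alive_Cons)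
qed

lemma finite_alive:
  "finite {u. birth T u \<omega> \<le> t} \<Longrightarrow> finite (alive T t \<omega>)"
  by (rule finite_subset[of _ "{u. birth T u \<omega> \<le> t}"]) (auto simp: alive_def)

lemma finite_birth_Cons:
  assumes "finite {u. birth T u \<omega> \<le> T [] \<omega> + t}"
  shows "finite {u. birth (\<lambda>u. T (b # u)) u \<omega> \<le> t}"
proof -
  have "(#) b ` {u. birth (\<lambda>u. T (b # u)) u \<omega> \<le> t} \<subseteq> {u. birth T u \<omega> \<le> T [] \<omega> + t}"
    by (auto simp: birth_Cons)
  then have "finite ((#) b ` {u. birth (\<lambda>u. T (b # u)) u \<omega> \<le> t})"
    using assms finite_subset by blast
  then show ?thesis
    by (rule finite_imageD) (auto simp: inj_on_def)
qed

lemma tree_prod_early: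
  assumes "\<And>u. 0 < T u \<omega>" "0 \<le> t" "t < T [] \<omega>"
  shows "tree_prod g T B t c \<omega> = g (B [] t \<omega> - c)"
  using assms by (simp add: tree_prod_def alive_early[of T \<omega>] position_def)

text \<open>The pathwise branching property: after the death of the root the system is the union of
  two systems, restarted with the remaining time and seen from a centre moved by the final position
  of the root.\<close>

lemma tree_prod_late:
  assumes pos: "\<And>u. 0 < T u \<omega>" and fin: "\<And>t. finite {u. birth T u \<omega> \<le> t}" and t: "T [] \<omega> \<le> t"
  shows "tree_prod g T B t c \<omega> =
    tree_prod g (\<lambda>u. T (False # u)) (\<lambda>u. B (False # u)) (t - T [] \<omega>) (c - B [] (T [] \<omega>) \<omega>) \<omega> *
    tree_prod g (\<lambda>u. T (True # u)) (\<lambda>u. B (True # u)) (t - T [] \<omega>) (c - B [] (T [] \<omega>) \<omega>) \<omega>"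
proof -
  define A where "A b = alive (\<lambda>u. T (b # u)) (t - T [] \<omega>) \<omega>" for b
  have fA: "finite (A b)" for b
    unfolding A_def by (rule finite_alive, rule finite_birth_Cons, rule fin)
  have m: "max 0 (min t (T [] \<omega>)) = T [] \<omega>"
    using pos[of "[]"] t by auto
  have al: "alive T t \<omega> = (#) False ` A False \<union> (#) True ` A True"
    unfolding alive_late[where T = T and t = t and \<omega> = \<omega>, OF t] A_def by (auto simp: UNIV_bool)
  have eq: "(\<Prod>u\<in>(#) b ` A b. g (position T B u t \<omega> - c)) =
     tree_prod g (\<lambda>u. T (b # u)) (\<lambda>u. B (b # u)) (t - T [] \<omega>) (c - B [] (T [] \<omega>) \<omega>) \<omega>" for b
    by (subst prod.reindex) (auto simp: tree_prod_def A_def position_Cons m algebra_simps intro!: prod.cong)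
  show ?thesis
    unfolding tree_prod_def[of g T] al
    by (subst prod.union_disjoint) (use fA in \<open>auto simp: eq\<close>)
qed

lemma finite_words: "finite {u :: bool list. length u \<le> n}"
  using finite_lists_length_le[of "UNIV :: bool set" n] by simp

lemma measurable_birth:
  assumes "\<And>u. T u \<in> borel_measurable M"
  shows "birth T u \<in> borel_measurable M"
  using assms by (simp add: birth_def[abs_def])

text \<open>The index set of the product is random. Restricting it to words of length at most
  \<open>n\<close> gives a deterministic finite index set, and since the living population is finite
  these products are eventually constant in \<open>n\<close>.\<close>

lemma measurable_tree_prod:
  assumes T [measurable]: "\<And>u. T u \<in> borel_measurable M"
    and B [measurable]: "\<And>u. (\<lambda>(s, \<omega>). B u s \<omega>) \<in> borel_measurable (borel \<Otimes>\<^sub>M M)"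
    and fin: "\<And>t \<omega>. \<omega> \<in> space M \<Longrightarrow> finite (alive T t \<omega>)"
    and g [measurable]: "g \<in> borel_measurable borel"
  shows "(\<lambda>(t, c, \<omega>). tree_prod g T B t c \<omega>) \<in> borel_measurable (borel \<Otimes>\<^sub>M borel \<Otimes>\<^sub>M M)"
proof -
  note [measurable] = measurable_birth[OF T]
  have pos [measurable]: "(\<lambda>(t, \<omega>). position T B u t \<omega>) \<in> borel_measurable (borel \<Otimes>\<^sub>M M)" for u
  proof -
    have "(\<lambda>x. B (take k u) (max 0 (min (fst x - birth T (take k u) (snd x)) (T (take k u) (snd x)))) (snd x))
      \<in> borel_measurable (borel \<Otimes>\<^sub>M M)" for k
      by (rule measurable_compose[OF _ B[of "take k u"], unfolded case_prod_beta fst_conv snd_conv,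
            of "\<lambda>x. (max 0 (min (fst x - birth T (take k u) (snd x)) (T (take k u) (snd x))), snd x)", simplified])
        measurable
    then show ?thesis
      unfolding position_def case_prod_beta by measurable
  qed
  define p where "p n x = (\<Prod>u\<in>{u. length u \<le> n}.
    if birth T u (snd (snd x)) \<le> fst x \<and> fst x < birth T u (snd (snd x)) + T u (snd (snd x))
    then g (position T B u (fst x) (snd (snd x)) - fst (snd x)) else 1)"
    for n :: nat and x :: "real \<times> real \<times> 'a"
  have pos': "(\<lambda>x. position T B u (fst x) (snd (snd x))) \<in> borel_measurable (borel \<Otimes>\<^sub>M borel \<Otimes>\<^sub>M M)" for u
    using measurable_compose[OF _ pos[of u], of "\<lambda>x. (fst x, snd (snd x))" "borel \<Otimes>\<^sub>M borel \<Otimes>\<^sub>M M"] by simp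
  note [measurable] = pos'
  have pm: "p n \<in> borel_measurable (borel \<Otimes>\<^sub>M borel \<Otimes>\<^sub>M M)" for n
    unfolding p_def by measurable
  have lim: "(\<lambda>n. p n x) \<longlonglongrightarrow> (case x of (t, c, \<omega>) \<Rightarrow> tree_prod g T B t c \<omega>)"
    if x: "x \<in> space (borel \<Otimes>\<^sub>M borel \<Otimes>\<^sub>M M)" for x
  proof -
    obtain t c \<omega> where xe: "x = (t, c, \<omega>)" by (cases x) auto
    have "finite (alive T t \<omega>)" using x fin by (auto simp: xe space_pair_measure)
    then have "finite (length ` alive T t \<omega>)" by simp
    then obtain m where m: "\<And>u. u \<in> alive T t \<omega> \<Longrightarrow> length u \<le> m"
      unfolding finite_nat_set_iff_bounded_le by auto
    have "p n x = tree_prod g T B t c \<omega>" if "m \<le> n" for n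
      unfolding p_def tree_prod_def xe fst_conv snd_conv
      by (rule prod.mono_neutral_cong_right)
        (use m that finite_words in \<open>auto simp: alive_def intro: order_trans\<close>)
    then have "\<forall>\<^sub>F n in sequentially. p n x = (case x of (t, c, \<omega>) \<Rightarrow> tree_prod g T B t c \<omega>)"
      unfolding xe eventually_sequentially by auto
    then show ?thesis by (rule tendsto_eventually)
  qed
  show ?thesis
    by (rule borel_measurable_LIMSEQ_order[OF lim pm])
qed

section \<open>Canonical marked trees\<close>

definition mark_space :: "(real \<times> (real \<Rightarrow> real)) measure" where
  "mark_space = borel \<Otimes>\<^sub>M PiM {0..} (\<lambda>_. borel)"

definition tree_space :: "(bool list \<Rightarrow> real \<times> (real \<Rightarrow> real)) measure" where
  "tree_space = PiM UNIV (\<lambda>_. mark_space)"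

text \<open>Evaluation of a path is not measurable in the pair (path, time) for the product
  \<open>\<sigma>\<close>-algebra; approximating the time from above by rationals gives a measurable function that
  agrees with the evaluation on continuous paths.\<close>

definition path_eval :: "(real \<Rightarrow> real) \<Rightarrow> real \<Rightarrow> real" where
  "path_eval p s = lim (\<lambda>n. p (real (nat \<lceil>real (Suc n) * s\<rceil>) / real (Suc n)))"

lemma path_eval_continuous:
  assumes "continuous_on {0..} p" "0 \<le> s"
  shows "path_eval p s = p s"
  unfolding path_eval_def
proof (rule limI)
  let ?a = "\<lambda>n. real (nat \<lceil>real (Suc n) * s\<rceil>) / real (Suc n)"
  have b: "s \<le> ?a n" "?a n \<le> s + 1 / real (Suc n)" for n
  proof -
    have "0 \<le> real (Suc n) * s" using assms by simp
    then have r: "real (Suc n) * s \<le> real (nat \<lceil>real (Suc n) * s\<rceil>)" "real (nat \<lceil>real (Suc n) * s\<rceil>) \<le> real (Suc n) * s + 1"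
      by linarith+
    show "s \<le> ?a n" using r(1) by (simp add: field_simps)
    have "?a n \<le> (real (Suc n) * s + 1) / real (Suc n)"
      using r(2) by (intro divide_right_mono) auto
    also have "\<dots> = s + 1 / real (Suc n)" by (simp add: add_divide_distrib)
    finally show "?a n \<le> s + 1 / real (Suc n)" .
  qed
  have "(\<lambda>n. s + inverse (real (Suc n))) \<longlonglongrightarrow> s + 0"
    by (intro tendsto_intros LIMSEQ_inverse_real_of_nat)
  then have "?a \<longlonglongrightarrow> s"
    by (intro tendsto_sandwich[OF _ _ tendsto_const, of s ?a sequentially "\<lambda>n. s + inverse (real (Suc n))"])
      (use b in \<open>auto simp: inverse_eq_divide\<close>)
  then show "(\<lambda>n. p (?a n)) \<longlonglongrightarrow> p s"
  proof (rule continuous_on_tendsto_compose[OF assms(1)])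
    have "0 \<le> ?a n" for n by (intro divide_nonneg_nonneg of_nat_0_le_iff)
    then show "\<forall>\<^sub>F n in sequentially. ?a n \<in> {0..}"
      unfolding atLeast_iff by (intro always_eventually allI)
  qed (use assms(2) in simp)
qed

lemma measurable_path_eval:
  "(\<lambda>(s, p). path_eval p s) \<in> borel_measurable (borel \<Otimes>\<^sub>M PiM {0..} (\<lambda>_. borel))"
proof -
  have "(\<lambda>x. (\<lambda>i x. snd x (real i / real (Suc n))) (nat \<lceil>real (Suc n) * fst x\<rceil>) x)
    \<in> borel_measurable (borel \<Otimes>\<^sub>M PiM {0::real..} (\<lambda>_. borel))" for n
  proof (rule measurable_compose_countable[where f = "\<lambda>i x. snd x (real i / real (Suc n))" and g = "\<lambda>x. nat \<lceil>real (Suc n) * fst x\<rceil>"])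
    fix i :: nat
    show "(\<lambda>x. snd x (real i / real (Suc n))) \<in> borel_measurable (borel \<Otimes>\<^sub>M PiM {0::real..} (\<lambda>_. borel))"
      by (rule measurable_compose[OF measurable_snd measurable_component_singleton]) simp
  qed measurable
  then show ?thesis
    unfolding case_prod_beta path_eval_def by (rule borel_measurable_lim_metric)
qed

definition good_tree :: "(bool list \<Rightarrow> real \<times> (real \<Rightarrow> real)) \<Rightarrow> bool" where
  "good_tree z \<longleftrightarrow> (\<forall>u. 0 < fst (z u)) \<and> (\<forall>t. finite {u. birth (\<lambda>u z. fst (z u)) u z \<le> t})"

text \<open>Off the good trees the lifetimes are 1 and, in \<open>canon_B\<close>, the displacements
  are 0, so that positivity and finiteness hold at every point of \<open>tree_space\<close>;
  pointwise facts such as \<open>measurable_tree_prod\<close> and \<open>tree_prod_late\<close> then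
  apply there.\<close>

definition canon_T :: "bool list \<Rightarrow> (bool list \<Rightarrow> real \<times> (real \<Rightarrow> real)) \<Rightarrow> real" where
  "canon_T u z = (if good_tree z then fst (z u) else 1)"

definition canon_B :: "bool list \<Rightarrow> real \<Rightarrow> (bool list \<Rightarrow> real \<times> (real \<Rightarrow> real)) \<Rightarrow> real" where
  "canon_B u s z = (if good_tree z then path_eval (snd (z u)) s else 0)"

lemma measurable_mark: "(\<lambda>z. z u) \<in> tree_space \<rightarrow>\<^sub>M mark_space"
  unfolding tree_space_def by (rule measurable_component_singleton) simp

lemma measurable_fst_mark [measurable]: "(\<lambda>z. fst (z u)) \<in> borel_measurable tree_space"
  by (rule measurable_compose[OF measurable_mark]) (simp add: mark_space_def)

lemma measurable_snd_mark [measurable]: "(\<lambda>z. snd (z u)) \<in> tree_space \<rightarrow>\<^sub>M PiM {0..} (\<lambda>_. borel)"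
  by (rule measurable_compose[OF measurable_mark]) (simp add: mark_space_def)

text \<open>Measurability of \<open>good_tree\<close> needs countable quantifiers: integer times
  suffice by monotonicity, and a set of binary words is finite exactly when its lengths are
  bounded.\<close>

lemma good_tree_iff:
  "good_tree z \<longleftrightarrow> (\<forall>u. 0 < fst (z u)) \<and>
     (\<forall>n::nat. \<exists>k. \<forall>u. birth (\<lambda>u z. fst (z u)) u z \<le> real n \<longrightarrow> length u \<le> k)"
proof -
  have "(\<forall>t. finite {u. birth (\<lambda>u z. fst (z u)) u z \<le> t}) \<longleftrightarrow>
     (\<forall>n::nat. finite {u. birth (\<lambda>u z. fst (z u)) u z \<le> real n})"
  proof (intro iffI allI)
    fix t :: real
    assume *: "\<forall>n::nat. finite {u. birth (\<lambda>u z. fst (z u)) u z \<le> real n}"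
    obtain n :: nat where "t \<le> real n" using real_arch_simple by blast
    then show "finite {u. birth (\<lambda>u z. fst (z u)) u z \<le> t}"
      by (intro finite_subset[OF _ *[rule_format, of n]]) auto
  qed auto
  moreover have "finite {u. birth (\<lambda>u z. fst (z u)) u z \<le> t} \<longleftrightarrow>
      (\<exists>k. \<forall>u. birth (\<lambda>u z. fst (z u)) u z \<le> t \<longrightarrow> length u \<le> k)" for t
  proof
    assume "finite {u. birth (\<lambda>u z. fst (z u)) u z \<le> t}"
    then have "finite (length ` {u. birth (\<lambda>u z. fst (z u)) u z \<le> t})" by simp
    then show "\<exists>k. \<forall>u. birth (\<lambda>u z. fst (z u)) u z \<le> t \<longrightarrow> length u \<le> k"
      unfolding finite_nat_set_iff_bounded_le by auto
  next
    assume "\<exists>k. \<forall>u. birth (\<lambda>u z. fst (z u)) u z \<le> t \<longrightarrow> length u \<le> k"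
    then show "finite {u. birth (\<lambda>u z. fst (z u)) u z \<le> t}"
      using finite_subset[OF _ finite_words] by (metis (mono_tags, lifting) Collect_mono)
  qed
  ultimately show ?thesis by (simp add: good_tree_def)
qed

lemma measurable_good_tree [measurable]: "Measurable.pred tree_space good_tree"
proof -
  have [measurable]: "birth (\<lambda>u z. fst (z u)) u \<in> borel_measurable tree_space" for u
    by (rule measurable_birth) measurable
  show ?thesis
    unfolding good_tree_iff[abs_def] by measurable
qed

lemma measurable_canon_T [measurable]: "canon_T u \<in> borel_measurable tree_space"
  unfolding canon_T_def[abs_def] by measurable

lemma measurable_canon_B [measurable]:
  "(\<lambda>(s, z). canon_B u s z) \<in> borel_measurable (borel \<Otimes>\<^sub>M tree_space)"
proof -
  have "(\<lambda>x. path_eval (snd (snd x u)) (fst x)) \<in> borel_measurable (borel \<Otimes>\<^sub>M tree_space)"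
    using measurable_compose[OF _ measurable_path_eval, of "\<lambda>x. (fst x, snd (snd x u))" "borel \<Otimes>\<^sub>M tree_space"]
    by simp
  then show ?thesis
    unfolding canon_B_def case_prod_beta by measurable
qed

lemma canon_T_pos: "0 < canon_T u z"
  by (simp add: canon_T_def good_tree_def)

lemma canon_T_finite: "finite {u. birth canon_T u z \<le> t}"
proof (cases "good_tree z")
  case True
  have "birth canon_T u z = birth (\<lambda>u z. fst (z u)) u z" for u
    by (rule birth_cong) (use True in \<open>simp add: canon_T_def\<close>)
  then show ?thesis using True by (simp add: good_tree_def)
next
  case False
  then have "birth canon_T u z = real (length u)" for u
    by (simp add: birth_def canon_T_def)
  moreover obtain n :: nat where "t \<le> real n" using real_arch_simple by blast
  ultimately show ?thesis
    by (intro finite_subset[OF _ finite_words[of n]]) (auto intro: order_trans)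
qed

lemma measurable_canon_tree_prod:
  assumes "g \<in> borel_measurable borel"
  shows "(\<lambda>(t, c, z). tree_prod g canon_T canon_B t c z) \<in> borel_measurable (borel \<Otimes>\<^sub>M borel \<Otimes>\<^sub>M tree_space)"
  by (rule measurable_tree_prod[OF _ _ _ assms]) (auto intro: finite_alive canon_T_finite)

section \<open>The law of the marked tree\<close>

abbreviation (input) path_space :: "(real \<Rightarrow> real) measure" where
  "path_space \<equiv> PiM {0..} (\<lambda>_. borel)"

lemma brownian_path_measurable:
  assumes "brownian_motion P B"
  shows "(\<lambda>\<omega>. \<lambda>s\<in>{0..}. B s \<omega>) \<in> P \<rightarrow>\<^sub>M path_space"
  by (rule measurable_restrict) (use assms in \<open>auto simp: brownian_motion_def\<close>)

text \<open>Since \<open>B 0 = 0\<close> and the grid starts at 0, the values on the grid are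
  partial sums of independent Gaussian increments. The right side does not depend on
  \<open>P\<close> or \<open>B\<close>, which is what uniqueness in law needs.\<close>

lemma brownian_cylinder:
  assumes bm: "brownian_motion P B" and s: "s 0 = 0" "\<And>i. i < n \<Longrightarrow> s i < s (Suc i)" and n: "0 < n"
    and J: "J = s ` K" "K \<subseteq> {..n}" and A: "\<And>j. j \<in> J \<Longrightarrow> A j \<in> sets borel"
  shows "emeasure P {\<omega> \<in> space P. \<forall>j\<in>J. B j \<omega> \<in> A j} =
    emeasure (PiM {..<n} (\<lambda>i. density lborel (\<lambda>x. ennreal (normal_density 0 (sqrt (s (Suc i) - s i)) x))))
      {x \<in> space (PiM {..<n} (\<lambda>_. borel)). \<forall>i\<in>K. (\<Sum>k<i. x k) \<in> A (s i)}"
    (is "_ = emeasure ?N ?S")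
proof -
  interpret prob_space P using bm by (simp add: brownian_motion_def)
  define D where "D i \<omega> = B (s (Suc i)) \<omega> - B (s i) \<omega>" for i \<omega>
  have sn: "0 \<le> s i" if "i \<le> n" for i
    using that
  proof (induction i)
    case (Suc i)
    then show ?case using s(2)[of i] by auto
  qed (simp add: s)
  have Bm: "B (s i) \<in> borel_measurable P" if "i \<le> n" for i
    using bm sn that by (auto simp: brownian_motion_def)
  have Dm: "D i \<in> borel_measurable P" if "i < n" for i
    unfolding D_def using Bm that by (intro borel_measurable_diff) auto
  have ind: "indep_vars (\<lambda>_. borel) D {..<n}"
    unfolding D_def[abs_def] using bm s unfolding brownian_motion_def by auto
  have dD: "distr P borel (D i) = density lborel (\<lambda>x. ennreal (normal_density 0 (sqrt (s (Suc i) - s i)) x))" if "i < n" for i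
  proof -
    have "distributed P lborel (D i) (normal_density 0 (sqrt (s (Suc i) - s i)))"
      unfolding D_def[abs_def] using bm that s sn[of i] unfolding brownian_motion_def by auto
    from distributed_distr_eq_density[OF this] show ?thesis
      by (simp cong: distr_cong)
  qed
  have "distr P (PiM {..<n} (\<lambda>_. borel)) (\<lambda>\<omega>. \<lambda>i\<in>{..<n}. D i \<omega>) = PiM {..<n} (\<lambda>i. distr P borel (D i))"
    using ind n Dm by (subst (asm) indep_vars_iff_distr_eq_PiM') auto
  also have "\<dots> = ?N"
    by (rule PiM_cong) (auto simp: dD)
  finally have dist: "distr P (PiM {..<n} (\<lambda>_. borel)) (\<lambda>\<omega>. \<lambda>i\<in>{..<n}. D i \<omega>) = ?N" .
  have B0: "B (s i) \<omega> = (\<Sum>k<i. D k \<omega>)" if "\<omega> \<in> space P" "i \<le> n" for i \<omega>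
  proof -
    have "(\<Sum>k<i. D k \<omega>) = B (s i) \<omega> - B (s 0) \<omega>"
      unfolding D_def by (rule sum_lessThan_telescope)
    then show ?thesis using bm that by (simp add: s brownian_motion_def)
  qed
  have Sm: "?S \<in> sets (PiM {..<n} (\<lambda>_. borel))"
  proof -
    have [measurable]: "(\<lambda>x. \<Sum>k<i. x k :: real) \<in> borel_measurable (PiM {..<n} (\<lambda>_. borel))" if "i \<in> K" for i
      by (rule borel_measurable_sum[where f = "\<lambda>k x. x k"], rule measurable_component_singleton) (use that J in auto)
    have [measurable]: "A (s i) \<in> sets borel" if "i \<in> K" for i using A J that by auto
    have "finite K" using J finite_subset by blast
    then show ?thesis by measurable
  qed
  have rm: "(\<lambda>\<omega>. \<lambda>i\<in>{..<n}. D i \<omega>) \<in> P \<rightarrow>\<^sub>M PiM {..<n} (\<lambda>_. borel)"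
    by (rule measurable_restrict) (use Dm in auto)
  have "emeasure ?N ?S = emeasure P ((\<lambda>\<omega>. \<lambda>i\<in>{..<n}. D i \<omega>) -` ?S \<inter> space P)"
    unfolding dist[symmetric] by (rule emeasure_distr[OF rm Sm])
  also have "(\<lambda>\<omega>. \<lambda>i\<in>{..<n}. D i \<omega>) -` ?S \<inter> space P = {\<omega> \<in> space P. \<forall>j\<in>J. B j \<omega> \<in> A j}"
  proof -
    have "(\<forall>i\<in>K. (\<Sum>k<i. (\<lambda>i\<in>{..<n}. D i \<omega>) k) \<in> A (s i)) \<longleftrightarrow> (\<forall>j\<in>J. B j \<omega> \<in> A j)" if \<omega>: "\<omega> \<in> space P" for \<omega>
    proof -
      have "(\<Sum>k<i. (\<lambda>i\<in>{..<n}. D i \<omega>) k) = B (s i) \<omega>" if "i \<in> K" for i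
        using B0[OF \<omega>, of i] that J by (auto intro!: sum.cong)
      then show ?thesis using J by simp
    qed
    then show ?thesis
      using measurable_space[OF rm] by auto
  qed
  finally show ?thesis ..
qed

text \<open>The displacements of different particles are only assumed to be Brownian motions, each
  by itself; uniqueness of the law on paths makes the marks identically distributed.\<close>

lemma brownian_law_unique:
  assumes bm: "brownian_motion P B" and bm': "brownian_motion P' B'"
  shows "distr P path_space (\<lambda>\<omega>. \<lambda>s\<in>{0..}. B s \<omega>) = distr P' path_space (\<lambda>\<omega>. \<lambda>s\<in>{0..}. B' s \<omega>)"
proof (rule measure_eqI_PiM_infinite)
  have "prob_space P" using bm by (simp add: brownian_motion_def)
  then show "finite_measure (distr P path_space (\<lambda>\<omega>. \<lambda>s\<in>{0..}. B s \<omega>))"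
    by (intro prob_space.finite_measure prob_space.prob_space_distr brownian_path_measurable bm)
  fix A :: "real \<Rightarrow> real set" and J :: "real set"
  assume J: "finite J" "J \<subseteq> {0..}" and A: "\<And>i. i \<in> J \<Longrightarrow> A i \<in> sets borel"
  \<comment> \<open>Adding 0 and 1 makes the grid start at 0 and have at least two points, so that
    \<open>n\<close> is positive.\<close>
  define l where "l = sorted_list_of_set (J \<union> {0, 1})"
  define s where "s i = l ! i" for i
  define n where "n = length l - 1"
  have setl: "set l = J \<union> {0, 1}" and sl: "sorted_wrt (<) l"
    using J strict_sorted_list_of_set[of "J \<union> {0, 1}"] set_sorted_list_of_set[of "J \<union> {0, 1}"]
    by (simp_all add: l_def del: sorted_list_of_set_insert)
  have ln: "length l = Suc n" and n: "0 < n"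
  proof -
    have "card (J \<union> {0, 1::real}) \<ge> card {0, 1::real}"
      by (rule card_mono) (use J in auto)
    then have "2 \<le> length l" unfolding l_def length_sorted_list_of_set by simp
    then show "length l = Suc n" "0 < n" by (auto simp: n_def)
  qed
  have smono: "s i < s j" if "i < j" "j \<le> n" for i j
    using sorted_wrt_nth_less[OF sl that(1)] that ln by (simp add: s_def)
  have s0: "s 0 = 0"
  proof -
    have "0 \<in> set l" using setl by simp
    then obtain k where k: "k \<le> n" "s k = 0" using ln by (auto simp: in_set_conv_nth s_def less_Suc_eq_le)
    have "s 0 \<in> set l" using ln by (simp add: s_def)
    then have "0 \<le> s 0" using setl J by auto
    then show ?thesis using smono[of 0 k] k by (cases "k = 0") auto
  qed
  define K where "K = {i. i \<le> n \<and> s i \<in> J}"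
  have K: "J = s ` K" "K \<subseteq> {..n}"
  proof -
    have "J \<subseteq> s ` K"
    proof
      fix j assume "j \<in> J"
      then have "j \<in> set l" using setl by simp
      then obtain i where "i \<le> n" "s i = j" using ln by (auto simp: in_set_conv_nth s_def less_Suc_eq_le)
      then show "j \<in> s ` K" using \<open>j \<in> J\<close> by (auto simp: K_def)
    qed
    then show "J = s ` K" "K \<subseteq> {..n}" by (auto simp: K_def)
  qed
  have cyl: "emeasure (distr P path_space (\<lambda>\<omega>. \<lambda>s\<in>{0..}. B s \<omega>)) (prod_emb {0..} (\<lambda>_. borel) J (Pi\<^sub>E J A))
      = emeasure P {\<omega> \<in> space P. \<forall>j\<in>J. B j \<omega> \<in> A j}" if "brownian_motion P B" for P :: "'z measure" and B
  proof -
    have "emeasure (distr P path_space (\<lambda>\<omega>. \<lambda>s\<in>{0..}. B s \<omega>)) (prod_emb {0..} (\<lambda>_. borel) J (Pi\<^sub>E J A))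
      = emeasure P ((\<lambda>\<omega>. \<lambda>s\<in>{0..}. B s \<omega>) -` prod_emb {0..} (\<lambda>_. borel) J (Pi\<^sub>E J A) \<inter> space P)"
      by (rule emeasure_distr[OF brownian_path_measurable[OF that] sets_PiM_I]) (use J A in auto)
    also have "(\<lambda>\<omega>. \<lambda>s\<in>{0..}. B s \<omega>) -` prod_emb {0..} (\<lambda>_. borel) J (Pi\<^sub>E J A) \<inter> space P
      = {\<omega> \<in> space P. \<forall>j\<in>J. B j \<omega> \<in> A j}"
      using J(2) by (auto simp: prod_emb_def PiE_iff extensional_def restrict_def subset_eq)
    finally show ?thesis .
  qed
  show "emeasure (distr P path_space (\<lambda>\<omega>. \<lambda>s\<in>{0..}. B s \<omega>)) (prod_emb {0..} (\<lambda>_. borel) J (Pi\<^sub>E J A)) =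
    emeasure (distr P' path_space (\<lambda>\<omega>. \<lambda>s\<in>{0..}. B' s \<omega>)) (prod_emb {0..} (\<lambda>_. borel) J (Pi\<^sub>E J A))"
    unfolding cyl[OF bm] cyl[OF bm']
    using brownian_cylinder[OF bm s0 _ n K A] brownian_cylinder[OF bm' s0 _ n K A] smono by simp
qed simp_all

text \<open>The displacement of the root represents all particles, their path laws being equal by
  \<open>brownian_law_unique\<close>.\<close>

definition mark_law :: "'a measure \<Rightarrow> (bool list \<Rightarrow> real \<Rightarrow> 'a \<Rightarrow> real) \<Rightarrow> (real \<times> (real \<Rightarrow> real)) measure" where
  "mark_law P B = density lborel (\<lambda>x. ennreal (exponential_density 1 x)) \<Otimes>\<^sub>M
     distr P path_space (\<lambda>\<omega>. \<lambda>s\<in>{0..}. B [] s \<omega>)"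

definition mark :: "(bool list \<Rightarrow> 'a \<Rightarrow> real) \<Rightarrow> (bool list \<Rightarrow> real \<Rightarrow> 'a \<Rightarrow> real) \<Rightarrow> bool list \<Rightarrow> 'a \<Rightarrow>
    real \<times> (real \<Rightarrow> real)" where
  "mark T B u \<omega> = (T u \<omega>, \<lambda>s\<in>{0..}. B u s \<omega>)"

definition tree_law :: "'a measure \<Rightarrow> (bool list \<Rightarrow> real \<Rightarrow> 'a \<Rightarrow> real) \<Rightarrow>
    (bool list \<Rightarrow> real \<times> (real \<Rightarrow> real)) measure" where
  "tree_law P B = PiM UNIV (\<lambda>_. mark_law P B)"

lemma sets_mark_law: "sets (mark_law P B) = sets mark_space"
  unfolding mark_law_def mark_space_def by (intro sets_pair_measure_cong) auto

lemma sets_tree_law: "sets (tree_law P B) = sets tree_space"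
  unfolding tree_law_def tree_space_def by (intro sets_PiM_cong) (auto simp: sets_mark_law)

lemma distr_independent_rvs:
  assumes P: "prob_space P" and ind: "independent_rvs P M X N Y"
  shows "distr P (M \<Otimes>\<^sub>M N) (\<lambda>\<omega>. (X \<omega>, Y \<omega>)) = distr P M X \<Otimes>\<^sub>M distr P N Y"
proof (rule sym)
  interpret prob_space P by fact
  have X [measurable]: "X \<in> P \<rightarrow>\<^sub>M M" and Y [measurable]: "Y \<in> P \<rightarrow>\<^sub>M N"
    and i: "indep_set {X -` A \<inter> space P | A. A \<in> sets M} {Y -` A \<inter> space P | A. A \<in> sets N}"
    using ind by (auto simp: independent_rvs_def)
  interpret X: prob_space "distr P M X" by (rule prob_space_distr[OF X])
  interpret Y: prob_space "distr P N Y" by (rule prob_space_distr[OF Y])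
  show "distr P M X \<Otimes>\<^sub>M distr P N Y = distr P (M \<Otimes>\<^sub>M N) (\<lambda>\<omega>. (X \<omega>, Y \<omega>))"
  proof (rule pair_measure_eqI)
    fix A B assume A: "A \<in> sets (distr P M X)" and B: "B \<in> sets (distr P N Y)"
    have "emeasure (distr P (M \<Otimes>\<^sub>M N) (\<lambda>\<omega>. (X \<omega>, Y \<omega>))) (A \<times> B)
      = emeasure P ((X -` A \<inter> space P) \<inter> (Y -` B \<inter> space P))"
      using A B by (subst emeasure_distr) (auto intro!: arg_cong[where f = "emeasure P"])
    also have "\<dots> = emeasure P (X -` A \<inter> space P) * emeasure P (Y -` B \<inter> space P)"
      using A B by (subst (1 2 3) emeasure_eq_measure, subst indep_setD[OF i]) (auto simp: ennreal_mult)
    finally show "emeasure (distr P M X) A * emeasure (distr P N Y) B =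
      emeasure (distr P (M \<Otimes>\<^sub>M N) (\<lambda>\<omega>. (X \<omega>, Y \<omega>))) (A \<times> B)"
      using A B by (simp add: emeasure_distr)
  qed (auto intro: X.sigma_finite_measure_axioms Y.sigma_finite_measure_axioms cong: sets_pair_measure_cong)
qed

context
  fixes P :: "'a measure" and T B
  assumes bbm: "binary_bbm P T B"
begin

lemma bbm_facts:
  shows bbm_prob: "prob_space P" and bbm_T: "distributed P lborel (T u) (exponential_density 1)"
    and bbm_B: "brownian_motion P (B u)"
    and bbm_ind: "independent_rvs P borel (T u) path_space (\<lambda>\<omega>. \<lambda>s\<in>{0..}. B u s \<omega>)"
    and bbm_indep: "prob_space.indep_vars P (\<lambda>_. mark_space) (mark T B) UNIV"
    and bbm_pos: "\<omega> \<in> space P \<Longrightarrow> 0 < T u \<omega>"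
    and bbm_fin: "\<omega> \<in> space P \<Longrightarrow> finite {u. birth T u \<omega> \<le> t}"
  using bbm by (auto simp: binary_bbm_def mark_def[abs_def] mark_space_def)

lemma bbm_T_measurable: "T u \<in> borel_measurable P"
  using distributed_measurable[OF bbm_T[of u]] by simp

lemma mark_measurable: "mark T B u \<in> P \<rightarrow>\<^sub>M mark_space"
  unfolding mark_def[abs_def] mark_space_def
  by (intro measurable_Pair bbm_T_measurable brownian_path_measurable bbm_B)

lemma distr_mark: "distr P mark_space (mark T B u) = mark_law P B"
proof -
  have "distr P mark_space (mark T B u) = distr P borel (T u) \<Otimes>\<^sub>M distr P path_space (\<lambda>\<omega>. \<lambda>s\<in>{0..}. B u s \<omega>)"
    unfolding mark_def[abs_def] mark_space_def
    by (rule distr_independent_rvs[OF bbm_prob bbm_ind])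
  also have "distr P borel (T u) = density lborel (\<lambda>x. ennreal (exponential_density 1 x))"
    using distributed_distr_eq_density[OF bbm_T[of u]] by (simp cong: distr_cong)
  also have "distr P path_space (\<lambda>\<omega>. \<lambda>s\<in>{0..}. B u s \<omega>) = distr P path_space (\<lambda>\<omega>. \<lambda>s\<in>{0..}. B [] s \<omega>)"
    by (rule brownian_law_unique[OF bbm_B bbm_B])
  finally show ?thesis by (simp add: mark_law_def)
qed

lemma prob_space_mark_law: "prob_space (mark_law P B)"
  unfolding distr_mark[of "[]", symmetric]
  by (rule prob_space.prob_space_distr[OF bbm_prob mark_measurable])

lemma tree_measurable: "(\<lambda>\<omega> u. mark T B u \<omega>) \<in> P \<rightarrow>\<^sub>M tree_space"
  unfolding tree_space_def
  using measurable_restrict[of UNIV "mark T B" P "\<lambda>_. mark_space"] mark_measurable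
  by (simp add: restrict_def)

text \<open>Independence over words makes the joint law of the marks a product of copies of
  \<open>mark_law\<close>, so that expectations on \<open>P\<close> can be computed on
  \<open>tree_space\<close>.\<close>

lemma distr_tree: "distr P tree_space (\<lambda>\<omega> u. mark T B u \<omega>) = tree_law P B"
proof -
  interpret prob_space P by (rule bbm_prob)
  have "distr P (PiM UNIV (\<lambda>_. mark_space)) (\<lambda>\<omega>. \<lambda>u\<in>UNIV. mark T B u \<omega>) = PiM UNIV (\<lambda>u. distr P mark_space (mark T B u))"
    using bbm_indep mark_measurable by (subst (asm) indep_vars_iff_distr_eq_PiM) auto
  then show ?thesis
    by (simp add: distr_mark tree_space_def tree_law_def restrict_def)
qed

lemma prob_space_tree_law: "prob_space (tree_law P B)"
  unfolding distr_tree[symmetric]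
  by (rule prob_space.prob_space_distr[OF bbm_prob tree_measurable])

lemma good_tree_bbm:
  assumes "\<omega> \<in> space P"
  shows "good_tree (\<lambda>u. mark T B u \<omega>)"
proof -
  have "birth (\<lambda>u z. fst (z u)) u (\<lambda>u. mark T B u \<omega>) = birth T u \<omega>" for u
    by (rule birth_cong) (simp add: mark_def)
  then show ?thesis
    using assms bbm_pos bbm_fin by (auto simp: good_tree_def mark_def)
qed

lemma canon_bbm:
  assumes "\<omega> \<in> space P"
  shows "canon_T u (\<lambda>u. mark T B u \<omega>) = T u \<omega>"
    and "0 \<le> s \<Longrightarrow> canon_B u s (\<lambda>u. mark T B u \<omega>) = B u s \<omega>"
proof -
  show "canon_T u (\<lambda>u. mark T B u \<omega>) = T u \<omega>"
    using good_tree_bbm[OF assms] by (simp add: canon_T_def mark_def)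
  assume s: "0 \<le> s"
  have "continuous_on {0..} (\<lambda>t. B u t \<omega>)"
    using bbm_B[of u] assms by (simp add: brownian_motion_def)
  then have "continuous_on {0..} (\<lambda>s\<in>{0..}. B u s \<omega>)"
    by (rule continuous_on_eq) simp
  then show "canon_B u s (\<lambda>u. mark T B u \<omega>) = B u s \<omega>"
    using good_tree_bbm[OF assms] s by (simp add: canon_B_def mark_def path_eval_continuous)
qed

end

section \<open>Branching at the first split\<close>

definition join_tree :: "'m \<Rightarrow> (bool list \<Rightarrow> 'm) \<Rightarrow> (bool list \<Rightarrow> 'm) \<Rightarrow> bool list \<Rightarrow> 'm" where
  "join_tree x z0 z1 u = (case u of [] \<Rightarrow> x | b # v \<Rightarrow> if b then z1 v else z0 v)"

lemma join_tree_simps [simp]: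
  "join_tree x z0 z1 [] = x" "join_tree x z0 z1 (False # v) = z0 v" "join_tree x z0 z1 (True # v) = z1 v"
  by (simp_all add: join_tree_def)

lemma measurable_join_tree:
  "(\<lambda>(x, z0, z1). join_tree x z0 z1) \<in> (M \<Otimes>\<^sub>M PiM UNIV (\<lambda>_. M) \<Otimes>\<^sub>M PiM UNIV (\<lambda>_. M)) \<rightarrow>\<^sub>M PiM UNIV (\<lambda>_. M)"
proof -
  have c: "(\<lambda>z. z v) \<in> PiM UNIV (\<lambda>_. M) \<rightarrow>\<^sub>M M" for v :: "bool list"
    by (rule measurable_component_singleton) simp
  have "(\<lambda>x. join_tree (fst x) (fst (snd x)) (snd (snd x)) u) \<in>
     (M \<Otimes>\<^sub>M PiM UNIV (\<lambda>_. M) \<Otimes>\<^sub>M PiM UNIV (\<lambda>_. M)) \<rightarrow>\<^sub>M M" for u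
  proof (cases u)
    case Nil
    then show ?thesis by simp
  next
    case (Cons b v)
    then show ?thesis
      using measurable_compose[OF measurable_compose[OF measurable_snd measurable_fst] c[of v]]
        measurable_compose[OF measurable_compose[OF measurable_snd measurable_snd] c[of v]]
      by (cases b) simp_all
  qed
  then have "(\<lambda>x. \<lambda>u\<in>UNIV. join_tree (fst x) (fst (snd x)) (snd (snd x)) u) \<in>
     (M \<Otimes>\<^sub>M PiM UNIV (\<lambda>_. M) \<Otimes>\<^sub>M PiM UNIV (\<lambda>_. M)) \<rightarrow>\<^sub>M PiM UNIV (\<lambda>_. M)"
    by (rule measurable_restrict)
  then show ?thesis by (simp add: case_prod_beta restrict_def)
qed

text \<open>A word is empty or begins with one of two letters, so an i.i.d. family over words is a
  root mark together with two independent copies of the whole family. Equality is checked on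
  cylinders, split along the first letter by \<open>K\<close>.\<close>

lemma distr_join_tree:
  assumes "prob_space M"
  shows "distr (M \<Otimes>\<^sub>M PiM UNIV (\<lambda>_. M) \<Otimes>\<^sub>M PiM UNIV (\<lambda>_. M)) (PiM UNIV (\<lambda>_. M))
    (\<lambda>(x, z0, z1). join_tree x z0 z1) = PiM UNIV (\<lambda>_::bool list. M)" (is "distr ?X ?W ?f = _")
proof -
  interpret M: prob_space M by fact
  interpret product_prob_space "\<lambda>_::bool list. M" UNIV ..
  interpret WW: pair_prob_space ?W ?W ..
  show ?thesis
  proof (rule PiM_eq)
    fix J :: "bool list set" and F
    assume J: "finite J" and F: "\<And>j. j \<in> J \<Longrightarrow> F j \<in> sets M"
    define K where "K b = {v. b # v \<in> J}" for b
    have fK: "finite (K b)" for b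
    proof -
      have "finite ((#) b ` K b)" by (rule finite_subset[OF _ J]) (auto simp: K_def)
      then show ?thesis by (rule finite_imageD) (auto simp: inj_on_def)
    qed
    define A where "A = (if [] \<in> J then F [] else space M)"
    define S where "S b = {z \<in> space ?W. \<forall>v\<in>K b. z v \<in> F (b # v)}" for b
    have A: "A \<in> sets M" using F by (simp add: A_def)
    have S: "emeasure ?W (S b) = (\<Prod>v\<in>K b. emeasure M (F (b # v)))" for b
      unfolding S_def by (rule emeasure_PiM_Collect) (use fK F in \<open>auto simp: K_def\<close>)
    have Ss: "S b \<in> sets ?W" for b
    proof -
      have "S b = prod_emb UNIV (\<lambda>_. M) (K b) (Pi\<^sub>E (K b) (\<lambda>v. F (b # v)))"
        unfolding S_def prod_emb_def by (auto simp: space_PiM Pi_iff)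
      then show ?thesis using fK F by (auto simp: K_def intro!: sets_PiM_I)
    qed
    have split: "J = ({[]} \<inter> J) \<union> ((#) False ` K False \<union> (#) True ` K True)"
    proof (rule set_eqI)
      fix u show "u \<in> J \<longleftrightarrow> u \<in> ({[]} \<inter> J) \<union> ((#) False ` K False \<union> (#) True ` K True)"
      proof (cases u)
        case (Cons b v) then show ?thesis by (cases b) (auto simp: K_def)
      qed auto
    qed
    have pJ: "(\<Prod>j\<in>J. emeasure M (F j)) =
       (\<Prod>j\<in>{[]} \<inter> J. emeasure M (F j)) * ((\<Prod>v\<in>K False. emeasure M (F (False # v))) * (\<Prod>v\<in>K True. emeasure M (F (True # v))))"
      by (subst split, subst prod.union_disjoint, use fK in auto)
        (subst prod.union_disjoint, use fK in \<open>auto simp: prod.reindex\<close>)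
    have pA: "(\<Prod>j\<in>{[]} \<inter> J. emeasure M (F j)) = emeasure M A"
      by (auto simp: A_def M.emeasure_space_1)
    have "?f -` prod_emb UNIV (\<lambda>_. M) J (Pi\<^sub>E J F) \<inter> space ?X = A \<times> (S False \<times> S True)" (is "?l = ?r")
    proof (rule set_eqI)
      fix y :: "'a \<times> (bool list \<Rightarrow> 'a) \<times> (bool list \<Rightarrow> 'a)"
      obtain x z0 z1 where y: "y = (x, z0, z1)" by (cases y) auto
      have sp: "y \<in> space ?X \<longleftrightarrow> x \<in> space M \<and> z0 \<in> space ?W \<and> z1 \<in> space ?W"
        by (simp add: y space_pair_measure)
      have "A \<subseteq> space M" using A sets.sets_into_space by auto
      have "?f y \<in> space ?W" if "y \<in> space ?X"
        using measurable_space[OF measurable_join_tree that] .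
      then have "y \<in> ?l \<longleftrightarrow> y \<in> space ?X \<and> (\<forall>j\<in>J. join_tree x z0 z1 j \<in> F j)"
        by (auto simp: y prod_emb_def space_PiM)
      also have "\<dots> \<longleftrightarrow> y \<in> space ?X \<and> x \<in> A \<and> (\<forall>v\<in>K False. z0 v \<in> F (False # v)) \<and> (\<forall>v\<in>K True. z1 v \<in> F (True # v))"
        using sp by (subst split, simp only: ball_Un) (auto simp: A_def)
      also have "\<dots> \<longleftrightarrow> y \<in> ?r"
        using sp \<open>A \<subseteq> space M\<close> unfolding S_def y by auto
      finally show "y \<in> ?l \<longleftrightarrow> y \<in> ?r" .
    qed
    then have "emeasure (distr ?X ?W ?f) (prod_emb UNIV (\<lambda>_. M) J (Pi\<^sub>E J F)) = emeasure ?X (A \<times> (S False \<times> S True))"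
      using F J by (subst emeasure_distr[OF measurable_join_tree]) (auto intro!: sets_PiM_I)
    also have "\<dots> = emeasure M A * (emeasure ?W (S False) * emeasure ?W (S True))"
      using A Ss by (simp add: WW.emeasure_pair_measure_Times P.emeasure_pair_measure_Times)
    finally show "emeasure (distr ?X ?W ?f) (prod_emb UNIV (\<lambda>_. M) J (Pi\<^sub>E J F)) = (\<Prod>j\<in>J. emeasure M (F j))"
      unfolding pJ pA S .
  qed simp
qed

text \<open>McKean's representation: as a function of \<open>t\<close> and \<open>c\<close> it
  solves the F-KPP equation, in the integrated form of \<open>mckean_equation\<close>.\<close>

definition mckean :: "(real \<Rightarrow> ennreal) \<Rightarrow> 'a measure \<Rightarrow> (bool list \<Rightarrow> 'a \<Rightarrow> real) \<Rightarrow>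
    (bool list \<Rightarrow> real \<Rightarrow> 'a \<Rightarrow> real) \<Rightarrow> real \<Rightarrow> real \<Rightarrow> ennreal" where
  "mckean g P T B t c = (\<integral>\<^sup>+\<omega>. tree_prod g T B t c \<omega> \<partial>P)"

context
  fixes P :: "'a measure" and T B
  assumes bbm: "binary_bbm P T B"
begin

lemma tree_prod_bbm:
  "\<omega> \<in> space P \<Longrightarrow> tree_prod g T B t c \<omega> = tree_prod g canon_T canon_B t c (\<lambda>u. mark T B u \<omega>)"
  by (rule tree_prod_cong) (auto simp: canon_bbm[OF bbm])

lemma measurable_tree_prod_bbm:
  assumes g: "g \<in> borel_measurable borel"
  shows "(\<lambda>(t, c, \<omega>). tree_prod g T B t c \<omega>) \<in> borel_measurable (borel \<Otimes>\<^sub>M borel \<Otimes>\<^sub>M P)"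
proof -
  have "(\<lambda>x. (fst x, fst (snd x), \<lambda>u. mark T B u (snd (snd x)))) \<in>
     (borel \<Otimes>\<^sub>M borel \<Otimes>\<^sub>M P) \<rightarrow>\<^sub>M (borel \<Otimes>\<^sub>M borel \<Otimes>\<^sub>M tree_space)"
    using measurable_compose[OF _ tree_measurable[OF bbm]] by measurable
  from measurable_compose[OF this measurable_canon_tree_prod[OF g]]
  have "(\<lambda>x. tree_prod g canon_T canon_B (fst x) (fst (snd x)) (\<lambda>u. mark T B u (snd (snd x))))
    \<in> borel_measurable (borel \<Otimes>\<^sub>M borel \<Otimes>\<^sub>M P)" by simp
  then show ?thesis
    by (rule measurable_cong[THEN iffD1, rotated]) (auto simp: space_pair_measure tree_prod_bbm)
qed

lemma mckean_canon:
  assumes g: "g \<in> borel_measurable borel"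
  shows "mckean g P T B t c = (\<integral>\<^sup>+z. tree_prod g canon_T canon_B t c z \<partial>tree_law P B)"
proof -
  have m: "tree_prod g canon_T canon_B t c \<in> borel_measurable tree_space"
    using measurable_compose[OF _ measurable_canon_tree_prod[OF g], of "\<lambda>z. (t, c, z)" tree_space] by simp
  have "mckean g P T B t c = (\<integral>\<^sup>+\<omega>. tree_prod g canon_T canon_B t c (\<lambda>u. mark T B u \<omega>) \<partial>P)"
    unfolding mckean_def by (rule nn_integral_cong) (rule tree_prod_bbm)
  also have "\<dots> = (\<integral>\<^sup>+z. tree_prod g canon_T canon_B t c z \<partial>distr P tree_space (\<lambda>\<omega> u. mark T B u \<omega>))"
    by (rule nn_integral_distr[symmetric, OF tree_measurable[OF bbm]]) (simp add: m)
  finally show ?thesis unfolding distr_tree[OF bbm] .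
qed

lemma measurable_mckean:
  assumes g: "g \<in> borel_measurable borel"
  shows "(\<lambda>(t, c). mckean g P T B t c) \<in> borel_measurable (borel \<Otimes>\<^sub>M borel)"
proof -
  interpret prob_space P by (rule bbm_prob[OF bbm])
  have "(\<lambda>x. tree_prod g T B (fst (fst x)) (snd (fst x)) (snd x)) \<in> borel_measurable ((borel \<Otimes>\<^sub>M borel) \<Otimes>\<^sub>M P)"
    using measurable_compose[OF _ measurable_tree_prod_bbm[OF g], of "\<lambda>x. (fst (fst x), snd (fst x), snd x)"]
    by simp
  then have "(\<lambda>y. \<integral>\<^sup>+\<omega>. tree_prod g T B (fst y) (snd y) \<omega> \<partial>P) \<in> borel_measurable (borel \<Otimes>\<^sub>M borel)"
    by (intro borel_measurable_nn_integral) (simp add: case_prod_beta)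
  then show ?thesis by (simp add: mckean_def case_prod_beta)
qed

text \<open>The lifetime is independent of the path, so given that the lifetime is \<open>s\<close>
  the path at its end is Gaussian of variance \<open>s\<close>.\<close>

lemma nn_integral_mark_law:
  assumes f [measurable]: "f \<in> borel_measurable (borel \<Otimes>\<^sub>M borel)"
  shows "(\<integral>\<^sup>+x. f (fst x, path_eval (snd x) (fst x)) \<partial>mark_law P B) =
    (\<integral>\<^sup>+s. ennreal (exponential_density 1 s) * (\<integral>\<^sup>+y. ennreal (normal_density 0 (sqrt s) y) * f (s, y) \<partial>lborel) \<partial>lborel)"
proof -
  interpret prob_space P by (rule bbm_prob[OF bbm])
  let ?W = "distr P path_space (\<lambda>\<omega>. \<lambda>s\<in>{0..}. B [] s \<omega>)"
  note Bm = brownian_path_measurable[OF bbm_B[OF bbm]]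
  interpret W: prob_space ?W by (rule prob_space_distr[OF Bm])
  have mW: "(\<lambda>x. f (fst x, path_eval (snd x) (fst x))) \<in> borel_measurable (borel \<Otimes>\<^sub>M path_space)"
    using measurable_path_eval by (simp add: case_prod_beta)
  have "(\<integral>\<^sup>+x. f (fst x, path_eval (snd x) (fst x)) \<partial>mark_law P B) =
    (\<integral>\<^sup>+s. (\<integral>\<^sup>+p. f (s, path_eval p s) \<partial>?W) \<partial>density lborel (\<lambda>x. ennreal (exponential_density 1 x)))"
    unfolding mark_law_def
    by (subst W.nn_integral_fst[symmetric]) (use mW in \<open>simp_all cong: measurable_cong_sets\<close>)
  also have "\<dots> = (\<integral>\<^sup>+s. ennreal (exponential_density 1 s) * (\<integral>\<^sup>+p. f (s, path_eval p s) \<partial>?W) \<partial>lborel)"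
  proof (rule nn_integral_density)
    have "(\<lambda>x. f (fst x, path_eval (snd x) (fst x))) \<in> borel_measurable (lborel \<Otimes>\<^sub>M ?W)"
      using mW by (simp cong: measurable_cong_sets)
    from W.borel_measurable_nn_integral_fst[OF this]
    show "(\<lambda>s. \<integral>\<^sup>+p. f (s, path_eval p s) \<partial>?W) \<in> borel_measurable lborel" by simp
  qed simp
  also have "\<dots> = (\<integral>\<^sup>+s. ennreal (exponential_density 1 s) * (\<integral>\<^sup>+y. ennreal (normal_density 0 (sqrt s) y) * f (s, y) \<partial>lborel) \<partial>lborel)"
  proof (rule nn_integral_cong_AE)
    have eq: "(\<integral>\<^sup>+p. f (s, path_eval p s) \<partial>?W) = (\<integral>\<^sup>+y. ennreal (normal_density 0 (sqrt s) y) * f (s, y) \<partial>lborel)"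
      if s: "0 < s" for s
    proof -
      have ms: "(\<lambda>p. f (s, path_eval p s)) \<in> borel_measurable path_space"
        using measurable_compose[OF _ mW, of "\<lambda>p. (s, p)" path_space] by simp
      have bb: "brownian_motion P (B [])" by (rule bbm_B[OF bbm])
      have "(\<integral>\<^sup>+p. f (s, path_eval p s) \<partial>?W) = (\<integral>\<^sup>+\<omega>. f (s, path_eval (\<lambda>s\<in>{0..}. B [] s \<omega>) s) \<partial>P)"
        by (rule nn_integral_distr[OF Bm]) (use ms in simp)
      \<comment> \<open>The definition of Brownian motion gives the law of increments only, so
        \<open>B [] 0\<close>, which is 0, is subtracted.\<close>
      also have "\<dots> = (\<integral>\<^sup>+\<omega>. f (s, B [] s \<omega> - B [] 0 \<omega>) \<partial>P)"
      proof (rule nn_integral_cong)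
        fix \<omega> assume \<omega>: "\<omega> \<in> space P"
        have "continuous_on {0..} (\<lambda>t. B [] t \<omega>)"
          using bb \<omega> by (simp add: brownian_motion_def)
        then have "continuous_on {0..} (\<lambda>s\<in>{0..}. B [] s \<omega>)"
          by (rule continuous_on_eq) simp
        then show "f (s, path_eval (\<lambda>s\<in>{0..}. B [] s \<omega>) s) = f (s, B [] s \<omega> - B [] 0 \<omega>)"
          using s bb \<omega> by (simp add: path_eval_continuous brownian_motion_def)
      qed
      also have "\<dots> = (\<integral>\<^sup>+y. ennreal (normal_density 0 (sqrt (s - 0)) y) * f (s, y) \<partial>lborel)"
      proof (rule distributed_nn_integral[symmetric])
        show "distributed P lborel (\<lambda>\<omega>. B [] s \<omega> - B [] 0 \<omega>) (normal_density 0 (sqrt (s - 0)))"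
          using bb s unfolding brownian_motion_def by blast
      qed (use measurable_compose[OF _ f, of "\<lambda>y. (s, y)" borel] in simp)
      finally show ?thesis by simp
    qed
    have "AE s in lborel. s \<noteq> (0::real)" by (rule AE_lborel_singleton)
    then show "AE s in lborel. ennreal (exponential_density 1 s) * (\<integral>\<^sup>+p. f (s, path_eval p s) \<partial>?W) =
      ennreal (exponential_density 1 s) * (\<integral>\<^sup>+y. ennreal (normal_density 0 (sqrt s) y) * f (s, y) \<partial>lborel)"
    proof eventually_elim
      case (elim s)
      then show ?case
        using eq[of s] by (cases "0 < s") (auto simp: exponential_density_def)
    qed
  qed
  finally show ?thesis .
qed

text \<open>On the product space the root mark and the two subtrees are independent. The weight
  \<open>a\<close> depends on the root mark alone, and each subtree contributes one factor
  \<open>mckean\<close>, whence the square. The weight will carry the test functions of the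
  branching time and position.\<close>

theorem branching_decomposition:
  assumes g: "g \<in> borel_measurable borel" and a: "a \<in> borel_measurable (borel \<Otimes>\<^sub>M borel)"
  shows "(\<integral>\<^sup>+\<omega>. a (T [] \<omega>, B [] (T [] \<omega>) \<omega>) * indicator {..t} (T [] \<omega>) * tree_prod g T B t c \<omega> \<partial>P) =
    (\<integral>\<^sup>+s. ennreal (exponential_density 1 s) * (\<integral>\<^sup>+y. ennreal (normal_density 0 (sqrt s) y) *
      (a (s, y) * indicator {..t} s * (mckean g P T B (t - s) (c - y))\<^sup>2) \<partial>lborel) \<partial>lborel)"
proof -
  interpret P: prob_space P by (rule bbm_prob[OF bbm])
  interpret W: prob_space "tree_law P B" by (rule prob_space_tree_law[OF bbm])
  interpret WW: pair_prob_space "tree_law P B" "tree_law P B" ..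
  define f where "f z = a (canon_T [] z, canon_B [] (canon_T [] z) z) * indicator {..t} (canon_T [] z)
    * tree_prod g canon_T canon_B t c z" for z
  have tpm: "tree_prod g canon_T canon_B t c \<in> borel_measurable tree_space" for t c
    using measurable_compose[OF _ measurable_canon_tree_prod[OF g], of "\<lambda>z. (t, c, z)" tree_space] by simp
  have cBm: "(\<lambda>z. canon_B [] (canon_T [] z) z) \<in> borel_measurable tree_space"
    using measurable_compose[OF _ measurable_canon_B, of "\<lambda>z. (canon_T [] z, z)" tree_space] by simp
  have fm: "f \<in> borel_measurable tree_space"
    unfolding f_def using measurable_compose[OF measurable_Pair[OF measurable_canon_T cBm] a] tpm by measurable
  have "(\<integral>\<^sup>+\<omega>. a (T [] \<omega>, B [] (T [] \<omega>) \<omega>) * indicator {..t} (T [] \<omega>) * tree_prod g T B t c \<omega> \<partial>P)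
    = (\<integral>\<^sup>+\<omega>. f (\<lambda>u. mark T B u \<omega>) \<partial>P)"
    by (rule nn_integral_cong)
      (auto simp: f_def canon_bbm[OF bbm] tree_prod_bbm less_imp_le[OF bbm_pos[OF bbm]])
  also have "\<dots> = (\<integral>\<^sup>+z. f z \<partial>distr P tree_space (\<lambda>\<omega> u. mark T B u \<omega>))"
    by (rule nn_integral_distr[symmetric, OF tree_measurable[OF bbm]]) (simp add: fm)
  also have "\<dots> = (\<integral>\<^sup>+z. f z \<partial>tree_law P B)"
    unfolding distr_tree[OF bbm] ..
  also have "\<dots> = (\<integral>\<^sup>+z. f z \<partial>distr (mark_law P B \<Otimes>\<^sub>M tree_law P B \<Otimes>\<^sub>M tree_law P B) (tree_law P B)
      (\<lambda>(x, z0, z1). join_tree x z0 z1))"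
    unfolding tree_law_def distr_join_tree[OF prob_space_mark_law[OF bbm]] ..
  also have "\<dots> = (\<integral>\<^sup>+x. f (join_tree (fst x) (fst (snd x)) (snd (snd x))) \<partial>(mark_law P B \<Otimes>\<^sub>M tree_law P B \<Otimes>\<^sub>M tree_law P B))"
    by (subst nn_integral_distr)
      (use fm measurable_join_tree[of "mark_law P B"] in
        \<open>simp_all add: tree_law_def[symmetric] case_prod_beta measurable_cong_sets[OF sets_tree_law refl]\<close>)
  also have "\<dots> = (\<integral>\<^sup>+x. (\<integral>\<^sup>+y. f (join_tree x (fst y) (snd y)) \<partial>(tree_law P B \<Otimes>\<^sub>M tree_law P B)) \<partial>mark_law P B)"
  proof -
    have "(\<lambda>x. f (join_tree (fst x) (fst (snd x)) (snd (snd x)))) \<in> borel_measurable (mark_law P B \<Otimes>\<^sub>M tree_law P B \<Otimes>\<^sub>M tree_law P B)"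
      using measurable_compose[OF measurable_join_tree[of "mark_law P B", folded tree_law_def]] fm
      by (simp add: case_prod_beta measurable_cong_sets[OF sets_tree_law refl])
    from WW.nn_integral_fst[OF this] show ?thesis by simp
  qed
  also have "\<dots> = (\<integral>\<^sup>+x. (\<integral>\<^sup>+z0. (\<integral>\<^sup>+z1. f (join_tree x z0 z1) \<partial>tree_law P B) \<partial>tree_law P B) \<partial>mark_law P B)"
  proof (rule nn_integral_cong)
    fix x assume x: "x \<in> space (mark_law P B)"
    have "(\<lambda>y. f (join_tree x (fst y) (snd y))) \<in> borel_measurable (tree_law P B \<Otimes>\<^sub>M tree_law P B)"
    proof -
      have "(\<lambda>y. (x, y)) \<in> (tree_law P B \<Otimes>\<^sub>M tree_law P B) \<rightarrow>\<^sub>M (mark_law P B \<Otimes>\<^sub>M tree_law P B \<Otimes>\<^sub>M tree_law P B)"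
        using x by simp
      from measurable_compose[OF measurable_compose[OF this measurable_join_tree[of "mark_law P B", folded tree_law_def]]] fm
      show ?thesis by (simp add: case_prod_beta measurable_cong_sets[OF sets_tree_law refl])
    qed
    from W.nn_integral_fst[OF this]
    show "(\<integral>\<^sup>+y. f (join_tree x (fst y) (snd y)) \<partial>(tree_law P B \<Otimes>\<^sub>M tree_law P B)) =
      (\<integral>\<^sup>+z0. (\<integral>\<^sup>+z1. f (join_tree x z0 z1) \<partial>tree_law P B) \<partial>tree_law P B)" by simp
  qed
  also have "\<dots> = (\<integral>\<^sup>+x. (\<lambda>(s, y). a (s, y) * indicator {..t} s * (mckean g P T B (t - s) (c - y))\<^sup>2)
      (fst x, path_eval (snd x) (fst x)) \<partial>mark_law P B)"
  proof (rule nn_integral_cong_AE)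
    have good: "AE z in tree_law P B. good_tree z"
      unfolding distr_tree[OF bbm, symmetric]
      by (subst AE_distr_iff) (auto simp: tree_measurable[OF bbm] good_tree_bbm[OF bbm])
    have pos: "AE x in mark_law P B. 0 < fst x"
      unfolding distr_mark[OF bbm, of "[]", symmetric]
    proof (subst AE_distr_iff[OF mark_measurable[OF bbm]])
      show "{x \<in> space mark_space. 0 < fst x} \<in> sets mark_space"
        unfolding mark_space_def by measurable
    qed (auto simp: bbm_pos[OF bbm] mark_def)
    show "AE x in mark_law P B. (\<integral>\<^sup>+z0. (\<integral>\<^sup>+z1. f (join_tree x z0 z1) \<partial>tree_law P B) \<partial>tree_law P B) =
      (\<lambda>(s, y). a (s, y) * indicator {..t} s * (mckean g P T B (t - s) (c - y))\<^sup>2) (fst x, path_eval (snd x) (fst x))"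
      using pos
    proof eventually_elim
      case (elim x)
      define s y where "s = fst x" and "y = path_eval (snd x) (fst x)"
      let ?tp = "tree_prod g canon_T canon_B (t - s) (c - y)"
      \<comment> \<open>\<open>canon_T\<close> and \<open>canon_B\<close> read the marks only on
        good trees. The joined tree is good when both subtrees are and the root lives for a positive
        time, which holds almost surely.\<close>
      have eq: "f (join_tree x z0 z1) = a (s, y) * indicator {..t} s * (?tp z0 * ?tp z1)"
        if z: "good_tree z0" "good_tree z1" for z0 z1
      proof -
        let ?z = "join_tree x z0 z1"
        have bF: "birth (\<lambda>u z. fst (z u)) (False # u) ?z = s + birth (\<lambda>u z. fst (z u)) u z0" for u
          unfolding birth_Cons s_def
          by (simp add: birth_cong[of "\<lambda>u z. fst (z (False # u))" ?z "\<lambda>u z. fst (z u)" z0])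
        have bT: "birth (\<lambda>u z. fst (z u)) (True # u) ?z = s + birth (\<lambda>u z. fst (z u)) u z1" for u
          unfolding birth_Cons s_def
          by (simp add: birth_cong[of "\<lambda>u z. fst (z (True # u))" ?z "\<lambda>u z. fst (z u)" z1])
        have gz: "good_tree ?z"
          unfolding good_tree_def
        proof (intro conjI allI)
          fix u show "0 < fst (?z u)"
            using z elim by (auto simp: join_tree_def good_tree_def split: list.splits)
        next
          fix t'
          have "{u. birth (\<lambda>u z. fst (z u)) u ?z \<le> t'} \<subseteq> {[]} \<union>
            ((#) False ` {u. birth (\<lambda>u z. fst (z u)) u z0 \<le> t' - s} \<union> (#) True ` {u. birth (\<lambda>u z. fst (z u)) u z1 \<le> t' - s})"
          proof
            fix u assume u: "u \<in> {u. birth (\<lambda>u z. fst (z u)) u ?z \<le> t'}"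
            show "u \<in> {[]} \<union> ((#) False ` {u. birth (\<lambda>u z. fst (z u)) u z0 \<le> t' - s} \<union> (#) True ` {u. birth (\<lambda>u z. fst (z u)) u z1 \<le> t' - s})"
            proof (cases u)
              case (Cons b v)
              then show ?thesis using u by (cases b) (auto simp: bF bT)
            qed simp
          qed
          moreover have "finite \<dots>" using z by (simp add: good_tree_def)
          ultimately show "finite {u. birth (\<lambda>u z. fst (z u)) u ?z \<le> t'}" by (rule finite_subset)
        qed
        have cT: "canon_T [] ?z = s" "canon_T (False # u) ?z = canon_T u z0" "canon_T (True # u) ?z = canon_T u z1" for u
          using gz z by (simp_all add: canon_T_def s_def)
        have cB: "canon_B [] s ?z = y" "canon_B (False # u) r ?z = canon_B u r z0" "canon_B (True # u) r ?z = canon_B u r z1" for u r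
          using gz z by (simp_all add: canon_B_def s_def y_def)
        show ?thesis
        proof (cases "s \<le> t")
          case True
          have "tree_prod g canon_T canon_B t c ?z =
             tree_prod g (\<lambda>u. canon_T (False # u)) (\<lambda>u. canon_B (False # u)) (t - s) (c - y) ?z *
             tree_prod g (\<lambda>u. canon_T (True # u)) (\<lambda>u. canon_B (True # u)) (t - s) (c - y) ?z"
            using tree_prod_late[of canon_T ?z t g canon_B c] True
            by (simp add: canon_T_pos canon_T_finite cT cB)
          also have "tree_prod g (\<lambda>u. canon_T (False # u)) (\<lambda>u. canon_B (False # u)) (t - s) (c - y) ?z = ?tp z0"
            by (rule tree_prod_cong) (simp_all add: cT cB)
          also have "tree_prod g (\<lambda>u. canon_T (True # u)) (\<lambda>u. canon_B (True # u)) (t - s) (c - y) ?z = ?tp z1"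
            by (rule tree_prod_cong) (simp_all add: cT cB)
          finally show ?thesis by (simp add: f_def cT cB)
        qed (simp add: f_def cT cB)
      qed
      have tpm': "?tp \<in> borel_measurable (tree_law P B)"
        using tpm by (simp add: measurable_cong_sets[OF sets_tree_law refl])
      have "(\<integral>\<^sup>+z0. (\<integral>\<^sup>+z1. f (join_tree x z0 z1) \<partial>tree_law P B) \<partial>tree_law P B) =
        (\<integral>\<^sup>+z0. (\<integral>\<^sup>+z1. a (s, y) * indicator {..t} s * (?tp z0 * ?tp z1) \<partial>tree_law P B) \<partial>tree_law P B)"
      proof (rule nn_integral_cong_AE)
        show "AE z0 in tree_law P B. (\<integral>\<^sup>+z1. f (join_tree x z0 z1) \<partial>tree_law P B) =
          (\<integral>\<^sup>+z1. a (s, y) * indicator {..t} s * (?tp z0 * ?tp z1) \<partial>tree_law P B)"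
          using good
        proof eventually_elim
          case (elim z0)
          show ?case
            by (rule nn_integral_cong_AE) (use good in eventually_elim, use eq elim in auto)
        qed
      qed
      also have "\<dots> = a (s, y) * indicator {..t} s * ((\<integral>\<^sup>+z0. ?tp z0 \<partial>tree_law P B) * (\<integral>\<^sup>+z1. ?tp z1 \<partial>tree_law P B))"
        using tpm' by (simp add: nn_integral_cmult nn_integral_multc)
      also have "\<dots> = a (s, y) * indicator {..t} s * (mckean g P T B (t - s) (c - y))\<^sup>2"
        by (simp add: mckean_canon[OF g] power2_eq_square)
      finally show ?case by (simp add: s_def y_def)
    qed
  qed
  also have "\<dots> = (\<integral>\<^sup>+s. ennreal (exponential_density 1 s) * (\<integral>\<^sup>+y. ennreal (normal_density 0 (sqrt s) y) *
      (\<lambda>(s, y). a (s, y) * indicator {..t} s * (mckean g P T B (t - s) (c - y))\<^sup>2) (s, y) \<partial>lborel) \<partial>lborel)"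
  proof (rule nn_integral_mark_law)
    have [measurable]: "(\<lambda>x. mckean g P T B (t - fst x) (c - snd x)) \<in> borel_measurable (borel \<Otimes>\<^sub>M borel)"
      using measurable_compose[OF _ measurable_mckean[OF g], of "\<lambda>x. (t - fst x, c - snd x)" "borel \<Otimes>\<^sub>M borel"]
      by simp
    show "(\<lambda>(s, y). a (s, y) * indicator {..t} s * (mckean g P T B (t - s) (c - y))\<^sup>2) \<in> borel_measurable (borel \<Otimes>\<^sub>M borel)"
      using a unfolding case_prod_beta by simp
  qed
  finally show ?thesis by simp
qed

text \<open>Before the first branching the root is the only particle, and its clock is independent
  of its path.\<close>

lemma no_branching:
  assumes g: "g \<in> borel_measurable borel" and t: "0 < t"
  shows "(\<integral>\<^sup>+\<omega>. indicator {t<..} (T [] \<omega>) * tree_prod g T B t c \<omega> \<partial>P) =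
    ennreal (exp (- t)) * (\<integral>\<^sup>+y. ennreal (normal_density 0 (sqrt t) y) * g (y - c) \<partial>lborel)"
proof -
  interpret P: prob_space P by (rule bbm_prob[OF bbm])
  let ?E = "density lborel (\<lambda>x. ennreal (exponential_density 1 x))"
  let ?W = "distr P path_space (\<lambda>\<omega>. \<lambda>s\<in>{0..}. B [] s \<omega>)"
  have bb: "brownian_motion P (B [])" by (rule bbm_B[OF bbm])
  note Bm = brownian_path_measurable[OF bb]
  interpret W: prob_space ?W by (rule P.prob_space_distr[OF Bm])
  have c0: "(\<lambda>p. p t) \<in> borel_measurable path_space"
    by (rule measurable_component_singleton) (use t in simp)
  have gm: "(\<lambda>p. g (p t - c)) \<in> borel_measurable path_space"
    using measurable_compose[OF borel_measurable_diff[OF c0 borel_measurable_const[of c]] g] by simp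
  have jm: "(\<lambda>x. indicator {t<..} (fst x) * g (snd x t - c)) \<in> borel_measurable mark_space"
    unfolding mark_space_def using measurable_compose[OF measurable_snd gm] by measurable
  have "(\<integral>\<^sup>+\<omega>. indicator {t<..} (T [] \<omega>) * tree_prod g T B t c \<omega> \<partial>P) =
     (\<integral>\<^sup>+\<omega>. (\<lambda>x. indicator {t<..} (fst x) * g (snd x t - c)) (mark T B [] \<omega>) \<partial>P)"
    by (rule nn_integral_cong)
      (use t in \<open>auto simp: tree_prod_early bbm_pos[OF bbm] mark_def split: split_indicator\<close>)
  also have "\<dots> = (\<integral>\<^sup>+x. indicator {t<..} (fst x) * g (snd x t - c) \<partial>mark_law P B)"
    unfolding distr_mark[OF bbm, of "[]", symmetric]
    by (rule nn_integral_distr[symmetric, OF mark_measurable[OF bbm]]) (use jm in simp)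
  also have "\<dots> = (\<integral>\<^sup>+s. (\<integral>\<^sup>+p. indicator {t<..} s * g (p t - c) \<partial>?W) \<partial>?E)"
    unfolding mark_law_def
    by (subst W.nn_integral_fst[symmetric])
      (use jm in \<open>simp_all add: mark_space_def cong: measurable_cong_sets\<close>)
  also have "\<dots> = (\<integral>\<^sup>+s. indicator {t<..} s * (\<integral>\<^sup>+p. g (p t - c) \<partial>?W) \<partial>?E)"
    using gm by (simp add: nn_integral_cmult)
  also have "\<dots> = emeasure ?E {t<..} * (\<integral>\<^sup>+p. g (p t - c) \<partial>?W)"
    by (simp add: nn_integral_multc)
  also have "emeasure ?E {t<..} = ennreal (exp (- t))"
  proof -
    have "emeasure ?E {t<..} = emeasure P ((T []) -` {t<..} \<inter> space P)"
    proof -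
      have "?E = distr P borel (T [])"
        using distributed_distr_eq_density[OF bbm_T[OF bbm, of "[]"]] by (simp cong: distr_cong)
      then show ?thesis
        using emeasure_distr[OF bbm_T_measurable[OF bbm, of "[]"], of "{t<..}"] by simp
    qed
    also have "\<dots> = ennreal (measure P {\<omega> \<in> space P. t < T [] \<omega>})"
      by (subst P.emeasure_eq_measure) (auto intro!: arg_cong[where f = "measure P"])
    also have "measure P {\<omega> \<in> space P. t < T [] \<omega>} = exp (- t)"
      using P.exponential_distributedD_gt[OF bbm_T[OF bbm, of "[]"], of t] t by simp
    finally show ?thesis .
  qed
  also have "(\<integral>\<^sup>+p. g (p t - c) \<partial>?W) = (\<integral>\<^sup>+y. ennreal (normal_density 0 (sqrt t) y) * g (y - c) \<partial>lborel)"
  proof -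
    have "(\<integral>\<^sup>+p. g (p t - c) \<partial>?W) = (\<integral>\<^sup>+\<omega>. g ((\<lambda>s\<in>{0..}. B [] s \<omega>) t - c) \<partial>P)"
      by (rule nn_integral_distr[OF Bm]) (use gm in simp)
    also have "\<dots> = (\<integral>\<^sup>+\<omega>. g (B [] t \<omega> - B [] 0 \<omega> - c) \<partial>P)"
      by (rule nn_integral_cong) (use t bb in \<open>auto simp: brownian_motion_def\<close>)
    also have "\<dots> = (\<integral>\<^sup>+y. ennreal (normal_density 0 (sqrt (t - 0)) y) * g (y - c) \<partial>lborel)"
    proof (rule distributed_nn_integral[symmetric])
      show "distributed P lborel (\<lambda>\<omega>. B [] t \<omega> - B [] 0 \<omega>) (normal_density 0 (sqrt (t - 0)))"
        using bb t unfolding brownian_motion_def by blast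
    qed (use g in simp)
    finally show ?thesis by simp
  qed
  finally show ?thesis .
qed

end

section \<open>Exponential tails from the integrated F-KPP equation\<close>

abbreviation (input) heat :: "real \<Rightarrow> real \<Rightarrow> real" where
  "heat s y \<equiv> normal_density 0 (sqrt s) y"

lemma nn_integral_normal_density:
  assumes "0 < \<sigma>"
  shows "(\<integral>\<^sup>+y. ennreal (normal_density \<mu> \<sigma> y) \<partial>lborel) = 1"
proof -
  interpret prob_space "density lborel (\<lambda>y. ennreal (normal_density \<mu> \<sigma> y))"
    by (rule prob_space_normal_density[OF assms])
  show ?thesis
    using emeasure_space_1 by (simp add: emeasure_density)
qed

lemma nn_integral_exponential_density:
  assumes "0 < \<kappa>"
  shows "(\<integral>\<^sup>+y. ennreal (exponential_density \<kappa> y) \<partial>lborel) = 1"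
proof -
  interpret prob_space "density lborel (\<lambda>y. ennreal (exponential_density \<kappa> y))"
    by (rule prob_space_exponential_density[OF assms])
  show ?thesis
    using emeasure_space_1 by (simp add: emeasure_density)
qed

text \<open>Completing the square: the exponential tilt of a centred Gaussian is a shifted Gaussian
  times the exponential moment.\<close>

lemma heat_tilt:
  assumes "0 < s"
  shows "heat s y * exp (b * (c - y)) = exp (b * c + b\<^sup>2 * s / 2) * normal_density (- b * s) (sqrt s) y"
proof -
  have "- y\<^sup>2 / (2 * s) + b * (c - y) = (b * c + b\<^sup>2 * s / 2) - (y + b * s)\<^sup>2 / (2 * s)"
    using assms by (simp add: field_simps power2_eq_square)
  then show ?thesis
    using assms by (simp add: normal_density_def mult_exp_exp[symmetric] field_simps flip: exp_add)
qed

lemma nn_integral_heat_tilt: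
  assumes "0 < s"
  shows "(\<integral>\<^sup>+y. ennreal (heat s y) * ennreal (exp (b * (c - y))) \<partial>lborel) = ennreal (exp (b * c + b\<^sup>2 * s / 2))"
proof -
  have "(\<integral>\<^sup>+y. ennreal (heat s y) * ennreal (exp (b * (c - y))) \<partial>lborel) =
    (\<integral>\<^sup>+y. ennreal (exp (b * c + b\<^sup>2 * s / 2)) * ennreal (normal_density (- b * s) (sqrt s) y) \<partial>lborel)"
    by (rule nn_integral_cong) (simp only: ennreal_mult[symmetric] normal_density_nonneg exp_ge_zero heat_tilt[OF assms])
  also have "\<dots> = ennreal (exp (b * c + b\<^sup>2 * s / 2))"
    using assms by (simp add: nn_integral_cmult nn_integral_normal_density)
  finally show ?thesis .
qed

text \<open>One step sends the constant \<open>a\<close> to \<open>b + \<theta> * a\<close>, a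
  contraction with fixed point \<open>b / (1 - \<theta>)\<close>. The iteration needs a first bound,
  and since \<open>W\<close> may be arbitrarily small no multiple of it need dominate
  \<open>u\<close>; adding \<open>\<epsilon>\<close> provides one, because \<open>u\<close> is at
  most 1 and hence at most \<open>(W r c + \<epsilon>) / \<epsilon>\<close>. At the end
  \<open>\<epsilon>\<close> tends to 0.\<close>

lemma geometric_iteration_bound:
  fixes u :: "'r \<Rightarrow> real \<Rightarrow> ennreal" and W :: "'r \<Rightarrow> real \<Rightarrow> real"
  assumes step: "\<And>a \<epsilon>. 0 \<le> a \<Longrightarrow> 0 < \<epsilon> \<Longrightarrow> (\<And>r c. r \<in> I \<Longrightarrow> u r c \<le> ennreal (a * (W r c + \<epsilon>))) \<Longrightarrow>
      (\<And>r c. r \<in> I \<Longrightarrow> u r c \<le> ennreal ((b + \<theta> * a) * (W r c + \<epsilon>)))"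
    and u1: "\<And>r c. u r c \<le> 1" and W: "\<And>r c. 0 \<le> W r c"
    and b: "0 \<le> b" and \<theta>: "0 \<le> \<theta>" "\<theta> < 1" and r: "r \<in> I"
  shows "u r c \<le> ennreal (b / (1 - \<theta>) * W r c)"
proof -
  have eps: "u r c \<le> ennreal (b / (1 - \<theta>) * (W r c + \<epsilon>))" if \<epsilon>: "0 < \<epsilon>" for \<epsilon>
  proof -
    define a where "a = rec_nat (1 / \<epsilon>) (\<lambda>_ a. b + \<theta> * a)"
    have a0: "a 0 = 1 / \<epsilon>" and aS: "a (Suc n) = b + \<theta> * a n" for n by (simp_all add: a_def)
    have nn: "0 \<le> a n" for n by (induction n) (use b \<theta> \<epsilon> in \<open>auto simp: a0 aS\<close>)
    have bd: "\<And>r c. r \<in> I \<Longrightarrow> u r c \<le> ennreal (a n * (W r c + \<epsilon>))" for n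
    proof (induction n)
      case 0
      fix r c
      have "1 \<le> 1 / \<epsilon> * (W r c + \<epsilon>)" using W[of r c] \<epsilon> by (simp add: field_simps)
      then show "u r c \<le> ennreal (a 0 * (W r c + \<epsilon>))"
        unfolding a0 using u1[of r c] by (meson ennreal_ge_1 order_trans)
    next
      case (Suc n)
      then show "\<And>r c. r \<in> I \<Longrightarrow> u r c \<le> ennreal (a (Suc n) * (W r c + \<epsilon>))"
        unfolding aS using step[OF nn[of n] \<epsilon>] by blast
    qed
    define L where "L = b / (1 - \<theta>)"
    have L: "L = b + \<theta> * L" using \<theta> by (simp add: L_def field_simps)
    have "a n = L + \<theta> ^ n * (1 / \<epsilon> - L)" for n
    proof (induction n)
      case (Suc n)
      have "a (Suc n) = (b + \<theta> * L) + \<theta> ^ Suc n * (1 / \<epsilon> - L)"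
        unfolding aS Suc by (simp add: algebra_simps)
      then show ?case using L by simp
    qed (simp add: a0)
    then have "a = (\<lambda>n. b / (1 - \<theta>) + \<theta> ^ n * (1 / \<epsilon> - b / (1 - \<theta>)))"
      unfolding L_def by (rule ext)
    moreover have "(\<lambda>n. b / (1 - \<theta>) + \<theta> ^ n * (1 / \<epsilon> - b / (1 - \<theta>))) \<longlonglongrightarrow> b / (1 - \<theta>) + 0 * (1 / \<epsilon> - b / (1 - \<theta>))"
      using \<theta> by (intro tendsto_intros LIMSEQ_power_zero) auto
    ultimately have "a \<longlonglongrightarrow> b / (1 - \<theta>)" by simp
    then have "(\<lambda>n. ennreal (a n * (W r c + \<epsilon>))) \<longlonglongrightarrow> ennreal (b / (1 - \<theta>) * (W r c + \<epsilon>))"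
      by (intro tendsto_ennrealI tendsto_intros)
    then show ?thesis
      by (rule tendsto_lowerbound) (use bd r in auto)
  qed
  have "((\<lambda>\<epsilon>. ennreal (b / (1 - \<theta>) * (W r c + \<epsilon>))) \<longlongrightarrow> ennreal (b / (1 - \<theta>) * (W r c + 0))) (at_right 0)"
    by (intro tendsto_ennrealI tendsto_intros)
  then have "u r c \<le> ennreal (b / (1 - \<theta>) * (W r c + 0))"
  proof (rule tendsto_lowerbound)
    show "\<forall>\<^sub>F \<epsilon> in at_right 0. u r c \<le> ennreal (b / (1 - \<theta>) * (W r c + \<epsilon>))"
      by (rule eventually_at_rightI[of 0 1], rule eps) auto
  qed simp
  then show ?thesis by simp
qed

text \<open>Abstracts \<open>(t, c) \<mapsto> \<P>(M\<^sub>t \<le> c)\<close>, for which equality holds.\<close>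

definition kpp_subsolution :: "(real \<Rightarrow> real \<Rightarrow> ennreal) \<Rightarrow> bool" where
  "kpp_subsolution u \<longleftrightarrow> (\<lambda>(t, c). u t c) \<in> borel_measurable (borel \<Otimes>\<^sub>M borel) \<and> (\<forall>t c. u t c \<le> 1) \<and>
    (\<forall>t>0. \<forall>c. u t c \<le> ennreal (exp (- t)) * (\<integral>\<^sup>+y. ennreal (heat t y) * indicator {..c} y \<partial>lborel) +
      (\<integral>\<^sup>+s. ennreal (exponential_density 1 s) * (\<integral>\<^sup>+y. ennreal (heat s y) *
         (indicator {..t} s * (u (t - s) (c - y))\<^sup>2) \<partial>lborel) \<partial>lborel))"

text \<open>Without branching, the Chernoff bound with parameter \<open>b\<close> applies to a
  single Gaussian particle; with a branching at time \<open>s\<close>, the bound \<open>h s\<close>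
  is averaged over the clock.\<close>

lemma kpp_step:
  assumes u: "kpp_subsolution u" and t: "0 < t" and b: "0 \<le> b"
    and p: "\<And>s. 0 < s \<Longrightarrow> s < t \<Longrightarrow> (\<integral>\<^sup>+y. ennreal (heat s y) * (u (t - s) (c - y))\<^sup>2 \<partial>lborel) \<le> h s"
  shows "u t c \<le> ennreal (exp (- t)) * ennreal (exp (b * c + b\<^sup>2 * t / 2)) +
    (\<integral>\<^sup>+s. ennreal (exponential_density 1 s) * (indicator {0<..<t} s * h s) \<partial>lborel)"
proof -
  have "u t c \<le> ennreal (exp (- t)) * (\<integral>\<^sup>+y. ennreal (heat t y) * indicator {..c} y \<partial>lborel) +
      (\<integral>\<^sup>+s. ennreal (exponential_density 1 s) * (\<integral>\<^sup>+y. ennreal (heat s y) *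
         (indicator {..t} s * (u (t - s) (c - y))\<^sup>2) \<partial>lborel) \<partial>lborel)"
    using u t by (simp add: kpp_subsolution_def)
  also have "\<dots> \<le> ennreal (exp (- t)) * ennreal (exp (b * c + b\<^sup>2 * t / 2)) +
    (\<integral>\<^sup>+s. ennreal (exponential_density 1 s) * (indicator {0<..<t} s * h s) \<partial>lborel)"
  proof (intro add_mono mult_left_mono nn_integral_mono_AE)
    have "(\<integral>\<^sup>+y. ennreal (heat t y) * indicator {..c} y \<partial>lborel) \<le>
        (\<integral>\<^sup>+y. ennreal (heat t y) * ennreal (exp (b * (c - y))) \<partial>lborel)"
    proof (intro nn_integral_mono mult_left_mono)
      fix y show "indicator {..c} y \<le> ennreal (exp (b * (c - y)))"
        using b by (auto split: split_indicator simp: ennreal_ge_1)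
    qed simp
    then show "(\<integral>\<^sup>+y. ennreal (heat t y) * indicator {..c} y \<partial>lborel) \<le> ennreal (exp (b * c + b\<^sup>2 * t / 2))"
      by (simp add: nn_integral_heat_tilt[OF t])
    have "AE s in lborel. s \<noteq> (0::real)" "AE s in lborel. s \<noteq> t" by (rule AE_lborel_singleton)+
    then show "AE s in lborel. ennreal (exponential_density 1 s) * (\<integral>\<^sup>+y. ennreal (heat s y) *
         (indicator {..t} s * (u (t - s) (c - y))\<^sup>2) \<partial>lborel) \<le>
         ennreal (exponential_density 1 s) * (indicator {0<..<t} s * h s)"
    proof eventually_elim
      case (elim s)
      consider "s < 0" | "t < s" | "0 < s" "s < t" using elim by linarith
      then show ?case
      proof cases
        case 3
        then show ?thesis using p[of s] by (intro mult_left_mono) auto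
      qed (auto simp: exponential_density_def)
    qed
  qed auto
  finally show ?thesis .
qed

lemma nn_integral_exponential_interval:
  assumes "0 \<le> t"
  shows "(\<integral>\<^sup>+s. ennreal (exponential_density 1 s) * indicator {0<..<t} s \<partial>lborel) = ennreal (1 - exp (- t))"
proof -
  interpret E: prob_space "density lborel (\<lambda>y. ennreal (exponential_density 1 y))"
    by (rule prob_space_exponential_density) simp
  have d: "distributed (density lborel (\<lambda>y. ennreal (exponential_density 1 y))) lborel (\<lambda>x. x) (exponential_density 1)"
    unfolding distributed_def by (auto simp: distr_id2 exponential_density_nonneg)
  have "(\<integral>\<^sup>+s. ennreal (exponential_density 1 s) * indicator {0<..<t} s \<partial>lborel) =
      (\<integral>\<^sup>+s. ennreal (exponential_density 1 s) * indicator {..t} s \<partial>lborel)"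
  proof (rule nn_integral_cong_AE)
    have "AE s in lborel. s \<noteq> (0::real)" "AE s in lborel. s \<noteq> t" by (rule AE_lborel_singleton)+
    then show "AE s in lborel. ennreal (exponential_density 1 s) * indicator {0<..<t} s =
       ennreal (exponential_density 1 s) * indicator {..t} s"
      by eventually_elim (auto simp: exponential_density_def split: split_indicator)
  qed
  also have "\<dots> = emeasure (density lborel (\<lambda>y. ennreal (exponential_density 1 y))) {..t}"
    by (simp add: emeasure_density)
  also have "\<dots> = ennreal (1 - exp (- t))"
    using E.exponential_distributedD_le[OF d assms] by (simp add: E.emeasure_eq_measure atMost_def)
  finally show ?thesis .
qed

text \<open>Discarding one of the two subtrees, \<open>u\<^sup>2 \<le> u\<close>, leaves a single
  Brownian path, for which the Chernoff bound with parameter 1 is \<open>exp (c + r / 2)\<close>.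
  The contraction factor \<open>\<theta>\<close> is the probability of a branching before
  \<open>r0\<close>, so the constant grows like \<open>exp r0\<close> and the bound serves for
  bounded times.\<close>

lemma kpp_chernoff:
  assumes u: "kpp_subsolution u" and r: "0 < r" "r \<le> r0"
  shows "u r c \<le> ennreal (exp r0 * exp (c + r / 2))"
proof -
  have u1: "u r c \<le> 1" for r c using u by (simp add: kpp_subsolution_def)
  define \<theta> where "\<theta> = 1 - exp (- r0)"
  have \<theta>: "0 \<le> \<theta>" "\<theta> < 1" using r by (auto simp: \<theta>_def)
  have "u r c \<le> ennreal (1 / (1 - \<theta>) * exp (c + r / 2))"
  proof (rule geometric_iteration_bound[where I = "{0<..r0}" and W = "\<lambda>r c. exp (c + r / 2)"])
    fix a \<epsilon> r c :: real
    assume a: "0 \<le> a" "0 < \<epsilon>" and r: "r \<in> {0<..r0}"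
      and IH: "\<And>r c. r \<in> {0<..r0} \<Longrightarrow> u r c \<le> ennreal (a * (exp (c + r / 2) + \<epsilon>))"
    have "u r c \<le> ennreal (exp (- r)) * ennreal (exp (1 * c + 1\<^sup>2 * r / 2)) +
      (\<integral>\<^sup>+s. ennreal (exponential_density 1 s) * (indicator {0<..<r} s * ennreal (a * (exp (c + r / 2) + \<epsilon>))) \<partial>lborel)"
    proof (rule kpp_step[OF u])
      fix s assume s: "0 < s" "s < r"
      have "(\<integral>\<^sup>+y. ennreal (heat s y) * (u (r - s) (c - y))\<^sup>2 \<partial>lborel) \<le>
        (\<integral>\<^sup>+y. ennreal (a * exp ((r - s) / 2)) * (ennreal (heat s y) * ennreal (exp (1 * (c - y)))) + ennreal (a * \<epsilon>) * ennreal (heat s y) \<partial>lborel)"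
      proof (rule nn_integral_mono)
        fix y
        have "(u (r - s) (c - y))\<^sup>2 \<le> u (r - s) (c - y)"
          using mult_left_mono[OF u1[of "r - s" "c - y"], of "u (r - s) (c - y)"] by (simp add: power2_eq_square)
        also have "\<dots> \<le> ennreal (a * (exp ((c - y) + (r - s) / 2) + \<epsilon>))"
          using r s by (intro IH) auto
        also have "\<dots> = ennreal (a * exp ((r - s) / 2)) * ennreal (exp (1 * (c - y))) + ennreal (a * \<epsilon>)"
          using a by (simp add: distrib_left exp_add mult_ac flip: ennreal_mult ennreal_plus)
        finally show "ennreal (heat s y) * (u (r - s) (c - y))\<^sup>2 \<le>
          ennreal (a * exp ((r - s) / 2)) * (ennreal (heat s y) * ennreal (exp (1 * (c - y)))) + ennreal (a * \<epsilon>) * ennreal (heat s y)"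
          by (rule order_trans[OF mult_left_mono]) (auto simp: distrib_left mult_ac)
      qed
      also have "\<dots> = ennreal (a * exp ((r - s) / 2)) * ennreal (exp (1 * c + 1\<^sup>2 * s / 2)) + ennreal (a * \<epsilon>)"
        using s by (simp add: nn_integral_add nn_integral_cmult nn_integral_heat_tilt nn_integral_normal_density
            nn_integral_heat_tilt[of s 1, simplified])
      also have "\<dots> = ennreal (a * (exp (c + r / 2) + \<epsilon>))"
        using a by (simp add: distrib_left flip: ennreal_mult ennreal_plus) (simp add: field_simps flip: exp_add)
      finally show "(\<integral>\<^sup>+y. ennreal (heat s y) * (u (r - s) (c - y))\<^sup>2 \<partial>lborel) \<le> ennreal (a * (exp (c + r / 2) + \<epsilon>))" .
    qed (use r in auto)
    also have "(\<integral>\<^sup>+s. ennreal (exponential_density 1 s) * (indicator {0<..<r} s * ennreal (a * (exp (c + r / 2) + \<epsilon>))) \<partial>lborel)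
      = ennreal (1 - exp (- r)) * ennreal (a * (exp (c + r / 2) + \<epsilon>))"
      using r by (simp add: mult.assoc[symmetric] nn_integral_multc nn_integral_exponential_interval)
    also have "ennreal (exp (- r)) * ennreal (exp (1 * c + 1\<^sup>2 * r / 2)) + \<dots> =
       ennreal (exp (- r) * exp (c + r / 2) + (1 - exp (- r)) * (a * (exp (c + r / 2) + \<epsilon>)))"
      using a r by (simp flip: ennreal_mult ennreal_plus)
    also have "\<dots> \<le> ennreal ((1 + \<theta> * a) * (exp (c + r / 2) + \<epsilon>))"
    proof (rule ennreal_leI)
      have "exp (- r) * exp (c + r / 2) \<le> 1 * exp (c + r / 2)" using r by (intro mult_right_mono) auto
      moreover have "(1 - exp (- r)) * (a * (exp (c + r / 2) + \<epsilon>)) \<le> \<theta> * (a * (exp (c + r / 2) + \<epsilon>))"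
        using a r by (intro mult_right_mono) (auto simp: \<theta>_def)
      moreover have "(1 + \<theta> * a) * (exp (c + r / 2) + \<epsilon>) = exp (c + r / 2) + \<epsilon> + \<theta> * (a * (exp (c + r / 2) + \<epsilon>))"
        by (simp add: algebra_simps)
      ultimately show "exp (- r) * exp (c + r / 2) + (1 - exp (- r)) * (a * (exp (c + r / 2) + \<epsilon>)) \<le> (1 + \<theta> * a) * (exp (c + r / 2) + \<epsilon>)"
        using a by linarith
    qed
    finally show "u r c \<le> ennreal ((1 + \<theta> * a) * (exp (c + r / 2) + \<epsilon>))" .
  qed (use r \<theta> u1 in auto)
  moreover have "1 / (1 - \<theta>) = exp r0" by (simp add: \<theta>_def exp_minus inverse_eq_divide)
  ultimately show ?thesis by simp
qed

text \<open>The centering with its logarithm frozen below time 1: it equals \<open>centering\<close>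
  from time 1 on, never exceeds \<open>sqrt 2 * r\<close>, and stays bounded near 0, where the
  logarithm would blow up.\<close>

definition front :: "real \<Rightarrow> real" where
  "front r = sqrt 2 * r - 3 / (2 * sqrt 2) * ln (max r 1)"

lemma front_le: "front r \<le> sqrt 2 * r"
  by (simp add: front_def)

lemma front_diff: "0 \<le> s \<Longrightarrow> front r - front (r - s) \<le> sqrt 2 * s"
proof -
  assume "0 \<le> s"
  then have "ln (max (r - s) 1) \<le> ln (max r 1)" by simp
  then have "3 / (2 * sqrt 2) * ln (max (r - s) 1) \<le> 3 / (2 * sqrt 2) * ln (max r 1)"
    by (intro mult_left_mono) auto
  then show ?thesis by (simp add: front_def algebra_simps)
qed

text \<open>Far below the front \<open>u\<close> is at most 1/10, so
  \<open>u\<^sup>2 \<le> u / 10\<close> and the equation becomes subcritical for the weight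
  \<open>W\<close>; elsewhere \<open>u\<^sup>2 \<le> 1 \<le> L * W\<close>. The iteration closes
  because 1/10 is less than \<open>\<kappa>\<close>.\<close>

lemma kpp_exponential_bound:
  assumes u: "kpp_subsolution u"
    and small: "\<And>r c. 0 < r \<Longrightarrow> c \<le> front r - K \<Longrightarrow> u r c \<le> ennreal (1 / 10)" and K: "0 \<le> K"
  obtains C where "0 < C" "\<And>r c. 0 < r \<Longrightarrow> u r c \<le> ennreal (C * exp (2 / 5 * (c - front r)))"
proof -
  have u1: "u r c \<le> 1" for r c using u by (simp add: kpp_subsolution_def)
  define \<delta> :: real where "\<delta> = 2 / 5"
  \<comment> \<open>The net rate: 1 from the clock, minus the Gaussian growth
    \<open>\<delta>\<^sup>2 / 2\<close> of the weight, minus \<open>sqrt 2 * \<delta>\<close> for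
    the speed of the front. It is about 0.35, so the factor 1/10 leaves
    \<open>\<theta> < 1\<close>.\<close>
  define \<kappa> where "\<kappa> = 1 - \<delta>\<^sup>2 / 2 - sqrt 2 * \<delta>"
  have s2: "sqrt 2 < 3 / 2" by (rule real_less_lsqrt) (auto simp: power2_eq_square)
  have \<kappa>: "1 / 4 < \<kappa>" "\<kappa> \<le> 1"
    using s2 real_sqrt_ge_zero[of 2] by (auto simp: \<kappa>_def \<delta>_def power2_eq_square simp del: real_sqrt_ge_zero real_sqrt_ge_0_iff)
  have \<delta>: "0 < \<delta>" by (simp add: \<delta>_def)
  define W where "W r c = exp (\<delta> * (c - front r))" for r c
  define L where "L = exp (\<delta> * K)"
  define \<theta> where "\<theta> = 1 / (10 * \<kappa>)"
  have \<theta>: "0 \<le> \<theta>" "\<theta> < 1" using \<kappa> by (auto simp: \<theta>_def field_simps)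
  \<comment> \<open>The 1 pays for the term without branching, \<open>L / \<kappa>\<close> for the
    region that is not far below the front.\<close>
  define b where "b = 1 + L / \<kappa>"
  have b: "0 < b" using \<kappa> by (simp add: b_def L_def add_pos_pos)
  have "u r c \<le> ennreal (b / (1 - \<theta>) * W r c)" if "0 < r" for r c
  proof (rule geometric_iteration_bound[where I = "{0<..}" and W = W])
    fix a \<epsilon> r c :: real
    assume a: "0 \<le> a" "0 < \<epsilon>" and r: "r \<in> {0<..}"
      and IH: "\<And>r c. r \<in> {0<..} \<Longrightarrow> u r c \<le> ennreal (a * (W r c + \<epsilon>))"
    define A where "A = L + a / 10"
    have A: "0 \<le> A" using a by (simp add: A_def L_def)
    have "u r c \<le> ennreal (exp (- r)) * ennreal (exp (\<delta> * c + \<delta>\<^sup>2 * r / 2)) +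
      (\<integral>\<^sup>+s. ennreal (exponential_density 1 s) * (indicator {0<..<r} s * ennreal (A * W r c * exp ((1 - \<kappa>) * s) + a * \<epsilon> / 10)) \<partial>lborel)"
    proof (rule kpp_step[OF u])
      fix s assume s: "0 < s" "s < r"
      have "(\<integral>\<^sup>+y. ennreal (heat s y) * (u (r - s) (c - y))\<^sup>2 \<partial>lborel) \<le>
        (\<integral>\<^sup>+y. ennreal (A * exp (- \<delta> * front (r - s))) * (ennreal (heat s y) * ennreal (exp (\<delta> * (c - y)))) + ennreal (a * \<epsilon> / 10) * ennreal (heat s y) \<partial>lborel)"
      proof (rule nn_integral_mono)
        fix y
        have We: "W (r - s) (c - y) = exp (- \<delta> * front (r - s)) * exp (\<delta> * (c - y))"
          by (simp add: W_def algebra_simps flip: exp_add)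
        have "(u (r - s) (c - y))\<^sup>2 \<le> ennreal (L * W (r - s) (c - y)) + ennreal (1 / 10) * u (r - s) (c - y)"
        proof (cases "c - y \<le> front (r - s) - K")
          case True
          then have "u (r - s) (c - y) \<le> ennreal (1 / 10)" using s by (intro small) auto
          then have "(u (r - s) (c - y))\<^sup>2 \<le> ennreal (1 / 10) * u (r - s) (c - y)"
            unfolding power2_eq_square by (rule mult_right_mono) simp
          then show ?thesis by (rule order_trans) simp
        next
          case False
          then have "0 \<le> \<delta> * K + \<delta> * (c - y - front (r - s))"
            using \<delta> by (simp flip: distrib_left)
          then have "1 \<le> L * W (r - s) (c - y)"
            by (simp add: L_def W_def flip: exp_add)
          then have "1 \<le> ennreal (L * W (r - s) (c - y))" by (simp add: ennreal_ge_1)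
          moreover have "(u (r - s) (c - y))\<^sup>2 \<le> 1"
            using u1[of "r - s" "c - y"] by (simp add: power_le_one)
          ultimately have "(u (r - s) (c - y))\<^sup>2 \<le> ennreal (L * W (r - s) (c - y))" by (rule order_trans[rotated])
          then show ?thesis by (rule order_trans) simp
        qed
        also have "\<dots> \<le> ennreal (L * W (r - s) (c - y)) + ennreal (1 / 10) * ennreal (a * (W (r - s) (c - y) + \<epsilon>))"
          using s by (intro add_left_mono mult_left_mono IH) auto
        also have "\<dots> = ennreal (A * exp (- \<delta> * front (r - s)) * exp (\<delta> * (c - y)) + a * \<epsilon> / 10)"
        proof -
          have "L * W (r - s) (c - y) + 1 / 10 * (a * (W (r - s) (c - y) + \<epsilon>)) = A * W (r - s) (c - y) + a * \<epsilon> / 10"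
            by (simp add: A_def algebra_simps)
          then show ?thesis
            using a by (simp add: We L_def mult.assoc flip: ennreal_mult ennreal_plus)
        qed
        also have "\<dots> = ennreal (A * exp (- \<delta> * front (r - s))) * ennreal (exp (\<delta> * (c - y))) + ennreal (a * \<epsilon> / 10)"
          using a A by (simp flip: ennreal_mult ennreal_plus)
        finally show "ennreal (heat s y) * (u (r - s) (c - y))\<^sup>2 \<le>
          ennreal (A * exp (- \<delta> * front (r - s))) * (ennreal (heat s y) * ennreal (exp (\<delta> * (c - y)))) + ennreal (a * \<epsilon> / 10) * ennreal (heat s y)"
          by (rule order_trans[OF mult_left_mono]) (auto simp: distrib_left mult_ac)
      qed
      also have "\<dots> = ennreal (A * exp (- \<delta> * front (r - s))) * ennreal (exp (\<delta> * c + \<delta>\<^sup>2 * s / 2)) + ennreal (a * \<epsilon> / 10)"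
        using s by (simp add: nn_integral_add nn_integral_cmult nn_integral_heat_tilt nn_integral_normal_density)
      also have "\<dots> = ennreal (A * (exp (- \<delta> * front (r - s)) * exp (\<delta> * c + \<delta>\<^sup>2 * s / 2)) + a * \<epsilon> / 10)"
        using a A by (simp add: mult.assoc flip: ennreal_mult ennreal_plus)
      also have "\<dots> \<le> ennreal (A * W r c * exp ((1 - \<kappa>) * s) + a * \<epsilon> / 10)"
      proof -
        have "\<delta> * (front r - front (r - s)) \<le> \<delta> * (sqrt 2 * s)"
          using s \<delta> front_diff[of s r] by (intro mult_left_mono) auto
        then have "- \<delta> * front (r - s) + (\<delta> * c + \<delta>\<^sup>2 * s / 2) \<le> \<delta> * (c - front r) + (1 - \<kappa>) * s"
          by (simp add: \<kappa>_def algebra_simps)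
        then have "exp (- \<delta> * front (r - s)) * exp (\<delta> * c + \<delta>\<^sup>2 * s / 2) \<le> W r c * exp ((1 - \<kappa>) * s)"
          by (simp add: W_def flip: exp_add)
        from mult_left_mono[OF this A] show ?thesis
          by (intro ennreal_leI add_right_mono) (simp add: mult.assoc)
      qed
      finally show "(\<integral>\<^sup>+y. ennreal (heat s y) * (u (r - s) (c - y))\<^sup>2 \<partial>lborel) \<le> ennreal (A * W r c * exp ((1 - \<kappa>) * s) + a * \<epsilon> / 10)" .
    qed (use r \<delta> in auto)
    also have "(\<integral>\<^sup>+s. ennreal (exponential_density 1 s) * (indicator {0<..<r} s * ennreal (A * W r c * exp ((1 - \<kappa>) * s) + a * \<epsilon> / 10)) \<partial>lborel)
      \<le> (\<integral>\<^sup>+s. ennreal (A * W r c / \<kappa>) * ennreal (exponential_density \<kappa> s) + ennreal (a * \<epsilon> / 10) * ennreal (exponential_density 1 s) \<partial>lborel)"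
    proof (rule nn_integral_mono)
      fix s
      have AW: "0 \<le> A * W r c" using A by (simp add: W_def)
      have "ennreal (exponential_density 1 s) * (indicator {0<..<r} s * ennreal (A * W r c * exp ((1 - \<kappa>) * s) + a * \<epsilon> / 10))
        \<le> ennreal (exponential_density 1 s) * ennreal (A * W r c * exp ((1 - \<kappa>) * s) + a * \<epsilon> / 10)"
        by (intro mult_left_mono) (auto split: split_indicator)
      also have "\<dots> = ennreal (exponential_density 1 s * (A * W r c * exp ((1 - \<kappa>) * s) + a * \<epsilon> / 10))"
        using AW a by (intro ennreal_mult[symmetric]) (auto simp: exponential_density_nonneg)
      also have "exponential_density 1 s * (A * W r c * exp ((1 - \<kappa>) * s) + a * \<epsilon> / 10) =
         A * W r c / \<kappa> * exponential_density \<kappa> s + a * \<epsilon> / 10 * exponential_density 1 s"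
      proof -
        have "exp (- s) * exp ((1 - \<kappa>) * s) = exp (- s * \<kappa>)" by (simp add: algebra_simps flip: exp_add)
        then show ?thesis using \<kappa>
          by (auto simp: exponential_density_def algebra_simps)
      qed
      also have "ennreal \<dots> = ennreal (A * W r c / \<kappa>) * ennreal (exponential_density \<kappa> s) + ennreal (a * \<epsilon> / 10) * ennreal (exponential_density 1 s)"
        using AW a \<kappa> by (simp add: exponential_density_nonneg flip: ennreal_mult ennreal_plus)
      finally show "ennreal (exponential_density 1 s) * (indicator {0<..<r} s * ennreal (A * W r c * exp ((1 - \<kappa>) * s) + a * \<epsilon> / 10))
        \<le> ennreal (A * W r c / \<kappa>) * ennreal (exponential_density \<kappa> s) + ennreal (a * \<epsilon> / 10) * ennreal (exponential_density 1 s)" .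
    qed
    also have "\<dots> = ennreal (A * W r c / \<kappa>) + ennreal (a * \<epsilon> / 10)"
      using \<kappa> by (simp add: nn_integral_add nn_integral_cmult nn_integral_exponential_density)
    also have "ennreal (exp (- r)) * ennreal (exp (\<delta> * c + \<delta>\<^sup>2 * r / 2)) + (ennreal (A * W r c / \<kappa>) + ennreal (a * \<epsilon> / 10)) =
       ennreal (exp (- r) * exp (\<delta> * c + \<delta>\<^sup>2 * r / 2) + (A * W r c / \<kappa> + a * \<epsilon> / 10))"
      using a A \<kappa> by (simp add: W_def flip: ennreal_mult ennreal_plus)
    also have "\<dots> \<le> ennreal ((b + \<theta> * a) * (W r c + \<epsilon>))"
    proof (rule ennreal_leI)
      have "\<delta> * front r \<le> \<delta> * (sqrt 2 * r)" using front_le \<delta> by (intro mult_left_mono) auto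
      moreover have "0 \<le> \<kappa> * r" using \<kappa> r by simp
      ultimately have "- r + (\<delta> * c + \<delta>\<^sup>2 * r / 2) \<le> \<delta> * (c - front r)"
        by (simp add: \<kappa>_def algebra_simps)
      then have "exp (- r) * exp (\<delta> * c + \<delta>\<^sup>2 * r / 2) \<le> W r c"
        by (simp add: W_def flip: exp_add)
      moreover have "A * W r c / \<kappa> = L / \<kappa> * W r c + \<theta> * a * W r c"
        using \<kappa> by (simp add: A_def \<theta>_def field_simps)
      moreover have "a * \<epsilon> / 10 \<le> (b + \<theta> * a) * \<epsilon>"
      proof -
        have "1 / 10 \<le> \<theta>" using \<kappa> by (simp add: \<theta>_def field_simps)
        then have "1 / 10 * a \<le> \<theta> * a" using a by (intro mult_right_mono)
        then have "a / 10 \<le> b + \<theta> * a" using b by simp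
        then have "a / 10 * \<epsilon> \<le> (b + \<theta> * a) * \<epsilon>" using a by (intro mult_right_mono) auto
        then show ?thesis by simp
      qed
      moreover have "(b + \<theta> * a) * (W r c + \<epsilon>) = W r c + L / \<kappa> * W r c + \<theta> * a * W r c + (b + \<theta> * a) * \<epsilon>"
        by (simp add: b_def algebra_simps)
      ultimately show "exp (- r) * exp (\<delta> * c + \<delta>\<^sup>2 * r / 2) + (A * W r c / \<kappa> + a * \<epsilon> / 10) \<le> (b + \<theta> * a) * (W r c + \<epsilon>)"
        by linarith
    qed
    finally show "u r c \<le> ennreal ((b + \<theta> * a) * (W r c + \<epsilon>))" by simp
  qed (use that \<theta> u1 b in \<open>auto simp: W_def\<close>)
  then show ?thesis
    using b \<theta> by (intro that[of "b / (1 - \<theta>)"]) (auto simp: W_def \<delta>_def)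
qed

text \<open>The exponent \<open>2/5\<close> is any number between \<open>\<gamma>/\<surd>2\<close> and the true decay rate \<open>\<surd>2 \<gamma>\<close>: above
  \<open>\<gamma>/\<surd>2\<close> the square of the bound dominates the tilt \<open>exp (- \<surd>2 \<gamma> z)\<close> as \<open>z\<close> tends to \<open>-\<infinity>\<close>.\<close>

theorem kpp_tail_bound:
  assumes u: "kpp_subsolution u" and mono: "\<And>r c c'. c \<le> c' \<Longrightarrow> u r c \<le> u r c'"
    and tight: "\<And>r. r0 \<le> r \<Longrightarrow> u r (front r - K) \<le> ennreal (1 / 10)"
  obtains C where "0 < C" "\<And>r c. 0 < r \<Longrightarrow> u r c \<le> ennreal (C * exp (2 / 5 * (c - front r)))"
proof -
  define r1 where "r1 = max r0 1"
  \<comment> \<open>The second entry is chosen for times below \<open>r1\<close>: there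
    \<open>c \<le> sqrt 2 * r1 - K'\<close>, and the bound of \<open>kpp_chernoff\<close> is at most
    \<open>exp (- ln 10)\<close>. The first entry covers later times by tightness.\<close>
  define K' where "K' = max (max K 0) (sqrt 2 * r1 + r1 + r1 / 2 + ln 10)"
  have small: "u r c \<le> ennreal (1 / 10)" if r: "0 < r" and c: "c \<le> front r - K'" for r c
  proof (cases "r1 \<le> r")
    case True
    have "u r c \<le> u r (front r - K)" using c by (intro mono) (simp add: K'_def)
    also have "\<dots> \<le> ennreal (1 / 10)" using True by (intro tight) (simp add: r1_def)
    finally show ?thesis .
  next
    case False
    have "u r c \<le> ennreal (exp r1 * exp (c + r / 2))"
      by (rule kpp_chernoff[OF u r]) (use False in simp)
    also have "\<dots> \<le> ennreal (1 / 10)"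
    proof (rule ennreal_leI)
      have "sqrt 2 * r \<le> sqrt 2 * r1" using False by (intro mult_left_mono) auto
      moreover have "sqrt 2 * r1 + r1 + r1 / 2 + ln 10 \<le> K'" by (simp add: K'_def)
      ultimately have "r1 + (c + r / 2) \<le> - ln 10"
        using c front_le[of r] False by linarith
      then have "exp (r1 + (c + r / 2)) \<le> exp (- ln 10)" by simp
      also have "\<dots> = 1 / 10" by (simp add: exp_minus)
      finally show "exp r1 * exp (c + r / 2) \<le> 1 / 10" by (simp add: exp_add)
    qed
    finally show ?thesis .
  qed
  show ?thesis
    by (rule kpp_exponential_bound[OF u small, of K']) (use that in \<open>auto simp: K'_def\<close>)
qed

section \<open>Asymptotics of the branching integral\<close>

lemma sqrt2_gam: "sqrt 2 * gam = 2 - sqrt 2"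
  by (simp add: gam_def algebra_simps)

lemma sqrt2_bounds: "7 / 5 < sqrt 2" "sqrt 2 < 142 / 100"
  by (rule real_less_rsqrt, simp add: power2_eq_square) (rule real_less_lsqrt, auto simp: power2_eq_square)

definition front_log :: "real \<Rightarrow> real" where
  "front_log r = 3 / (2 * sqrt 2) * ln (max r 1)"

lemma front_eq: "front r = sqrt 2 * r - front_log r"
  by (simp add: front_def front_log_def)

lemma front_centering: "1 \<le> r \<Longrightarrow> front r = centering r"
  by (simp add: front_def centering_def)

lemma front_log_nonneg: "0 \<le> front_log r"
  by (simp add: front_log_def)

lemma front_log_le: "r \<le> t \<Longrightarrow> 1 \<le> t \<Longrightarrow> front_log r \<le> 2 * ln t"
proof -
  assume "r \<le> t" "1 \<le> t"
  then have "front_log r \<le> 3 / (2 * sqrt 2) * ln t"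
    unfolding front_log_def by (intro mult_left_mono) auto
  also have "\<dots> \<le> 2 * ln t"
    using \<open>1 \<le> t\<close> sqrt2_bounds by (intro mult_right_mono) (auto simp: field_simps)
  finally show ?thesis .
qed

text \<open>The product of \<open>sqrt 2 * gam\<close> and \<open>3 / (2 * sqrt 2)\<close> is
  \<open>3 * gam / 2\<close>: the polynomial factor of the theorem is the exponential tilt of the
  logarithmic correction of the front.\<close>

lemma exp_front_log: "exp (sqrt 2 * gam * front_log r) = max r 1 powr (3 * gam / 2)"
  by (simp add: front_log_def powr_def field_simps)

lemma heat_nonneg: "0 \<le> heat s y"
  by (rule normal_density_nonneg)

lemma heat_measurable [measurable]:
  assumes [measurable]: "f \<in> borel_measurable M" "g \<in> borel_measurable M"
  shows "(\<lambda>x. heat (f x) (g x)) \<in> borel_measurable M"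
  unfolding normal_density_def by measurable

text \<open>Because \<open>(1 + \<gamma>)\<^sup>2 = 2\<close>, completing the square with the tilt \<open>\<surd>2 \<gamma>\<close> is exact: it extracts both the
  exponential rate and the factor \<open>(t - s)\<^bsup>3 \<gamma> / 2\<^esup>\<close> for every branching time \<open>s\<close>.\<close>

lemma heat_front_identity:
  assumes s: "0 < s"
  shows "exp (- s) * heat s (sqrt 2 * \<alpha> * t - front (t - s) - z) =
    exp (- (2 * gam * (1 - \<alpha>) * t)) * (max (t - s) 1 powr (3 * gam / 2) *
      (exp (- (sqrt 2 * gam * z)) * heat s (2 * (s - (1 - \<alpha>) / sqrt 2 * t) + front_log (t - s) - z)))"
proof -
  define l where "l = front_log (t - s)"
  define q where "q = sqrt (2::real)"
  have q: "q * q = 2" by (simp add: q_def)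
  have q1: "(1 - \<alpha>) / q = (1 - \<alpha>) * q / 2"
    using q by (simp add: q_def field_simps)
  define Y where "Y = 2 * (s - (1 - \<alpha>) / q * t) + l - z"
  define X where "X = q * \<alpha> * t - (q * (t - s) - l) - z"
  have XY: "X = Y - (2 - q) * s"
    by (simp add: X_def Y_def q1 field_simps)
  have XD: "X\<^sup>2 / (2 * s) = Y\<^sup>2 / (2 * s) - (2 - q) * Y + (2 - q)\<^sup>2 * s / 2"
    using s unfolding XY by (simp add: field_simps power2_eq_square)
  have "(2 - q)\<^sup>2 = 2 * (3 - 2 * q)" using q by (simp add: power2_eq_square algebra_simps)
  then have q2: "(2 - q)\<^sup>2 * s / 2 = (3 - 2 * q) * s" by simp
  have qY: "(2 - q) * Y = (4 - 2 * q) * s - (2 * (q - 1) * (1 - \<alpha>) * t) + (2 - q) * l - (2 - q) * z"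
  proof -
    have "(2 - q) * ((1 - \<alpha>) * q * t) = 2 * (q - 1) * (1 - \<alpha>) * t"
    proof -
      have "(2 - q) * ((1 - \<alpha>) * q * t) = (2 * q - q * q) * (1 - \<alpha>) * t" by (simp add: algebra_simps)
      then show ?thesis by (simp add: q algebra_simps)
    qed
    moreover have "Y = 2 * s - (1 - \<alpha>) * q * t + l - z"
      by (simp add: Y_def q1 field_simps)
    moreover have "(2 - q) * (2 * s - W + l - z) = (4 - 2 * q) * s - (2 - q) * W + (2 - q) * l - (2 - q) * z" for W
      by (simp add: algebra_simps)
    ultimately show ?thesis by simp
  qed
  \<comment> \<open>All terms linear in \<open>s\<close> cancel:
    \<open>- 1 + (4 - 2 * q) - (3 - 2 * q) = 0\<close>. What remains is the rate, the tilts in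
    \<open>l\<close> and \<open>z\<close>, and the Gaussian in \<open>Y\<close>.\<close>
  have "- s - X\<^sup>2 / (2 * s) = - (2 * (q - 1) * (1 - \<alpha>) * t) + ((2 - q) * l + (- ((2 - q) * z) - Y\<^sup>2 / (2 * s)))"
    unfolding XD q2 qY by (simp add: algebra_simps)
  then have e: "exp (- s) * exp (- X\<^sup>2 / (2 * s)) =
     exp (- (2 * (q - 1) * (1 - \<alpha>) * t)) * (exp ((2 - q) * l) * (exp (- ((2 - q) * z)) * exp (- Y\<^sup>2 / (2 * s))))"
    by (simp flip: exp_add)
  have "exp (- s) * heat s X = exp (- (2 * (q - 1) * (1 - \<alpha>) * t)) * (exp ((2 - q) * l) * (exp (- ((2 - q) * z)) * heat s Y))"
    using s e by (simp add: normal_density_def)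
  moreover have "exp ((2 - sqrt 2) * front_log (t - s)) = max (t - s) 1 powr (3 * gam / 2)"
    unfolding sqrt2_gam[symmetric] by (rule exp_front_log)
  ultimately show ?thesis
    unfolding X_def Y_def l_def q_def sqrt2_gam front_eq by (simp add: gam_def)
qed

lemma exp_minus_le_inverse_sqrt:
  assumes "0 < q"
  shows "exp (- q) \<le> 1 / sqrt q"
proof -
  have "q \<le> exp (2 * q)" using exp_ge_add_one_self[of "2 * q"] assms by linarith
  then have "sqrt q \<le> sqrt (exp (2 * q))" by (rule real_sqrt_le_mono)
  also have "\<dots> = exp q" by (simp add: exp_double)
  finally show ?thesis using assms by (simp add: exp_minus field_simps)
qed

text \<open>The factor \<open>1 / sqrt s\<close> is harmless when \<open>s\<close> is of order
  \<open>t\<close>. When it is not, \<open>\<bar>x\<bar>\<close> is of order \<open>t\<close>, and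
  half of the Gaussian exponent pays for the factor through
  \<open>exp (- q) \<le> 1 / sqrt q\<close>; the other half gives the exponential on the
  right.\<close>

lemma heat_sup_bound:
  assumes t: "1 \<le> t" and s: "0 < s" "s \<le> t" and l: "0 < l" "l * t / 2 \<le> s \<or> l * t / 2 \<le> \<bar>x\<bar>"
  shows "sqrt t * heat s x \<le> (1 / sqrt (pi * l) + 4 / l) * exp (- x\<^sup>2 / (4 * t))"
proof (cases "l * t / 2 \<le> s")
  case True
  have "sqrt t * (1 / sqrt (2 * pi * s)) \<le> sqrt t * (1 / sqrt (2 * pi * (l * t / 2)))"
    using True t s l by (intro mult_left_mono divide_left_mono) (auto intro!: mult_pos_pos)
  also have "\<dots> = 1 / sqrt (pi * l)"
    using t l by (simp add: real_sqrt_mult)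
  finally have 1: "sqrt t * (1 / sqrt (2 * pi * s)) \<le> 1 / sqrt (pi * l) + 4 / l"
    using l by (simp add: add_increasing2)
  have "x\<^sup>2 / (4 * t) \<le> x\<^sup>2 / (2 * s)"
    using s t by (intro divide_left_mono) auto
  then have 2: "exp (- x\<^sup>2 / (2 * s)) \<le> exp (- x\<^sup>2 / (4 * t))" by simp
  have "sqrt t * heat s x = sqrt t * (1 / sqrt (2 * pi * s)) * exp (- x\<^sup>2 / (2 * s))"
    using s by (simp add: normal_density_def)
  also have "\<dots> \<le> (1 / sqrt (pi * l) + 4 / l) * exp (- x\<^sup>2 / (4 * t))"
    using 1 2 l t by (intro mult_mono) auto
  finally show ?thesis .
next
  case False
  then have x: "l * t / 2 \<le> \<bar>x\<bar>" using l by simp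
  then have x0: "0 < \<bar>x\<bar>" using l t by (meson half_gt_zero less_le_trans mult_pos_pos zero_less_one)
  define q where "q = x\<^sup>2 / (4 * s)"
  have q: "0 < q" using x0 s by (simp add: q_def)
  have sq: "sqrt q = \<bar>x\<bar> / (2 * sqrt s)"
    using s by (simp add: q_def real_sqrt_divide real_sqrt_mult)
  have "x\<^sup>2 / (4 * t) \<le> q" unfolding q_def
    using s t by (intro divide_left_mono) auto
  then have 2: "exp (- q) \<le> exp (- x\<^sup>2 / (4 * t))" by simp
  have "sqrt t * (1 / sqrt (2 * pi * s)) * exp (- q) \<le> sqrt t * (1 / sqrt (2 * pi * s)) * (1 / sqrt q)"
    using exp_minus_le_inverse_sqrt[OF q] t s by (intro mult_left_mono) auto
  also have "\<dots> = sqrt t * (2 / \<bar>x\<bar>) * (1 / sqrt (2 * pi))"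
    using s by (simp add: sq real_sqrt_mult)
  also have "\<dots> \<le> sqrt t * (2 / \<bar>x\<bar>) * 1"
  proof (intro mult_left_mono)
    have "1 \<le> 2 * pi" using pi_ge_two by simp
    then show "1 / sqrt (2 * pi) \<le> 1" by (simp add: real_sqrt_ge_1_iff)
  qed (use t in auto)
  also have "\<dots> \<le> sqrt t * (2 / (l * t / 2)) * 1"
    using x x0 l t by (intro mult_left_mono mult_right_mono divide_left_mono) (auto intro!: mult_pos_pos)
  also have "\<dots> = 4 / l * (sqrt t / t)"
    by (simp add: field_simps)
  also have "\<dots> \<le> 4 / l * 1"
  proof (intro mult_left_mono)
    have "sqrt t * 1 \<le> sqrt t * sqrt t" using t by (intro mult_left_mono) auto
    then show "sqrt t / t \<le> 1" using t by (simp add: field_simps)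
  qed (use l in auto)
  finally have 1: "sqrt t * (1 / sqrt (2 * pi * s)) * exp (- q) \<le> 1 / sqrt (pi * l) + 4 / l"
    using l by (simp add: add_increasing)
  have "exp (- x\<^sup>2 / (2 * s)) = exp (- q) * exp (- q)"
    using s by (simp add: q_def field_simps flip: exp_add)
  then have "sqrt t * heat s x = sqrt t * (1 / sqrt (2 * pi * s)) * exp (- q) * exp (- q)"
    using s by (simp add: normal_density_def)
  also have "\<dots> \<le> (1 / sqrt (pi * l) + 4 / l) * exp (- x\<^sup>2 / (4 * t))"
    using 1 2 l t by (intro mult_mono) auto
  finally show ?thesis .
qed

lemma nn_integral_heat_shift:
  assumes "0 < s"
  shows "(\<integral>\<^sup>+z. ennreal (heat s (w - z)) \<partial>lborel) = 1"
proof -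
  have "heat s (w - z) = normal_density w (sqrt s) z" for z
    by (simp add: normal_density_def power2_commute)
  then show ?thesis using assms by (simp add: nn_integral_normal_density)
qed

lemma nn_integral_exp_abs: "(\<integral>\<^sup>+z. ennreal (exp (- \<bar>z\<bar> / 10)) \<partial>lborel) < \<infinity>"
proof -
  have "(\<integral>\<^sup>+z. ennreal (exp (- \<bar>z\<bar> / 10)) \<partial>lborel) \<le>
    (\<integral>\<^sup>+z. ennreal 10 * ennreal (exponential_density (1 / 10) z) + ennreal 10 * ennreal (exponential_density (1 / 10) (0 + (-1) * z)) \<partial>lborel)"
  proof (rule nn_integral_mono)
    fix z :: real
    show "ennreal (exp (- \<bar>z\<bar> / 10)) \<le> ennreal 10 * ennreal (exponential_density (1 / 10) z) + ennreal 10 * ennreal (exponential_density (1 / 10) (0 + (-1) * z))"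
    proof -
      have "exp (- \<bar>z\<bar> / 10) \<le> 10 * exponential_density (1 / 10) z + 10 * exponential_density (1 / 10) (0 + (-1) * z)"
        by (cases "z \<ge> 0") (auto simp: exponential_density_def)
      from ennreal_leI[OF this] show ?thesis
        by (simp add: ennreal_plus ennreal_mult exponential_density_nonneg del: ennreal_plus[symmetric])
    qed
  qed
  also have "\<dots> = ennreal 10 + ennreal 10 * (\<integral>\<^sup>+z. ennreal (exponential_density (1 / 10) (0 + (-1) * z)) \<partial>lborel)"
    by (simp add: nn_integral_add nn_integral_cmult nn_integral_exponential_density)
  also have "(\<integral>\<^sup>+z. ennreal (exponential_density (1 / 10) (0 + (-1) * z)) \<partial>lborel) = 1"
    using nn_integral_real_affine[of "\<lambda>z. ennreal (exponential_density (1 / 10) z)" "-1" 0]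
    by (simp add: nn_integral_exponential_density)
  finally show ?thesis by (rule le_less_trans) (simp add: ennreal_mult_less_top less_top[symmetric])
qed


text \<open>For \<open>z \<ge> 0\<close> the tilt decays at rate \<open>2 - sqrt 2\<close>, more
  than 1/5. For \<open>z < 0\<close> it grows at that rate while the square of the bound decays at
  rate 4/5, and the difference exceeds 1/5 because \<open>sqrt 2 > 7 / 5\<close>.\<close>

lemma kernel_tail_weight:
  assumes F: "0 \<le> f" "f \<le> 1" "f \<le> C * exp (2 / 5 * z)" and C: "0 < C"
  shows "exp (- (sqrt 2 * gam * z)) * f\<^sup>2 \<le> (1 + C\<^sup>2) * exp (- \<bar>z\<bar> / 5)"
proof (cases "0 \<le> z")
  case True
  have "exp (- (sqrt 2 * gam * z)) * f\<^sup>2 \<le> exp (- \<bar>z\<bar> / 5) * 1"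
  proof (intro mult_mono)
    have "(1 / 5) * z \<le> (2 - sqrt 2) * z"
      using True sqrt2_bounds by (intro mult_right_mono) auto
    then show "exp (- (sqrt 2 * gam * z)) \<le> exp (- \<bar>z\<bar> / 5)"
      using True by (simp add: sqrt2_gam)
  qed (use F in \<open>auto intro: power_le_one\<close>)
  also have "\<dots> \<le> (1 + C\<^sup>2) * exp (- \<bar>z\<bar> / 5)" by simp
  finally show ?thesis .
next
  case False
  have "f\<^sup>2 \<le> (C * exp (2 / 5 * z))\<^sup>2" using F by (intro power_mono) auto
  also have "\<dots> = C\<^sup>2 * exp (4 / 5 * z)" by (simp add: power_mult_distrib flip: exp_double)
  finally have "exp (- (sqrt 2 * gam * z)) * f\<^sup>2 \<le> exp (- (sqrt 2 * gam * z)) * (C\<^sup>2 * exp (4 / 5 * z))"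
    by (intro mult_left_mono) auto
  also have "\<dots> = C\<^sup>2 * exp (- (sqrt 2 * gam * z) + 4 / 5 * z)"
    by (simp flip: exp_add)
  also have "\<dots> \<le> C\<^sup>2 * exp (- \<bar>z\<bar> / 5)"
  proof (intro mult_left_mono)
    have "(sqrt 2 - 6 / 5 - 1 / 5) * z \<le> 0"
      using False sqrt2_bounds by (intro mult_nonneg_nonpos) auto
    then show "exp (- (sqrt 2 * gam * z) + 4 / 5 * z) \<le> exp (- \<bar>z\<bar> / 5)"
      using False unfolding sqrt2_gam by (simp add: algebra_simps)
  qed simp
  also have "\<dots> \<le> (1 + C\<^sup>2) * exp (- \<bar>z\<bar> / 5)" by (intro mult_right_mono) auto
  finally show ?thesis .
qed

section \<open>Laplace's method in the branching time\<close>

definition main_rate :: "real \<Rightarrow> real \<Rightarrow> real" where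
  "main_rate \<alpha> t = (v_coeff \<alpha> * t) powr (3 * gam / 2) * exp (- (2 * gam * (1 - \<alpha>) * t))"

text \<open>The analytic part, free of the process: \<open>F r z\<close> stands for the functional
  of one subtree of age \<open>r\<close> seen from \<open>front r + z\<close>, and \<open>A\<close>
  and \<open>Bf\<close> for weights of the normalised branching time and position. The exponential
  bound on \<open>F\<close> is what domination rests on.\<close>

locale laplace_setting =
  fixes \<alpha> :: real and F :: "real \<Rightarrow> real \<Rightarrow> real" and Finf :: "real \<Rightarrow> real" and C :: real
    and A Bf :: "real \<Rightarrow> real"
  assumes \<alpha>: "- gam < \<alpha>" "\<alpha> < 1"
    and F_meas [measurable]: "(\<lambda>x. F (fst x) (snd x)) \<in> borel_measurable (borel \<Otimes>\<^sub>M borel)"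
    and F: "\<And>r z. 0 \<le> F r z" "\<And>r z. F r z \<le> 1" "\<And>r z. 0 < r \<Longrightarrow> F r z \<le> C * exp (2 / 5 * z)"
    and C: "0 < C"
    and F_lim: "\<And>z. ((\<lambda>r. F r z) \<longlongrightarrow> Finf z) at_top"
    and A_meas [measurable]: "A \<in> borel_measurable borel" and A: "\<And>k. 0 \<le> A k" "\<And>k. A k \<le> 1"
    and B_meas [measurable]: "Bf \<in> borel_measurable borel" and B: "\<And>x. 0 \<le> Bf x" "\<And>x. Bf x \<le> 1"
begin

text \<open>\<open>lam * t\<close> is the typical first branching time and \<open>vel * t\<close>
  the time left after it. \<open>scl t\<close> is the standard deviation of the branching time, the
  4 coming from the slope 2 of the Gaussian argument in \<open>heat_front_identity\<close>.\<close>

definition lam :: real where "lam = (1 - \<alpha>) / sqrt 2"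
definition vel :: real where "vel = v_coeff \<alpha>"
definition scl :: "real \<Rightarrow> real" where "scl t = sqrt (t * (lam / 4))"

lemma main_rate_vel: "main_rate \<alpha> t = (vel * t) powr (3 * gam / 2) * exp (- (2 * gam * (1 - \<alpha>) * t))"
  by (simp add: main_rate_def vel_def)

lemma lam_vel: "0 < lam" "0 < vel" "lam + vel = 1" "lam < 1" "vel < 1"
proof -
  show 1: "0 < lam" "0 < vel" using \<alpha> by (auto simp: lam_def vel_def v_coeff_def)
  have "lam + vel = (1 + gam) / sqrt 2" by (simp add: lam_def vel_def v_coeff_def add_divide_distrib diff_divide_distrib)
  then show 2: "lam + vel = 1" by (simp add: gam_def)
  show "lam < 1" "vel < 1" using 1 2 by linarith+
qed

lemma scl_pos: "0 < t \<Longrightarrow> 0 < scl t"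
  using lam_vel by (simp add: scl_def)

text \<open>The integrand of \<open>branch_int\<close> in the variable \<open>z\<close>, divided by
  \<open>main_rate\<close>. The difference of \<open>centering\<close> and \<open>front\<close>
  inside \<open>Bf\<close> vanishes as soon as \<open>t - s \<ge> 1\<close>.\<close>

definition kern :: "real \<Rightarrow> real \<Rightarrow> real \<Rightarrow> real" where
  "kern t s z = (max (t - s) 1 / (vel * t)) powr (3 * gam / 2) *
     (exp (- (sqrt 2 * gam * z)) * heat s (2 * (s - lam * t) + front_log (t - s) - z)) *
     (A ((s - lam * t) / scl t) * Bf (- z + (centering (t - s) - front (t - s))) * (F (t - s) z)\<^sup>2)"

lemma kern_nonneg: "0 \<le> kern t s z"
  unfolding kern_def by (intro mult_nonneg_nonneg) (auto simp: A B heat_nonneg)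

lemma front_measurable [measurable]: "front \<in> borel_measurable borel"
  unfolding front_def by measurable

lemma front_log_measurable [measurable]: "front_log \<in> borel_measurable borel"
  unfolding front_log_def by measurable

lemma centering_measurable [measurable]: "centering \<in> borel_measurable borel"
  unfolding centering_def by measurable

lemma F_measurable [measurable (raw)]:
  "f \<in> borel_measurable M \<Longrightarrow> g \<in> borel_measurable M \<Longrightarrow> (\<lambda>x. F (f x) (g x)) \<in> borel_measurable M"
  using measurable_compose[OF measurable_Pair F_meas, of f M g] by simp

lemma kern_measurable [measurable]:
  "(\<lambda>x. kern t (fst x) (snd x)) \<in> borel_measurable (borel \<Otimes>\<^sub>M borel)"
  unfolding kern_def by measurable

definition weight :: real where "weight = (1 / vel) powr (3 * gam / 2) * (1 + C\<^sup>2)"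

text \<open>Since \<open>max (t - s) 1 \<le> t\<close>, the power is bounded by a constant, and
  \<open>kernel_tail_weight\<close> disposes of the tilt and of \<open>F\<close>. Only the heat
  kernel still depends on \<open>s\<close>.\<close>

lemma kern_le:
  assumes t: "1 \<le> t" and s: "0 < s" "s < t"
  shows "kern t s z \<le> weight * (exp (- \<bar>z\<bar> / 5) * heat s (2 * (s - lam * t) + front_log (t - s) - z))"
proof -
  let ?h = "heat s (2 * (s - lam * t) + front_log (t - s) - z)"
  have g: "0 \<le> gam" using sqrt2_bounds by (simp add: gam_def)
  have 1: "(max (t - s) 1 / (vel * t)) powr (3 * gam / 2) \<le> (1 / vel) powr (3 * gam / 2)"
  proof (rule powr_mono2)
    show "max (t - s) 1 / (vel * t) \<le> 1 / vel"
      using t s lam_vel by (simp add: field_simps)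
  qed (use g t lam_vel in auto)
  have 2: "exp (- (sqrt 2 * gam * z)) * (F (t - s) z)\<^sup>2 \<le> (1 + C\<^sup>2) * exp (- \<bar>z\<bar> / 5)"
    using s by (intro kernel_tail_weight F C) auto
  have 3: "A ((s - lam * t) / scl t) * Bf (- z + (centering (t - s) - front (t - s))) \<le> 1"
    using A B by (simp add: mult_le_one)
  have "kern t s z = (max (t - s) 1 / (vel * t)) powr (3 * gam / 2) * ?h *
      (exp (- (sqrt 2 * gam * z)) * (F (t - s) z)\<^sup>2) * (A ((s - lam * t) / scl t) * Bf (- z + (centering (t - s) - front (t - s))))"
    by (simp add: kern_def)
  also have "\<dots> \<le> (1 / vel) powr (3 * gam / 2) * ?h * ((1 + C\<^sup>2) * exp (- \<bar>z\<bar> / 5)) * 1"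
    by (rule mult_mono[OF mult_mono[OF mult_mono[OF 1 order_refl] 2] 3]) (auto simp: heat_nonneg A B)
  finally show ?thesis by (simp add: weight_def mult_ac)
qed

lemma weight_nonneg: "0 \<le> weight"
  by (simp add: weight_def)

definition branch_int :: "real \<Rightarrow> ennreal" where
  "branch_int t = (\<integral>\<^sup>+s. ennreal (exponential_density 1 s) * (\<integral>\<^sup>+y. ennreal (heat s y) *
     (ennreal (A ((s - lam * t) / scl t) * Bf (y - (sqrt 2 * \<alpha> * t - centering (t - s)))) *
       indicator {..t} s * (ennreal (F (t - s) (sqrt 2 * \<alpha> * t - y - front (t - s))))\<^sup>2) \<partial>lborel) \<partial>lborel)"

lemma branch_int_eq:
  assumes t: "0 < t"
  shows "branch_int t = ennreal (main_rate \<alpha> t) * (\<integral>\<^sup>+s. indicator {0<..<t} s * (\<integral>\<^sup>+z. ennreal (kern t s z) \<partial>lborel) \<partial>lborel)"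
proof -
  have "branch_int t = (\<integral>\<^sup>+s. ennreal (main_rate \<alpha> t) * (indicator {0<..<t} s * (\<integral>\<^sup>+z. ennreal (kern t s z) \<partial>lborel)) \<partial>lborel)"
    unfolding branch_int_def
  proof (rule nn_integral_cong_AE)
    have "AE s in lborel. s \<noteq> (0::real)" "AE s in lborel. s \<noteq> t" by (rule AE_lborel_singleton)+
    then show "AE s in lborel. ennreal (exponential_density 1 s) * (\<integral>\<^sup>+y. ennreal (heat s y) *
       (ennreal (A ((s - lam * t) / scl t) * Bf (y - (sqrt 2 * \<alpha> * t - centering (t - s)))) *
       indicator {..t} s * (ennreal (F (t - s) (sqrt 2 * \<alpha> * t - y - front (t - s))))\<^sup>2) \<partial>lborel) =
       ennreal (main_rate \<alpha> t) * (indicator {0<..<t} s * (\<integral>\<^sup>+z. ennreal (kern t s z) \<partial>lborel))"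
    proof eventually_elim
      case (elim s)
      consider "s < 0" | "t < s" | "0 < s" "s < t" using elim by linarith
      then show ?case
      proof cases
        case 3
        \<comment> \<open>The substitution \<open>y = X - z\<close> depends on \<open>s\<close>:
          seen from the branching position \<open>y\<close>, the barrier then lies at
          \<open>front (t - s) + z\<close>.\<close>
        define X where "X = sqrt 2 * \<alpha> * t - front (t - s)"
        let ?h = "\<lambda>y. ennreal (heat s y) * (ennreal (A ((s - lam * t) / scl t) * Bf (y - (sqrt 2 * \<alpha> * t - centering (t - s)))) *
          (ennreal (F (t - s) (sqrt 2 * \<alpha> * t - y - front (t - s))))\<^sup>2)"
        have hm: "?h \<in> borel_measurable borel" by measurable
        have "(\<integral>\<^sup>+y. ?h y \<partial>lborel) = (\<integral>\<^sup>+z. ?h (X + (-1) * z) \<partial>lborel)"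
          using nn_integral_real_affine[OF hm, of "-1" X] by simp
        then have "ennreal (exponential_density 1 s) * (\<integral>\<^sup>+y. ?h y \<partial>lborel) =
          (\<integral>\<^sup>+z. ennreal (exponential_density 1 s) * ?h (X + (-1) * z) \<partial>lborel)"
          by (simp only:) (rule nn_integral_cmult[symmetric], measurable)
        also have "\<dots> = (\<integral>\<^sup>+z. ennreal (main_rate \<alpha> t) * ennreal (kern t s z) \<partial>lborel)"
        proof (rule nn_integral_cong)
          fix z
          let ?A = "A ((s - lam * t) / scl t)" and ?B = "Bf (- z + (centering (t - s) - front (t - s)))"
          have "exp (- s) * heat s (X - z) =
              exp (- (2 * gam * (1 - \<alpha>) * t)) * (max (t - s) 1 powr (3 * gam / 2) *
              (exp (- (sqrt 2 * gam * z)) * heat s (2 * (s - lam * t) + front_log (t - s) - z)))"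
            using heat_front_identity[OF 3(1), of \<alpha> t z] by (simp add: X_def lam_def)
          also have "max (t - s) 1 powr (3 * gam / 2) = (vel * t) powr (3 * gam / 2) * (max (t - s) 1 / (vel * t)) powr (3 * gam / 2)"
            using t lam_vel by (simp add: powr_divide)
          finally have id: "exp (- s) * heat s (X - z) = main_rate \<alpha> t * ((max (t - s) 1 / (vel * t)) powr (3 * gam / 2) *
              (exp (- (sqrt 2 * gam * z)) * heat s (2 * (s - lam * t) + front_log (t - s) - z)))"
            by (simp add: main_rate_vel mult_ac)
          have "ennreal (exponential_density 1 s) * ?h (X + (-1) * z) =
            ennreal (exponential_density 1 s * (heat s (X - z) * (?A * ?B * (F (t - s) z)\<^sup>2)))"
            by (simp add: X_def ennreal_mult' A B F heat_nonneg exponential_density_nonneg algebra_simps flip: ennreal_power)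
          also have "exponential_density 1 s * (heat s (X - z) * (?A * ?B * (F (t - s) z)\<^sup>2)) =
             (exp (- s) * heat s (X - z)) * (?A * ?B * (F (t - s) z)\<^sup>2)"
            using 3 by (simp add: exponential_density_def)
          also have "\<dots> = main_rate \<alpha> t * kern t s z"
            unfolding id kern_def by (simp only: mult.assoc)
          finally show "ennreal (exponential_density 1 s) * ?h (X + (-1) * z) = ennreal (main_rate \<alpha> t) * ennreal (kern t s z)"
            by (simp add: ennreal_mult kern_nonneg main_rate_vel)
        qed
        also have "\<dots> = ennreal (main_rate \<alpha> t) * (\<integral>\<^sup>+z. ennreal (kern t s z) \<partial>lborel)"
        proof (rule nn_integral_cmult)
          show "(\<lambda>z. ennreal (kern t s z)) \<in> borel_measurable lborel"
            using measurable_compose[OF _ kern_measurable, of "\<lambda>z. (s, z)" borel t] by simp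
        qed
        finally show ?thesis using 3 by simp
      qed (auto simp: exponential_density_def)
    qed
  qed
  also have "\<dots> = ennreal (main_rate \<alpha> t) * (\<integral>\<^sup>+s. indicator {0<..<t} s * (\<integral>\<^sup>+z. ennreal (kern t s z) \<partial>lborel) \<partial>lborel)"
  proof (rule nn_integral_cmult)
    have "(\<lambda>s. \<integral>\<^sup>+z. ennreal (kern t s z) \<partial>lborel) \<in> borel_measurable borel"
      by (rule lborel.borel_measurable_nn_integral) (use kern_measurable in \<open>simp add: case_prod_beta\<close>)
    then show "(\<lambda>s. indicator {0<..<t} s * (\<integral>\<^sup>+z. ennreal (kern t s z) \<partial>lborel)) \<in> borel_measurable lborel"
      by simp
  qed
  finally show ?thesis .
qed

text \<open>Beyond \<open>c * t\<close> the weight in \<open>z\<close> is at most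
  \<open>exp (- (c * t) / 5)\<close>, and the heat kernel integrates to 1 in \<open>z\<close> for
  each \<open>s\<close>, so its singularity at small \<open>s\<close> does no harm. The interval of
  branching times has length \<open>t\<close>.\<close>

lemma kern_tail:
  assumes t: "1 \<le> t" and c: "0 < c"
  shows "(\<integral>\<^sup>+s. indicator {0<..<t} s * (\<integral>\<^sup>+z. indicator {z. c * t < \<bar>z\<bar>} z * ennreal (kern t s z) \<partial>lborel) \<partial>lborel)
    \<le> ennreal (weight * exp (- (c * t) / 5) * t)"
proof -
  have "(\<integral>\<^sup>+s. indicator {0<..<t} s * (\<integral>\<^sup>+z. indicator {z. c * t < \<bar>z\<bar>} z * ennreal (kern t s z) \<partial>lborel) \<partial>lborel)
    \<le> (\<integral>\<^sup>+s. ennreal (weight * exp (- (c * t) / 5)) * indicator {0<..<t} s \<partial>lborel)"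
  proof (rule nn_integral_mono)
    fix s
    show "indicator {0<..<t} s * (\<integral>\<^sup>+z. indicator {z. c * t < \<bar>z\<bar>} z * ennreal (kern t s z) \<partial>lborel) \<le>
      ennreal (weight * exp (- (c * t) / 5)) * indicator {0<..<t} s"
    proof (cases "s \<in> {0<..<t}")
      case True
      let ?w = "2 * (s - lam * t) + front_log (t - s)"
      have "(\<integral>\<^sup>+z. indicator {z. c * t < \<bar>z\<bar>} z * ennreal (kern t s z) \<partial>lborel) \<le>
        (\<integral>\<^sup>+z. ennreal (weight * exp (- (c * t) / 5)) * ennreal (heat s (?w - z)) \<partial>lborel)"
      proof (rule nn_integral_mono)
        fix z
        show "indicator {z. c * t < \<bar>z\<bar>} z * ennreal (kern t s z) \<le> ennreal (weight * exp (- (c * t) / 5)) * ennreal (heat s (?w - z))"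
        proof (cases "c * t < \<bar>z\<bar>")
          case z: True
          have "kern t s z \<le> weight * (exp (- \<bar>z\<bar> / 5) * heat s (?w - z))"
            using t True by (intro kern_le) auto
          also have "\<dots> \<le> weight * (exp (- (c * t) / 5) * heat s (?w - z))"
            using z by (intro mult_left_mono mult_right_mono heat_nonneg weight_nonneg) auto
          finally show ?thesis
            using z by (simp add: weight_nonneg heat_nonneg mult.assoc ennreal_leI flip: ennreal_mult)
        qed simp
      qed
      also have "\<dots> = ennreal (weight * exp (- (c * t) / 5))"
        using True by (simp add: nn_integral_cmult nn_integral_heat_shift)
      finally show ?thesis using True by simp
    qed simp
  qed
  also have "\<dots> = ennreal (weight * exp (- (c * t) / 5)) * ennreal t"
    using t by (simp add: nn_integral_cmult)
  finally show ?thesis using t by (simp add: weight_nonneg ennreal_mult)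
qed


text \<open>The bound \<open>lam / 4\<close> keeps \<open>z\<close> too small to compensate for an
  early branching time in \<open>heat_sup_bound\<close>; the bound 1/5 lets the term
  \<open>z\<^sup>2 / (2 * t)\<close> from the Gaussian exponent be absorbed by half of the decay
  \<open>exp (- \<bar>z\<bar> / 5)\<close>.\<close>

definition cut :: real where "cut = min (1 / 5) (lam / 4)"

lemma cut: "0 < cut" "cut \<le> 1 / 5" "cut \<le> lam / 4"
  using lam_vel by (auto simp: cut_def)

text \<open>The coordinates are \<open>k\<close> and \<open>z\<close>, with branching time
  \<open>lam * t + scl t * k\<close>; the factor \<open>scl t\<close> is the Jacobian.\<close>

definition resc :: "real \<Rightarrow> real \<times> real \<Rightarrow> real" where
  "resc t x = indicator {0<..<t} (lam * t + scl t * fst x) * indicator {z. \<bar>z\<bar> \<le> cut * t} (snd x) *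
     (scl t * kern t (lam * t + scl t * fst x) (snd x))"

lemma kern_measurable_raw [measurable (raw)]:
  "f \<in> borel_measurable M \<Longrightarrow> g \<in> borel_measurable M \<Longrightarrow> (\<lambda>x. kern t (f x) (g x)) \<in> borel_measurable M"
  using measurable_compose[OF measurable_Pair kern_measurable, of f M g t] by simp

lemma resc_measurable [measurable]: "resc t \<in> borel_measurable (lborel \<Otimes>\<^sub>M lborel)"
  unfolding resc_def by measurable

lemma kern_integral_split:
  assumes t: "1 \<le> t"
  shows "(\<integral>\<^sup>+s. indicator {0<..<t} s * (\<integral>\<^sup>+z. ennreal (kern t s z) \<partial>lborel) \<partial>lborel) =
    (\<integral>\<^sup>+x. ennreal (resc t x) \<partial>(lborel \<Otimes>\<^sub>M lborel)) +
    (\<integral>\<^sup>+s. indicator {0<..<t} s * (\<integral>\<^sup>+z. indicator {z. cut * t < \<bar>z\<bar>} z * ennreal (kern t s z) \<partial>lborel) \<partial>lborel)"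
proof -
  let ?K = "\<lambda>s. \<integral>\<^sup>+z. ennreal (kern t s z) \<partial>lborel"
  let ?T = "\<lambda>s. \<integral>\<^sup>+z. indicator {z. cut * t < \<bar>z\<bar>} z * ennreal (kern t s z) \<partial>lborel"
  let ?L = "\<lambda>s. \<integral>\<^sup>+z. indicator {z. \<bar>z\<bar> \<le> cut * t} z * ennreal (kern t s z) \<partial>lborel"
  have Tm [measurable]: "?T \<in> borel_measurable borel"
    by (rule lborel.borel_measurable_nn_integral) (simp add: case_prod_beta)
  have Lm [measurable]: "?L \<in> borel_measurable borel"
    by (rule lborel.borel_measurable_nn_integral) (simp add: case_prod_beta)
  have "?K s = ?L s + ?T s" for s
  proof -
    have "?K s = (\<integral>\<^sup>+z. indicator {z. \<bar>z\<bar> \<le> cut * t} z * ennreal (kern t s z) + indicator {z. cut * t < \<bar>z\<bar>} z * ennreal (kern t s z) \<partial>lborel)"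
      by (rule nn_integral_cong) (auto split: split_indicator)
    also have "\<dots> = ?L s + ?T s"
      by (rule nn_integral_add) measurable
    finally show ?thesis .
  qed
  then have "(\<integral>\<^sup>+s. indicator {0<..<t} s * ?K s \<partial>lborel) =
     (\<integral>\<^sup>+s. indicator {0<..<t} s * ?L s + indicator {0<..<t} s * ?T s \<partial>lborel)"
    by (simp add: distrib_left)
  also have "\<dots> = (\<integral>\<^sup>+s. indicator {0<..<t} s * ?L s \<partial>lborel) + (\<integral>\<^sup>+s. indicator {0<..<t} s * ?T s \<partial>lborel)"
    by (rule nn_integral_add) measurable
  also have "(\<integral>\<^sup>+s. indicator {0<..<t} s * ?L s \<partial>lborel) =
     ennreal (scl t) * (\<integral>\<^sup>+k. indicator {0<..<t} (lam * t + scl t * k) * ?L (lam * t + scl t * k) \<partial>lborel)"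
    using nn_integral_real_affine[of "\<lambda>s. indicator {0<..<t} s * ?L s" "scl t" "lam * t"] scl_pos[of t] t by simp
  also have "\<dots> = (\<integral>\<^sup>+k. ennreal (scl t) * (indicator {0<..<t} (lam * t + scl t * k) * ?L (lam * t + scl t * k)) \<partial>lborel)"
    by (rule nn_integral_cmult[symmetric]) measurable
  also have "\<dots> = (\<integral>\<^sup>+k. (\<integral>\<^sup>+z. ennreal (resc t (k, z)) \<partial>lborel) \<partial>lborel)"
  proof (rule nn_integral_cong)
    fix k
    let ?s = "lam * t + scl t * k"
    have "ennreal (scl t) * (indicator {0<..<t} ?s * ?L ?s) =
      (\<integral>\<^sup>+z. ennreal (scl t) * indicator {0<..<t} ?s * (indicator {z. \<bar>z\<bar> \<le> cut * t} z * ennreal (kern t ?s z)) \<partial>lborel)"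
      by (subst nn_integral_cmult) (simp_all add: mult.assoc)
    also have "\<dots> = (\<integral>\<^sup>+z. ennreal (resc t (k, z)) \<partial>lborel)"
      using scl_pos[of t] t
      by (intro nn_integral_cong) (auto simp: resc_def ennreal_mult kern_nonneg split: split_indicator)
    finally show "ennreal (scl t) * (indicator {0<..<t} ?s * ?L ?s) = (\<integral>\<^sup>+z. ennreal (resc t (k, z)) \<partial>lborel)" .
  qed
  also have "\<dots> = (\<integral>\<^sup>+x. ennreal (resc t x) \<partial>(lborel \<Otimes>\<^sub>M lborel))"
    by (rule lborel.nn_integral_fst) measurable
  finally show ?thesis .
qed

definition dom_const :: real where
  "dom_const = weight * sqrt (lam / 4) * (1 / sqrt (pi * lam) + 4 / lam) * exp 1"

lemma dom_const_nonneg: "0 \<le> dom_const"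
  using lam_vel by (simp add: dom_const_def weight_nonneg)

text \<open>An integrable bound valid for all large \<open>t\<close>, Gaussian in \<open>k\<close>
  and exponential in \<open>z\<close>. The two hypotheses on \<open>ln t\<close> make the
  logarithmic shift of the front negligible.\<close>

lemma resc_le:
  assumes t: "1 \<le> t" and l1: "2 * ln t \<le> lam / 4 * t" and l2: "(2 * ln t)\<^sup>2 \<le> 2 * t"
  shows "resc t (k, z) \<le> dom_const * (exp (- lam * k\<^sup>2 / 8) * exp (- \<bar>z\<bar> / 10))"
proof (cases "lam * t + scl t * k \<in> {0<..<t} \<and> \<bar>z\<bar> \<le> cut * t")
  case True
  define s where "s = lam * t + scl t * k"
  define l where "l = front_log (t - s)"
  define x where "x = 2 * (s - lam * t) + l - z"
  have s: "0 < s" "s < t" and z: "\<bar>z\<bar> \<le> cut * t" using True by (auto simp: s_def)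
  have l: "0 \<le> l" "l \<le> 2 * ln t"
    using s t by (auto simp: l_def front_log_nonneg front_log_le)
  \<comment> \<open>If \<open>s < lam * t / 2\<close>, then \<open>2 * (s - lam * t)\<close> is
    below \<open>- lam * t\<close>, while \<open>l\<close> and \<open>\<bar>z\<bar>\<close> are at
    most a quarter of \<open>lam * t\<close> each, so \<open>x\<close> is below
    \<open>- lam * t / 2\<close>.\<close>
  have "lam * t / 2 \<le> s \<or> lam * t / 2 \<le> \<bar>x\<bar>"
  proof (rule disjCI)
    assume "\<not> lam * t / 2 \<le> \<bar>x\<bar>"
    then have "- (lam * t / 2) < x" by linarith
    moreover have "- (cut * t) \<le> z" using z by linarith
    moreover have "cut * t \<le> lam / 4 * t" using cut t by (intro mult_right_mono) auto
    ultimately show "lam * t / 2 \<le> s"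
      using l l1 unfolding x_def by (simp add: field_simps)
  qed
  then have hb: "sqrt t * heat s x \<le> (1 / sqrt (pi * lam) + 4 / lam) * exp (- x\<^sup>2 / (4 * t))"
    using s t lam_vel by (intro heat_sup_bound) auto
  \<comment> \<open>The square of a sum is at least half the square of the first term minus the
    square of the second. The first term has square \<open>lam * t * k\<^sup>2\<close>; the second,
    \<open>l - z\<close>, has square at most \<open>4 * t + 2 * \<bar>z\<bar> * t / 5\<close>.
    Division by \<open>4 * t\<close> gives the claim.\<close>
  have ex: "exp (- x\<^sup>2 / (4 * t)) \<le> exp 1 * (exp (- lam * k\<^sup>2 / 8) * exp (\<bar>z\<bar> / 10))"
  proof -
    have xe: "x = 2 * (scl t * k) + (l - z)" by (simp add: x_def s_def)
    have "(2 * (scl t * k))\<^sup>2 = lam * t * k\<^sup>2"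
      using t lam_vel by (simp add: power_mult_distrib scl_def)
    moreover have "(2 * (scl t * k))\<^sup>2 / 2 - (l - z)\<^sup>2 \<le> x\<^sup>2"
    proof -
      have "0 \<le> (2 * (scl t * k) + 2 * (l - z))\<^sup>2" by simp
      then show ?thesis unfolding xe by (simp add: power2_eq_square algebra_simps)
    qed
    moreover have "(l - z)\<^sup>2 \<le> 2 * l\<^sup>2 + 2 * z\<^sup>2"
    proof -
      have "0 \<le> (l + z)\<^sup>2" by simp
      then show ?thesis by (simp add: power2_eq_square algebra_simps)
    qed
    moreover have "l\<^sup>2 \<le> 2 * t"
      using l2 power_mono[OF l(2) l(1), of 2] by linarith
    moreover have "z\<^sup>2 \<le> \<bar>z\<bar> * (t / 5)"
    proof -
      have "cut * t \<le> 1 / 5 * t" using cut t by (intro mult_right_mono) auto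
      then have "\<bar>z\<bar> * \<bar>z\<bar> \<le> \<bar>z\<bar> * (t / 5)" using z by (intro mult_left_mono) auto
      then show ?thesis by (simp add: power2_eq_square)
    qed
    ultimately have "lam * t * k\<^sup>2 / 2 - 4 * t - 2 * (\<bar>z\<bar> * (t / 5)) \<le> x\<^sup>2" by linarith
    then have "(lam * t * k\<^sup>2 / 2 - 4 * t - 2 * (\<bar>z\<bar> * (t / 5))) / (4 * t) \<le> x\<^sup>2 / (4 * t)"
      using t by (intro divide_right_mono) auto
    also have "(lam * t * k\<^sup>2 / 2 - 4 * t - 2 * (\<bar>z\<bar> * (t / 5))) / (4 * t) = lam * k\<^sup>2 / 8 - 1 - \<bar>z\<bar> / 10"
      using t by (simp add: field_simps)
    finally show ?thesis by (simp flip: exp_add)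
  qed
  have "resc t (k, z) = scl t * kern t s z"
    using True by (simp add: resc_def s_def)
  also have "\<dots> \<le> scl t * (weight * (exp (- \<bar>z\<bar> / 5) * heat s x))"
    unfolding x_def l_def using s t scl_pos[of t] by (intro mult_left_mono kern_le) auto
  also have "\<dots> = weight * sqrt (lam / 4) * exp (- \<bar>z\<bar> / 5) * (sqrt t * heat s x)"
    using t by (simp add: scl_def real_sqrt_mult real_sqrt_divide)
  also have "\<dots> \<le> weight * sqrt (lam / 4) * exp (- \<bar>z\<bar> / 5) * ((1 / sqrt (pi * lam) + 4 / lam) * (exp 1 * (exp (- lam * k\<^sup>2 / 8) * exp (\<bar>z\<bar> / 10))))"
    using hb ex lam_vel weight_nonneg
    by (intro mult_left_mono) (auto intro: order_trans[OF hb mult_left_mono])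
  also have "\<dots> = dom_const * (exp (- lam * k\<^sup>2 / 8) * (exp (- \<bar>z\<bar> / 5) * exp (\<bar>z\<bar> / 10)))"
    by (simp add: dom_const_def mult_ac)
  also have "exp (- \<bar>z\<bar> / 5) * exp (\<bar>z\<bar> / 10) = exp (- \<bar>z\<bar> / 10)"
    by (simp flip: exp_add)
  finally show ?thesis .
next
  case False
  then have "resc t (k, z) = 0" by (auto simp: resc_def)
  then show ?thesis using dom_const_nonneg by simp
qed

text \<open>The factor 1/2 is the inverse of the slope 2 in the Gaussian argument; it becomes the
  1/2 in \<open>C1\<close>.\<close>

definition lim_fun :: "real \<times> real \<Rightarrow> real" where
  "lim_fun x = 1 / 2 * (std_normal_density (fst x) * A (fst x)) *
     (Bf (- snd x) * (exp (- (sqrt 2 * gam * snd x)) * (Finf (snd x))\<^sup>2))"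

lemma scl_over: "((\<lambda>t. scl t / t) \<longlongrightarrow> 0) at_top"
proof -
  have "((\<lambda>t::real. sqrt (lam / 4) * (1 / sqrt t)) \<longlongrightarrow> sqrt (lam / 4) * 0) at_top"
    by (intro tendsto_intros) real_asymp
  then have "((\<lambda>t::real. sqrt (lam / 4) * (1 / sqrt t)) \<longlongrightarrow> 0) at_top" by simp
  then show ?thesis
  proof (rule Lim_transform_eventually)
    show "\<forall>\<^sub>F t in at_top. sqrt (lam / 4) * (1 / sqrt t) = scl t / t"
      using eventually_gt_at_top[of 0]
    proof eventually_elim
      case (elim t)
      have "scl t = sqrt (lam / 4) * sqrt t" unfolding scl_def by (subst mult.commute) (rule real_sqrt_mult)
      moreover have "sqrt t / t = 1 / sqrt t" using elim by (simp add: field_simps)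
      ultimately show ?case by (metis times_divide_eq_right)
    qed
  qed
qed

text \<open>For fixed \<open>k\<close> and \<open>z\<close> the logarithm and \<open>z\<close> are
  negligible against \<open>sqrt t\<close>, so the Gaussian argument divided by
  \<open>sqrt t\<close> tends to \<open>sqrt lam * k\<close>, while \<open>t - s t\<close> tends to
  infinity and \<open>F\<close> reaches its limit.\<close>

lemma resc_tendsto: "((\<lambda>t. resc t (k, z)) \<longlongrightarrow> lim_fun (k, z)) at_top"
proof -
  define s where "s t = lam * t + scl t * k" for t
  define x where "x t = 2 * (s t - lam * t) + front_log (t - s t) - z" for t
  have s_t: "((\<lambda>t. s t / t) \<longlongrightarrow> lam) at_top"
  proof -
    have "((\<lambda>t. lam + scl t / t * k) \<longlongrightarrow> lam + 0 * k) at_top"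
      by (intro tendsto_intros scl_over)
    then have "((\<lambda>t. lam + scl t / t * k) \<longlongrightarrow> lam) at_top" by simp
    then show ?thesis
    proof (rule Lim_transform_eventually)
      show "\<forall>\<^sub>F t in at_top. lam + scl t / t * k = s t / t"
        using eventually_gt_at_top[of 0] by eventually_elim (simp add: s_def field_simps)
    qed
  qed
  have r_t: "((\<lambda>t. (t - s t) / t) \<longlongrightarrow> vel) at_top"
  proof -
    have "((\<lambda>t. 1 - s t / t) \<longlongrightarrow> 1 - lam) at_top" by (intro tendsto_intros s_t)
    moreover have "1 - lam = vel" using lam_vel by simp
    ultimately have "((\<lambda>t. 1 - s t / t) \<longlongrightarrow> vel) at_top" by simp
    then show ?thesis
    proof (rule Lim_transform_eventually)
      show "\<forall>\<^sub>F t in at_top. 1 - s t / t = (t - s t) / t"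
        using eventually_gt_at_top[of 0] by eventually_elim (simp add: field_simps)
    qed
  qed
  have r_top: "filterlim (\<lambda>t. t - s t) at_top at_top"
  proof -
    have "filterlim (\<lambda>t. (t - s t) / t * t) at_top at_top"
      by (rule filterlim_tendsto_pos_mult_at_top[OF r_t]) (use lam_vel in \<open>auto intro: filterlim_ident\<close>)
    moreover have "\<forall>\<^sub>F t in at_top. (t - s t) / t * t = t - s t"
      using eventually_gt_at_top[of 0] by eventually_elim simp
    ultimately show ?thesis
      using filterlim_cong[of at_top at_top at_top at_top "\<lambda>t. (t - s t) / t * t" "\<lambda>t. t - s t"] by simp
  qed
  have r1: "\<forall>\<^sub>F t in at_top. 1 \<le> t - s t"
    using r_top by (simp add: filterlim_at_top)
  have s_pos: "\<forall>\<^sub>F t in at_top. 0 < s t"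
  proof -
    have "\<forall>\<^sub>F t in at_top. 0 < s t / t" by (rule order_tendstoD(1)[OF s_t]) (use lam_vel in simp)
    then show ?thesis using eventually_gt_at_top[of 0] by eventually_elim (simp add: zero_less_divide_iff)
  qed
  have z_in: "\<forall>\<^sub>F t in at_top. \<bar>z\<bar> \<le> cut * t"
    using eventually_ge_at_top[of "\<bar>z\<bar> / cut"] by eventually_elim (use cut in \<open>simp add: field_simps\<close>)
  have ell: "((\<lambda>t. front_log (t - s t) / sqrt t) \<longlongrightarrow> 0) at_top"
  proof (rule tendsto_sandwich[where f = "\<lambda>_. 0" and h = "\<lambda>t. 2 * ln t / sqrt t"])
    show "((\<lambda>t::real. 2 * ln t / sqrt t) \<longlongrightarrow> 0) at_top" by real_asymp
    show "\<forall>\<^sub>F t in at_top. 0 \<le> front_log (t - s t) / sqrt t"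
      using eventually_gt_at_top[of 0] by eventually_elim (simp add: front_log_nonneg)
    show "\<forall>\<^sub>F t in at_top. front_log (t - s t) / sqrt t \<le> 2 * ln t / sqrt t"
      using s_pos eventually_ge_at_top[of 1]
      by eventually_elim (intro divide_right_mono front_log_le, auto)
  qed simp
  have x_t: "((\<lambda>t. x t / sqrt t) \<longlongrightarrow> sqrt lam * k) at_top"
  proof -
    have "((\<lambda>t::real. sqrt lam * k + front_log (t - s t) / sqrt t - z * (1 / sqrt t)) \<longlongrightarrow> sqrt lam * k + 0 - z * 0) at_top"
      by (intro tendsto_intros ell) real_asymp
    then have "((\<lambda>t::real. sqrt lam * k + front_log (t - s t) / sqrt t - z * (1 / sqrt t)) \<longlongrightarrow> sqrt lam * k) at_top" by simp
    then show ?thesis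
    proof (rule Lim_transform_eventually)
      show "\<forall>\<^sub>F t in at_top. sqrt lam * k + front_log (t - s t) / sqrt t - z * (1 / sqrt t) = x t / sqrt t"
        using eventually_gt_at_top[of 0]
      proof eventually_elim
        case (elim t)
        have "2 * scl t = sqrt lam * sqrt t" by (simp add: scl_def real_sqrt_mult real_sqrt_divide mult.commute)
        then have "2 * (s t - lam * t) = sqrt lam * k * sqrt t" by (simp add: s_def algebra_simps)
        then have "x t = sqrt lam * k * sqrt t + front_log (t - s t) - z" by (simp add: x_def)
        then show ?case using elim by (simp add: add_divide_distrib diff_divide_distrib)
      qed
    qed
  qed
  have heat_lim: "((\<lambda>t. scl t * heat (s t) (x t)) \<longlongrightarrow> 1 / 2 * std_normal_density k) at_top"
  proof -
    have "((\<lambda>t. sqrt (lam / 4) * (1 / sqrt (2 * pi * (s t / t))) * exp (- ((x t / sqrt t)\<^sup>2 / (2 * (s t / t)))))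
       \<longlongrightarrow> sqrt (lam / 4) * (1 / sqrt (2 * pi * lam)) * exp (- ((sqrt lam * k)\<^sup>2 / (2 * lam)))) at_top"
      using lam_vel by (intro tendsto_intros s_t x_t) auto
    also have "sqrt (lam / 4) * (1 / sqrt (2 * pi * lam)) * exp (- ((sqrt lam * k)\<^sup>2 / (2 * lam))) = 1 / 2 * std_normal_density k"
      using lam_vel by (simp add: std_normal_density_def power_mult_distrib real_sqrt_mult real_sqrt_divide)
    finally show ?thesis
    proof (rule Lim_transform_eventually)
      show "\<forall>\<^sub>F t in at_top. sqrt (lam / 4) * (1 / sqrt (2 * pi * (s t / t))) * exp (- ((x t / sqrt t)\<^sup>2 / (2 * (s t / t)))) =
        scl t * heat (s t) (x t)"
        using eventually_gt_at_top[of 0] s_pos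
      proof eventually_elim
        case (elim t)
        then have "sqrt (lam / 4) * (1 / sqrt (2 * pi * (s t / t))) = scl t * (1 / sqrt (2 * pi * s t))"
          by (simp add: scl_def real_sqrt_mult real_sqrt_divide)
        moreover have "(x t / sqrt t)\<^sup>2 / (2 * (s t / t)) = (x t)\<^sup>2 / (2 * s t)"
          using elim by (simp add: power_divide)
        ultimately show ?case using elim by (simp add: normal_density_def)
      qed
    qed
  qed
  have pw: "((\<lambda>t. (max (t - s t) 1 / (vel * t)) powr (3 * gam / 2)) \<longlongrightarrow> 1) at_top"
  proof -
    have "((\<lambda>t. ((t - s t) / t / vel) powr (3 * gam / 2)) \<longlongrightarrow> (vel / vel) powr (3 * gam / 2)) at_top"
      using lam_vel by (intro tendsto_intros r_t) auto
    also have "(vel / vel) powr (3 * gam / 2) = 1" using lam_vel by simp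
    finally show ?thesis
      by (rule Lim_transform_eventually) (use r1 in \<open>eventually_elim, auto simp: max_def mult.commute\<close>)
  qed
  have Fl: "((\<lambda>t. F (t - s t) z) \<longlongrightarrow> Finf z) at_top"
    by (rule filterlim_compose[OF F_lim r_top])
  have "((\<lambda>t. (max (t - s t) 1 / (vel * t)) powr (3 * gam / 2) * (exp (- (sqrt 2 * gam * z)) * (scl t * heat (s t) (x t))) *
      (A k * Bf (- z) * (F (t - s t) z)\<^sup>2)) \<longlongrightarrow>
      1 * (exp (- (sqrt 2 * gam * z)) * (1 / 2 * std_normal_density k)) * (A k * Bf (- z) * (Finf z)\<^sup>2)) at_top"
    by (intro tendsto_intros pw heat_lim Fl)
  also have "1 * (exp (- (sqrt 2 * gam * z)) * (1 / 2 * std_normal_density k)) * (A k * Bf (- z) * (Finf z)\<^sup>2) = lim_fun (k, z)"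
    by (simp add: lim_fun_def mult_ac)
  finally show ?thesis
  proof (rule Lim_transform_eventually)
    show "\<forall>\<^sub>F t in at_top. (max (t - s t) 1 / (vel * t)) powr (3 * gam / 2) * (exp (- (sqrt 2 * gam * z)) * (scl t * heat (s t) (x t))) *
      (A k * Bf (- z) * (F (t - s t) z)\<^sup>2) = resc t (k, z)"
      using s_pos r1 z_in eventually_gt_at_top[of 0]
    proof eventually_elim
      case (elim t)
      have "(s t - lam * t) / scl t = k" using scl_pos[OF elim(4)] by (simp add: s_def)
      moreover have "centering (t - s t) = front (t - s t)" using elim by (simp add: front_centering)
      moreover have "s t \<in> {0<..<t}" using elim by auto
      ultimately show ?case
        using elim unfolding resc_def fst_conv snd_conv s_def[of t, symmetric] kern_def
        by (simp add: x_def mult_ac)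
    qed
  qed
qed

lemma Finf: "0 \<le> Finf z" "Finf z \<le> 1"
  by (rule tendsto_lowerbound[OF F_lim] tendsto_upperbound[OF F_lim], simp_all add: F)+

lemma Finf_measurable [measurable]: "Finf \<in> borel_measurable borel"
proof (rule borel_measurable_LIMSEQ_real)
  show "(\<lambda>n. F (real n) z) \<longlonglongrightarrow> Finf z" for z
    by (rule filterlim_compose[OF F_lim filterlim_real_sequentially])
qed measurable

text \<open>Dominated convergence treats the part with \<open>\<bar>z\<bar> \<le> cut * t\<close>,
  along arbitrary sequences tending to infinity; the rest is exponentially small by
  \<open>kern_tail\<close>.\<close>

theorem laplace_limit_pair:
  "((\<lambda>t. branch_int t / ennreal (main_rate \<alpha> t)) \<longlongrightarrow> (\<integral>\<^sup>+x. ennreal (lim_fun x) \<partial>(lborel \<Otimes>\<^sub>M lborel))) at_top"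
proof -
  have m1: "((\<lambda>t. \<integral>\<^sup>+x. ennreal (resc t x) \<partial>(lborel \<Otimes>\<^sub>M lborel)) \<longlongrightarrow> (\<integral>\<^sup>+x. ennreal (lim_fun x) \<partial>(lborel \<Otimes>\<^sub>M lborel))) at_top"
  proof (rule tendsto_at_topI_sequentially)
    fix X :: "nat \<Rightarrow> real" assume X: "filterlim X at_top sequentially"
    define w where "w x = dom_const * (exp (- lam * (fst x)\<^sup>2 / 8) * exp (- \<bar>snd x\<bar> / 10))" for x :: "real \<times> real"
    have "\<forall>\<^sub>F t in at_top. \<forall>k z. resc t (k, z) \<le> w (k, z)"
    proof -
      have "((\<lambda>t::real. ln t / t) \<longlongrightarrow> 0) at_top" by real_asymp
      then have "\<forall>\<^sub>F t in at_top. ln t / t < lam / 8" by (rule order_tendstoD(2)) (use lam_vel in simp)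
      moreover have "\<forall>\<^sub>F t::real in at_top. (2 * ln t)\<^sup>2 \<le> 2 * t" by real_asymp
      ultimately show ?thesis
        using eventually_ge_at_top[of 1]
      proof eventually_elim
        case (elim t)
        have "2 * ln t \<le> lam / 4 * t" using elim by (simp add: field_simps)
        then show ?case using resc_le[OF elim(3) _ elim(2)] by (simp add: w_def)
      qed
    qed
    then have "\<forall>\<^sub>F n in sequentially. \<forall>k z. resc (X n) (k, z) \<le> w (k, z)"
      by (rule eventually_compose_filterlim[OF _ X])
    then obtain n0 where n0: "\<And>n k z. n0 \<le> n \<Longrightarrow> resc (X n) (k, z) \<le> w (k, z)"
      unfolding eventually_sequentially by blast
    have wfin: "(\<integral>\<^sup>+x. ennreal (w x) \<partial>(lborel \<Otimes>\<^sub>M lborel)) < \<infinity>"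
    proof -
      have g: "(\<integral>\<^sup>+k. ennreal (exp (- lam * k\<^sup>2 / 8)) \<partial>lborel) = ennreal (sqrt (8 * pi / lam))"
      proof -
        define \<sigma> where "\<sigma> = sqrt (4 / lam)"
        have \<sigma>: "0 < \<sigma>" "\<sigma>\<^sup>2 = 4 / lam" using lam_vel by (auto simp: \<sigma>_def)
        have e: "exp (- lam * k\<^sup>2 / 8) = sqrt (8 * pi / lam) * normal_density 0 \<sigma> k" for k
        proof -
          have "2 * pi * \<sigma>\<^sup>2 = 8 * pi / lam" by (simp add: \<sigma>)
          moreover have "- (k - 0)\<^sup>2 / (2 * \<sigma>\<^sup>2) = - lam * k\<^sup>2 / 8" using lam_vel by (simp add: \<sigma>)
          moreover have "0 < 8 * pi / lam" using lam_vel by simp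
          ultimately show ?thesis
            unfolding normal_density_def using lam_vel by (simp only:) simp
        qed
        show ?thesis
          unfolding e using \<sigma> lam_vel
          by (simp add: ennreal_mult nn_integral_cmult nn_integral_normal_density)
      qed
      have "(\<integral>\<^sup>+x. ennreal (w x) \<partial>(lborel \<Otimes>\<^sub>M lborel)) = (\<integral>\<^sup>+k. \<integral>\<^sup>+z. ennreal (w (k, z)) \<partial>lborel \<partial>lborel)"
        by (rule lborel.nn_integral_fst[symmetric]) (simp add: w_def)
      also have "\<dots> = (\<integral>\<^sup>+k. ennreal dom_const * (ennreal (exp (- lam * k\<^sup>2 / 8)) * (\<integral>\<^sup>+z. ennreal (exp (- \<bar>z\<bar> / 10)) \<partial>lborel)) \<partial>lborel)"
        by (rule nn_integral_cong)
          (simp add: w_def ennreal_mult' dom_const_nonneg nn_integral_cmult mult.assoc[symmetric] del: times_divide_eq_left)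
      also have "\<dots> = ennreal dom_const * (ennreal (sqrt (8 * pi / lam)) * (\<integral>\<^sup>+z. ennreal (exp (- \<bar>z\<bar> / 10)) \<partial>lborel))"
        by (simp add: nn_integral_cmult nn_integral_multc g[simplified])
      also have "\<dots> < \<infinity>"
        using nn_integral_exp_abs by (simp add: ennreal_mult_less_top)
      finally show ?thesis .
    qed
    \<comment> \<open>The domination holds only from \<open>n0\<close> on, so the sequence is
      shifted.\<close>
    have "(\<lambda>n. \<integral>\<^sup>+x. ennreal (resc (X (n + n0)) x) \<partial>(lborel \<Otimes>\<^sub>M lborel)) \<longlonglongrightarrow> (\<integral>\<^sup>+x. ennreal (lim_fun x) \<partial>(lborel \<Otimes>\<^sub>M lborel))"
    proof (rule nn_integral_dominated_convergence[where w = "\<lambda>x. ennreal (w x)"])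
      show "AE x in lborel \<Otimes>\<^sub>M lborel. ennreal (resc (X (j + n0)) x) \<le> ennreal (w x)" for j
        using n0[of "j + n0"] by (intro AE_I2) (auto intro: ennreal_leI)
      show "AE x in lborel \<Otimes>\<^sub>M lborel. (\<lambda>i. ennreal (resc (X (i + n0)) x)) \<longlonglongrightarrow> ennreal (lim_fun x)"
      proof (rule AE_I2)
        fix x :: "real \<times> real"
        have "(\<lambda>i. resc (X i) (fst x, snd x)) \<longlonglongrightarrow> lim_fun (fst x, snd x)"
          by (rule filterlim_compose[OF resc_tendsto X])
        then show "(\<lambda>i. ennreal (resc (X (i + n0)) x)) \<longlonglongrightarrow> ennreal (lim_fun x)"
          by (intro tendsto_ennrealI LIMSEQ_ignore_initial_segment) simp
      qed
    qed (use wfin in \<open>simp_all add: w_def lim_fun_def\<close>)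
    then show "(\<lambda>n. \<integral>\<^sup>+x. ennreal (resc (X n) x) \<partial>(lborel \<Otimes>\<^sub>M lborel)) \<longlonglongrightarrow> (\<integral>\<^sup>+x. ennreal (lim_fun x) \<partial>(lborel \<Otimes>\<^sub>M lborel))"
      by (rule LIMSEQ_offset)
  qed
  have m2: "((\<lambda>t. \<integral>\<^sup>+s. indicator {0<..<t} s * (\<integral>\<^sup>+z. indicator {z. cut * t < \<bar>z\<bar>} z * ennreal (kern t s z) \<partial>lborel) \<partial>lborel) \<longlongrightarrow> 0) at_top"
  proof (rule tendsto_sandwich[OF _ _ tendsto_const])
    have "((\<lambda>t. weight * exp (- (cut * t) / 5) * t) \<longlongrightarrow> 0) at_top"
    proof -
      have "((\<lambda>u::real. exp (- u / 5) * u) \<longlongrightarrow> 0) at_top" by real_asymp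
      moreover have "filterlim (\<lambda>t. cut * t) at_top at_top"
        using cut(1) by (intro filterlim_tendsto_pos_mult_at_top[OF tendsto_const _ filterlim_ident])
      ultimately have "((\<lambda>t. exp (- (cut * t) / 5) * (cut * t)) \<longlongrightarrow> 0) at_top"
        by (rule filterlim_compose)
      then have "((\<lambda>t. weight / cut * (exp (- (cut * t) / 5) * (cut * t))) \<longlongrightarrow> weight / cut * 0) at_top"
        by (intro tendsto_intros)
      then show ?thesis using cut(1) by (simp add: field_simps)
    qed
    from tendsto_ennrealI[OF this]
    show "((\<lambda>t. ennreal (weight * exp (- (cut * t) / 5) * t)) \<longlongrightarrow> 0) at_top" by simp
    show "\<forall>\<^sub>F t in at_top. (\<integral>\<^sup>+s. indicator {0<..<t} s * (\<integral>\<^sup>+z. indicator {z. cut * t < \<bar>z\<bar>} z * ennreal (kern t s z) \<partial>lborel) \<partial>lborel)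
       \<le> ennreal (weight * exp (- (cut * t) / 5) * t)"
      using eventually_ge_at_top[of 1] by eventually_elim (rule kern_tail, use cut in auto)
  qed auto
  have "((\<lambda>t. (\<integral>\<^sup>+x. ennreal (resc t x) \<partial>(lborel \<Otimes>\<^sub>M lborel)) +
     (\<integral>\<^sup>+s. indicator {0<..<t} s * (\<integral>\<^sup>+z. indicator {z. cut * t < \<bar>z\<bar>} z * ennreal (kern t s z) \<partial>lborel) \<partial>lborel))
     \<longlongrightarrow> (\<integral>\<^sup>+x. ennreal (lim_fun x) \<partial>(lborel \<Otimes>\<^sub>M lborel)) + 0) at_top"
    by (intro tendsto_intros m1 m2)
  then have "((\<lambda>t. (\<integral>\<^sup>+x. ennreal (resc t x) \<partial>(lborel \<Otimes>\<^sub>M lborel)) +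
     (\<integral>\<^sup>+s. indicator {0<..<t} s * (\<integral>\<^sup>+z. indicator {z. cut * t < \<bar>z\<bar>} z * ennreal (kern t s z) \<partial>lborel) \<partial>lborel))
     \<longlongrightarrow> (\<integral>\<^sup>+x. ennreal (lim_fun x) \<partial>(lborel \<Otimes>\<^sub>M lborel))) at_top" by simp
  then show ?thesis
  proof (rule Lim_transform_eventually)
    show "\<forall>\<^sub>F t in at_top. (\<integral>\<^sup>+x. ennreal (resc t x) \<partial>(lborel \<Otimes>\<^sub>M lborel)) +
     (\<integral>\<^sup>+s. indicator {0<..<t} s * (\<integral>\<^sup>+z. indicator {z. cut * t < \<bar>z\<bar>} z * ennreal (kern t s z) \<partial>lborel) \<partial>lborel) =
     branch_int t / ennreal (main_rate \<alpha> t)"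
      using eventually_ge_at_top[of 1]
    proof eventually_elim
      case (elim t)
      have "0 < main_rate \<alpha> t" using elim lam_vel by (simp add: main_rate_vel)
      then show ?case
        using elim by (simp add: branch_int_eq kern_integral_split[symmetric] ennreal_mult_divide_eq mult.commute[of "ennreal (main_rate \<alpha> t)"])
    qed
  qed
qed

end

section \<open>The maximum and the McKean functionals\<close>

lemma birth_snoc: "birth T (u @ [b]) \<omega> = birth T u \<omega> + T u \<omega>"
  by (simp add: birth_def)

text \<open>Among the finitely many words born by time \<open>t\<close>, a longest one has no child
  born by then, so it is still alive.\<close>

lemma alive_nonempty:
  assumes pos: "\<And>u. 0 < T u \<omega>" and fin: "finite {u. birth T u \<omega> \<le> t}" and t: "0 \<le> t"
  shows "alive T t \<omega> \<noteq> {}"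
proof -
  let ?S = "{u. birth T u \<omega> \<le> t}"
  have "[] \<in> ?S" using t by simp
  then have ne: "length ` ?S \<noteq> {}" by blast
  have f: "finite (length ` ?S)" using fin by simp
  have "Max (length ` ?S) \<in> length ` ?S" by (rule Max_in[OF f ne])
  then obtain u where u: "birth T u \<omega> \<le> t" "length u = Max (length ` ?S)" by auto
  have "\<not> birth T (u @ [True]) \<omega> \<le> t"
  proof
    assume "birth T (u @ [True]) \<omega> \<le> t"
    then have "length (u @ [True]) \<in> length ` ?S" by (intro imageI) simp
    then have "length (u @ [True]) \<le> Max (length ` ?S)" by (rule Max_ge[OF f])
    then show False using u by simp
  qed
  then have "u \<in> alive T t \<omega>" using u by (simp add: alive_def birth_snoc)
  then show ?thesis by blast
qed

text \<open>For a set closed downwards, the maximum belongs to it exactly when all particles do, so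
  its indicator is a product over particles. \<open>UNIV\<close> is the case without
  constraint.\<close>

definition down_set :: "real set \<Rightarrow> bool" where
  "down_set S \<longleftrightarrow> (\<forall>x\<in>S. \<forall>y\<le>x. y \<in> S)"

lemma down_set_simps [simp]: "down_set UNIV" "down_set {..q}"
  by (auto simp: down_set_def)

definition test_g :: "real set \<Rightarrow> (real \<Rightarrow> real) \<Rightarrow> real \<Rightarrow> ennreal" where
  "test_g S \<phi> x = ennreal (indicator S x * exp (- \<phi> x))"

lemma test_g_measurable:
  assumes [measurable]: "S \<in> sets borel" "\<phi> \<in> borel_measurable borel"
  shows "test_g S \<phi> \<in> borel_measurable borel"
  unfolding test_g_def by measurable

lemma ennreal_prod_mono:
  fixes f g :: "'i \<Rightarrow> ennreal"
  shows "(\<And>i. i \<in> A \<Longrightarrow> f i \<le> g i) \<Longrightarrow> prod f A \<le> prod g A"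
  by (induction A rule: infinite_finite_induct) (auto intro: mult_mono)

text \<open>It bounds how much the distribution function of the maximum can grow over a step
  \<open>h\<close> on the event that a branching has occurred, uniformly in time and level.\<close>

definition heat_modulus :: "real \<Rightarrow> ennreal" where
  "heat_modulus h = (\<integral>\<^sup>+s. ennreal (exponential_density 1 s) *
     (\<integral>\<^sup>+y. ennreal (max 0 (heat s y - heat s (y - h))) \<partial>lborel) \<partial>lborel)"

context
  fixes P :: "'a measure" and T B
  assumes bbm: "binary_bbm P T B"
begin

lemma alive_bbm:
  assumes "\<omega> \<in> space P"
  shows "finite (alive T t \<omega>)" "0 \<le> t \<Longrightarrow> alive T t \<omega> \<noteq> {}"
  using alive_nonempty[of T \<omega> t] finite_alive[of T \<omega> t] assms bbm_pos[OF bbm] bbm_fin[OF bbm] by auto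

lemma max_position_in:
  assumes "\<omega> \<in> space P" "0 \<le> t"
  obtains u where "u \<in> alive T t \<omega>" "max_position T B t \<omega> = position T B u t \<omega>"
proof -
  have "max_position T B t \<omega> \<in> (\<lambda>u. position T B u t \<omega>) ` alive T t \<omega>"
    unfolding max_position_def using alive_bbm[OF assms(1), of t] assms(2) by (intro Max_in) auto
  then show ?thesis using that by blast
qed

lemma max_position_ge:
  assumes "\<omega> \<in> space P" "u \<in> alive T t \<omega>"
  shows "position T B u t \<omega> \<le> max_position T B t \<omega>"
  unfolding max_position_def using alive_bbm[OF assms(1), of t] assms(2) by (intro Max_ge) auto

lemma max_position_down:
  assumes "\<omega> \<in> space P" "0 \<le> t" "down_set S"
  shows "max_position T B t \<omega> - c \<in> S \<longleftrightarrow> (\<forall>u\<in>alive T t \<omega>. position T B u t \<omega> - c \<in> S)"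
proof -
  obtain v where v: "v \<in> alive T t \<omega>" "max_position T B t \<omega> = position T B v t \<omega>"
    using max_position_in[OF assms(1,2)] by blast
  show ?thesis
  proof
    assume *: "max_position T B t \<omega> - c \<in> S"
    show "\<forall>u\<in>alive T t \<omega>. position T B u t \<omega> - c \<in> S"
    proof
      fix u assume "u \<in> alive T t \<omega>"
      then have "position T B u t \<omega> - c \<le> max_position T B t \<omega> - c"
        using max_position_ge[OF assms(1)] by simp
      then show "position T B u t \<omega> - c \<in> S" using * assms(3) by (auto simp: down_set_def)
    qed
  qed (use v in auto)
qed

lemma tree_prod_test_g:
  assumes "\<omega> \<in> space P" "0 \<le> t" "down_set S"
  shows "tree_prod (test_g S \<phi>) T B t c \<omega> =
    ennreal (indicator S (max_position T B t \<omega> - c) * exp (- point_integral (particles T B t c \<omega>) \<phi>))"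
proof -
  note fin = alive_bbm(1)[OF assms(1), of t]
  have "tree_prod (test_g S \<phi>) T B t c \<omega> =
     ennreal (\<Prod>u\<in>alive T t \<omega>. indicator S (position T B u t \<omega> - c) * exp (- \<phi> (position T B u t \<omega> - c)))"
    unfolding tree_prod_def test_g_def by (rule prod_ennreal) auto
  also have "(\<Prod>u\<in>alive T t \<omega>. indicator S (position T B u t \<omega> - c) * exp (- \<phi> (position T B u t \<omega> - c))) =
     (\<Prod>u\<in>alive T t \<omega>. indicator S (position T B u t \<omega> - c)) * exp (- (\<Sum>u\<in>alive T t \<omega>. \<phi> (position T B u t \<omega> - c)))"
    by (simp add: prod.distrib exp_sum[OF fin] flip: sum_negf)
  also have "(\<Prod>u\<in>alive T t \<omega>. indicator S (position T B u t \<omega> - c)) = (indicator S (max_position T B t \<omega> - c) :: real)"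
  proof (cases "max_position T B t \<omega> - c \<in> S")
    case True
    then show ?thesis using max_position_down[OF assms, of c] by simp
  next
    case False
    then show ?thesis using max_position_down[OF assms, of c] fin by (auto simp: prod_zero_iff indicator_eq_0_iff)
  qed
  also have "(\<Sum>u\<in>alive T t \<omega>. \<phi> (position T B u t \<omega> - c)) = point_integral (particles T B t c \<omega>) \<phi>"
    unfolding particles_def by (rule point_integral_sum[OF fin, symmetric])
  finally show ?thesis .
qed

text \<open>At time \<open>T []\<close> both children are already alive, and before it only the root
  is, so the infimum is attained.\<close>

lemma first_branching_eq:
  assumes \<omega>: "\<omega> \<in> space P"
  shows "first_branching T \<omega> = T [] \<omega>"
  unfolding first_branching_def
proof (rule cInf_eq_minimum)
  have p: "0 < T u \<omega>" for u using bbm_pos[OF bbm \<omega>] .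
  have "{[False], [True]} \<subseteq> alive T (T [] \<omega>) \<omega>"
    using p by (auto simp: alive_def birth_def)
  from card_mono[OF alive_bbm(1)[OF \<omega>] this]
  show "T [] \<omega> \<in> {t. 0 \<le> t \<and> 2 \<le> card (alive T t \<omega>)}"
    using less_imp_le[OF p] by simp
next
  fix t assume t: "t \<in> {t. 0 \<le> t \<and> 2 \<le> card (alive T t \<omega>)}"
  show "T [] \<omega> \<le> t"
  proof (rule ccontr)
    assume "\<not> T [] \<omega> \<le> t"
    then have "alive T t \<omega> = {[]}" using t bbm_pos[OF bbm \<omega>] by (intro alive_early) auto
    then show False using t by simp
  qed
qed

lemma position_first_branching:
  assumes \<omega>: "\<omega> \<in> space P"
  shows "position T B [] (first_branching T \<omega>) \<omega> = B [] (T [] \<omega>) \<omega>"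
  using less_imp_le[OF bbm_pos[OF bbm \<omega>, of "[]"]] by (simp add: first_branching_eq[OF \<omega>] position_def)

lemma measurable_tree_prod_fixed:
  "g \<in> borel_measurable borel \<Longrightarrow> tree_prod g T B t c \<in> borel_measurable P"
  using measurable_compose[OF _ measurable_tree_prod_bbm[OF bbm], of "\<lambda>\<omega>. (t, c, \<omega>)" P g] by simp

text \<open>The integral of \<open>\<phi>\<close> is recovered as minus the logarithm of a
  multiplicative functional, whose measurability is known.\<close>

lemma measurable_particles:
  assumes t: "0 \<le> t"
  shows "particles T B t c \<in> P \<rightarrow>\<^sub>M borel"
proof (rule measurable_point_measureI)
  fix \<phi> :: "real \<Rightarrow> real" assume \<phi>: "test_fun \<phi>"
  have "(\<lambda>\<omega>. - ln (enn2real (tree_prod (test_g UNIV \<phi>) T B t c \<omega>))) \<in> borel_measurable P"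
    by (intro borel_measurable_uminus borel_measurable_ln borel_measurable_enn2real measurable_tree_prod_fixed test_g_measurable
        test_fun_measurable \<phi>) auto
  then show "(\<lambda>\<omega>. point_integral (particles T B t c \<omega>) \<phi>) \<in> borel_measurable P"
    by (rule measurable_cong[THEN iffD1, rotated]) (simp add: tree_prod_test_g t)
qed

lemma measurable_max_position:
  assumes t: "0 \<le> t"
  shows "max_position T B t \<in> borel_measurable P"
  unfolding borel_measurable_iff_le
proof
  fix a
  have "{\<omega> \<in> space P. max_position T B t \<omega> \<le> a} = {\<omega> \<in> space P. tree_prod (test_g {..0} (\<lambda>_. 0)) T B t a \<omega> = 1}"
  proof (rule Collect_cong, rule conj_cong[OF refl])
    fix \<omega> assume "\<omega> \<in> space P"
    then show "max_position T B t \<omega> \<le> a \<longleftrightarrow> tree_prod (test_g {..0} (\<lambda>_. 0)) T B t a \<omega> = 1"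
      using tree_prod_test_g[of \<omega> t "{..0}" "\<lambda>_. 0" a] t
      by (auto simp: point_integral_def indicator_def)
  qed
  also have "\<dots> \<in> sets P"
  proof -
    have [measurable]: "tree_prod (test_g {..0} (\<lambda>_. 0)) T B t a \<in> borel_measurable P"
      by (rule measurable_tree_prod_fixed[OF test_g_measurable]) auto
    show ?thesis by measurable
  qed
  finally show "{\<omega> \<in> space P. max_position T B t \<omega> \<le> a} \<in> sets P" .
qed

lemma measurable_B_T: "(\<lambda>\<omega>. B [] (T [] \<omega>) \<omega>) \<in> borel_measurable P"
proof -
  have "(\<lambda>\<omega>. canon_B [] (canon_T [] (\<lambda>u. mark T B u \<omega>)) (\<lambda>u. mark T B u \<omega>)) \<in> borel_measurable P"
  proof -
    have "(\<lambda>z. canon_B [] (canon_T [] z) z) \<in> borel_measurable tree_space"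
      using measurable_compose[OF _ measurable_canon_B, of "\<lambda>z. (canon_T [] z, z)" tree_space] by simp
    from measurable_compose[OF tree_measurable[OF bbm] this] show ?thesis .
  qed
  then show ?thesis
    by (rule measurable_cong[THEN iffD1, rotated]) (simp add: canon_bbm[OF bbm] less_imp_le[OF bbm_pos[OF bbm]])
qed

text \<open>The expectation is split according to whether the root has branched by time
  \<open>t\<close>. For the distribution function of the maximum this is the integrated F-KPP
  equation.\<close>

lemma mckean_equation:
  assumes g: "g \<in> borel_measurable borel" and t: "0 < t"
  shows "mckean g P T B t c = ennreal (exp (- t)) * (\<integral>\<^sup>+y. ennreal (heat t y) * g (y - c) \<partial>lborel) +
    (\<integral>\<^sup>+s. ennreal (exponential_density 1 s) * (\<integral>\<^sup>+y. ennreal (heat s y) *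
      (indicator {..t} s * (mckean g P T B (t - s) (c - y))\<^sup>2) \<partial>lborel) \<partial>lborel)"
proof -
  note [measurable] = measurable_tree_prod_fixed[OF g] bbm_T_measurable[OF bbm]
  have "mckean g P T B t c = (\<integral>\<^sup>+\<omega>. indicator {t<..} (T [] \<omega>) * tree_prod g T B t c \<omega> +
      1 * indicator {..t} (T [] \<omega>) * tree_prod g T B t c \<omega> \<partial>P)"
    unfolding mckean_def by (rule nn_integral_cong) (auto split: split_indicator)
  also have "\<dots> = (\<integral>\<^sup>+\<omega>. indicator {t<..} (T [] \<omega>) * tree_prod g T B t c \<omega> \<partial>P) +
    (\<integral>\<^sup>+\<omega>. 1 * indicator {..t} (T [] \<omega>) * tree_prod g T B t c \<omega> \<partial>P)"
    by (rule nn_integral_add) measurable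
  also have "(\<integral>\<^sup>+\<omega>. indicator {t<..} (T [] \<omega>) * tree_prod g T B t c \<omega> \<partial>P) =
      ennreal (exp (- t)) * (\<integral>\<^sup>+y. ennreal (heat t y) * g (y - c) \<partial>lborel)"
    by (rule no_branching[OF bbm g t])
  also have "(\<integral>\<^sup>+\<omega>. 1 * indicator {..t} (T [] \<omega>) * tree_prod g T B t c \<omega> \<partial>P) =
    (\<integral>\<^sup>+s. ennreal (exponential_density 1 s) * (\<integral>\<^sup>+y. ennreal (heat s y) *
      (indicator {..t} s * (mckean g P T B (t - s) (c - y))\<^sup>2) \<partial>lborel) \<partial>lborel)"
    using branching_decomposition[OF bbm g, of "\<lambda>_. 1" t c] by simp
  finally show ?thesis .
qed

section \<open>The distribution function of the maximum\<close>

definition cdf_max :: "real \<Rightarrow> real \<Rightarrow> ennreal" where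
  "cdf_max t c = mckean (test_g {..0} (\<lambda>_. 0)) P T B t c"

lemma test_g_le_1: "(\<And>x. 0 \<le> \<phi> x) \<Longrightarrow> test_g S \<phi> x \<le> 1"
  by (auto simp: test_g_def indicator_def)

lemma tree_prod_le_1: "(\<And>x. g x \<le> 1) \<Longrightarrow> tree_prod g T B t c \<omega> \<le> 1"
  unfolding tree_prod_def by (rule prod_le_1) auto

lemma mckean_le_1: "(\<And>x. g x \<le> 1) \<Longrightarrow> mckean g P T B t c \<le> 1"
proof -
  assume "\<And>x. g x \<le> 1"
  then have "mckean g P T B t c \<le> (\<integral>\<^sup>+\<omega>. 1 \<partial>P)"
    unfolding mckean_def by (intro nn_integral_mono tree_prod_le_1)
  then show ?thesis using prob_space.emeasure_space_1[OF bbm_prob[OF bbm]] by simp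
qed

lemma mckean_mono: "(\<And>x. g x \<le> g' x) \<Longrightarrow> mckean g P T B t c \<le> mckean g' P T B t c"
  unfolding mckean_def tree_prod_def by (intro nn_integral_mono ennreal_prod_mono) auto

lemma cdf_max_kpp: "kpp_subsolution cdf_max"
  unfolding kpp_subsolution_def
proof (intro conjI allI impI)
  have g: "test_g {..0} (\<lambda>_. 0) \<in> borel_measurable borel" by (rule test_g_measurable) auto
  show "(\<lambda>(t, c). cdf_max t c) \<in> borel_measurable (borel \<Otimes>\<^sub>M borel)"
    unfolding cdf_max_def by (rule measurable_mckean[OF bbm g])
  show "cdf_max t c \<le> 1" for t c
    unfolding cdf_max_def by (rule mckean_le_1, rule test_g_le_1) simp
  fix t c :: real assume t: "0 < t"
  have "test_g {..0} (\<lambda>_. 0) (y - c) = indicator {..c} y" for y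
    by (auto simp: test_g_def indicator_def)
  then show "cdf_max t c \<le> ennreal (exp (- t)) * (\<integral>\<^sup>+y. ennreal (heat t y) * indicator {..c} y \<partial>lborel) +
      (\<integral>\<^sup>+s. ennreal (exponential_density 1 s) * (\<integral>\<^sup>+y. ennreal (heat s y) *
         (indicator {..t} s * (cdf_max (t - s) (c - y))\<^sup>2) \<partial>lborel) \<partial>lborel)"
    unfolding cdf_max_def using mckean_equation[OF g t, of c] by simp
qed

lemma cdf_max_eq:
  assumes "0 \<le> t"
  shows "cdf_max t c = ennreal (measure P {\<omega> \<in> space P. max_position T B t \<omega> \<le> c})"
proof -
  interpret prob_space P by (rule bbm_prob[OF bbm])
  note [measurable] = measurable_max_position[OF assms]
  have "cdf_max t c = (\<integral>\<^sup>+\<omega>. indicator {\<omega> \<in> space P. max_position T B t \<omega> \<le> c} \<omega> \<partial>P)"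
    unfolding cdf_max_def mckean_def
    by (rule nn_integral_cong) (auto simp: tree_prod_test_g assms point_integral_def indicator_def)
  also have "\<dots> = emeasure P {\<omega> \<in> space P. max_position T B t \<omega> \<le> c}"
    by (rule nn_integral_indicator) measurable
  finally show ?thesis by (simp add: emeasure_eq_measure)
qed

text \<open>After the first branching, moving the level by \<open>h\<close> amounts to translating
  the Gaussian kernel, while the squared factor is at most 1. The event without branching costs
  \<open>exp (- t)\<close>, which disappears in the limit, so the limit law inherits a modulus of
  continuity.\<close>

lemma cdf_max_modulus:
  assumes t: "0 < t"
  shows "cdf_max t (c + h) \<le> ennreal (exp (- t)) + cdf_max t c + heat_modulus h"
proof -
  have g: "test_g {..0} (\<lambda>_. 0) \<in> borel_measurable borel" by (rule test_g_measurable) auto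
  have cm: "(\<lambda>x. cdf_max (fst x) (snd x)) \<in> borel_measurable (borel \<Otimes>\<^sub>M borel)"
  proof -
    have "(\<lambda>(t, c). cdf_max t c) \<in> borel_measurable (borel \<Otimes>\<^sub>M borel)"
      using cdf_max_kpp unfolding kpp_subsolution_def by blast
    then show ?thesis by (simp add: case_prod_beta')
  qed
  have [measurable]: "(\<lambda>x. cdf_max (f x) (k x)) \<in> borel_measurable M"
    if "f \<in> borel_measurable M" "k \<in> borel_measurable M" for f k :: "'z \<Rightarrow> real" and M
    using measurable_compose[OF measurable_Pair[OF that] cm] by simp
  have u1: "cdf_max r z \<le> 1" for r z
    using cdf_max_kpp by (simp add: kpp_subsolution_def)
  let ?I = "\<lambda>c. (\<integral>\<^sup>+s. ennreal (exponential_density 1 s) * (\<integral>\<^sup>+y. ennreal (heat s y) *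
      (indicator {..t} s * (cdf_max (t - s) (c - y))\<^sup>2) \<partial>lborel) \<partial>lborel)"
  have eq: "cdf_max t c' = ennreal (exp (- t)) * (\<integral>\<^sup>+y. ennreal (heat t y) * test_g {..0} (\<lambda>_. 0) (y - c') \<partial>lborel) + ?I c'" for c'
    unfolding cdf_max_def by (rule mckean_equation[OF g t])
  have first: "(\<integral>\<^sup>+y. ennreal (heat t y) * test_g {..0} (\<lambda>_. 0) (y - c') \<partial>lborel) \<le> 1" for c'
  proof -
    have "(\<integral>\<^sup>+y. ennreal (heat t y) * test_g {..0} (\<lambda>_. 0) (y - c') \<partial>lborel) \<le> (\<integral>\<^sup>+y. ennreal (heat t y) * 1 \<partial>lborel)"
      by (intro nn_integral_mono mult_left_mono test_g_le_1) auto
    then show ?thesis using t by (simp add: nn_integral_normal_density)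
  qed
  have "?I (c + h) \<le> (\<integral>\<^sup>+s. ennreal (exponential_density 1 s) * (\<integral>\<^sup>+y. ennreal (heat s y) *
      (indicator {..t} s * (cdf_max (t - s) (c - y))\<^sup>2) \<partial>lborel) + ennreal (exponential_density 1 s) *
      (\<integral>\<^sup>+y. ennreal (max 0 (heat s y - heat s (y - h))) \<partial>lborel) \<partial>lborel)"
  proof (rule nn_integral_mono)
    fix s
    let ?k = "\<lambda>y. ennreal (heat s y) * (indicator {..t} s * (cdf_max (t - s) (c - y))\<^sup>2)"
    have "(\<integral>\<^sup>+y. ennreal (heat s y) * (indicator {..t} s * (cdf_max (t - s) (c + h - y))\<^sup>2) \<partial>lborel) \<le>
      (\<integral>\<^sup>+y. ?k (-h + 1 * y) + ennreal (max 0 (heat s y - heat s (y - h))) \<partial>lborel)"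
    proof (rule nn_integral_mono)
      fix y
      define w where "w = indicator {..t} s * (cdf_max (t - s) (c + h - y))\<^sup>2"
      have w1: "w \<le> 1" using u1[of "t - s" "c + h - y"] by (auto simp: w_def indicator_def power_le_one)
      have "ennreal (heat s y) \<le> ennreal (heat s (y - h) + max 0 (heat s y - heat s (y - h)))"
        by (rule ennreal_leI) linarith
      also have "\<dots> = ennreal (heat s (y - h)) + ennreal (max 0 (heat s y - heat s (y - h)))"
        by (rule ennreal_plus) (auto simp: heat_nonneg)
      finally have "ennreal (heat s y) * w \<le> (ennreal (heat s (y - h)) + ennreal (max 0 (heat s y - heat s (y - h)))) * w"
        by (rule mult_right_mono) simp
      also have "\<dots> = ennreal (heat s (y - h)) * w + ennreal (max 0 (heat s y - heat s (y - h))) * w"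
        by (rule distrib_right)
      also have "\<dots> \<le> ennreal (heat s (y - h)) * w + ennreal (max 0 (heat s y - heat s (y - h))) * 1"
        by (intro add_left_mono mult_left_mono w1) simp
      finally show "ennreal (heat s y) * (indicator {..t} s * (cdf_max (t - s) (c + h - y))\<^sup>2) \<le>
         ?k (-h + 1 * y) + ennreal (max 0 (heat s y - heat s (y - h)))"
        by (simp add: w_def algebra_simps)
    qed
    also have "\<dots> = (\<integral>\<^sup>+y. ?k (-h + 1 * y) \<partial>lborel) + (\<integral>\<^sup>+y. ennreal (max 0 (heat s y - heat s (y - h))) \<partial>lborel)"
      by (rule nn_integral_add) measurable
    also have "(\<integral>\<^sup>+y. ?k (-h + 1 * y) \<partial>lborel) = (\<integral>\<^sup>+y. ?k y \<partial>lborel)"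
    proof -
      have "?k \<in> borel_measurable borel" by measurable
      from nn_integral_real_affine[OF this, of 1 "-h"] show ?thesis by simp
    qed
    finally show "ennreal (exponential_density 1 s) * (\<integral>\<^sup>+y. ennreal (heat s y) * (indicator {..t} s * (cdf_max (t - s) (c + h - y))\<^sup>2) \<partial>lborel) \<le>
       ennreal (exponential_density 1 s) * (\<integral>\<^sup>+y. ?k y \<partial>lborel) + ennreal (exponential_density 1 s) *
      (\<integral>\<^sup>+y. ennreal (max 0 (heat s y - heat s (y - h))) \<partial>lborel)"
      by (subst distrib_left[symmetric]) (rule mult_left_mono, auto)
  qed
  also have "\<dots> = ?I c + heat_modulus h"
    unfolding heat_modulus_def
    by (rule nn_integral_add) measurable
  finally have 2: "?I (c + h) \<le> ?I c + heat_modulus h" .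
  have "cdf_max t (c + h) \<le> ennreal (exp (- t)) * 1 + (?I c + heat_modulus h)"
    unfolding eq[of "c + h"] by (intro add_mono mult_left_mono first 2) auto
  also have "?I c \<le> cdf_max t c" unfolding eq[of c] by simp
  finally show ?thesis by (simp add: add.assoc add_left_mono add_right_mono)
qed

end

text \<open>The positive part is at most the kernel itself, an integrable function independent of
  the translation, and the kernel is continuous in space.\<close>

lemma heat_modulus_tendsto:
  assumes X: "X \<longlonglongrightarrow> 0"
  shows "(\<lambda>n. heat_modulus (X n)) \<longlonglongrightarrow> 0"
proof -
  let ?f = "\<lambda>h x. ennreal (exponential_density 1 (fst x)) * ennreal (max 0 (heat (fst x) (snd x) - heat (fst x) (snd x - h)))"
  have fst_eq: "heat_modulus h = (\<integral>\<^sup>+x. ?f h x \<partial>(lborel \<Otimes>\<^sub>M lborel))" for h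
    unfolding heat_modulus_def by (subst lborel.nn_integral_fst[symmetric]) (simp_all add: nn_integral_cmult)
  have "(\<lambda>n. \<integral>\<^sup>+x. ?f (X n) x \<partial>(lborel \<Otimes>\<^sub>M lborel)) \<longlonglongrightarrow> (\<integral>\<^sup>+x. 0 \<partial>(lborel \<Otimes>\<^sub>M lborel :: (real \<times> real) measure))"
  proof (rule nn_integral_dominated_convergence[where w = "\<lambda>x. ennreal (exponential_density 1 (fst x)) * ennreal (heat (fst x) (snd x))"])
    show "(\<integral>\<^sup>+x. ennreal (exponential_density 1 (fst x)) * ennreal (heat (fst x) (snd x)) \<partial>(lborel \<Otimes>\<^sub>M lborel)) < \<infinity>"
    proof -
      have "(\<integral>\<^sup>+x. ennreal (exponential_density 1 (fst x)) * ennreal (heat (fst x) (snd x)) \<partial>(lborel \<Otimes>\<^sub>M lborel))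
        = (\<integral>\<^sup>+s. ennreal (exponential_density 1 s) * (\<integral>\<^sup>+y. ennreal (heat s y) \<partial>lborel) \<partial>lborel)"
        by (subst lborel.nn_integral_fst[symmetric]) (simp_all add: nn_integral_cmult)
      also have "\<dots> = (\<integral>\<^sup>+s. ennreal (exponential_density 1 s) \<partial>lborel)"
      proof (rule nn_integral_cong_AE)
        have "AE s in lborel. s \<noteq> (0::real)" by (rule AE_lborel_singleton)
        then show "AE s in lborel. ennreal (exponential_density 1 s) * (\<integral>\<^sup>+y. ennreal (heat s y) \<partial>lborel) = ennreal (exponential_density 1 s)"
        proof eventually_elim
          case (elim s)
          then show ?case
            by (cases "0 < s") (auto simp: nn_integral_normal_density exponential_density_def)
        qed
      qed
      finally show ?thesis by (simp add: nn_integral_exponential_density)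
    qed
    show "AE x in lborel \<Otimes>\<^sub>M lborel. ?f (X j) x \<le> ennreal (exponential_density 1 (fst x)) * ennreal (heat (fst x) (snd x))" for j
      by (intro AE_I2 mult_left_mono ennreal_leI) (auto simp: heat_nonneg)
    show "AE x in lborel \<Otimes>\<^sub>M lborel. (\<lambda>i. ?f (X i) x) \<longlonglongrightarrow> 0"
    proof (rule AE_I2)
      fix x :: "real \<times> real"
      have h: "(\<lambda>i. heat (fst x) (snd x - X i)) \<longlonglongrightarrow> heat (fst x) (snd x - 0)"
      proof (cases "fst x = 0")
        case False
        then show ?thesis unfolding normal_density_def by (intro tendsto_intros X) auto
      qed (simp add: normal_density_def)
      have "(\<lambda>i. ennreal (exponential_density 1 (fst x) * max 0 (heat (fst x) (snd x) - heat (fst x) (snd x - X i)))) \<longlonglongrightarrow>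
         ennreal (exponential_density 1 (fst x) * max 0 (heat (fst x) (snd x) - heat (fst x) (snd x - 0)))"
        by (intro tendsto_ennrealI tendsto_intros h tendsto_max)
      then show "(\<lambda>i. ?f (X i) x) \<longlonglongrightarrow> 0"
        by (simp add: ennreal_mult exponential_density_nonneg)
    qed
  qed auto
  then show ?thesis unfolding fst_eq by simp
qed

section \<open>The extremal process\<close>

lemma point_max_eq:
  assumes "mult \<mu> m \<noteq> 0" "\<And>x. m < x \<Longrightarrow> mult \<mu> x = 0"
  shows "point_max \<mu> = m"
  unfolding point_max_def
  by (rule Greatest_equality) (use assms in \<open>auto simp: not_less[symmetric]\<close>)

text \<open>\<open>point_max\<close> is a \<open>GREATEST\<close>, which says nothing unless a
  largest atom exists; this has to be proved for \<open>L\<close>-almost every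
  configuration.\<close>

definition has_max :: "point_measure \<Rightarrow> bool" where
  "has_max \<mu> \<longleftrightarrow> mult \<mu> (point_max \<mu>) \<noteq> 0 \<and> (\<forall>x>point_max \<mu>. mult \<mu> x = 0)"

lemma point_max_shift_union:
  assumes "has_max \<mu>" "has_max \<nu>"
  shows "point_max (point_shift c (point_union \<mu> \<nu>)) = max (point_max \<mu>) (point_max \<nu>) + c"
  by (rule point_max_eq)
    (use assms in \<open>auto simp: has_max_def point_shift.rep_eq point_union.rep_eq max_def split: if_splits\<close>)

lemma continuous_on_fst_UNIV: "continuous_on UNIV f \<Longrightarrow> continuous_on UNIV (\<lambda>x. f (fst x))"
  by (rule continuous_on_compose2[of UNIV f]) (auto intro: continuous_on_fst continuous_on_id)

context
  fixes P :: "'a measure" and T B and L :: "point_measure measure"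
  assumes bbm: "binary_bbm P T B" and ext: "is_extremal_process P T B L"
begin

abbreviation (input) "centred t \<omega> \<equiv> particles T B t (centering t) \<omega>"
abbreviation (input) "cmax t \<omega> \<equiv> max_position T B t \<omega> - centering t"

lemma L_prob: "prob_space L" and sets_L: "sets L = sets borel"
  using ext by (auto simp: is_extremal_process_def)

lemma measurable_L_iff: "f \<in> measurable L M \<longleftrightarrow> f \<in> measurable borel M"
  by (simp add: measurable_cong_sets[OF sets_L refl])

text \<open>Part of the hypothesis on \<open>L\<close>: convergence in law requires the pair of
  process and maximum to be a random element under \<open>L\<close>, whose measurable sets are the
  Borel sets.\<close>

lemma measurable_point_max: "point_max \<in> borel_measurable borel"
proof -
  have "(\<lambda>\<mu>. (\<mu>, point_max \<mu>)) \<in> L \<rightarrow>\<^sub>M borel"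
    using ext by (simp add: is_extremal_process_def converges_in_law_def)
  from measurable_compose[OF this borel_measurable_continuous_onI[OF continuous_on_snd[OF continuous_on_id]]]
  have "point_max \<in> borel_measurable L" by simp
  then show ?thesis by (simp add: measurable_L_iff)
qed

lemma extremal_limit:
  fixes G :: "point_measure \<times> real \<Rightarrow> real"
  assumes "continuous_on UNIV G" "\<And>x. \<bar>G x\<bar> \<le> K"
  shows "((\<lambda>t. \<integral>\<omega>. G (centred t \<omega>, cmax t \<omega>) \<partial>P) \<longlongrightarrow> (\<integral>\<mu>. G (\<mu>, point_max \<mu>) \<partial>L)) at_top"
proof -
  have "bounded (range G)" using assms(2) by (auto simp: bounded_iff)
  then show ?thesis
    using ext assms(1) by (simp add: is_extremal_process_def converges_in_law_def)
qed

lemma measurable_continuous_pair: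
  fixes G :: "point_measure \<times> real \<Rightarrow> real"
  assumes "continuous_on UNIV G"
  shows "(\<lambda>\<mu>. G (\<mu>, point_max \<mu>)) \<in> borel_measurable L"
    and "0 \<le> t \<Longrightarrow> (\<lambda>\<omega>. G (centred t \<omega>, cmax t \<omega>)) \<in> borel_measurable P"
proof -
  have G: "G \<in> borel_measurable (borel \<Otimes>\<^sub>M borel)"
    unfolding borel_prod using assms by (rule borel_measurable_continuous_onI)
  show "(\<lambda>\<mu>. G (\<mu>, point_max \<mu>)) \<in> borel_measurable L"
    unfolding measurable_L_iff
    by (rule measurable_compose[OF measurable_Pair G]) (use measurable_point_max in auto)
  assume "0 \<le> t"
  then show "(\<lambda>\<omega>. G (centred t \<omega>, cmax t \<omega>)) \<in> borel_measurable P"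
    using measurable_particles[OF bbm] measurable_max_position[OF bbm]
    by (intro measurable_compose[OF measurable_Pair G]) auto
qed

text \<open>A nonnegative continuous functional of the pair that vanishes at all finite times
  integrates to 0 in the limit. It carries closed relations between the process and its maximum over
  to \<open>L\<close>.\<close>

lemma extremal_null:
  fixes G :: "point_measure \<times> real \<Rightarrow> real"
  assumes G: "continuous_on UNIV G" "\<And>x. 0 \<le> G x" "\<And>x. G x \<le> 1"
    and null: "\<And>t \<omega>. 0 \<le> t \<Longrightarrow> \<omega> \<in> space P \<Longrightarrow> G (centred t \<omega>, cmax t \<omega>) = 0"
  shows "AE \<mu> in L. G (\<mu>, point_max \<mu>) = 0"
proof -
  interpret L: prob_space L by (rule L_prob)
  have "((\<lambda>t. \<integral>\<omega>. G (centred t \<omega>, cmax t \<omega>) \<partial>P) \<longlongrightarrow> (\<integral>\<mu>. G (\<mu>, point_max \<mu>) \<partial>L)) at_top"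
    by (rule extremal_limit[OF G(1), of 1]) (use G in \<open>auto simp: abs_le_iff intro: order_trans[of _ 0]\<close>)
  moreover have "((\<lambda>t. \<integral>\<omega>. G (centred t \<omega>, cmax t \<omega>) \<partial>P) \<longlongrightarrow> 0) at_top"
  proof (rule tendsto_eventually)
    show "\<forall>\<^sub>F t in at_top. (\<integral>\<omega>. G (centred t \<omega>, cmax t \<omega>) \<partial>P) = 0"
      using eventually_ge_at_top[of 0]
    proof eventually_elim
      case (elim t)
      have "(\<integral>\<omega>. G (centred t \<omega>, cmax t \<omega>) \<partial>P) = (\<integral>\<omega>. 0 \<partial>P)"
        by (rule Bochner_Integration.integral_cong) (use null elim in auto)
      then show ?case by simp
    qed
  qed
  ultimately have z: "(\<integral>\<mu>. G (\<mu>, point_max \<mu>) \<partial>L) = 0"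
    by (rule tendsto_unique[OF trivial_limit_at_top_linorder])
  have "integrable L (\<lambda>\<mu>. G (\<mu>, point_max \<mu>))"
    by (rule L.integrable_const_bound[where B = 1]) (use G measurable_continuous_pair(1)[OF G(1)] in auto)
  from integral_nonneg_eq_0_iff_AE[OF this] show ?thesis
    using z G by simp
qed

lemma particles_mult:
  assumes "\<omega> \<in> space P"
  shows "mult (particles T B t c \<omega>) x \<noteq> 0 \<longleftrightarrow> (\<exists>u\<in>alive T t \<omega>. position T B u t \<omega> - c = x)"
  using alive_bbm(1)[OF bbm assms, of t] by (auto simp: particles_def point_sum.rep_eq card_gt_0_iff)

text \<open>\<open>G a R\<close> is positive when the second coordinate lies below \<open>a\<close>
  although the window holds an atom above \<open>a\<close>, which is impossible for finite systems.
  Rational \<open>a\<close> and integer \<open>R\<close> catch every violation.\<close>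

lemma extremal_none_above: "AE \<mu> in L. \<forall>x>point_max \<mu>. mult \<mu> x = 0"
proof -
  define \<phi> where "\<phi> a R x = max 0 (min (x - a) 1) * tent R x" for a and R x
  have \<phi>: "test_fun (\<phi> a R)" for a R
    unfolding \<phi>_def
    by (rule test_funI[of _ "real R + 1"]) (auto simp: tent_def intro!: continuous_intros)
  have \<phi>0: "0 \<le> \<phi> a R x" for a R x by (simp add: \<phi>_def tent_nonneg)
  define G where "G a R x = max 0 (min 1 (a - snd x)) * min 1 (point_integral (fst x) (\<phi> a R))"
    for a R and x :: "point_measure \<times> real"
  have pi0: "0 \<le> point_integral \<mu> (\<phi> a R)" for \<mu> a R by (intro point_integral_nonneg \<phi>0)
  have "AE \<mu> in L. G a R (\<mu>, point_max \<mu>) = 0" for a R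
  proof (rule extremal_null)
    show "continuous_on UNIV (G a R)"
      unfolding G_def
      by (intro continuous_intros continuous_on_fst_UNIV continuous_on_point_integral \<phi>)
    show "0 \<le> G a R x" "G a R x \<le> 1" for x
      using pi0 by (auto simp: G_def intro!: mult_nonneg_nonneg mult_le_one)
    fix t :: real and \<omega> assume t: "0 \<le> t" and \<omega>: "\<omega> \<in> space P"
    show "G a R (centred t \<omega>, cmax t \<omega>) = 0"
    proof (cases "cmax t \<omega> < a")
      case True
      have "\<phi> a R (position T B u t \<omega> - centering t) = 0" if "u \<in> alive T t \<omega>" for u
        using max_position_ge[OF bbm \<omega> that] True by (simp add: \<phi>_def)
      then have "point_integral (centred t \<omega>) (\<phi> a R) = 0"
        using alive_bbm(1)[OF bbm \<omega>, of t] by (simp add: particles_def point_integral_sum)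
      then show ?thesis by (simp add: G_def)
    qed (simp add: G_def)
  qed
  then have "AE \<mu> in L. \<forall>q::rat. \<forall>R. G (of_rat q) R (\<mu>, point_max \<mu>) = 0"
    by (simp add: AE_all_countable)
  then show ?thesis
  proof eventually_elim
    case (elim \<mu>)
    show ?case
    proof (intro allI impI, rule ccontr)
      fix x assume x: "point_max \<mu> < x" "mult \<mu> x \<noteq> 0"
      obtain q where q: "point_max \<mu> < of_rat q" "of_rat q < x" using of_rat_dense[OF x(1)] by auto
      obtain R :: nat where R: "\<bar>x\<bar> \<le> real R" using real_arch_simple by blast
      have "0 < \<phi> (of_rat q) R x" using q R by (simp add: \<phi>_def tent_def)
      also have "\<phi> (of_rat q) R x \<le> point_integral \<mu> (\<phi> (of_rat q) R)"
        by (rule point_integral_ge_atom[OF \<phi> \<phi>0 x(2)])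
      finally have "0 < G (of_rat q) R (\<mu>, point_max \<mu>)"
        using q by (simp add: G_def)
      then show False using elim by (metis less_irrefl)
    qed
  qed
qed

text \<open>\<open>G c n\<close> is positive when the second coordinate is close to \<open>c\<close>
  although no atom is. Its vanishing yields atoms arbitrarily close to
  \<open>point_max \<mu>\<close>, and local finiteness forces one of them to sit exactly
  there.\<close>

lemma extremal_atom: "AE \<mu> in L. mult \<mu> (point_max \<mu>) \<noteq> 0"
proof -
  define \<phi> where "\<phi> c n x = max 0 (min 1 (2 - real (Suc n) * \<bar>x - c\<bar>))" for c n x
  have sup: "\<bar>x - c\<bar> < 2 / real (Suc n)" if "\<phi> c n x \<noteq> 0" for c n x
  proof -
    have "real (Suc n) * \<bar>x - c\<bar> < 2" using that by (auto simp: \<phi>_def max_def min_def split: if_splits)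
    then show ?thesis by (simp add: field_simps)
  qed
  have \<phi>: "test_fun (\<phi> c n)" for c n
  proof (rule test_funI[of _ "\<bar>c\<bar> + 2"])
    show "continuous_on UNIV (\<phi> c n)" unfolding \<phi>_def by (intro continuous_intros)
    fix x assume "\<phi> c n x \<noteq> 0"
    from sup[OF this] have "\<bar>x - c\<bar> < 2 / real (Suc n)" .
    also have "\<dots> \<le> 2" by (simp add: field_simps)
    finally show "\<bar>x\<bar> \<le> \<bar>c\<bar> + 2" by linarith
  qed
  have \<phi>0: "0 \<le> \<phi> c n x" for c n x by (simp add: \<phi>_def)
  define G where "G c n x = max 0 (1 - real (Suc n) * \<bar>snd x - c\<bar>) * max 0 (1 - point_integral (fst x) (\<phi> c n))"
    for c n and x :: "point_measure \<times> real"
  have pi0: "0 \<le> point_integral \<mu> (\<phi> c n)" for \<mu> c n by (intro point_integral_nonneg \<phi>0)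
  have "AE \<mu> in L. G c n (\<mu>, point_max \<mu>) = 0" for c n
  proof (rule extremal_null)
    show "continuous_on UNIV (G c n)"
      unfolding G_def
      by (intro continuous_intros continuous_on_fst_UNIV continuous_on_point_integral \<phi>)
    show "0 \<le> G c n x" "G c n x \<le> 1" for x
      using pi0 by (auto simp: G_def intro!: mult_nonneg_nonneg mult_le_one)
    fix t :: real and \<omega> assume t: "0 \<le> t" and \<omega>: "\<omega> \<in> space P"
    show "G c n (centred t \<omega>, cmax t \<omega>) = 0"
    proof (cases "real (Suc n) * \<bar>cmax t \<omega> - c\<bar> < 1")
      case True
      obtain u where "u \<in> alive T t \<omega>" "max_position T B t \<omega> = position T B u t \<omega>"
        using max_position_in[OF bbm \<omega> t] by blast
      then have "mult (centred t \<omega>) (cmax t \<omega>) \<noteq> 0" using particles_mult[OF \<omega>] by metis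
      from point_integral_ge_atom[OF \<phi> \<phi>0 this]
      have "\<phi> c n (cmax t \<omega>) \<le> point_integral (centred t \<omega>) (\<phi> c n)" .
      moreover have "\<phi> c n (cmax t \<omega>) = 1" using True by (simp add: \<phi>_def)
      ultimately show ?thesis by (simp add: G_def)
    qed (simp add: G_def)
  qed
  then have "AE \<mu> in L. \<forall>q::rat. \<forall>n. G (of_rat q) n (\<mu>, point_max \<mu>) = 0"
    by (simp add: AE_all_countable)
  then show ?thesis
  proof eventually_elim
    case (elim \<mu>)
    define p where "p = point_max \<mu>"
    have near: "\<exists>x. mult \<mu> x \<noteq> 0 \<and> \<bar>x - p\<bar> < 3 / real (Suc n)" for n
    proof -
      obtain q where q: "p < of_rat q" "of_rat q < p + 1 / real (Suc n)"
        using of_rat_dense[of p "p + 1 / real (Suc n)"] by auto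
      have d: "\<bar>p - of_rat q\<bar> < 1 / real (Suc n)" using q by linarith
      then have "real (Suc n) * \<bar>p - of_rat q\<bar> < 1" by (simp add: field_simps)
      moreover have "G (of_rat q) n (\<mu>, p) = 0" using elim by (simp add: p_def)
      ultimately have "1 \<le> point_integral \<mu> (\<phi> (of_rat q) n)"
        by (auto simp: G_def max_def split: if_splits)
      then have "point_integral \<mu> (\<phi> (of_rat q) n) \<noteq> 0" by linarith
      then obtain x where x: "mult \<mu> x \<noteq> 0" "\<phi> (of_rat q) n x \<noteq> 0"
        unfolding point_integral_def by (auto elim!: sum.not_neutral_contains_not_neutral)
      have "\<bar>x - p\<bar> < 2 / real (Suc n) + 1 / real (Suc n)"
        using sup[OF x(2)] d by linarith
      then show ?thesis using x(1) by (auto simp flip: add_divide_distrib)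
    qed
    show ?case
    proof (rule ccontr)
      assume "\<not> mult \<mu> (point_max \<mu>) \<noteq> 0"
      then have p0: "mult \<mu> p = 0" by (simp add: p_def)
      let ?S = "{x. mult \<mu> x \<noteq> 0 \<and> \<bar>x\<bar> \<le> \<bar>p\<bar> + 3}"
      have fS: "finite ((\<lambda>x. \<bar>x - p\<bar>) ` ?S)" using finite_atoms by simp
      define \<delta> where "\<delta> = Min (insert 1 ((\<lambda>x. \<bar>x - p\<bar>) ` ?S))"
      have \<delta>: "0 < \<delta>"
        unfolding \<delta>_def using fS p0 by (subst Min_gr_iff) auto
      obtain n where n: "1 / real (Suc n) < \<delta> / 3" using \<delta> nat_approx_posE[of "\<delta> / 3"] by auto
      obtain x where x: "mult \<mu> x \<noteq> 0" "\<bar>x - p\<bar> < 3 / real (Suc n)" using near by blast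
      have "3 / real (Suc n) \<le> 3" by (simp add: field_simps)
      then have "x \<in> ?S" using x by auto
      then have "\<delta> \<le> \<bar>x - p\<bar>" unfolding \<delta>_def using fS by (intro Min_le) auto
      then show False using x(2) n by linarith
    qed
  qed
qed

lemma extremal_has_max: "AE \<mu> in L. has_max \<mu>"
  using extremal_none_above extremal_atom by eventually_elim (auto simp: has_max_def)

text \<open>The mass at \<open>a\<close> is at most the integral of a hat function of half-width
  \<open>h\<close>, which at finite time is bounded by an increment of the distribution function
  over \<open>2 * h\<close>. By \<open>cdf_max_modulus\<close> the limit is at most
  \<open>heat_modulus (2 * h)\<close>, which tends to 0.\<close>

lemma extremal_max_no_atom: "measure L {\<mu> \<in> space L. point_max \<mu> = a} = 0"
proof -
  interpret P: prob_space P by (rule bbm_prob[OF bbm])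
  interpret L: prob_space L by (rule L_prob)
  note [measurable] = measurable_point_max[folded measurable_L_iff]
  let ?A = "{\<mu> \<in> space L. point_max \<mu> = a}"
  have bound: "ennreal (measure L ?A) \<le> heat_modulus (2 * h)" if h: "0 < h" for h
  proof -
    define G where "G x = max 0 (1 - \<bar>snd x - a\<bar> / h)" for x :: "point_measure \<times> real"
    have Gc: "continuous_on UNIV G" unfolding G_def using h by (intro continuous_intros) auto
    have G01: "0 \<le> G x" "G x \<le> 1" for x using h by (auto simp: G_def)
    have "ennreal (measure L ?A) \<le> ennreal (\<integral>\<mu>. G (\<mu>, point_max \<mu>) \<partial>L)"
    proof (rule ennreal_leI)
      have "measure L ?A = (\<integral>\<mu>. indicator ?A \<mu> \<partial>L)" by simp
      also have "\<dots> \<le> (\<integral>\<mu>. G (\<mu>, point_max \<mu>) \<partial>L)"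
      proof (rule integral_mono)
        show "integrable L (\<lambda>\<mu>. G (\<mu>, point_max \<mu>))"
          by (rule L.integrable_const_bound[where B = 1]) (use G01 measurable_continuous_pair(1)[OF Gc] in auto)
        show "indicator ?A \<mu> \<le> G (\<mu>, point_max \<mu>)" for \<mu>
          using G01 by (auto simp: indicator_def G_def)
      qed (auto simp: L.emeasure_eq_measure)
      finally show "measure L ?A \<le> (\<integral>\<mu>. G (\<mu>, point_max \<mu>) \<partial>L)" .
    qed
    also have "\<dots> \<le> 0 + heat_modulus (2 * h)"
    proof (rule tendsto_le[OF trivial_limit_at_top_linorder])
      show "((\<lambda>t. ennreal (\<integral>\<omega>. G (centred t \<omega>, cmax t \<omega>) \<partial>P)) \<longlongrightarrow> ennreal (\<integral>\<mu>. G (\<mu>, point_max \<mu>) \<partial>L)) at_top"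
        by (intro tendsto_ennrealI extremal_limit[OF Gc, where K = 1]) (use G01 in \<open>auto simp: abs_le_iff intro: order_trans[of _ 0]\<close>)
      have "((\<lambda>t::real. exp (- t)) \<longlongrightarrow> 0) at_top" by real_asymp
      from tendsto_ennrealI[OF this]
      show "((\<lambda>t. ennreal (exp (- t)) + heat_modulus (2 * h)) \<longlongrightarrow> 0 + heat_modulus (2 * h)) at_top"
        by (intro tendsto_add) auto
      show "\<forall>\<^sub>F t in at_top. ennreal (\<integral>\<omega>. G (centred t \<omega>, cmax t \<omega>) \<partial>P) \<le> ennreal (exp (- t)) + heat_modulus (2 * h)"
        using eventually_gt_at_top[of 0]
      proof eventually_elim
        case (elim t)
        then have t0: "0 \<le> t" by simp
        note [measurable] = measurable_max_position[OF bbm t0]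
        define c where "c = centering t + a - h"
        have e1: "ennreal (\<integral>\<omega>. G (centred t \<omega>, cmax t \<omega>) \<partial>P) = (\<integral>\<^sup>+\<omega>. ennreal (G (centred t \<omega>, cmax t \<omega>)) \<partial>P)"
          using G01 measurable_continuous_pair(2)[OF Gc t0]
          by (intro nn_integral_eq_integral[symmetric] P.integrable_const_bound[where B = 1]) auto
        \<comment> \<open>The distribution function at the left end \<open>c\<close> is added on the
          left side, to be cancelled at the end; subtraction in \<open>ennreal\<close> is
          avoided.\<close>
        have "ennreal (\<integral>\<omega>. G (centred t \<omega>, cmax t \<omega>) \<partial>P) + cdf_max P T B t c = (\<integral>\<^sup>+\<omega>. ennreal (G (centred t \<omega>, cmax t \<omega>)) \<partial>P) +
            (\<integral>\<^sup>+\<omega>. indicator {\<omega> \<in> space P. max_position T B t \<omega> \<le> c} \<omega> \<partial>P)"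
          by (simp add: e1 cdf_max_eq[OF bbm t0] P.emeasure_eq_measure)
        also have "\<dots> = (\<integral>\<^sup>+\<omega>. ennreal (G (centred t \<omega>, cmax t \<omega>)) + indicator {\<omega> \<in> space P. max_position T B t \<omega> \<le> c} \<omega> \<partial>P)"
          by (rule nn_integral_add[symmetric]) (use measurable_continuous_pair(2)[OF Gc t0] in auto)
        also have "\<dots> \<le> (\<integral>\<^sup>+\<omega>. indicator {\<omega> \<in> space P. max_position T B t \<omega> \<le> c + 2 * h} \<omega> \<partial>P)"
        proof (rule nn_integral_mono)
          fix \<omega> assume "\<omega> \<in> space P"
          consider "max_position T B t \<omega> \<le> c" | "c < max_position T B t \<omega>" "max_position T B t \<omega> \<le> c + 2 * h" | "c + 2 * h < max_position T B t \<omega>"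
            by linarith
          then show "ennreal (G (centred t \<omega>, cmax t \<omega>)) + indicator {\<omega> \<in> space P. max_position T B t \<omega> \<le> c} \<omega>
             \<le> indicator {\<omega> \<in> space P. max_position T B t \<omega> \<le> c + 2 * h} \<omega>"
          proof cases
            case 1
            then have "1 \<le> \<bar>cmax t \<omega> - a\<bar> / h" using h by (simp add: c_def field_simps)
            then have "G (centred t \<omega>, cmax t \<omega>) = 0" by (simp add: G_def)
            then show ?thesis using 1 h \<open>\<omega> \<in> space P\<close> by simp
          next
            case 2
            then show ?thesis using G01(2)[of "(centred t \<omega>, cmax t \<omega>)"] \<open>\<omega> \<in> space P\<close> by (simp add: ennreal_le_1)
          next
            case 3
            then have "1 \<le> \<bar>cmax t \<omega> - a\<bar> / h" using h by (simp add: c_def field_simps)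
            then have "G (centred t \<omega>, cmax t \<omega>) = 0" by (simp add: G_def)
            then show ?thesis using 3 h by simp
          qed
        qed
        also have "\<dots> = cdf_max P T B t (c + 2 * h)"
          by (simp add: cdf_max_eq[OF bbm t0] P.emeasure_eq_measure)
        also have "\<dots> \<le> ennreal (exp (- t)) + cdf_max P T B t c + heat_modulus (2 * h)"
          by (rule cdf_max_modulus[OF bbm elim])
        also have "\<dots> = (ennreal (exp (- t)) + heat_modulus (2 * h)) + cdf_max P T B t c"
          by (simp add: add_ac)
        finally show ?case
          by (simp add: add.commute[of _ "cdf_max P T B t c"] ennreal_add_left_cancel_le cdf_max_eq[OF bbm t0])
      qed
    qed
    finally show ?thesis by simp
  qed
  have "(\<lambda>n. heat_modulus (2 * (1 / real (Suc n)))) \<longlonglongrightarrow> 0"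
  proof (rule heat_modulus_tendsto)
    have "(\<lambda>n. 2 * inverse (real (Suc n))) \<longlonglongrightarrow> 2 * 0" by (intro tendsto_intros LIMSEQ_inverse_real_of_nat)
    then show "(\<lambda>n. 2 * (1 / real (Suc n))) \<longlonglongrightarrow> 0" by (simp add: inverse_eq_divide)
  qed
  then have "ennreal (measure L ?A) \<le> 0"
    by (rule tendsto_lowerbound) (intro always_eventually allI bound, simp_all)
  then show ?thesis by (simp add: measure_nonneg order_antisym)
qed

text \<open>Continuous ramps bound the indicator from above (\<open>b = 1\<close>) and from below
  (\<open>b = 0\<close>). As they steepen, both integrals under \<open>L\<close> tend to the same
  value, because the maximum has no atom at \<open>a\<close>.\<close>

lemma extremal_limit_indicator:
  fixes H :: "point_measure \<Rightarrow> real"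
  assumes Hc: "continuous_on UNIV H" and H01: "\<And>\<mu>. 0 \<le> H \<mu>" "\<And>\<mu>. H \<mu> \<le> 1"
  shows "((\<lambda>t. \<integral>\<omega>. indicator {..a} (cmax t \<omega>) * H (centred t \<omega>) \<partial>P) \<longlongrightarrow>
    (\<integral>\<mu>. indicator {..a} (point_max \<mu>) * H \<mu> \<partial>L)) at_top"
proof -
  interpret P: prob_space P by (rule bbm_prob[OF bbm])
  interpret L: prob_space L by (rule L_prob)
  note [measurable] = measurable_point_max[folded measurable_L_iff]
  have Hm [measurable]: "H \<in> borel_measurable borel" by (rule borel_measurable_continuous_onI[OF Hc])
  then have HL [measurable]: "H \<in> borel_measurable L" by (simp add: measurable_L_iff)
  define G where "G b n x = max 0 (min 1 (b - real (Suc n) * (snd x - a))) * H (fst x)"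
    for b :: real and n and x :: "point_measure \<times> real"
  have Gc: "continuous_on UNIV (G b n)" for b n
    unfolding G_def by (intro continuous_intros continuous_on_fst_UNIV Hc)
  have G01: "0 \<le> G b n x" "G b n x \<le> 1" for b n x
    using H01 by (auto simp: G_def intro!: mult_nonneg_nonneg mult_le_one)
  have Glim: "((\<lambda>t. \<integral>\<omega>. G b n (centred t \<omega>, cmax t \<omega>) \<partial>P) \<longlongrightarrow> (\<integral>\<mu>. G b n (\<mu>, point_max \<mu>) \<partial>L)) at_top" for b n
    by (rule extremal_limit[OF Gc, where K = 1]) (use G01 in \<open>auto simp: abs_le_iff intro: order_trans[of _ 0]\<close>)
  let ?I = "\<integral>\<mu>. indicator {..a} (point_max \<mu>) * H \<mu> \<partial>L"
  have pint: "integrable P (\<lambda>\<omega>. indicator {..a} (cmax t \<omega>) * H (centred t \<omega>))"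
    "integrable P (\<lambda>\<omega>. G b n (centred t \<omega>, cmax t \<omega>))" if t: "0 \<le> t" for t b n
  proof -
    note [measurable] = measurable_particles[OF bbm t] measurable_max_position[OF bbm t] measurable_continuous_pair(2)[OF Gc t]
    show "integrable P (\<lambda>\<omega>. indicator {..a} (cmax t \<omega>) * H (centred t \<omega>))"
      by (rule P.integrable_const_bound[where B = 1]) (use H01 in \<open>auto simp: indicator_def\<close>)
    show "integrable P (\<lambda>\<omega>. G b n (centred t \<omega>, cmax t \<omega>))"
      by (rule P.integrable_const_bound[where B = 1]) (use G01 in auto)
  qed
  have ne: "AE \<mu> in L. point_max \<mu> \<noteq> a"
    by (rule L.AE_prob_1[of "{\<mu> \<in> space L. point_max \<mu> \<noteq> a}", THEN AE_mp, OF _ AE_I2])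
      (use extremal_max_no_atom L.prob_neg[of "\<lambda>\<mu>. point_max \<mu> = a"] in auto)
  have lim: "(\<lambda>n. \<integral>\<mu>. G b n (\<mu>, point_max \<mu>) \<partial>L) \<longlonglongrightarrow> ?I" for b
  proof (rule integral_dominated_convergence[where w = "\<lambda>_. 1"])
    show "AE \<mu> in L. (\<lambda>n. G b n (\<mu>, point_max \<mu>)) \<longlonglongrightarrow> indicator {..a} (point_max \<mu>) * H \<mu>"
      using ne
    proof eventually_elim
      case (elim \<mu>)
      define d where "d = point_max \<mu> - a"
      have "\<forall>\<^sub>F n in sequentially. max 0 (min 1 (b - real (Suc n) * d)) = indicator {..a} (point_max \<mu>)"
      proof (cases "d < 0")
        case True
        obtain N :: nat where N: "(1 + \<bar>b\<bar>) / (- d) \<le> real N" using real_arch_simple by blast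
        have "1 \<le> b - real (Suc n) * d" if "N \<le> n" for n
        proof -
          have "(1 + \<bar>b\<bar>) / (- d) \<le> real (Suc n)" using N that by linarith
          then have "1 + \<bar>b\<bar> \<le> - (real (Suc n) * d)" using True by (simp add: field_simps)
          then show ?thesis by linarith
        qed
        then show ?thesis using True by (auto simp: eventually_sequentially d_def intro!: exI[of _ N])
      next
        case False
        then have d: "0 < d" using elim by (simp add: d_def)
        obtain N :: nat where N: "\<bar>b\<bar> / d \<le> real N" using real_arch_simple by blast
        have "max 0 (min 1 (b - real (Suc n) * d)) = 0" if "N \<le> n" for n
        proof -
          have "\<bar>b\<bar> / d \<le> real (Suc n)" using N that by linarith
          then have "\<bar>b\<bar> \<le> real (Suc n) * d" using d by (simp add: field_simps)
          then have "b - real (Suc n) * d \<le> 0" by linarith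
          then show ?thesis by (auto simp only: max_def min_def split: if_splits)
        qed
        then show ?thesis using d by (auto simp: eventually_sequentially d_def intro!: exI[of _ N])
      qed
      then have "\<forall>\<^sub>F n in sequentially. G b n (\<mu>, point_max \<mu>) = indicator {..a} (point_max \<mu>) * H \<mu>"
        by eventually_elim (simp add: G_def d_def)
      then show ?case by (rule tendsto_eventually)
    qed
  qed (use G01 measurable_continuous_pair(1)[OF Gc] in auto)
  show ?thesis
  proof (rule tendstoI)
    fix e :: real assume e: "0 < e"
    have "\<forall>\<^sub>F n in sequentially. (\<integral>\<mu>. G 1 n (\<mu>, point_max \<mu>) \<partial>L) < ?I + e"
      "\<forall>\<^sub>F n in sequentially. ?I - e < (\<integral>\<mu>. G 0 n (\<mu>, point_max \<mu>) \<partial>L)"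
      using order_tendstoD[OF lim] e by simp_all
    then have "\<forall>\<^sub>F n in sequentially. (\<integral>\<mu>. G 1 n (\<mu>, point_max \<mu>) \<partial>L) < ?I + e \<and>
       ?I - e < (\<integral>\<mu>. G 0 n (\<mu>, point_max \<mu>) \<partial>L)"
      by (rule eventually_conj)
    then obtain n where n: "(\<integral>\<mu>. G 1 n (\<mu>, point_max \<mu>) \<partial>L) < ?I + e" "?I - e < (\<integral>\<mu>. G 0 n (\<mu>, point_max \<mu>) \<partial>L)"
      by (auto simp: eventually_sequentially)
    have "\<forall>\<^sub>F t in at_top. (\<integral>\<omega>. G 1 n (centred t \<omega>, cmax t \<omega>) \<partial>P) < ?I + e"
      "\<forall>\<^sub>F t in at_top. ?I - e < (\<integral>\<omega>. G 0 n (centred t \<omega>, cmax t \<omega>) \<partial>P)"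
      using order_tendstoD[OF Glim] n by simp_all
    then show "\<forall>\<^sub>F t in at_top. dist (\<integral>\<omega>. indicator {..a} (cmax t \<omega>) * H (centred t \<omega>) \<partial>P) ?I < e"
      using eventually_ge_at_top[of 0]
    proof eventually_elim
      case (elim t)
      have 1: "(\<integral>\<omega>. indicator {..a} (cmax t \<omega>) * H (centred t \<omega>) \<partial>P) \<le> (\<integral>\<omega>. G 1 n (centred t \<omega>, cmax t \<omega>) \<partial>P)"
      proof (rule integral_mono[OF pint(1) pint(2)])
        fix \<omega>
        show "indicator {..a} (cmax t \<omega>) * H (centred t \<omega>) \<le> G 1 n (centred t \<omega>, cmax t \<omega>)"
        proof (cases "cmax t \<omega> \<le> a")
          case True
          then have "real (Suc n) * (cmax t \<omega> - a) \<le> 0" by (intro mult_nonneg_nonpos) auto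
          then show ?thesis using True by (simp add: G_def)
        qed (use G01 in auto)
      qed (use elim in auto)
      have 2: "(\<integral>\<omega>. G 0 n (centred t \<omega>, cmax t \<omega>) \<partial>P) \<le> (\<integral>\<omega>. indicator {..a} (cmax t \<omega>) * H (centred t \<omega>) \<partial>P)"
      proof (rule integral_mono[OF pint(2) pint(1)])
        fix \<omega>
        show "G 0 n (centred t \<omega>, cmax t \<omega>) \<le> indicator {..a} (cmax t \<omega>) * H (centred t \<omega>)"
        proof (cases "cmax t \<omega> \<le> a")
          case True
          then show ?thesis using H01 by (simp add: G_def mult_left_le_one_le)
        next
          case False
          then have "0 \<le> real (Suc n) * (cmax t \<omega> - a)" by (intro mult_nonneg_nonneg) auto
          then have "0 - real (Suc n) * (cmax t \<omega> - a) \<le> 0" by linarith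
          then have "max 0 (min 1 (0 - real (Suc n) * (cmax t \<omega> - a))) = 0"
            by (auto simp only: max_def min_def split: if_splits)
          then show ?thesis using False unfolding G_def by simp
        qed
      qed (use elim in auto)
      show ?case using 1 2 elim unfolding dist_real_def by linarith
    qed
  qed
qed

end

section \<open>Asymptotics of the joint functionals\<close>

lemma test_fun_zero: "test_fun (\<lambda>_. 0)"
  by (auto simp: test_fun_def)

lemma point_integral_zero [simp]: "point_integral \<mu> (\<lambda>_. 0) = 0"
  by (simp add: point_integral_def)

text \<open>The \<open>F\<close> of \<open>laplace_setting\<close>: the probability, damped by
  \<open>\<phi>\<close>, that a system of age \<open>r\<close> stays below
  \<open>front r + z + q\<close>.\<close>

definition hit_fun :: "'a measure \<Rightarrow> (bool list \<Rightarrow> 'a \<Rightarrow> real) \<Rightarrow> (bool list \<Rightarrow> real \<Rightarrow> 'a \<Rightarrow> real) \<Rightarrow>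
    real \<Rightarrow> (real \<Rightarrow> real) \<Rightarrow> real \<Rightarrow> real \<Rightarrow> real" where
  "hit_fun P T B q \<phi> r z = enn2real (mckean (test_g {..q} \<phi>) P T B r (front r + z))"

definition hit_lim :: "point_measure measure \<Rightarrow> real \<Rightarrow> (real \<Rightarrow> real) \<Rightarrow> real \<Rightarrow> real" where
  "hit_lim L q \<phi> z = (\<integral>\<mu>. indicator {..z + q} (point_max \<mu>) * exp (- point_integral \<mu> (\<lambda>x. \<phi> (x - z))) \<partial>L)"

definition tau_std :: "real \<Rightarrow> (bool list \<Rightarrow> 'a \<Rightarrow> real) \<Rightarrow> real \<Rightarrow> 'a \<Rightarrow> real" where
  "tau_std \<alpha> T t \<omega> = (T [] \<omega> - (1 - \<alpha>) / sqrt 2 * t) / sqrt (t * ((1 - \<alpha>) / (4 * sqrt 2)))"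

definition pos_std :: "real \<Rightarrow> (bool list \<Rightarrow> 'a \<Rightarrow> real) \<Rightarrow> (bool list \<Rightarrow> real \<Rightarrow> 'a \<Rightarrow> real) \<Rightarrow> real \<Rightarrow> 'a \<Rightarrow> real" where
  "pos_std \<alpha> T B t \<omega> = B [] (T [] \<omega>) \<omega> - (sqrt 2 * \<alpha> * t - centering (t - T [] \<omega>))"

definition lim_z :: "point_measure measure \<Rightarrow> real \<Rightarrow> (real \<Rightarrow> real) \<Rightarrow> (real \<Rightarrow> real) \<Rightarrow> ennreal" where
  "lim_z L q \<phi> Bf = (\<integral>\<^sup>+z. ennreal (Bf (- z) * (exp (- (sqrt 2 * gam * z)) * (hit_lim L q \<phi> z)\<^sup>2)) \<partial>lborel)"

context
  fixes P :: "'a measure" and T B and L :: "point_measure measure"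
  assumes bbm: "binary_bbm P T B" and ext: "is_extremal_process P T B L"
begin

lemma mckean_eq_integral:
  assumes t: "0 \<le> t" and S: "down_set S" "S \<in> sets borel" and \<phi>: "test_fun \<phi>" "\<And>x. 0 \<le> \<phi> x"
  shows "mckean (test_g S \<phi>) P T B t c =
    ennreal (\<integral>\<omega>. indicator S (max_position T B t \<omega> - c) * exp (- point_integral (particles T B t c \<omega>) \<phi>) \<partial>P)"
proof -
  interpret P: prob_space P by (rule bbm_prob[OF bbm])
  note [measurable] = measurable_max_position[OF bbm t] S(2)
    measurable_compose[OF measurable_particles[OF bbm t] measurable_point_integral[OF \<phi>(1)]]
  have "mckean (test_g S \<phi>) P T B t c =
    (\<integral>\<^sup>+\<omega>. ennreal (indicator S (max_position T B t \<omega> - c) * exp (- point_integral (particles T B t c \<omega>) \<phi>)) \<partial>P)"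
    unfolding mckean_def by (rule nn_integral_cong) (simp add: tree_prod_test_g[OF bbm _ t S(1)])
  also have "\<dots> = ennreal (\<integral>\<omega>. indicator S (max_position T B t \<omega> - c) * exp (- point_integral (particles T B t c \<omega>) \<phi>) \<partial>P)"
  proof (rule nn_integral_eq_integral)
    show "integrable P (\<lambda>\<omega>. indicator S (max_position T B t \<omega> - c) * exp (- point_integral (particles T B t c \<omega>) \<phi>))"
      by (rule P.integrable_const_bound[where B = 1])
        (use \<phi>(2) in \<open>auto simp: indicator_def point_integral_nonneg\<close>)
  qed auto
  finally show ?thesis .
qed

text \<open>Seen from \<open>centering t + z\<close>, the particles are those seen from
  \<open>centering t\<close> moved by \<open>- z\<close>. The limit is therefore a functional of the
  extremal process with a half-line constraint on its maximum.\<close>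

lemma hit_fun_lim:
  assumes \<phi>: "test_fun \<phi>" "\<And>x. 0 \<le> \<phi> x"
  shows "((\<lambda>r. hit_fun P T B q \<phi> r z) \<longlongrightarrow> hit_lim L q \<phi> z) at_top"
proof -
  have sh: "test_fun (\<lambda>x. \<phi> (x - z))" using test_fun_shift[OF \<phi>(1), of "- z"] by simp
  have "((\<lambda>t. \<integral>\<omega>. indicator {..z + q} (max_position T B t \<omega> - centering t) *
     exp (- point_integral (particles T B t (centering t) \<omega>) (\<lambda>x. \<phi> (x - z))) \<partial>P) \<longlongrightarrow> hit_lim L q \<phi> z) at_top"
    unfolding hit_lim_def
    by (rule extremal_limit_indicator[OF bbm ext])
      (auto intro!: continuous_intros continuous_on_point_integral sh point_integral_nonneg \<phi>)
  then show ?thesis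
  proof (rule Lim_transform_eventually)
    show "\<forall>\<^sub>F t in at_top. (\<integral>\<omega>. indicator {..z + q} (max_position T B t \<omega> - centering t) *
     exp (- point_integral (particles T B t (centering t) \<omega>) (\<lambda>x. \<phi> (x - z))) \<partial>P) = hit_fun P T B q \<phi> t z"
      using eventually_ge_at_top[of 1]
    proof eventually_elim
      case (elim t)
      then have t: "0 \<le> t" by simp
      have "hit_fun P T B q \<phi> t z = (\<integral>\<omega>. indicator {..q} (max_position T B t \<omega> - (centering t + z)) *
        exp (- point_integral (particles T B t (centering t + z) \<omega>) \<phi>) \<partial>P)"
        unfolding hit_fun_def front_centering[OF elim]
        by (subst mckean_eq_integral[OF t _ _ \<phi>]) (auto intro!: enn2real_ennreal integral_nonneg_AE)
      also have "\<dots> = (\<integral>\<omega>. indicator {..z + q} (max_position T B t \<omega> - centering t) *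
         exp (- point_integral (particles T B t (centering t) \<omega>) (\<lambda>x. \<phi> (x - z))) \<partial>P)"
      proof (rule Bochner_Integration.integral_cong[OF refl])
        fix \<omega> assume "\<omega> \<in> space P"
        from alive_bbm(1)[OF bbm this, of t]
        have "point_integral (particles T B t (centering t + z) \<omega>) \<phi> = point_integral (particles T B t (centering t) \<omega>) (\<lambda>x. \<phi> (x - z))"
          by (simp add: particles_def point_integral_sum diff_diff_eq)
        moreover have "indicator {..q} (max_position T B t \<omega> - (centering t + z)) = (indicator {..z + q} (max_position T B t \<omega> - centering t) :: real)"
          by (auto simp: indicator_def)
        ultimately show "indicator {..q} (max_position T B t \<omega> - (centering t + z)) * exp (- point_integral (particles T B t (centering t + z) \<omega>) \<phi>) =
          indicator {..z + q} (max_position T B t \<omega> - centering t) * exp (- point_integral (particles T B t (centering t) \<omega>) (\<lambda>x. \<phi> (x - z)))"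
          by simp
      qed
      finally show ?case by simp
    qed
  qed
qed

lemma hit_lim_cdf: "hit_lim L 0 (\<lambda>_. 0) z = measure L {\<mu> \<in> space L. point_max \<mu> \<le> z}"
proof -
  interpret L: prob_space L by (rule L_prob[OF bbm ext])
  have [measurable]: "point_max \<in> borel_measurable L"
    using measurable_point_max[OF bbm ext] measurable_L_iff[OF bbm ext] by blast
  have "hit_lim L 0 (\<lambda>_. 0) z = (\<integral>\<mu>. indicator {\<mu> \<in> space L. point_max \<mu> \<le> z} \<mu> \<partial>L)"
    unfolding hit_lim_def by (rule Bochner_Integration.integral_cong) (auto simp: indicator_def)
  then show ?thesis by simp
qed

lemma hit_fun_cdf:
  assumes "1 \<le> t"
  shows "hit_fun P T B 0 (\<lambda>_. 0) t z = measure P {\<omega> \<in> space P. max_position T B t \<omega> \<le> centering t + z}"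
  using cdf_max_eq[OF bbm, of t "centering t + z"] assms
  by (simp add: hit_fun_def front_centering cdf_max_def[OF bbm] measure_nonneg)

text \<open>The limit defining \<open>wave\<close> exists and is the distribution function of the
  maximum under \<open>L\<close>: Bramson's theorem enters through the hypothesis on
  \<open>L\<close>.\<close>

lemma wave_eq: "wave P T B z = hit_lim L 0 (\<lambda>_. 0) z"
  unfolding wave_def
proof (rule tendsto_Lim)
  have "((\<lambda>r. hit_fun P T B 0 (\<lambda>_. 0) r z) \<longlongrightarrow> hit_lim L 0 (\<lambda>_. 0) z) at_top"
    by (rule hit_fun_lim[OF test_fun_zero]) simp
  then show "((\<lambda>t. \<P>(\<omega> in P. max_position T B t \<omega> \<le> centering t + z)) \<longlongrightarrow> hit_lim L 0 (\<lambda>_. 0) z) at_top"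
    by (rule Lim_transform_eventually)
      (use eventually_ge_at_top[of 1] in \<open>eventually_elim, simp add: hit_fun_cdf\<close>)
qed simp

text \<open>Under \<open>L\<close> the maximum is a real number, so its distribution function falls
  below 1/10 far to the left. Convergence transfers this to all large times, which is the tightness
  required by \<open>kpp_tail_bound\<close>.\<close>

lemma cdf_max_tail:
  obtains C where "0 < C" "\<And>r c. 0 < r \<Longrightarrow> cdf_max P T B r c \<le> ennreal (C * exp (2 / 5 * (c - front r)))"
proof -
  interpret L: prob_space L by (rule L_prob[OF bbm ext])
  have [measurable]: "point_max \<in> borel_measurable L"
    using measurable_point_max[OF bbm ext] measurable_L_iff[OF bbm ext] by blast
  have "(\<lambda>n. measure L {\<mu> \<in> space L. point_max \<mu> \<le> - real n}) \<longlonglongrightarrow> measure L (\<Inter>n. {\<mu> \<in> space L. point_max \<mu> \<le> - real n})"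
    by (rule L.finite_Lim_measure_decseq) (auto simp: decseq_def)
  also have "(\<Inter>n. {\<mu> \<in> space L. point_max \<mu> \<le> - real n}) = {}"
  proof -
    have "\<exists>n. \<not> point_max \<mu> \<le> - real n" for \<mu>
      using reals_Archimedean2[of "- point_max \<mu>"] by (auto simp: not_le) (metis minus_less_iff)
    then show ?thesis by auto
  qed
  finally have "(\<lambda>n. measure L {\<mu> \<in> space L. point_max \<mu> \<le> - real n}) \<longlonglongrightarrow> 0" by simp
  then have "\<forall>\<^sub>F n in sequentially. measure L {\<mu> \<in> space L. point_max \<mu> \<le> - real n} < 1 / 10"
    by (rule order_tendstoD(2)) simp
  then obtain n where n: "hit_lim L 0 (\<lambda>_. 0) (- real n) < 1 / 10"
    unfolding hit_lim_cdf eventually_sequentially by auto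
  have "\<forall>\<^sub>F r in at_top. hit_fun P T B 0 (\<lambda>_. 0) r (- real n) < 1 / 10"
    by (rule order_tendstoD(2)[OF hit_fun_lim[OF test_fun_zero] n]) simp
  then obtain r0 where r0: "\<And>r. r0 \<le> r \<Longrightarrow> hit_fun P T B 0 (\<lambda>_. 0) r (- real n) < 1 / 10"
    by (auto simp: eventually_at_top_linorder)
  show ?thesis
  proof (rule kpp_tail_bound[OF cdf_max_kpp[OF bbm], of "max r0 1" "real n"])
    show "cdf_max P T B r c \<le> cdf_max P T B r c'" if "c \<le> c'" for r c c'
      unfolding cdf_max_def[OF bbm] mckean_def tree_prod_def
      using that by (intro nn_integral_mono ennreal_prod_mono) (auto simp: test_g_def indicator_def)
    show "cdf_max P T B r (front r - real n) \<le> ennreal (1 / 10)" if "max r0 1 \<le> r" for r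
    proof -
      have "cdf_max P T B r (front r - real n) = ennreal (hit_fun P T B 0 (\<lambda>_. 0) r (- real n))"
        using that cdf_max_eq[OF bbm, of r "front r - real n"]
        by (simp add: hit_fun_cdf front_centering)
      then show ?thesis using r0[of r] that by (simp add: ennreal_leI)
    qed
  qed (use that in blast)
qed

lemma hit_fun_le_cdf:
  assumes "q \<le> 0" "\<And>x. 0 \<le> \<phi> x"
  shows "ennreal (hit_fun P T B q \<phi> r z) \<le> cdf_max P T B r (front r + z)"
proof -
  have "mckean (test_g {..q} \<phi>) P T B r (front r + z) \<le> cdf_max P T B r (front r + z)"
    unfolding cdf_max_def[OF bbm]
    by (rule mckean_mono[OF bbm]) (use assms in \<open>auto simp: test_g_def indicator_def\<close>)
  moreover have "cdf_max P T B r (front r + z) \<le> 1"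
    using cdf_max_kpp[OF bbm] by (simp add: kpp_subsolution_def)
  ultimately show ?thesis
    by (simp add: hit_fun_def) (metis ennreal_enn2real ennreal_one_less_top order_le_less_trans)
qed

lemma ennreal_hit_fun:
  assumes "\<And>x. 0 \<le> \<phi> x"
  shows "ennreal (hit_fun P T B q \<phi> r z) = mckean (test_g {..q} \<phi>) P T B r (front r + z)"
proof -
  have "mckean (test_g {..q} \<phi>) P T B r (front r + z) \<le> 1"
    by (rule mckean_le_1[OF bbm], rule test_g_le_1[OF bbm], rule assms)
  then show ?thesis
    unfolding hit_fun_def by (metis ennreal_enn2real ennreal_one_less_top order_le_less_trans)
qed

text \<open>For \<open>q \<le> 0\<close> the functional is at most the distribution function of the
  maximum, so the tail bound applies to it.\<close>

lemma hit_fun_setting: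
  assumes \<alpha>: "\<alpha> \<in> {- gam<..<1}" and \<phi>: "test_fun \<phi>" "\<And>x. 0 \<le> \<phi> x" and q: "q \<le> 0"
    and A: "A \<in> borel_measurable borel" "\<And>k. 0 \<le> A k" "\<And>k. A k \<le> 1"
    and Bf: "Bf \<in> borel_measurable borel" "\<And>k. 0 \<le> Bf k" "\<And>k. Bf k \<le> 1"
  obtains C where "laplace_setting \<alpha> (hit_fun P T B q \<phi>) (hit_lim L q \<phi>) C A Bf"
proof -
  obtain C where C: "0 < C" "\<And>r c. 0 < r \<Longrightarrow> cdf_max P T B r c \<le> ennreal (C * exp (2 / 5 * (c - front r)))"
    using cdf_max_tail by blast
  have "laplace_setting \<alpha> (hit_fun P T B q \<phi>) (hit_lim L q \<phi>) C A Bf"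
  proof
    show "(\<lambda>x. hit_fun P T B q \<phi> (fst x) (snd x)) \<in> borel_measurable (borel \<Otimes>\<^sub>M borel)"
    proof -
      have fm: "front \<in> borel_measurable borel" unfolding front_def by measurable
      have "test_g {..q} \<phi> \<in> borel_measurable borel"
        by (rule test_g_measurable) (auto intro: test_fun_measurable \<phi>)
      note mm = measurable_mckean[OF bbm this]
      have "(\<lambda>x. (fst x, front (fst x) + snd x)) \<in> (borel \<Otimes>\<^sub>M borel) \<rightarrow>\<^sub>M (borel \<Otimes>\<^sub>M borel)"
        using measurable_compose[OF measurable_fst fm] by measurable
      from measurable_compose[OF this mm]
      have "(\<lambda>x. mckean (test_g {..q} \<phi>) P T B (fst x) (front (fst x) + snd x)) \<in> borel_measurable (borel \<Otimes>\<^sub>M borel)"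
        by simp
      then show ?thesis unfolding hit_fun_def by measurable
    qed
    show "hit_fun P T B q \<phi> r z \<le> 1" for r z
    proof -
      have "ennreal (hit_fun P T B q \<phi> r z) \<le> 1"
        unfolding ennreal_hit_fun[OF \<phi>(2)] by (rule mckean_le_1[OF bbm], rule test_g_le_1[OF bbm], rule \<phi>(2))
      then show ?thesis by simp
    qed
    show "hit_fun P T B q \<phi> r z \<le> C * exp (2 / 5 * z)" if "0 < r" for r z
    proof -
      have "ennreal (hit_fun P T B q \<phi> r z) \<le> ennreal (C * exp (2 / 5 * z))"
        using order_trans[OF hit_fun_le_cdf[OF q \<phi>(2)] C(2)[OF that, of "front r + z"]] by simp
      then show ?thesis using C(1) by simp
    qed
    show "((\<lambda>r. hit_fun P T B q \<phi> r z) \<longlongrightarrow> hit_lim L q \<phi> z) at_top" for z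
      by (rule hit_fun_lim[OF \<phi>])
  qed (use \<alpha> C(1) A Bf in \<open>auto simp: hit_fun_def\<close>)
  then show ?thesis by (rule that)
qed


lemma measurable_tau_std: "tau_std \<alpha> T t \<in> borel_measurable P"
  unfolding tau_std_def using bbm_T_measurable[OF bbm] by measurable

lemma measurable_pos_std: "pos_std \<alpha> T B t \<in> borel_measurable P"
proof -
  note [measurable] = bbm_T_measurable[OF bbm] measurable_B_T[OF bbm]
  have [measurable]: "centering \<in> borel_measurable borel" unfolding centering_def by measurable
  show ?thesis unfolding pos_std_def by measurable
qed

text \<open>The decomposition at the first branching gives \<open>branch_int\<close>, to which
  \<open>laplace_limit_pair\<close> applies, plus the contribution of no branching before
  \<open>t\<close>, which is of smaller order. The limit factorises into an integral over
  \<open>k\<close> and one over \<open>z\<close>: this is the source of the independence of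
  \<open>\<xi>\<close>.\<close>

theorem class_limit:
  assumes \<alpha>: "\<alpha> \<in> {- gam<..<1}" and \<phi>: "test_fun \<phi>" "\<And>x. 0 \<le> \<phi> x" and q: "q \<le> 0"
    and A: "A \<in> borel_measurable borel" "\<And>k. 0 \<le> A k" "\<And>k. A k \<le> 1"
    and Bf: "Bf \<in> borel_measurable borel" "\<And>k. 0 \<le> Bf k" "\<And>k. Bf k \<le> 1"
  shows "((\<lambda>t. ennreal ((\<integral>\<omega>. A (tau_std \<alpha> T t \<omega>) * Bf (pos_std \<alpha> T B t \<omega>) *
      (indicator {..q} (max_position T B t \<omega> - sqrt 2 * \<alpha> * t) *
        exp (- point_integral (particles T B t (sqrt 2 * \<alpha> * t) \<omega>) \<phi>)) \<partial>P) / main_rate \<alpha> t)) \<longlongrightarrow>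
    ennreal (1 / 2) * (\<integral>\<^sup>+k. ennreal (std_normal_density k * A k) \<partial>lborel) * lim_z L q \<phi> Bf) at_top"
    and "lim_z L q \<phi> Bf < \<infinity>"
proof -
  interpret P: prob_space P by (rule bbm_prob[OF bbm])
  obtain C where "laplace_setting \<alpha> (hit_fun P T B q \<phi>) (hit_lim L q \<phi>) C A Bf"
    by (rule hit_fun_setting[OF \<alpha> \<phi> q A Bf])
  then interpret laplace_setting \<alpha> "hit_fun P T B q \<phi>" "hit_lim L q \<phi>" C A Bf .
  have hitC: "hit_lim L q \<phi> z \<le> C * exp (2 / 5 * z)" for z
  proof (rule tendsto_upperbound[OF F_lim])
    show "\<forall>\<^sub>F r in at_top. hit_fun P T B q \<phi> r z \<le> C * exp (2 / 5 * z)"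
      using eventually_gt_at_top[of 0] by eventually_elim (rule F)
  qed simp
  show fin: "lim_z L q \<phi> Bf < \<infinity>"
  proof -
    have "lim_z L q \<phi> Bf \<le> (\<integral>\<^sup>+z. ennreal (1 + C\<^sup>2) * ennreal (exp (- \<bar>z\<bar> / 10)) \<partial>lborel)"
      unfolding lim_z_def
    proof (rule nn_integral_mono)
      fix z
      have "Bf (- z) * (exp (- (sqrt 2 * gam * z)) * (hit_lim L q \<phi> z)\<^sup>2) \<le> 1 * ((1 + C\<^sup>2) * exp (- \<bar>z\<bar> / 5))"
        using B Finf hitC C by (intro mult_mono kernel_tail_weight) auto
      also have "\<dots> \<le> (1 + C\<^sup>2) * exp (- \<bar>z\<bar> / 10)" by (simp add: add_pos_nonneg)
      finally show "ennreal (Bf (- z) * (exp (- (sqrt 2 * gam * z)) * (hit_lim L q \<phi> z)\<^sup>2)) \<le> ennreal (1 + C\<^sup>2) * ennreal (exp (- \<bar>z\<bar> / 10))"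
        by (subst ennreal_mult[symmetric]) (auto intro: ennreal_leI)
    qed
    also have "\<dots> < \<infinity>"
      using nn_integral_exp_abs by (simp add: nn_integral_cmult ennreal_mult_less_top)
    finally show ?thesis .
  qed
  have g: "test_g {..q} \<phi> \<in> borel_measurable borel"
    by (rule test_g_measurable) (auto intro: test_fun_measurable \<phi>)
  have limv: "(\<integral>\<^sup>+x. ennreal (lim_fun x) \<partial>(lborel \<Otimes>\<^sub>M lborel)) =
      ennreal (1 / 2) * (\<integral>\<^sup>+k. ennreal (std_normal_density k * A k) \<partial>lborel) * lim_z L q \<phi> Bf"
  proof -
    have "(\<integral>\<^sup>+x. ennreal (lim_fun x) \<partial>(lborel \<Otimes>\<^sub>M lborel)) = (\<integral>\<^sup>+k. \<integral>\<^sup>+z. ennreal (lim_fun (k, z)) \<partial>lborel \<partial>lborel)"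
      by (rule lborel.nn_integral_fst[symmetric]) (simp add: lim_fun_def)
    also have "\<dots> = (\<integral>\<^sup>+k. \<integral>\<^sup>+z. ennreal (1 / 2) * ennreal (std_normal_density k * A k) *
        ennreal (Bf (- z) * (exp (- (sqrt 2 * gam * z)) * (hit_lim L q \<phi> z)\<^sup>2)) \<partial>lborel \<partial>lborel)"
    proof (intro nn_integral_cong)
      fix k z
      have "0 \<le> std_normal_density k * A k" "0 \<le> Bf (- z) * (exp (- (sqrt 2 * gam * z)) * (hit_lim L q \<phi> z)\<^sup>2)"
        using A B by simp_all
      then show "ennreal (lim_fun (k, z)) = ennreal (1 / 2) * ennreal (std_normal_density k * A k) *
        ennreal (Bf (- z) * (exp (- (sqrt 2 * gam * z)) * (hit_lim L q \<phi> z)\<^sup>2))"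
        unfolding lim_fun_def fst_conv snd_conv by (simp only: ennreal_mult'')
    qed
    also have "\<dots> = (\<integral>\<^sup>+k. ennreal (1 / 2) * ennreal (std_normal_density k * A k) * lim_z L q \<phi> Bf \<partial>lborel)"
      unfolding lim_z_def by (intro nn_integral_cong nn_integral_cmult) measurable
    also have "\<dots> = ennreal (1 / 2) * (\<integral>\<^sup>+k. ennreal (std_normal_density k * A k) \<partial>lborel) * lim_z L q \<phi> Bf"
      by (subst nn_integral_multc, measurable, subst nn_integral_cmult, measurable)
    finally show ?thesis .
  qed
  define f where "f t \<omega> = A (tau_std \<alpha> T t \<omega>) * Bf (pos_std \<alpha> T B t \<omega>) *
      (indicator {..q} (max_position T B t \<omega> - sqrt 2 * \<alpha> * t) *
        exp (- point_integral (particles T B t (sqrt 2 * \<alpha> * t) \<omega>) \<phi>))" for t \<omega>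
  let ?tp = "\<lambda>t. tree_prod (test_g {..q} \<phi>) T B t (sqrt 2 * \<alpha> * t)"
  let ?AB = "\<lambda>t \<omega>. ennreal (A (tau_std \<alpha> T t \<omega>) * Bf (pos_std \<alpha> T B t \<omega>))"
  have decomp: "ennreal (\<integral>\<omega>. f t \<omega> \<partial>P) = branch_int t + (\<integral>\<^sup>+\<omega>. ?AB t \<omega> * indicator {t<..} (T [] \<omega>) * ?tp t \<omega> \<partial>P)"
    if t: "0 < t" for t
  proof -
    have t0: "0 \<le> t" using t by simp
    note [measurable] = measurable_max_position[OF bbm t0] measurable_tau_std measurable_pos_std bbm_T_measurable[OF bbm]
      measurable_compose[OF measurable_particles[OF bbm t0] measurable_point_integral[OF \<phi>(1)]]
      measurable_tree_prod_fixed[OF bbm g]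
    have f01: "0 \<le> f t \<omega>" "f t \<omega> \<le> 1" for \<omega>
      unfolding f_def using A B \<phi>(2)
      by (auto intro!: mult_nonneg_nonneg mult_le_one point_integral_nonneg simp: indicator_def)
    have "ennreal (\<integral>\<omega>. f t \<omega> \<partial>P) = (\<integral>\<^sup>+\<omega>. ennreal (f t \<omega>) \<partial>P)"
    proof (rule nn_integral_eq_integral[symmetric])
      have "f t \<in> borel_measurable P" unfolding f_def by measurable
      then show "integrable P (f t)"
        by (intro P.integrable_const_bound[where B = 1]) (use f01 in auto)
    qed (use f01 in auto)
    also have "\<dots> = (\<integral>\<^sup>+\<omega>. ?AB t \<omega> * indicator {..t} (T [] \<omega>) * ?tp t \<omega> + ?AB t \<omega> * indicator {t<..} (T [] \<omega>) * ?tp t \<omega> \<partial>P)"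
    proof (rule nn_integral_cong)
      fix \<omega> assume "\<omega> \<in> space P"
      then have "ennreal (f t \<omega>) = ?AB t \<omega> * ?tp t \<omega>"
        by (simp add: f_def tree_prod_test_g[OF bbm _ t0] ennreal_mult A B)
      then show "ennreal (f t \<omega>) = ?AB t \<omega> * indicator {..t} (T [] \<omega>) * ?tp t \<omega> + ?AB t \<omega> * indicator {t<..} (T [] \<omega>) * ?tp t \<omega>"
        by (auto split: split_indicator)
    qed
    also have "\<dots> = (\<integral>\<^sup>+\<omega>. ?AB t \<omega> * indicator {..t} (T [] \<omega>) * ?tp t \<omega> \<partial>P) +
       (\<integral>\<^sup>+\<omega>. ?AB t \<omega> * indicator {t<..} (T [] \<omega>) * ?tp t \<omega> \<partial>P)"
      by (rule nn_integral_add) measurable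
    also have "(\<integral>\<^sup>+\<omega>. ?AB t \<omega> * indicator {..t} (T [] \<omega>) * ?tp t \<omega> \<partial>P) = branch_int t"
    proof -
      define a where "a x = ennreal (A ((fst x - lam * t) / scl t) * Bf (snd x - (sqrt 2 * \<alpha> * t - centering (t - fst x))))" for x :: "real \<times> real"
      have am: "a \<in> borel_measurable (borel \<Otimes>\<^sub>M borel)" unfolding a_def by measurable
      have "?AB t \<omega> = a (T [] \<omega>, B [] (T [] \<omega>) \<omega>)" for \<omega>
      proof -
        have "scl t = sqrt (t * ((1 - \<alpha>) / (4 * sqrt 2)))" by (simp add: scl_def lam_def mult.commute)
        then show ?thesis unfolding a_def tau_std_def pos_std_def fst_conv snd_conv lam_def by (simp only:)
      qed
      then have "(\<integral>\<^sup>+\<omega>. ?AB t \<omega> * indicator {..t} (T [] \<omega>) * ?tp t \<omega> \<partial>P) =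
         (\<integral>\<^sup>+s. ennreal (exponential_density 1 s) * (\<integral>\<^sup>+y. ennreal (heat s y) *
          (a (s, y) * indicator {..t} s * (mckean (test_g {..q} \<phi>) P T B (t - s) (sqrt 2 * \<alpha> * t - y))\<^sup>2) \<partial>lborel) \<partial>lborel)"
        using branching_decomposition[OF bbm g am, of t "sqrt 2 * \<alpha> * t"] by simp
      also have "\<dots> = branch_int t"
        unfolding branch_int_def a_def ennreal_hit_fun[OF \<phi>(2)] by simp
      finally show ?thesis .
    qed
    finally show ?thesis .
  qed
  \<comment> \<open>The Chernoff bound with the tilt \<open>sqrt 2 * gam\<close> gives the
    exponential rate of \<open>main_rate\<close> without its growing power of
    \<open>t\<close>.\<close>
  have rest: "(\<integral>\<^sup>+\<omega>. ?AB t \<omega> * indicator {t<..} (T [] \<omega>) * ?tp t \<omega> \<partial>P) \<le> ennreal (exp (- (2 * gam * (1 - \<alpha>) * t)))"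
    if t: "0 < t" for t
  proof -
    have "(\<integral>\<^sup>+\<omega>. ?AB t \<omega> * indicator {t<..} (T [] \<omega>) * ?tp t \<omega> \<partial>P) \<le> (\<integral>\<^sup>+\<omega>. indicator {t<..} (T [] \<omega>) * ?tp t \<omega> \<partial>P)"
    proof (intro nn_integral_mono mult_right_mono)
      fix \<omega>
      have "?AB t \<omega> \<le> 1" using A B by (simp add: ennreal_le_1 mult_le_one)
      then show "?AB t \<omega> * indicator {t<..} (T [] \<omega>) \<le> indicator {t<..} (T [] \<omega>)"
        by (auto split: split_indicator)
    qed simp
    also have "\<dots> = ennreal (exp (- t)) * (\<integral>\<^sup>+y. ennreal (heat t y) * test_g {..q} \<phi> (y - sqrt 2 * \<alpha> * t) \<partial>lborel)"
      by (rule no_branching[OF bbm g t])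
    also have "\<dots> \<le> ennreal (exp (- t)) * (\<integral>\<^sup>+y. ennreal (heat t y) * ennreal (exp ((sqrt 2 * gam) * (sqrt 2 * \<alpha> * t - y))) \<partial>lborel)"
    proof (intro mult_left_mono nn_integral_mono)
      fix y
      show "test_g {..q} \<phi> (y - sqrt 2 * \<alpha> * t) \<le> ennreal (exp ((sqrt 2 * gam) * (sqrt 2 * \<alpha> * t - y)))"
      proof (cases "y - sqrt 2 * \<alpha> * t \<le> q")
        case True
        have "0 \<le> (sqrt 2 * gam) * (sqrt 2 * \<alpha> * t - y)"
          using True q sqrt2_bounds by (intro mult_nonneg_nonneg) (auto simp: gam_def)
        then have "1 \<le> ennreal (exp ((sqrt 2 * gam) * (sqrt 2 * \<alpha> * t - y)))" by (simp add: ennreal_ge_1)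
        with test_g_le_1[OF bbm \<phi>(2)] show ?thesis by (rule order_trans)
      qed (simp add: test_g_def)
    qed auto
    also have "\<dots> = ennreal (exp (- t)) * ennreal (exp ((sqrt 2 * gam) * (sqrt 2 * \<alpha> * t) + (sqrt 2 * gam)\<^sup>2 * t / 2))"
      by (simp only: nn_integral_heat_tilt[OF t])
    also have "\<dots> = ennreal (exp (- (2 * gam * (1 - \<alpha>) * t)))"
    proof -
      \<comment> \<open>\<open>gam\<close> is the positive root of
        \<open>x\<^sup>2 + 2 * x = 1\<close>, so
        \<open>- 1 + (sqrt 2 * gam)\<^sup>2 / 2 = - 2 * gam\<close>.\<close>
      have "- t + ((sqrt 2 * gam) * (sqrt 2 * \<alpha> * t) + (sqrt 2 * gam)\<^sup>2 * t / 2) = - (2 * gam * (1 - \<alpha>) * t)"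
      proof -
        have s2: "sqrt 2 * sqrt 2 = (2::real)" by simp
        have "gam\<^sup>2 = 1 - 2 * gam" by (simp add: gam_def power2_eq_square algebra_simps)
        then have "(sqrt 2 * gam)\<^sup>2 * t / 2 = (1 - 2 * gam) * t" by (simp add: power_mult_distrib)
        moreover have "(sqrt 2 * gam) * (sqrt 2 * \<alpha> * t) = 2 * gam * \<alpha> * t"
          using s2 by (simp add: mult_ac)
        ultimately show ?thesis by (simp add: algebra_simps)
      qed
      then show ?thesis by (simp flip: ennreal_mult exp_add)
    qed
    finally show ?thesis .
  qed
  have restlim: "((\<lambda>t. (\<integral>\<^sup>+\<omega>. ?AB t \<omega> * indicator {t<..} (T [] \<omega>) * ?tp t \<omega> \<partial>P) / ennreal (main_rate \<alpha> t)) \<longlongrightarrow> 0) at_top"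
  proof (rule tendsto_sandwich[OF _ _ tendsto_const])
    have "((\<lambda>t. (vel * t) powr (- (3 * gam / 2))) \<longlongrightarrow> 0) at_top"
    proof (rule tendsto_neg_powr)
      show "- (3 * gam / 2) < 0" using sqrt2_bounds by (simp add: gam_def)
      show "filterlim (\<lambda>t. vel * t) at_top at_top"
        using lam_vel by (intro filterlim_tendsto_pos_mult_at_top[OF tendsto_const _ filterlim_ident])
    qed
    from tendsto_ennrealI[OF this]
    show "((\<lambda>t. ennreal ((vel * t) powr (- (3 * gam / 2)))) \<longlongrightarrow> 0) at_top" by simp
    show "\<forall>\<^sub>F t in at_top. (\<integral>\<^sup>+\<omega>. ?AB t \<omega> * indicator {t<..} (T [] \<omega>) * ?tp t \<omega> \<partial>P) / ennreal (main_rate \<alpha> t)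
      \<le> ennreal ((vel * t) powr (- (3 * gam / 2)))"
      using eventually_gt_at_top[of 0]
    proof eventually_elim
      case (elim t)
      have m: "0 < main_rate \<alpha> t" using elim lam_vel by (simp add: main_rate_vel)
      have "(\<integral>\<^sup>+\<omega>. ?AB t \<omega> * indicator {t<..} (T [] \<omega>) * ?tp t \<omega> \<partial>P) / ennreal (main_rate \<alpha> t) \<le>
        ennreal (exp (- (2 * gam * (1 - \<alpha>) * t))) / ennreal (main_rate \<alpha> t)"
        by (rule divide_right_mono_ennreal[OF rest[OF elim]])
      also have "\<dots> = ennreal (exp (- (2 * gam * (1 - \<alpha>) * t)) / main_rate \<alpha> t)"
        using m by (simp add: divide_ennreal)
      also have "exp (- (2 * gam * (1 - \<alpha>) * t)) / main_rate \<alpha> t = (vel * t) powr (- (3 * gam / 2))"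
        using elim lam_vel by (simp add: main_rate_vel powr_minus inverse_eq_divide)
      finally show ?case .
    qed
  qed auto
  have "((\<lambda>t. branch_int t / ennreal (main_rate \<alpha> t) + (\<integral>\<^sup>+\<omega>. ?AB t \<omega> * indicator {t<..} (T [] \<omega>) * ?tp t \<omega> \<partial>P) / ennreal (main_rate \<alpha> t))
    \<longlongrightarrow> (\<integral>\<^sup>+x. ennreal (lim_fun x) \<partial>(lborel \<Otimes>\<^sub>M lborel)) + 0) at_top"
    by (rule tendsto_add[OF laplace_limit_pair restlim])
  then have "((\<lambda>t. branch_int t / ennreal (main_rate \<alpha> t) + (\<integral>\<^sup>+\<omega>. ?AB t \<omega> * indicator {t<..} (T [] \<omega>) * ?tp t \<omega> \<partial>P) / ennreal (main_rate \<alpha> t))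
    \<longlongrightarrow> ennreal (1 / 2) * (\<integral>\<^sup>+k. ennreal (std_normal_density k * A k) \<partial>lborel) * lim_z L q \<phi> Bf) at_top"
    by (simp add: limv)
  then show "((\<lambda>t. ennreal ((\<integral>\<omega>. A (tau_std \<alpha> T t \<omega>) * Bf (pos_std \<alpha> T B t \<omega>) *
      (indicator {..q} (max_position T B t \<omega> - sqrt 2 * \<alpha> * t) *
        exp (- point_integral (particles T B t (sqrt 2 * \<alpha> * t) \<omega>) \<phi>)) \<partial>P) / main_rate \<alpha> t)) \<longlongrightarrow>
    ennreal (1 / 2) * (\<integral>\<^sup>+k. ennreal (std_normal_density k * A k) \<partial>lborel) * lim_z L q \<phi> Bf) at_top"
  proof (rule Lim_transform_eventually)
    show "\<forall>\<^sub>F t in at_top. branch_int t / ennreal (main_rate \<alpha> t) + (\<integral>\<^sup>+\<omega>. ?AB t \<omega> * indicator {t<..} (T [] \<omega>) * ?tp t \<omega> \<partial>P) / ennreal (main_rate \<alpha> t) =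
      ennreal ((\<integral>\<omega>. A (tau_std \<alpha> T t \<omega>) * Bf (pos_std \<alpha> T B t \<omega>) *
      (indicator {..q} (max_position T B t \<omega> - sqrt 2 * \<alpha> * t) *
        exp (- point_integral (particles T B t (sqrt 2 * \<alpha> * t) \<omega>) \<phi>)) \<partial>P) / main_rate \<alpha> t)"
      using eventually_gt_at_top[of 0]
    proof eventually_elim
      case (elim t)
      have m: "0 < main_rate \<alpha> t" using elim lam_vel by (simp add: main_rate_vel)
      have "0 \<le> (\<integral>\<omega>. f t \<omega> \<partial>P)"
        unfolding f_def by (intro integral_nonneg_AE AE_I2) (auto simp: A B intro!: mult_nonneg_nonneg)
      then have "ennreal ((\<integral>\<omega>. f t \<omega> \<partial>P) / main_rate \<alpha> t) = ennreal (\<integral>\<omega>. f t \<omega> \<partial>P) / ennreal (main_rate \<alpha> t)"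
        using m by (simp add: divide_ennreal)
      then show ?case
        unfolding f_def[symmetric] decomp[OF elim] by (simp add: add_divide_distrib_ennreal)
    qed
  qed
qed

end

section \<open>A multiplicative class of observables\<close>

type_synonym obs = "real \<times> real \<times> real \<times> point_measure"

definition base_fun :: "real set \<Rightarrow> real set \<Rightarrow> real set \<Rightarrow> (real \<Rightarrow> real) \<Rightarrow> obs \<Rightarrow> real" where
  "base_fun A D S \<phi> y = indicator A (fst y) * indicator D (fst (snd y)) *
     (indicator S (fst (snd (snd y))) * exp (- point_integral (snd (snd (snd y))) \<phi>))"

text \<open>All Borel sets are allowed for the first two coordinates, because
  \<open>class_limit\<close> holds for measurable weights. The maximum enters through half-lines, a
  family stable under intersection, and the process through Laplace functionals, whose exponents
  add.\<close>

definition base_class :: "(obs \<Rightarrow> real) set" where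
  "base_class = {base_fun A D S \<phi> | A D S \<phi>. A \<in> sets borel \<and> D \<in> sets borel \<and>
     S \<in> insert UNIV (range atMost) \<and> test_fun \<phi> \<and> (\<forall>x. 0 \<le> \<phi> x)}"

lemma base_fun_in:
  "A \<in> sets borel \<Longrightarrow> D \<in> sets borel \<Longrightarrow> S \<in> insert UNIV (range atMost) \<Longrightarrow> test_fun \<phi> \<Longrightarrow> (\<And>x. 0 \<le> \<phi> x) \<Longrightarrow>
    base_fun A D S \<phi> \<in> base_class"
  unfolding base_class_def by blast

lemma base_fun_bounds: "(\<And>x. 0 \<le> \<phi> x) \<Longrightarrow> 0 \<le> base_fun A D S \<phi> y \<and> base_fun A D S \<phi> y \<le> 1"
  by (auto simp: base_fun_def indicator_def point_integral_nonneg)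

lemma base_class_bounded: "g \<in> base_class \<Longrightarrow> \<exists>K. \<forall>x. \<bar>g x\<bar> \<le> K"
proof -
  assume "g \<in> base_class"
  then obtain A D S \<phi> where "g = base_fun A D S \<phi>" "\<forall>x. 0 \<le> \<phi> x" unfolding base_class_def by blast
  then show ?thesis using base_fun_bounds[of \<phi> A D S] by (intro exI[of _ 1]) auto
qed

lemma base_fun_measurable:
  assumes [measurable]: "A \<in> sets borel" "D \<in> sets borel" "S \<in> sets borel" and \<phi>: "test_fun \<phi>"
  shows "base_fun A D S \<phi> \<in> borel_measurable borel"
proof -
  note [measurable] = measurable_point_integral[OF \<phi>]
  have "base_fun A D S \<phi> \<in> borel_measurable (borel \<Otimes>\<^sub>M borel \<Otimes>\<^sub>M borel \<Otimes>\<^sub>M borel)"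
    unfolding base_fun_def by measurable
  then show ?thesis by (simp add: borel_prod)
qed

lemma base_class_measurable: "g \<in> base_class \<Longrightarrow> g \<in> borel_measurable borel"
  unfolding base_class_def by (auto intro!: base_fun_measurable)

lemma base_fun_mult:
  assumes "test_fun \<phi>" "test_fun \<psi>"
  shows "base_fun A D S \<phi> y * base_fun A' D' S' \<psi> y = base_fun (A \<inter> A') (D \<inter> D') (S \<inter> S') (\<lambda>x. \<phi> x + \<psi> x) y"
  by (simp add: base_fun_def indicator_inter_arith point_integral_add[OF assms] exp_add[symmetric] mult_ac exp_diff)

lemma base_class_mult:
  assumes "f \<in> base_class" "g \<in> base_class"
  shows "(\<lambda>y. f y * g y) \<in> base_class"
proof -
  obtain A D S \<phi> where f: "f = base_fun A D S \<phi>" "A \<in> sets borel" "D \<in> sets borel" "S \<in> insert UNIV (range atMost)"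
    "test_fun \<phi>" "\<forall>x. 0 \<le> \<phi> x"
    using assms(1) unfolding base_class_def by blast
  obtain A' D' S' \<psi> where g: "g = base_fun A' D' S' \<psi>" "A' \<in> sets borel" "D' \<in> sets borel" "S' \<in> insert UNIV (range atMost)"
    "test_fun \<psi>" "\<forall>x. 0 \<le> \<psi> x"
    using assms(2) unfolding base_class_def by blast
  have "S \<inter> S' \<in> insert UNIV (range atMost)"
    using f(4) g(4) by (auto simp: Int_atMost)
  then have "base_fun (A \<inter> A') (D \<inter> D') (S \<inter> S') (\<lambda>x. \<phi> x + \<psi> x) \<in> base_class"
    using f g by (intro base_fun_in test_fun_add) auto
  then show ?thesis using base_fun_mult[OF f(5) g(5)] by (simp add: f(1) g(1))
qed

lemma base_closure_mult:
  "f \<in> fun_closure base_class \<Longrightarrow> g \<in> fun_closure base_class \<Longrightarrow> (\<lambda>y. f y * g y) \<in> fun_closure base_class"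
  by (rule fun_closure_mult[OF base_class_bounded base_class_mult])

lemma base_fun_one: "base_fun UNIV UNIV UNIV (\<lambda>_. 0) = (\<lambda>_. 1)"
  by (rule ext) (simp add: base_fun_def point_integral_def)

lemma const_one_closure: "(\<lambda>_. 1) \<in> fun_closure base_class"
  unfolding base_fun_one[symmetric]
  by (intro fun_closure.base base_fun_in) (auto simp: test_fun_def)

text \<open>Induction over the generation of the topology from the subbasis. The value 1 is reached
  on a whole neighbourhood of \<open>\<mu>\<close>, not only at \<open>\<mu>\<close>, so that
  countably many bumps can later be extracted from a covering.\<close>

lemma point_measure_bump:
  assumes "generate_topology pm_basis U" "\<mu> \<in> U"
  shows "\<exists>g\<in>fun_closure base_class. (\<forall>y. 0 \<le> g y \<and> g y \<le> 1 \<and> (g y \<noteq> 0 \<longrightarrow> snd (snd (snd y)) \<in> U)) \<and>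
    (\<exists>V. open V \<and> \<mu> \<in> V \<and> (\<forall>y. snd (snd (snd y)) \<in> V \<longrightarrow> g y = 1))"
  using assms
proof induction
  case UNIV
  show ?case by (rule bexI[OF _ const_one_closure]) auto
next
  case (Int a b)
  obtain g V where g: "g \<in> fun_closure base_class" "\<forall>y. 0 \<le> g y \<and> g y \<le> 1 \<and> (g y \<noteq> 0 \<longrightarrow> snd (snd (snd y)) \<in> a)"
    "open V" "\<mu> \<in> V" "\<forall>y. snd (snd (snd y)) \<in> V \<longrightarrow> g y = 1"
    using Int by auto
  obtain h W where h: "h \<in> fun_closure base_class" "\<forall>y. 0 \<le> h y \<and> h y \<le> 1 \<and> (h y \<noteq> 0 \<longrightarrow> snd (snd (snd y)) \<in> b)"
    "open W" "\<mu> \<in> W" "\<forall>y. snd (snd (snd y)) \<in> W \<longrightarrow> h y = 1"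
    using Int by auto
  have gy: "0 \<le> g y" "g y \<le> 1" "g y \<noteq> 0 \<Longrightarrow> snd (snd (snd y)) \<in> a" for y
    using g(2)[rule_format, of y] by blast+
  have hy: "0 \<le> h y" "h y \<le> 1" "h y \<noteq> 0 \<Longrightarrow> snd (snd (snd y)) \<in> b" for y
    using h(2)[rule_format, of y] by blast+
  show ?case
  proof (intro bexI[of _ "\<lambda>y. g y * h y"] conjI allI exI[of _ "V \<inter> W"] base_closure_mult impI)
    fix y
    show "0 \<le> g y * h y" using gy(1) hy(1) by (rule mult_nonneg_nonneg)
    show "g y * h y \<le> 1" using gy hy by (intro mult_le_one)
    show "snd (snd (snd y)) \<in> a \<inter> b" if "g y * h y \<noteq> 0" using gy(3)[of y] hy(3)[of y] that by simp
    show "g y * h y = 1" if "snd (snd (snd y)) \<in> V \<inter> W"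
      using that g(5)[rule_format, of y] h(5)[rule_format, of y] by simp
  qed (use g h in auto)
next
  case (UN K)
  then obtain k where k: "k \<in> K" "\<mu> \<in> k" by auto
  obtain g where g: "g \<in> fun_closure base_class" "\<forall>y. 0 \<le> g y \<and> g y \<le> 1 \<and> (g y \<noteq> 0 \<longrightarrow> snd (snd (snd y)) \<in> k)"
    "\<exists>V. open V \<and> \<mu> \<in> V \<and> (\<forall>y. snd (snd (snd y)) \<in> V \<longrightarrow> g y = 1)"
    using UN.IH[OF k] by blast
  show ?case using g k by (intro bexI[OF _ g(1)]) blast
next
  case (Basis s)
  then obtain i a b where s: "s = (\<lambda>\<mu>. point_integral \<mu> (bern_fun i)) -` {real_of_rat a<..<real_of_rat b}"
    by (auto simp: pm_basis_def)
  define f where "f = base_fun UNIV UNIV UNIV (bern_fun i)"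
  have fe: "f y = exp (- point_integral (snd (snd (snd y))) (bern_fun i))" for y
    by (simp add: f_def base_fun_def)
  have f: "f \<in> fun_closure base_class"
    unfolding f_def by (intro fun_closure.base base_fun_in test_fun_bern_fun bern_fun_nonneg) auto
  have f01: "0 \<le> f y" "f y \<le> 1" for y
    using base_fun_bounds[OF bern_fun_nonneg] by (auto simp: f_def)
  define v0 where "v0 = exp (- point_integral \<mu> (bern_fun i))"
  \<comment> \<open>The decreasing map \<open>exp (- x)\<close> reverses the interval with ends
    \<open>a\<close> and \<open>b\<close>; \<open>\<eta>\<close> is the distance from
    \<open>v0\<close> to the nearer transformed end.\<close>
  define \<eta> where "\<eta> = min (v0 - exp (- real_of_rat b)) (exp (- real_of_rat a) - v0)"
  have \<eta>: "0 < \<eta>" using Basis by (simp add: \<eta>_def v0_def s)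
  have close: "\<nu> \<in> s" if "\<bar>exp (- point_integral \<nu> (bern_fun i)) - v0\<bar> < \<eta>" for \<nu>
  proof -
    have "exp (- real_of_rat b) < exp (- point_integral \<nu> (bern_fun i))"
      "exp (- point_integral \<nu> (bern_fun i)) < exp (- real_of_rat a)"
      using that unfolding \<eta>_def by linarith+
    then show ?thesis by (simp add: s)
  qed
  \<comment> \<open>A plateau of height 1 within \<open>\<eta> / 2\<close> of \<open>v0\<close>, and
    0 from distance \<open>\<eta>\<close> on.\<close>
  define \<psi> where "\<psi> v = max 0 (min 1 (2 - 2 * \<bar>v - v0\<bar> / \<eta>))" for v
  have \<psi>: "continuous_on {0..1} \<psi>" unfolding \<psi>_def using \<eta> by (intro continuous_intros) auto
  define g where "g y = 1 * \<psi> (f y)" for y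
  have gcl: "g \<in> fun_closure base_class"
    unfolding g_def
    by (rule fun_closure_compose[OF base_class_bounded base_class_mult f f01 const_one_closure \<psi>])
  define V where "V = {\<nu>. \<bar>exp (- point_integral \<nu> (bern_fun i)) - v0\<bar> < \<eta> / 2}"
  have V1: "open V"
    unfolding V_def
    by (intro open_Collect_less continuous_intros continuous_on_point_integral test_fun_bern_fun)
  have V2: "\<mu> \<in> V" using \<eta> by (simp add: V_def v0_def)
  have V3: "g y = 1" if "snd (snd (snd y)) \<in> V" for y
  proof -
    have "2 * \<bar>f y - v0\<bar> / \<eta> \<le> 1" using that \<eta> by (simp add: V_def fe field_simps)
    then show ?thesis by (simp add: g_def \<psi>_def)
  qed
  have g3: "0 \<le> g y \<and> g y \<le> 1 \<and> (g y \<noteq> 0 \<longrightarrow> snd (snd (snd y)) \<in> s)" for y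
  proof -
    have "snd (snd (snd y)) \<in> s" if "g y \<noteq> 0"
    proof (rule close)
      have "2 * \<bar>f y - v0\<bar> / \<eta> < 2" using that by (simp add: g_def \<psi>_def max_def min_def split: if_splits)
      then show "\<bar>exp (- point_integral (snd (snd (snd y))) (bern_fun i)) - v0\<bar> < \<eta>"
        using \<eta> by (simp add: fe field_simps)
    qed
    then show ?thesis by (simp add: g_def \<psi>_def)
  qed
  show ?case
    by (intro bexI[OF _ gcl] conjI allI exI[of _ V] impI V1 V2 V3) (simp_all add: g3)
qed

text \<open>Bumps multiply over coordinates: indicators of open sets for the first two, an interval
  for the maximum, and \<open>point_measure_bump\<close> for the process.\<close>

lemma obs_bump:
  assumes G: "open (G :: obs set)" and y0: "y0 \<in> G"
  shows "\<exists>g\<in>fun_closure base_class. (\<forall>y. 0 \<le> g y \<and> g y \<le> 1 \<and> (g y \<noteq> 0 \<longrightarrow> y \<in> G)) \<and>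
    (\<exists>W. open W \<and> y0 \<in> W \<and> (\<forall>y\<in>W. g y = 1))"
proof -
  obtain k x m \<mu> where y0e: "y0 = (k, x, m, \<mu>)" by (cases y0) auto
  obtain I1 H1 where 1: "open I1" "open H1" "(k, x, m, \<mu>) \<in> I1 \<times> H1" "I1 \<times> H1 \<subseteq> G"
    by (rule open_prod_elim[OF G y0[unfolded y0e]])
  then have k: "k \<in> I1" "(x, m, \<mu>) \<in> H1" by auto
  obtain I2 H2 where 2: "open I2" "open H2" "(x, m, \<mu>) \<in> I2 \<times> H2" "I2 \<times> H2 \<subseteq> H1"
    by (rule open_prod_elim[OF 1(2) k(2)])
  then have x: "x \<in> I2" "(m, \<mu>) \<in> H2" by auto
  obtain I3 U where 3: "open I3" "open U" "(m, \<mu>) \<in> I3 \<times> U" "I3 \<times> U \<subseteq> H2"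
    by (rule open_prod_elim[OF 2(2) x(2)])
  then have m: "m \<in> I3" "\<mu> \<in> U" by auto
  have sub: "(k', x', m', \<mu>') \<in> G" if "k' \<in> I1" "x' \<in> I2" "m' \<in> I3" "\<mu>' \<in> U" for k' x' m' \<mu>'
  proof -
    have "(m', \<mu>') \<in> H2" using 3(4) that(3,4) by (rule subsetD[OF _ SigmaI])
    then have "(x', m', \<mu>') \<in> H1" using 2(4) that(2) by (intro subsetD[OF 2(4)] SigmaI)
    then show ?thesis using that(1) by (intro subsetD[OF 1(4)] SigmaI)
  qed
  obtain e where e: "0 < e" "\<And>y. \<bar>y - m\<bar> < e \<Longrightarrow> y \<in> I3"
    using 3(1) m(1) unfolding open_real by blast
  have "generate_topology pm_basis U" using 3(2) by (simp add: open_point_measure_basis)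
  from point_measure_bump[OF this m(2)]
  obtain g V where g: "g \<in> fun_closure base_class" "\<forall>y. 0 \<le> g y \<and> g y \<le> 1 \<and> (g y \<noteq> 0 \<longrightarrow> snd (snd (snd y)) \<in> U)"
    "open V" "\<mu> \<in> V" "\<forall>y. snd (snd (snd y)) \<in> V \<longrightarrow> g y = 1"
    by (elim bexE conjE exE)
  define b where "b q = base_fun I1 I2 {..q} (\<lambda>_. 0)" for q
  have b: "b q \<in> fun_closure base_class" for q
    unfolding b_def using 1 2 by (intro fun_closure.base base_fun_in) (auto simp: test_fun_def)
  \<comment> \<open>A difference of half-lines gives a half-open interval; the half-width
    \<open>e / 2\<close> keeps its closed right end inside \<open>I3\<close>.\<close>
  define h where "h y = (1 * b (m + e / 2) y + (-1) * b (m - e / 2) y) * g y" for y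
  have h: "h \<in> fun_closure base_class"
    unfolding h_def by (intro base_closure_mult fun_closure.lin b g)
  have he: "h y = indicator I1 (fst y) * indicator I2 (fst (snd y)) * indicator {m - e / 2<..m + e / 2} (fst (snd (snd y))) * g y" for y
    using e(1) by (auto simp: h_def b_def base_fun_def point_integral_def indicator_def)
  show ?thesis
  proof (intro bexI[OF _ h] conjI allI exI[of _ "I1 \<times> I2 \<times> {m - e / 2<..<m + e / 2} \<times> V"])
    fix y :: obs
    obtain k' x' m' \<mu>' where y: "y = (k', x', m', \<mu>')" by (cases y) auto
    have gy: "0 \<le> g y" "g y \<le> 1" "g y \<noteq> 0 \<Longrightarrow> snd (snd (snd y)) \<in> U"
      using g(2)[rule_format, of y] by blast+
    show "0 \<le> h y" "h y \<le> 1" using gy(1,2) by (auto simp: he indicator_def)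
    show "h y \<noteq> 0 \<longrightarrow> y \<in> G"
    proof
      assume "h y \<noteq> 0"
      then have *: "k' \<in> I1" "x' \<in> I2" "m - e / 2 < m'" "m' \<le> m + e / 2" "g y \<noteq> 0"
        by (auto simp: he y indicator_def split: if_splits)
      have "\<bar>m' - m\<bar> < e" using *(3,4) e(1) by linarith
      then show "y \<in> G" unfolding y using * gy(3) e(2) by (intro sub) (auto simp: y)
    qed
  next
    show "\<forall>y\<in>I1 \<times> I2 \<times> {m - e / 2<..<m + e / 2} \<times> V. h y = 1"
      using g(5) e(1) by (auto simp: he)
  qed (use 1(1) 2(1) k x g e in \<open>auto simp: y0e intro!: open_Times\<close>)
qed

text \<open>The plateaus from \<open>obs_bump\<close> cover \<open>G\<close>, and by second
  countability countably many of them do.\<close>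

lemma obs_bump_sequence:
  assumes G: "open (G :: obs set)"
  shows "\<exists>g :: nat \<Rightarrow> obs \<Rightarrow> real. \<forall>n. g n \<in> fun_closure base_class \<and> (\<forall>x. 0 \<le> g n x \<and> g n x \<le> 1 \<and>
      (g n x \<noteq> 0 \<longrightarrow> x \<in> G)) \<and> (\<forall>x\<in>G. \<exists>n. g n x = 1)"
proof -
  have zero: "(\<lambda>_. 0) \<in> fun_closure base_class"
    using fun_closure.lin[OF const_one_closure const_one_closure, of 0 0] by simp
  define F where "F = {W. open W \<and> (\<exists>g\<in>fun_closure base_class. (\<forall>y. 0 \<le> g y \<and> g y \<le> 1 \<and> (g y \<noteq> 0 \<longrightarrow> y \<in> G)) \<and> (\<forall>y\<in>W. g y = 1))}"
  have "open W" if "W \<in> F" for W using that by (simp add: F_def)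
  then obtain F' where F': "F' \<subseteq> F" "countable F'" "\<Union>F' = \<Union>F"
    by (rule Lindelof)
  have cover: "G \<subseteq> \<Union>F'"
  proof
    fix y assume "y \<in> G"
    from obs_bump[OF G this] obtain g W where g: "g \<in> fun_closure base_class"
      "\<forall>y. 0 \<le> g y \<and> g y \<le> 1 \<and> (g y \<noteq> 0 \<longrightarrow> y \<in> G)" "open W" "y \<in> W" "\<forall>y\<in>W. g y = 1"
      by (elim bexE conjE exE)
    then have "W \<in> F" unfolding F_def by (intro CollectI conjI bexI[OF _ g(1)])
    then show "y \<in> \<Union>F'" unfolding F'(3) using g(4) by (rule UnionI)
  qed
  \<comment> \<open>The empty set, served by the zero function, keeps the family nonempty for the
    enumeration \<open>from_nat_into\<close>.\<close>
  define F2 where "F2 = insert {} F'"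
  have F2: "F2 \<noteq> {}" "countable F2" using F' by (auto simp: F2_def)
  have "\<forall>W\<in>F2. \<exists>g\<in>fun_closure base_class. (\<forall>y. 0 \<le> g y \<and> g y \<le> 1 \<and> (g y \<noteq> 0 \<longrightarrow> y \<in> G)) \<and> (\<forall>y\<in>W. g y = 1)"
  proof
    fix W assume "W \<in> F2"
    then consider "W = {}" | "W \<in> F" using F' by (auto simp: F2_def)
    then show "\<exists>g\<in>fun_closure base_class. (\<forall>y. 0 \<le> g y \<and> g y \<le> 1 \<and> (g y \<noteq> 0 \<longrightarrow> y \<in> G)) \<and> (\<forall>y\<in>W. g y = 1)"
    proof cases
      case 1
      then show ?thesis by (intro bexI[OF _ zero]) auto
    qed (simp add: F_def)
  qed
  from bchoice[OF this[unfolded Bex_def]]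
  obtain h where "\<forall>W\<in>F2. h W \<in> fun_closure base_class \<and> (\<forall>y. 0 \<le> h W y \<and> h W y \<le> 1 \<and> (h W y \<noteq> 0 \<longrightarrow> y \<in> G)) \<and> (\<forall>y\<in>W. h W y = 1)"
    by (rule exE)
  note h0 = this[rule_format]
  note h = h0[THEN conjunct1] h0[THEN conjunct2, THEN conjunct1, rule_format] h0[THEN conjunct2, THEN conjunct2, rule_format]
  define g where "g n = h (from_nat_into F2 n)" for n
  have fn: "from_nat_into F2 n \<in> F2" for n by (rule from_nat_into[OF F2(1)])
  show ?thesis
  proof (intro exI[of _ g] allI conjI ballI)
    fix x assume "x \<in> G"
    then obtain W where W: "W \<in> F2" "x \<in> W" using cover by (auto simp: F2_def)
    then obtain n where "from_nat_into F2 n = W" using from_nat_into_surj[OF F2(2)] by blast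
    then show "\<exists>n. g n x = 1" using h(3)[OF W] by (auto simp: g_def)
  next
    fix n x
    show "g n \<in> fun_closure base_class" unfolding g_def by (rule h(1)[OF fn])
    show "0 \<le> g n x" "g n x \<le> 1" "g n x \<noteq> 0 \<longrightarrow> x \<in> G"
      using h(2)[OF fn, of n x] unfolding g_def by blast+
  qed
qed

section \<open>The limit law\<close>

text \<open>A convergent sequence of shifts is bounded, so one finite window of atoms serves for all
  of them.\<close>

lemma tendsto_point_integral_shift:
  assumes \<phi>: "test_fun \<phi>" and X: "X \<longlonglongrightarrow> z"
  shows "(\<lambda>n. point_integral \<mu> (\<lambda>x. \<phi> (x + X n))) \<longlonglongrightarrow> point_integral \<mu> (\<lambda>x. \<phi> (x + z))"
proof -
  obtain R :: nat where R: "\<And>x. \<phi> x \<noteq> 0 \<Longrightarrow> \<bar>x\<bar> \<le> real R" using \<phi> test_fun_support by metis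
  have c: "isCont \<phi> x" for x
    using \<phi> by (simp add: test_fun_def continuous_on_eq_continuous_at)
  obtain K where K: "\<And>n. \<bar>X n\<bar> \<le> K"
    using convergent_imp_Bseq[OF convergentI[OF X]] by (auto simp: Bseq_def)
  define M where "M = real R + max K \<bar>z\<bar>"
  have eq: "point_integral \<mu> (\<lambda>x. \<phi> (x + c)) = (\<Sum>x | mult \<mu> x \<noteq> 0 \<and> \<bar>x\<bar> \<le> M. real (mult \<mu> x) * \<phi> (x + c))"
    if "\<bar>c\<bar> \<le> max K \<bar>z\<bar>" for c
  proof (rule point_integral_eq, intro allI impI)
    fix x assume "\<phi> (x + c) \<noteq> 0"
    then show "\<bar>x\<bar> \<le> M" using R[of "x + c"] that unfolding M_def by linarith
  qed
  have "(\<lambda>n. \<Sum>x | mult \<mu> x \<noteq> 0 \<and> \<bar>x\<bar> \<le> M. real (mult \<mu> x) * \<phi> (x + X n)) \<longlonglongrightarrow>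
     (\<Sum>x | mult \<mu> x \<noteq> 0 \<and> \<bar>x\<bar> \<le> M. real (mult \<mu> x) * \<phi> (x + z))"
  proof (intro tendsto_sum tendsto_mult tendsto_const)
    fix x
    show "(\<lambda>n. \<phi> (x + X n)) \<longlonglongrightarrow> \<phi> (x + z)"
      by (rule isCont_tendsto_compose[OF c]) (intro tendsto_intros X)
  qed
  then show ?thesis
    using eq[of z] eq[of "X n" for n] K by (simp add: le_max_iff_disj)
qed

text \<open>Joint measurability as for \<open>path_eval\<close>: the shift is approximated from
  above by multiples of \<open>1 / real (Suc n)\<close>, which leaves countably many measurable maps
  to paste, and the integral is continuous in the shift.\<close>

lemma measurable_point_integral_shift:
  assumes \<phi>: "test_fun \<phi>"
  shows "(\<lambda>x. point_integral (snd x) (\<lambda>y. \<phi> (y + fst x))) \<in> borel_measurable (borel \<Otimes>\<^sub>M borel)"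
proof (rule borel_measurable_LIMSEQ_real)
  fix n :: nat
  show "(\<lambda>x. (\<lambda>i x. point_integral (snd x) (\<lambda>y. \<phi> (y + of_int i / real (Suc n)))) \<lceil>real (Suc n) * fst x\<rceil> x)
    \<in> borel_measurable (borel \<Otimes>\<^sub>M borel)"
  proof (rule measurable_compose_countable[where f = "\<lambda>i x. point_integral (snd x) (\<lambda>y. \<phi> (y + of_int i / real (Suc n)))"
        and g = "\<lambda>x. \<lceil>real (Suc n) * fst x\<rceil>"])
    fix i :: int
    show "(\<lambda>x. point_integral (snd x) (\<lambda>y. \<phi> (y + of_int i / real (Suc n)))) \<in> borel_measurable (borel \<Otimes>\<^sub>M borel)"
      by (rule measurable_compose[OF measurable_snd measurable_point_integral[OF test_fun_shift[OF \<phi>]]])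
  qed measurable
next
  fix x :: "real \<times> point_measure"
  let ?a = "\<lambda>n. of_int \<lceil>real (Suc n) * fst x\<rceil> / real (Suc n)"
  have b: "fst x \<le> ?a n" "?a n \<le> fst x + 1 / real (Suc n)" for n
  proof -
    have "?a n \<ge> (real (Suc n) * fst x) / real (Suc n)" by (intro divide_right_mono) auto
    then show "fst x \<le> ?a n" by simp
    have "?a n \<le> (real (Suc n) * fst x + 1) / real (Suc n)" by (intro divide_right_mono) linarith+
    also have "\<dots> = fst x + 1 / real (Suc n)" by (simp add: add_divide_distrib)
    finally show "?a n \<le> fst x + 1 / real (Suc n)" .
  qed
  have "(\<lambda>n. fst x + inverse (real (Suc n))) \<longlonglongrightarrow> fst x + 0"
    by (intro tendsto_intros LIMSEQ_inverse_real_of_nat)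
  then have "?a \<longlonglongrightarrow> fst x"
    by (intro tendsto_sandwich[OF _ _ tendsto_const, of "fst x" ?a sequentially "\<lambda>n. fst x + inverse (real (Suc n))"])
      (use b in \<open>auto simp: inverse_eq_divide\<close>)
  then show "(\<lambda>n. point_integral (snd x) (\<lambda>y. \<phi> (y + ?a n))) \<longlonglongrightarrow> point_integral (snd x) (\<lambda>y. \<phi> (y + fst x))"
    by (rule tendsto_point_integral_shift[OF \<phi>])
qed

lemma measurable_point_shift [measurable (raw)]:
  assumes f: "f \<in> borel_measurable M" and X: "X \<in> M \<rightarrow>\<^sub>M (borel :: point_measure measure)"
  shows "(\<lambda>\<omega>. point_shift (f \<omega>) (X \<omega>)) \<in> M \<rightarrow>\<^sub>M borel"
proof (rule measurable_point_measureI)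
  fix \<phi> :: "real \<Rightarrow> real" assume "test_fun \<phi>"
  from measurable_compose[OF measurable_Pair[OF f X] measurable_point_integral_shift[OF this]]
  show "(\<lambda>\<omega>. point_integral (point_shift (f \<omega>) (X \<omega>)) \<phi>) \<in> borel_measurable M"
    by (simp add: point_integral_shift)
qed

lemma measurable_point_union [measurable (raw)]:
  assumes X: "X \<in> M \<rightarrow>\<^sub>M (borel :: point_measure measure)" and Y: "Y \<in> M \<rightarrow>\<^sub>M (borel :: point_measure measure)"
  shows "(\<lambda>\<omega>. point_union (X \<omega>) (Y \<omega>)) \<in> M \<rightarrow>\<^sub>M borel"
proof (rule measurable_point_measureI)
  fix \<phi> :: "real \<Rightarrow> real" assume \<phi>: "test_fun \<phi>"
  show "(\<lambda>\<omega>. point_integral (point_union (X \<omega>) (Y \<omega>)) \<phi>) \<in> borel_measurable M"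
    using measurable_compose[OF X measurable_point_integral[OF \<phi>]] measurable_compose[OF Y measurable_point_integral[OF \<phi>]]
    by (simp add: point_integral_union[OF \<phi>])
qed

lemma independent_rvs_pair:
  assumes M: "prob_space M" and N: "prob_space N" and X: "X \<in> M \<rightarrow>\<^sub>M M'" and Y: "Y \<in> N \<rightarrow>\<^sub>M N'"
  shows "independent_rvs (M \<Otimes>\<^sub>M N) M' (\<lambda>\<omega>. X (fst \<omega>)) N' (\<lambda>\<omega>. Y (snd \<omega>))"
proof -
  interpret M: prob_space M by fact
  interpret N: prob_space N by fact
  interpret MN: pair_prob_space M N ..
  have mX: "(\<lambda>\<omega>. X (fst \<omega>)) \<in> (M \<Otimes>\<^sub>M N) \<rightarrow>\<^sub>M M'" and mY: "(\<lambda>\<omega>. Y (snd \<omega>)) \<in> (M \<Otimes>\<^sub>M N) \<rightarrow>\<^sub>M N'"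
    using X Y by measurable
  have "MN.indep_set {(\<lambda>\<omega>. X (fst \<omega>)) -` A \<inter> space (M \<Otimes>\<^sub>M N) | A. A \<in> sets M'}
     {(\<lambda>\<omega>. Y (snd \<omega>)) -` A \<inter> space (M \<Otimes>\<^sub>M N) | A. A \<in> sets N'}"
  proof (rule MN.indep_setI)
    show "{(\<lambda>\<omega>. X (fst \<omega>)) -` A \<inter> space (M \<Otimes>\<^sub>M N) | A. A \<in> sets M'} \<subseteq> MN.events"
      using mX by (auto intro: measurable_sets)
    show "{(\<lambda>\<omega>. Y (snd \<omega>)) -` A \<inter> space (M \<Otimes>\<^sub>M N) | A. A \<in> sets N'} \<subseteq> MN.events"
      using mY by (auto intro: measurable_sets)
    fix a b
    assume "a \<in> {(\<lambda>\<omega>. X (fst \<omega>)) -` A \<inter> space (M \<Otimes>\<^sub>M N) | A. A \<in> sets M'}"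
      and "b \<in> {(\<lambda>\<omega>. Y (snd \<omega>)) -` A \<inter> space (M \<Otimes>\<^sub>M N) | A. A \<in> sets N'}"
    then obtain A A' where A: "A \<in> sets M'" "A' \<in> sets N'" and ab: "a = (\<lambda>\<omega>. X (fst \<omega>)) -` A \<inter> space (M \<Otimes>\<^sub>M N)"
      "b = (\<lambda>\<omega>. Y (snd \<omega>)) -` A' \<inter> space (M \<Otimes>\<^sub>M N)" by auto
    define U where "U = X -` A \<inter> space M"
    define V where "V = Y -` A' \<inter> space N"
    have UV: "U \<in> sets M" "V \<in> sets N" using A X Y by (auto simp: U_def V_def intro: measurable_sets)
    have "a = U \<times> space N" "b = space M \<times> V" "a \<inter> b = U \<times> V"
      by (auto simp: ab U_def V_def space_pair_measure)
    then show "MN.prob (a \<inter> b) = MN.prob a * MN.prob b"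
      using UV by (simp add: measure_def N.emeasure_pair_measure_Times M.emeasure_space_1 N.emeasure_space_1 enn2real_mult)
  qed
  then show ?thesis using mX mY by (simp add: independent_rvs_def)
qed

section \<open>Construction of the limit law\<close>

definition tilt :: "real \<Rightarrow> real" where
  "tilt z = exp (- (sqrt 2 * gam * z))"

text \<open>The joint law of \<open>\<chi>\<close>, \<open>\<E>\<^sub>1\<close> and
  \<open>\<E>\<^sub>2\<close>: the point \<open>z\<close> carries Lebesgue measure with the tilt,
  and both maxima are constrained to lie at or below it. With \<open>K\<close> the constant
  \<open>C1\<close>, integrating out the processes leaves the density
  \<open>tilt z * (w z)\<^sup>2 / (2 * K)\<close> of \<open>\<chi>\<close>.\<close>

definition limit_pre :: "point_measure measure \<Rightarrow> real \<Rightarrow> (real \<times> point_measure \<times> point_measure) measure" where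
  "limit_pre L K = density (lborel \<Otimes>\<^sub>M L \<Otimes>\<^sub>M L) (\<lambda>x. ennreal (1 / (2 * K) * tilt (fst x)) *
     (indicator {..fst x} (point_max (fst (snd x))) * indicator {..fst x} (point_max (snd (snd x)))))"

text \<open>For fixed \<open>z\<close> the density splits into one factor for each process, so
  Fubini gives a product of two integrals over \<open>L\<close>: this is the conditional
  independence of the processes.\<close>

lemma nn_integral_limit_pre:
  assumes L: "prob_space L" "sets L = sets borel" and pm: "point_max \<in> borel_measurable borel" and K: "0 < K"
    and f0: "f0 \<in> borel_measurable borel" and f1: "(\<lambda>x. f1 (fst x) (snd x)) \<in> borel_measurable (borel \<Otimes>\<^sub>M borel)"
    and f2: "(\<lambda>x. f2 (fst x) (snd x)) \<in> borel_measurable (borel \<Otimes>\<^sub>M borel)"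
  shows "(\<integral>\<^sup>+x. f0 (fst x) * (f1 (fst x) (fst (snd x)) * f2 (fst x) (snd (snd x))) \<partial>limit_pre L K) =
    (\<integral>\<^sup>+z. ennreal (1 / (2 * K) * tilt z) * f0 z * ((\<integral>\<^sup>+\<mu>. indicator {..z} (point_max \<mu>) * f1 z \<mu> \<partial>L) *
      (\<integral>\<^sup>+\<mu>. indicator {..z} (point_max \<mu>) * f2 z \<mu> \<partial>L)) \<partial>lborel)"
proof -
  interpret L: prob_space L by fact
  interpret LL: pair_prob_space L L ..
  have Lm: "f \<in> borel_measurable L \<longleftrightarrow> f \<in> borel_measurable borel" for f :: "point_measure \<Rightarrow> 'z::topological_space"
    by (simp add: measurable_cong_sets[OF L(2) refl])
  have [measurable]: "point_max \<in> borel_measurable L" using pm Lm by blast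
  note [measurable] = f0
  have [measurable]: "tilt \<in> borel_measurable borel" unfolding tilt_def by measurable
  have s1: "sets (borel \<Otimes>\<^sub>M L) = sets (borel \<Otimes>\<^sub>M borel)" by (intro sets_pair_measure_cong L(2) refl)
  have f1L: "(\<lambda>x. f1 (fst x) (snd x)) \<in> borel_measurable (borel \<Otimes>\<^sub>M L)" using f1 by (simp add: measurable_cong_sets[OF s1 refl])
  have f2L: "(\<lambda>x. f2 (fst x) (snd x)) \<in> borel_measurable (borel \<Otimes>\<^sub>M L)" using f2 by (simp add: measurable_cong_sets[OF s1 refl])
  have [measurable]: "(\<lambda>x. f1 (fst x) (fst (snd x))) \<in> borel_measurable (lborel \<Otimes>\<^sub>M L \<Otimes>\<^sub>M L)"
    using measurable_compose[OF _ f1L, of "\<lambda>x. (fst x, fst (snd x))" "lborel \<Otimes>\<^sub>M L \<Otimes>\<^sub>M L"] by simp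
  have [measurable]: "(\<lambda>x. f2 (fst x) (snd (snd x))) \<in> borel_measurable (lborel \<Otimes>\<^sub>M L \<Otimes>\<^sub>M L)"
    using measurable_compose[OF _ f2L, of "\<lambda>x. (fst x, snd (snd x))" "lborel \<Otimes>\<^sub>M L \<Otimes>\<^sub>M L"] by simp
  have f1z [measurable]: "f1 z \<in> borel_measurable L" for z
    using measurable_compose[OF _ f1L, of "\<lambda>\<mu>. (z, \<mu>)" L] by simp
  have f2z [measurable]: "f2 z \<in> borel_measurable L" for z
    using measurable_compose[OF _ f2L, of "\<lambda>\<mu>. (z, \<mu>)" L] by simp
  have [measurable]: "(\<lambda>x. indicator {..fst x} (point_max (fst (snd x))) :: ennreal) \<in> borel_measurable (lborel \<Otimes>\<^sub>M L \<Otimes>\<^sub>M L)"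
    "(\<lambda>x. indicator {..fst x} (point_max (snd (snd x))) :: ennreal) \<in> borel_measurable (lborel \<Otimes>\<^sub>M L \<Otimes>\<^sub>M L)"
    unfolding indicator_def atMost_iff by measurable
  let ?d = "\<lambda>x. ennreal (1 / (2 * K) * tilt (fst x)) *
     (indicator {..fst x} (point_max (fst (snd x))) * indicator {..fst x} (point_max (snd (snd x))))"
  let ?f = "\<lambda>x. f0 (fst x) * (f1 (fst x) (fst (snd x)) * f2 (fst x) (snd (snd x)))"
  have "(\<integral>\<^sup>+x. ?f x \<partial>limit_pre L K) = (\<integral>\<^sup>+x. ?d x * ?f x \<partial>(lborel \<Otimes>\<^sub>M L \<Otimes>\<^sub>M L))"
    unfolding limit_pre_def by (rule nn_integral_density) measurable
  also have "\<dots> = (\<integral>\<^sup>+z. \<integral>\<^sup>+y. ?d (z, y) * ?f (z, y) \<partial>(L \<Otimes>\<^sub>M L) \<partial>lborel)"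
    by (rule LL.nn_integral_fst[symmetric]) measurable
  also have "\<dots> = (\<integral>\<^sup>+z. ennreal (1 / (2 * K) * tilt z) * f0 z * ((\<integral>\<^sup>+\<mu>. indicator {..z} (point_max \<mu>) * f1 z \<mu> \<partial>L) *
      (\<integral>\<^sup>+\<mu>. indicator {..z} (point_max \<mu>) * f2 z \<mu> \<partial>L)) \<partial>lborel)"
  proof (rule nn_integral_cong)
    fix z
    define c where "c = ennreal (1 / (2 * K) * tilt z) * f0 z"
    define g1 where "g1 \<mu> = indicator {..z} (point_max \<mu>) * f1 z \<mu>" for \<mu>
    define g2 where "g2 \<mu> = indicator {..z} (point_max \<mu>) * f2 z \<mu>" for \<mu>
    have g12: "g1 \<in> borel_measurable L" "g2 \<in> borel_measurable L"
      unfolding g1_def g2_def by measurable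
    note gm [measurable] = measurable_compose[OF measurable_fst g12(1)] measurable_compose[OF measurable_snd g12(2)]
    have "(\<integral>\<^sup>+y. ?d (z, y) * ?f (z, y) \<partial>(L \<Otimes>\<^sub>M L)) = (\<integral>\<^sup>+y. c * (g1 (fst y) * g2 (snd y)) \<partial>(L \<Otimes>\<^sub>M L))"
      by (simp add: mult_ac c_def g1_def g2_def)
    also have "\<dots> = (\<integral>\<^sup>+\<mu>1. \<integral>\<^sup>+\<mu>2. c * (g1 (fst (\<mu>1, \<mu>2)) * g2 (snd (\<mu>1, \<mu>2))) \<partial>L \<partial>L)"
      by (rule L.nn_integral_fst[symmetric]) measurable
    also have "\<dots> = c * ((\<integral>\<^sup>+\<mu>. g1 \<mu> \<partial>L) * (\<integral>\<^sup>+\<mu>. g2 \<mu> \<partial>L))"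
      using g12 by (simp add: nn_integral_cmult nn_integral_multc)
    also have "\<dots> = ennreal (1 / (2 * K) * tilt z) * f0 z * ((\<integral>\<^sup>+\<mu>. indicator {..z} (point_max \<mu>) * f1 z \<mu> \<partial>L) *
      (\<integral>\<^sup>+\<mu>. indicator {..z} (point_max \<mu>) * f2 z \<mu> \<partial>L))"
      by (simp add: c_def g1_def g2_def)
    finally show "(\<integral>\<^sup>+y. ?d (z, y) * ?f (z, y) \<partial>(L \<Otimes>\<^sub>M L)) = ennreal (1 / (2 * K) * tilt z) * f0 z *
      ((\<integral>\<^sup>+\<mu>. indicator {..z} (point_max \<mu>) * f1 z \<mu> \<partial>L) * (\<integral>\<^sup>+\<mu>. indicator {..z} (point_max \<mu>) * f2 z \<mu> \<partial>L))" .
  qed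
  finally show ?thesis .
qed

lemma AE_pair_snd:
  assumes R: "sigma_finite_measure R" and P: "AE y in R. P y"
  shows "AE x in N \<Otimes>\<^sub>M R. P (snd x)"
proof -
  interpret R: sigma_finite_measure R by fact
  obtain Z where Z: "{y \<in> space R. \<not> P y} \<subseteq> Z" "emeasure R Z = 0" "Z \<in> sets R" using P by (rule AE_E)
  show ?thesis
  proof (rule AE_I')
    show "space N \<times> Z \<in> null_sets (N \<Otimes>\<^sub>M R)"
      using Z by (simp add: null_sets_def R.emeasure_pair_measure_Times)
    show "{x \<in> space (N \<Otimes>\<^sub>M R). \<not> P (snd x)} \<subseteq> space N \<times> Z"
      using Z(1) by (auto simp: space_pair_measure)
  qed
qed

lemma AE_pair_fst:
  assumes R: "sigma_finite_measure R" and P: "AE y in N. P y"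
  shows "AE x in N \<Otimes>\<^sub>M R. P (fst x)"
proof -
  interpret R: sigma_finite_measure R by fact
  obtain Z where Z: "{y \<in> space N. \<not> P y} \<subseteq> Z" "emeasure N Z = 0" "Z \<in> sets N" using P by (rule AE_E)
  show ?thesis
  proof (rule AE_I')
    show "Z \<times> space R \<in> null_sets (N \<Otimes>\<^sub>M R)"
      using Z by (simp add: null_sets_def R.emeasure_pair_measure_Times)
    show "{x \<in> space (N \<Otimes>\<^sub>M R). \<not> P (fst x)} \<subseteq> Z \<times> space R"
      using Z(1) by (auto simp: space_pair_measure)
  qed
qed

lemma nn_integral_pair_mult:
  assumes R: "sigma_finite_measure R" and f: "f \<in> borel_measurable N" and g: "g \<in> borel_measurable R"
  shows "(\<integral>\<^sup>+x. f (fst x) * g (snd x) \<partial>(N \<Otimes>\<^sub>M R)) = (\<integral>\<^sup>+x. f x \<partial>N) * (\<integral>\<^sup>+y. g y \<partial>R)"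
proof -
  interpret R: sigma_finite_measure R by fact
  note [measurable] = measurable_compose[OF measurable_fst f] measurable_compose[OF measurable_snd g]
  have "(\<integral>\<^sup>+x. f (fst x) * g (snd x) \<partial>(N \<Otimes>\<^sub>M R)) = (\<integral>\<^sup>+x. \<integral>\<^sup>+y. f (fst (x, y)) * g (snd (x, y)) \<partial>R \<partial>N)"
    by (rule R.nn_integral_fst[symmetric]) measurable
  then show ?thesis using f g by (simp add: nn_integral_cmult nn_integral_multc)
qed

text \<open>The exponential variable is not drawn separately: it is the gap between
  \<open>z\<close>, the value of \<open>\<chi>\<close>, and the larger of the two maxima.\<close>

definition limit_map :: "real \<times> point_measure \<times> point_measure \<Rightarrow> real \<times> real \<times> point_measure \<times> point_measure" where
  "limit_map x = (fst x, fst x - max (point_max (fst (snd x))) (point_max (snd (snd x))), fst (snd x), snd (snd x))"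

definition limit_rest :: "point_measure measure \<Rightarrow> real \<Rightarrow> (real \<times> real \<times> point_measure \<times> point_measure) measure" where
  "limit_rest L K = distr (limit_pre L K) borel limit_map"

definition limit_law :: "point_measure measure \<Rightarrow> real \<Rightarrow> (real \<times> real \<times> real \<times> point_measure \<times> point_measure) measure" where
  "limit_law L K = density lborel (\<lambda>x. ennreal (std_normal_density x)) \<Otimes>\<^sub>M limit_rest L K"



lemma measurable_borel_tuple:
  "f \<in> measurable (borel \<Otimes>\<^sub>M borel \<Otimes>\<^sub>M borel \<Otimes>\<^sub>M borel \<Otimes>\<^sub>M borel) M \<Longrightarrow>
    f \<in> measurable (borel :: (real \<times> real \<times> real \<times> point_measure \<times> point_measure) measure) M"
  by (simp add: borel_prod)

lemma measurable_borel_rest: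
  "f \<in> measurable (borel \<Otimes>\<^sub>M borel \<Otimes>\<^sub>M borel \<Otimes>\<^sub>M borel) M \<Longrightarrow>
    f \<in> measurable (borel :: (real \<times> real \<times> point_measure \<times> point_measure) measure) M"
  by (simp add: borel_prod)

lemma integral_uniform_measure:
  fixes f :: "'b \<Rightarrow> real"
  assumes P: "prob_space P" and A: "A \<in> sets P" "0 < measure P A" and f: "f \<in> borel_measurable P"
  shows "(\<integral>x. f x \<partial>uniform_measure P A) = (\<integral>x. indicator A x * f x \<partial>P) / measure P A"
proof -
  interpret prob_space P by fact
  have "uniform_measure P A = density P (\<lambda>x. ennreal (indicator A x / measure P A))"
    unfolding uniform_measure_def
  proof (rule density_cong)
    show "AE x in P. indicator A x / emeasure P A = ennreal (indicator A x / measure P A)"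
      using A(2) divide_ennreal[of 1 "measure P A"] by (auto simp: emeasure_eq_measure split: split_indicator)
  qed (use A in auto)
  then have "(\<integral>x. f x \<partial>uniform_measure P A) = (\<integral>x. (indicator A x / measure P A) *\<^sub>R f x \<partial>P)"
    using A f by (simp add: integral_density)
  also have "\<dots> = (\<integral>x. (indicator A x * f x) / measure P A \<partial>P)"
    by simp
  finally show ?thesis by simp
qed

lemma converges_in_law_cong:
  assumes "converges_in_law (\<lambda>t. uniform_measure P (A t)) Y Q Z" "\<And>t \<omega>. \<omega> \<in> space P \<Longrightarrow> Y t \<omega> = Y' t \<omega>"
  shows "converges_in_law (\<lambda>t. uniform_measure P (A t)) Y' Q Z"
proof -
  have 1: "Y t \<in> uniform_measure P (A t) \<rightarrow>\<^sub>M borel \<longleftrightarrow> Y' t \<in> uniform_measure P (A t) \<rightarrow>\<^sub>M borel" for t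
    by (rule measurable_cong) (simp add: assms(2))
  have 2: "(\<integral>\<omega>. f (Y t \<omega>) \<partial>uniform_measure P (A t)) = (\<integral>\<omega>. f (Y' t \<omega>) \<partial>uniform_measure P (A t))" for f t
    by (rule Bochner_Integration.integral_cong) (simp_all add: assms(2))
  show ?thesis using assms(1) unfolding converges_in_law_def 1 2 .
qed

type_synonym lim_obs = "real \<times> real \<times> real \<times> point_measure \<times> point_measure"

definition chi_of :: "lim_obs \<Rightarrow> real" where "chi_of \<omega> = fst (snd \<omega>)"
definition exp_of :: "lim_obs \<Rightarrow> real" where "exp_of \<omega> = fst (snd (snd \<omega>))"
definition proc1 :: "lim_obs \<Rightarrow> point_measure" where "proc1 \<omega> = fst (snd (snd (snd \<omega>)))"
definition proc2 :: "lim_obs \<Rightarrow> point_measure" where "proc2 \<omega> = snd (snd (snd (snd \<omega>)))"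
definition proc_of :: "lim_obs \<Rightarrow> point_measure" where
  "proc_of \<omega> = point_shift (- chi_of \<omega>) (point_union (proc1 \<omega>) (proc2 \<omega>))"

lemma lim_obs_measurable [measurable]:
  "chi_of \<in> borel_measurable borel" "exp_of \<in> borel_measurable borel"
  "proc1 \<in> borel_measurable borel" "proc2 \<in> borel_measurable borel" "proc_of \<in> borel_measurable borel"
proof -
  show 1: "chi_of \<in> borel_measurable borel" "exp_of \<in> borel_measurable borel"
    "proc1 \<in> borel_measurable borel" "proc2 \<in> borel_measurable borel"
    unfolding chi_of_def exp_of_def proc1_def proc2_def by (rule measurable_borel_tuple, measurable)+
  show "proc_of \<in> borel_measurable borel"
    unfolding proc_of_def using 1 by measurable
qed

definition bbm_obs :: "(bool list \<Rightarrow> 'a \<Rightarrow> real) \<Rightarrow> (bool list \<Rightarrow> real \<Rightarrow> 'a \<Rightarrow> real) \<Rightarrow> real \<Rightarrow> real \<Rightarrow> 'a \<Rightarrow> obs" where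
  "bbm_obs T B \<alpha> t \<omega> = (tau_std \<alpha> T t \<omega>, pos_std \<alpha> T B t \<omega>, max_position T B t \<omega> - sqrt 2 * \<alpha> * t,
     particles T B t (sqrt 2 * \<alpha> * t) \<omega>)"

definition limit_obs :: "lim_obs \<Rightarrow> obs" where
  "limit_obs \<omega> = (fst \<omega>, - chi_of \<omega>, - exp_of \<omega>, proc_of \<omega>)"

lemma measurable_obs:
  "f \<in> measurable M (borel \<Otimes>\<^sub>M borel \<Otimes>\<^sub>M borel \<Otimes>\<^sub>M borel) \<Longrightarrow> f \<in> measurable M (borel :: obs measure)"
  by (simp add: borel_prod)

section \<open>Laws of the limit variables\<close>

context
  fixes P :: "'a measure" and T B and L :: "point_measure measure" and \<alpha> :: real
  assumes bbm: "binary_bbm P T B" and ext: "is_extremal_process P T B L" and \<alpha>: "\<alpha> \<in> {- gam<..<1}"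
begin

abbreviation (input) "w \<equiv> wave P T B"
abbreviation (input) "K \<equiv> C1 (wave P T B)"
abbreviation (input) "Q \<equiv> limit_law L K"

lemma wave_cdf: "w z = measure L {\<mu> \<in> space L. point_max \<mu> \<le> z}"
  by (simp add: wave_eq[OF bbm ext] hit_lim_cdf[OF bbm ext])

lemma hit_lim_measurable:
  assumes "test_fun \<phi>" "\<And>x. 0 \<le> \<phi> x" "q \<le> 0"
  shows "hit_lim L q \<phi> \<in> borel_measurable borel"
proof -
  obtain C where "laplace_setting \<alpha> (hit_fun P T B q \<phi>) (hit_lim L q \<phi>) C (\<lambda>_. 1) (\<lambda>_. 1)"
    by (rule hit_fun_setting[OF bbm ext \<alpha> assms, of "\<lambda>_. 1" "\<lambda>_. 1"]) auto
  then show ?thesis by (rule laplace_setting.Finf_measurable)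
qed

lemma wave_measurable [measurable]: "w \<in> borel_measurable borel"
  using hit_lim_measurable[OF test_fun_zero] by (simp add: wave_eq[OF bbm ext, abs_def])

lemma tilt_measurable [measurable]: "tilt \<in> borel_measurable borel"
  unfolding tilt_def by measurable

lemma tilt_pos: "0 < tilt z"
  by (simp add: tilt_def)

lemma nn_wave: "(\<integral>\<^sup>+z. ennreal (tilt z * (w z)\<^sup>2) \<partial>lborel) = lim_z L 0 (\<lambda>_. 0) (\<lambda>_. 1)"
  by (simp add: lim_z_def tilt_def wave_eq[OF bbm ext])

lemma nn_wave_finite: "(\<integral>\<^sup>+z. ennreal (tilt z * (w z)\<^sup>2) \<partial>lborel) < \<infinity>"
  unfolding nn_wave by (rule class_limit(2)[OF bbm ext \<alpha> test_fun_zero, where A = "\<lambda>_. 1"]) auto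

lemma tilt_wave_integrable: "integrable lborel (\<lambda>z. tilt z * (w z)\<^sup>2)"
proof (rule integrableI_nonneg)
  show "AE z in lborel. 0 \<le> tilt z * (w z)\<^sup>2" by (simp add: less_imp_le[OF tilt_pos])
qed (use nn_wave_finite in auto)

lemma wave_integrable: "integrable lborel (\<lambda>z. exp (- (sqrt 2 * gam * z)) * (w z)\<^sup>2)"
  using tilt_wave_integrable by (simp add: tilt_def)

lemma nn_wave_C1: "(\<integral>\<^sup>+z. ennreal (tilt z * (w z)\<^sup>2) \<partial>lborel) = ennreal (2 * K)"
proof -
  have "(\<integral>\<^sup>+z. ennreal (tilt z * (w z)\<^sup>2) \<partial>lborel) = ennreal (\<integral>z. tilt z * (w z)\<^sup>2 \<partial>lborel)"
    by (rule nn_integral_eq_integral[OF tilt_wave_integrable]) (simp add: less_imp_le[OF tilt_pos])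
  then show ?thesis by (simp add: C1_def tilt_def)
qed

lemma L_measurable_point_max: "point_max \<in> borel_measurable L"
  using measurable_point_max[OF bbm ext] measurable_L_iff[OF bbm ext] by blast

text \<open>\<open>w\<close> is nondecreasing and tends to 1, hence is bounded away from 0 on an
  interval of length 1.\<close>

lemma C1_pos: "0 < K"
proof -
  interpret L: prob_space L by (rule L_prob[OF bbm ext])
  note [measurable] = L_measurable_point_max
  have "(\<lambda>n. measure L {\<mu> \<in> space L. point_max \<mu> \<le> real n}) \<longlonglongrightarrow> measure L (\<Union>n. {\<mu> \<in> space L. point_max \<mu> \<le> real n})"
    by (rule L.finite_Lim_measure_incseq) (auto simp: incseq_def)
  also have "(\<Union>n. {\<mu> \<in> space L. point_max \<mu> \<le> real n}) = space L"
    using real_arch_simple by auto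
  finally have "(\<lambda>n. w (real n)) \<longlonglongrightarrow> 1" by (simp add: wave_cdf L.prob_space)
  then have "\<forall>\<^sub>F n in sequentially. 0 < w (real n)" by (rule order_tendstoD(1)) simp
  then obtain n where n: "0 < w (real n)" by (auto simp: eventually_sequentially)
  have mono: "w a \<le> w b" if "a \<le> b" for a b
    unfolding wave_cdf using that by (intro L.finite_measure_mono) auto
  have "(\<integral>\<^sup>+z. ennreal (tilt z * (w z)\<^sup>2) \<partial>lborel) \<noteq> 0"
  proof
    assume "(\<integral>\<^sup>+z. ennreal (tilt z * (w z)\<^sup>2) \<partial>lborel) = 0"
    then have "AE z in lborel. ennreal (tilt z * (w z)\<^sup>2) = 0"
      by (subst (asm) nn_integral_0_iff_AE) auto
    then have "AE z in lborel. z \<notin> {real n..real n + 1}"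
    proof eventually_elim
      case (elim z)
      show ?case
      proof
        assume "z \<in> {real n..real n + 1}"
        then have "0 < w z" using mono[of "real n" z] n by auto
        then show False using elim tilt_pos[of z] by (simp add: ennreal_eq_0_iff mult_le_0_iff)
      qed
    qed
    then have "emeasure lborel {real n..real n + 1} = 0"
      by (subst (asm) AE_iff_measurable[where N = "{real n..real n + 1}"]) auto
    then show False by simp
  qed
  then show ?thesis unfolding nn_wave_C1 by (simp add: ennreal_eq_0_iff not_le)
qed

text \<open>The version with a strict inequality serves the survival function of
  \<open>exp_of\<close>; it rests on the absence of atoms in the law of the maximum.\<close>

lemma nn_integral_cdf:
  "(\<integral>\<^sup>+\<mu>. indicator {..z} (point_max \<mu>) * indicator {..a} (point_max \<mu>) \<partial>L) = ennreal (w (min z a))"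
  "a \<le> z \<Longrightarrow> (\<integral>\<^sup>+\<mu>. indicator {..z} (point_max \<mu>) * indicator {..<a} (point_max \<mu>) \<partial>L) = ennreal (w a)"
proof -
  interpret L: prob_space L by (rule L_prob[OF bbm ext])
  note [measurable] = L_measurable_point_max
  have eq: "(\<integral>\<^sup>+\<mu>. indicator {\<mu> \<in> space L. point_max \<mu> \<le> a} \<mu> \<partial>L) = ennreal (w a)" for a
    by (simp add: wave_cdf L.emeasure_eq_measure)
  show "(\<integral>\<^sup>+\<mu>. indicator {..z} (point_max \<mu>) * indicator {..a} (point_max \<mu>) \<partial>L) = ennreal (w (min z a))"
    unfolding eq[symmetric] by (rule nn_integral_cong) (auto simp: indicator_def)
  assume az: "a \<le> z"
  have ne: "AE \<mu> in L. \<not> (\<mu> \<in> space L \<and> point_max \<mu> = a)"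
    using extremal_max_no_atom[OF bbm ext, of a]
    by (subst AE_iff_measurable[where N = "{\<mu> \<in> space L. point_max \<mu> = a}"]) (auto simp: L.emeasure_eq_measure)
  show "(\<integral>\<^sup>+\<mu>. indicator {..z} (point_max \<mu>) * indicator {..<a} (point_max \<mu>) \<partial>L) = ennreal (w a)"
    unfolding eq[symmetric]
  proof (intro nn_integral_cong_AE, use ne AE_space in eventually_elim)
    case (elim \<mu>)
    then have "point_max \<mu> < a \<longleftrightarrow> point_max \<mu> \<le> a" by auto
    then show ?case using az elim by (auto simp: indicator_def)
  qed
qed

lemma pre_int:
  assumes "f0 \<in> borel_measurable borel" "(\<lambda>x. f1 (fst x) (snd x)) \<in> borel_measurable (borel \<Otimes>\<^sub>M borel)"
    "(\<lambda>x. f2 (fst x) (snd x)) \<in> borel_measurable (borel \<Otimes>\<^sub>M borel)"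
  shows "(\<integral>\<^sup>+x. f0 (fst x) * (f1 (fst x) (fst (snd x)) * f2 (fst x) (snd (snd x))) \<partial>limit_pre L K) =
    (\<integral>\<^sup>+z. ennreal (1 / (2 * K) * tilt z) * f0 z * ((\<integral>\<^sup>+\<mu>. indicator {..z} (point_max \<mu>) * f1 z \<mu> \<partial>L) *
      (\<integral>\<^sup>+\<mu>. indicator {..z} (point_max \<mu>) * f2 z \<mu> \<partial>L)) \<partial>lborel)"
  by (rule nn_integral_limit_pre[OF L_prob[OF bbm ext] sets_L[OF bbm ext] measurable_point_max[OF bbm ext] C1_pos assms])

lemma sets_limit_pre: "sets (limit_pre L K) = sets (borel \<Otimes>\<^sub>M borel \<Otimes>\<^sub>M borel)"
  unfolding limit_pre_def by (simp add: sets_L[OF bbm ext] cong: sets_pair_measure_cong)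

lemma limit_map_measurable: "limit_map \<in> limit_pre L K \<rightarrow>\<^sub>M borel"
proof -
  note [measurable] = measurable_point_max[OF bbm ext]
  have "limit_map \<in> (borel \<Otimes>\<^sub>M borel \<Otimes>\<^sub>M borel) \<rightarrow>\<^sub>M (borel \<Otimes>\<^sub>M borel \<Otimes>\<^sub>M borel \<Otimes>\<^sub>M borel)"
    unfolding limit_map_def by measurable
  then show ?thesis by (simp add: borel_prod measurable_cong_sets[OF sets_limit_pre refl])
qed

text \<open>Translating by \<open>y\<close> takes the factor \<open>tilt y\<close> out of the
  integral: this is where the exponential law of parameter \<open>sqrt 2 * gam\<close> comes
  from.\<close>

lemma nn_tilt:
  assumes "0 \<le> y" and D: "D \<in> sets borel"
  shows "(\<integral>\<^sup>+z. ennreal (1 / (2 * K) * tilt z) * indicator D z * (ennreal (w (z - y)) * ennreal (w (z - y))) \<partial>lborel) =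
    ennreal (1 / (2 * K) * tilt y) * (\<integral>\<^sup>+z. indicator D (z + y) * ennreal (tilt z * (w z)\<^sup>2) \<partial>lborel)"
proof -
  note [measurable] = D
  let ?f = "\<lambda>z. ennreal (1 / (2 * K) * tilt z) * indicator D z * (ennreal (w (z - y)) * ennreal (w (z - y)))"
  have K: "0 < K" by (rule C1_pos)
  have w0: "0 \<le> w z" for z by (simp add: wave_cdf)
  have "(\<integral>\<^sup>+z. ?f z \<partial>lborel) = (\<integral>\<^sup>+z. ?f (y + 1 * z) \<partial>lborel)"
    using nn_integral_real_affine[of ?f 1 y] by simp
  also have "\<dots> = (\<integral>\<^sup>+z. ennreal (1 / (2 * K) * tilt y) * (indicator D (z + y) * ennreal (tilt z * (w z)\<^sup>2)) \<partial>lborel)"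
  proof (rule nn_integral_cong)
    fix z
    have "tilt (y + 1 * z) = tilt y * tilt z"
      by (simp add: tilt_def algebra_simps flip: exp_add)
    then have "ennreal (1 / (2 * K) * tilt (y + 1 * z)) * (ennreal (w z) * ennreal (w z)) = ennreal (1 / (2 * K) * tilt y) * ennreal (tilt z * (w z)\<^sup>2)"
      using K w0[of z] tilt_pos[of y] tilt_pos[of z]
      by (simp add: power2_eq_square mult_ac less_imp_le flip: ennreal_mult)
    then show "?f (y + 1 * z) = ennreal (1 / (2 * K) * tilt y) * (indicator D (z + y) * ennreal (tilt z * (w z)\<^sup>2))"
      by (auto simp: add.commute split: split_indicator)
  qed
  also have "\<dots> = ennreal (1 / (2 * K) * tilt y) * (\<integral>\<^sup>+z. indicator D (z + y) * ennreal (tilt z * (w z)\<^sup>2) \<partial>lborel)"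
    by (rule nn_integral_cmult) measurable
  finally show ?thesis .
qed

lemma prob_limit_pre: "prob_space (limit_pre L K)"
proof
  have "emeasure (limit_pre L K) (space (limit_pre L K)) = (\<integral>\<^sup>+x. (\<lambda>_. 1) (fst x) * ((\<lambda>_ _. 1) (fst x) (fst (snd x)) * (\<lambda>_ _. 1) (fst x) (snd (snd x))) \<partial>limit_pre L K)"
    by simp
  also have "\<dots> = (\<integral>\<^sup>+z. ennreal (1 / (2 * K) * tilt z) * 1 * ((\<integral>\<^sup>+\<mu>. indicator {..z} (point_max \<mu>) * 1 \<partial>L) *
      (\<integral>\<^sup>+\<mu>. indicator {..z} (point_max \<mu>) * 1 \<partial>L)) \<partial>lborel)"
    by (rule pre_int) auto
  also have "\<dots> = (\<integral>\<^sup>+z. ennreal (1 / (2 * K) * tilt z) * indicator UNIV z * (ennreal (w (z - 0)) * ennreal (w (z - 0))) \<partial>lborel)"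
  proof -
    have "indicator {..z} (point_max \<mu>) * indicator {..z} (point_max \<mu>) = (indicator {..z} (point_max \<mu>) :: ennreal)" for z \<mu>
      by (auto split: split_indicator)
    then have "(\<integral>\<^sup>+\<mu>. indicator {..z} (point_max \<mu>) \<partial>L) = ennreal (w z)" for z
      using nn_integral_cdf(1)[of z z] by simp
    then show ?thesis by simp
  qed
  also have "\<dots> = ennreal (1 / (2 * K)) * ennreal (2 * K)"
    by (subst nn_tilt) (auto simp: nn_wave_C1 tilt_def[of 0])
  also have "\<dots> = 1" using C1_pos by (simp flip: ennreal_mult)
  finally show "emeasure (limit_pre L K) (space (limit_pre L K)) = 1" .
qed

lemma prob_limit_rest: "prob_space (limit_rest L K)"
  unfolding limit_rest_def by (rule prob_space.prob_space_distr[OF prob_limit_pre limit_map_measurable])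

lemma prob_normal: "prob_space (density lborel (\<lambda>x. ennreal (std_normal_density x)))"
  by (rule prob_space_normal_density) simp

lemma prob_limit_law: "prob_space (limit_law L K)"
proof -
  interpret N: prob_space "density lborel (\<lambda>x. ennreal (std_normal_density x))" by (rule prob_normal)
  interpret R: prob_space "limit_rest L K" by (rule prob_limit_rest)
  interpret NR: pair_prob_space "density lborel (\<lambda>x. ennreal (std_normal_density x))" "limit_rest L K" ..
  show ?thesis unfolding limit_law_def by (rule NR.prob_space_axioms)
qed

lemma sets_limit_law: "sets (limit_law L K) = sets borel"
proof -
  have "sets (limit_law L K) = sets (borel \<Otimes>\<^sub>M borel :: (real \<times> real \<times> real \<times> point_measure \<times> point_measure) measure)"
    unfolding limit_law_def by (intro sets_pair_measure_cong) (auto simp: limit_rest_def)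
  then show ?thesis by (simp only: borel_prod)
qed

lemma limit_law_measurable: "f \<in> measurable (limit_law L K) M \<longleftrightarrow> f \<in> measurable borel M"
  by (simp add: measurable_cong_sets[OF sets_limit_law refl])

lemma nn_integral_limit_law:
  assumes f: "f \<in> borel_measurable borel" and g: "g \<in> borel_measurable borel"
  shows "(\<integral>\<^sup>+x. f (fst x) * g (snd x) \<partial>limit_law L K) =
    (\<integral>\<^sup>+k. ennreal (std_normal_density k) * f k \<partial>lborel) * (\<integral>\<^sup>+x. g (limit_map x) \<partial>limit_pre L K)"
proof -
  interpret R: prob_space "limit_rest L K" by (rule prob_limit_rest)
  have "(\<integral>\<^sup>+x. f (fst x) * g (snd x) \<partial>limit_law L K) =
    (\<integral>\<^sup>+k. f k \<partial>density lborel (\<lambda>x. ennreal (std_normal_density x))) * (\<integral>\<^sup>+y. g y \<partial>limit_rest L K)"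
    unfolding limit_law_def using f g
    by (intro nn_integral_pair_mult R.sigma_finite_measure_axioms) (auto simp: limit_rest_def)
  also have "(\<integral>\<^sup>+k. f k \<partial>density lborel (\<lambda>x. ennreal (std_normal_density x))) = (\<integral>\<^sup>+k. ennreal (std_normal_density k) * f k \<partial>lborel)"
    using f by (intro nn_integral_density) auto
  also have "(\<integral>\<^sup>+y. g y \<partial>limit_rest L K) = (\<integral>\<^sup>+x. g (limit_map x) \<partial>limit_pre L K)"
    unfolding limit_rest_def using g by (intro nn_integral_distr limit_map_measurable) auto
  finally show ?thesis .
qed

lemma Q_meas: "f \<in> measurable borel M \<Longrightarrow> f \<in> measurable Q M"
  by (simp add: limit_law_measurable)

lemma pm_meas [measurable]: "point_max \<in> borel_measurable borel"
  by (rule measurable_point_max[OF bbm ext])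

lemma nn_Q_snd:
  assumes g: "g \<in> borel_measurable borel"
  shows "(\<integral>\<^sup>+\<omega>. g (snd \<omega>) \<partial>Q) = (\<integral>\<^sup>+x. g (limit_map x) \<partial>limit_pre L K)"
proof -
  have "(\<integral>\<^sup>+\<omega>. (\<lambda>_. 1) (fst \<omega>) * g (snd \<omega>) \<partial>Q) = (\<integral>\<^sup>+k. ennreal (std_normal_density k) * 1 \<partial>lborel) * (\<integral>\<^sup>+x. g (limit_map x) \<partial>limit_pre L K)"
    by (rule nn_integral_limit_law[OF _ g]) simp
  then show ?thesis by (simp add: nn_integral_normal_density)
qed

text \<open>The gap is at least \<open>y\<close> exactly when both maxima are at most
  \<open>z - y\<close>, which turns the two factors \<open>w z\<close> of the density into
  \<open>w (z - y)\<close>; then \<open>nn_tilt\<close> applies.\<close>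

lemma joint_law:
  assumes y: "0 \<le> y"
  shows "\<P>(\<omega> in Q. chi_of \<omega> \<le> x \<and> exp_of \<omega> \<ge> y) =
    1 / (2 * K) * exp (- (sqrt 2 * gam * y)) * (LINT z:{..x - y}|lborel. exp (- (sqrt 2 * gam * z)) * (w z)\<^sup>2)"
proof -
  interpret Q: prob_space Q by (rule prob_limit_law)
  have K: "0 < K" by (rule C1_pos)
  note [measurable] = wave_measurable tilt_measurable
  have I: "integrable lborel (\<lambda>z. indicator {..x - y} z * (tilt z * (w z)\<^sup>2))"
    using integrable_mult_indicator[OF _ tilt_wave_integrable, of "{..x - y}"] by simp
  define S where "S = {\<omega> \<in> space Q. chi_of \<omega> \<le> x \<and> exp_of \<omega> \<ge> y}"
  have Ss: "S \<in> sets Q"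
    unfolding S_def using Q_meas[OF lim_obs_measurable(1)] Q_meas[OF lim_obs_measurable(2)] by measurable
  have "emeasure Q S = (\<integral>\<^sup>+\<omega>. indicator S \<omega> \<partial>Q)" using Ss by simp
  also have "\<dots> = (\<integral>\<^sup>+\<omega>. (\<lambda>r. indicator {..x} (fst r) * indicator {y..} (fst (snd r))) (snd \<omega>) \<partial>Q)"
    by (rule nn_integral_cong) (auto simp: S_def chi_of_def exp_of_def indicator_def)
  also have "\<dots> = (\<integral>\<^sup>+r. indicator {..x} (fst (limit_map r)) * indicator {y..} (fst (snd (limit_map r))) \<partial>limit_pre L K)"
    by (rule nn_Q_snd, rule measurable_borel_rest, measurable)
  also have "\<dots> = (\<integral>\<^sup>+r. indicator {..x} (fst r) * ((\<lambda>z \<mu>. indicator {..z - y} (point_max \<mu>)) (fst r) (fst (snd r)) *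
      (\<lambda>z \<mu>. indicator {..z - y} (point_max \<mu>)) (fst r) (snd (snd r))) \<partial>limit_pre L K)"
    by (rule nn_integral_cong) (auto simp: limit_map_def indicator_def)
  also have "\<dots> = (\<integral>\<^sup>+z. ennreal (1 / (2 * K) * tilt z) * indicator {..x} z *
      ((\<integral>\<^sup>+\<mu>. indicator {..z} (point_max \<mu>) * indicator {..z - y} (point_max \<mu>) \<partial>L) *
       (\<integral>\<^sup>+\<mu>. indicator {..z} (point_max \<mu>) * indicator {..z - y} (point_max \<mu>) \<partial>L)) \<partial>lborel)"
    by (rule pre_int) (unfold indicator_def atMost_iff, measurable)
  also have "\<dots> = (\<integral>\<^sup>+z. ennreal (1 / (2 * K) * tilt z) * indicator {..x} z * (ennreal (w (z - y)) * ennreal (w (z - y))) \<partial>lborel)"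
    using y by (simp add: nn_integral_cdf(1) min_absorb2)
  also have "\<dots> = ennreal (1 / (2 * K) * tilt y) * (\<integral>\<^sup>+z. indicator {..x} (z + y) * ennreal (tilt z * (w z)\<^sup>2) \<partial>lborel)"
    by (rule nn_tilt[OF y]) simp
  also have "(\<integral>\<^sup>+z. indicator {..x} (z + y) * ennreal (tilt z * (w z)\<^sup>2) \<partial>lborel) = (\<integral>\<^sup>+z. ennreal (indicator {..x - y} z * (tilt z * (w z)\<^sup>2)) \<partial>lborel)"
    by (rule nn_integral_cong) (auto simp: indicator_def)
  also have "\<dots> = ennreal (\<integral>z. indicator {..x - y} z * (tilt z * (w z)\<^sup>2) \<partial>lborel)"
    by (rule nn_integral_eq_integral[OF I]) (auto simp: less_imp_le[OF tilt_pos])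
  finally have "emeasure Q S = ennreal (1 / (2 * K) * tilt y * (\<integral>z. indicator {..x - y} z * (tilt z * (w z)\<^sup>2) \<partial>lborel))"
    using K tilt_pos[of y]
    by (subst ennreal_mult) (auto intro!: integral_nonneg_AE simp: less_imp_le[OF tilt_pos])
  then have "measure Q S = 1 / (2 * K) * tilt y * (\<integral>z. indicator {..x - y} z * (tilt z * (w z)\<^sup>2) \<partial>lborel)"
    unfolding Q.emeasure_eq_measure
    by (subst (asm) ennreal_inj)
      (use K tilt_pos[of y] in \<open>auto intro!: mult_nonneg_nonneg integral_nonneg_AE simp: less_imp_le[OF tilt_pos]\<close>)
  then show ?thesis by (simp add: S_def tilt_def set_lebesgue_integral_def)
qed

text \<open>A gap larger than \<open>a\<close> leaves \<open>z\<close> unrestricted, so the integral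
  in \<open>nn_tilt\<close> is the full \<open>2 * K\<close>, which cancels the normalisation and
  leaves \<open>tilt a\<close>.\<close>

lemma exp_of_exponential: "distributed Q lborel exp_of (exponential_density (sqrt 2 * gam))"
proof -
  interpret Q: prob_space Q by (rule prob_limit_law)
  have K: "0 < K" by (rule C1_pos)
  note em [measurable] = Q_meas[OF lim_obs_measurable(2)]
  have pos: "0 < sqrt 2 * gam" using sqrt2_bounds by (simp add: gam_def)
  show ?thesis
    unfolding Q.exponential_distributed_iff[OF pos]
  proof (intro conjI allI impI)
    show "exp_of \<in> borel_measurable Q" by (rule em)
    fix a :: real assume a: "0 \<le> a"
    define S where "S = {\<omega> \<in> space Q. a < exp_of \<omega>}"
    have Ss: "S \<in> sets Q" unfolding S_def by measurable
    have "emeasure Q S = (\<integral>\<^sup>+\<omega>. indicator S \<omega> \<partial>Q)" using Ss by simp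
    also have "\<dots> = (\<integral>\<^sup>+\<omega>. (\<lambda>r. indicator {a<..} (fst (snd r))) (snd \<omega>) \<partial>Q)"
      by (rule nn_integral_cong) (auto simp: S_def exp_of_def indicator_def)
    also have "\<dots> = (\<integral>\<^sup>+r. indicator {a<..} (fst (snd (limit_map r))) \<partial>limit_pre L K)"
      by (rule nn_Q_snd, rule measurable_borel_rest, measurable)
    also have "\<dots> = (\<integral>\<^sup>+r. indicator UNIV (fst r) * ((\<lambda>z \<mu>. indicator {..<z - a} (point_max \<mu>)) (fst r) (fst (snd r)) *
        (\<lambda>z \<mu>. indicator {..<z - a} (point_max \<mu>)) (fst r) (snd (snd r))) \<partial>limit_pre L K)"
      by (rule nn_integral_cong) (auto simp: limit_map_def indicator_def)
    also have "\<dots> = (\<integral>\<^sup>+z. ennreal (1 / (2 * K) * tilt z) * indicator UNIV z *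
        ((\<integral>\<^sup>+\<mu>. indicator {..z} (point_max \<mu>) * indicator {..<z - a} (point_max \<mu>) \<partial>L) *
         (\<integral>\<^sup>+\<mu>. indicator {..z} (point_max \<mu>) * indicator {..<z - a} (point_max \<mu>) \<partial>L)) \<partial>lborel)"
      by (rule pre_int) (unfold indicator_def lessThan_iff, measurable)
    also have "\<dots> = (\<integral>\<^sup>+z. ennreal (1 / (2 * K) * tilt z) * indicator UNIV z * (ennreal (w (z - a)) * ennreal (w (z - a))) \<partial>lborel)"
      using a by (simp add: nn_integral_cdf(2))
    also have "\<dots> = ennreal (1 / (2 * K) * tilt a) * (\<integral>\<^sup>+z. indicator UNIV (z + a) * ennreal (tilt z * (w z)\<^sup>2) \<partial>lborel)"
      by (rule nn_tilt[OF a]) simp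
    also have "\<dots> = ennreal (1 / (2 * K) * tilt a) * ennreal (2 * K)"
      by (simp add: nn_wave_C1)
    also have "\<dots> = ennreal (exp (- a * (sqrt 2 * gam)))"
      using K tilt_pos[of a] by (simp add: tilt_def mult_ac flip: ennreal_mult)
    finally have eS: "measure Q S = exp (- a * (sqrt 2 * gam))"
      by (simp add: Q.emeasure_eq_measure)
    have "{\<omega> \<in> space Q. exp_of \<omega> \<le> a} = space Q - S" by (auto simp: S_def)
    then show "measure Q {\<omega> \<in> space Q. exp_of \<omega> \<le> a} = 1 - exp (- a * (sqrt 2 * gam))"
      using Q.prob_compl[OF Ss] eS by simp
  qed
qed

lemma xi_normal: "distributed Q lborel fst std_normal_density"
proof -
  interpret R: prob_space "limit_rest L K" by (rule prob_limit_rest)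
  have "distr Q lborel fst = distr Q (density lborel (\<lambda>x. ennreal (std_normal_density x))) fst"
    by (rule distr_cong) auto
  also have "\<dots> = density lborel (\<lambda>x. ennreal (std_normal_density x))"
    unfolding limit_law_def by (rule R.distr_pair_fst)
  finally show ?thesis
    unfolding distributed_def by (auto intro!: Q_meas measurable_borel_tuple)
qed

lemma xi_independent:
  assumes f: "f \<in> measurable borel M"
  shows "independent_rvs Q borel fst M (\<lambda>\<omega>. f (snd \<omega>))"
  unfolding limit_law_def
  using independent_rvs_pair[OF prob_normal prob_limit_rest, of "\<lambda>x. x" borel f M] f
  by (simp add: limit_rest_def measurable_cong_sets[OF sets_distr refl])

lemma xi_independent_obs:
  "independent_rvs Q borel fst borel (\<lambda>\<omega>. (chi_of \<omega>, exp_of \<omega>))"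
  "independent_rvs Q borel fst borel (\<lambda>\<omega>. (chi_of \<omega>, exp_of \<omega>, proc_of \<omega>))"
proof -
  \<comment> \<open>\<open>proc_of\<close> ignores the first coordinate, so 0 may be put
    there.\<close>
  have p: "(\<lambda>r. proc_of (0, r)) \<in> borel_measurable borel"
    using lim_obs_measurable(5) by (rule measurable_compose[rotated]) (intro borel_measurable_continuous_onI continuous_intros)
  have 1: "(\<lambda>r. (fst r, fst (snd r))) \<in> measurable borel (borel :: (real \<times> real) measure)"
    by (intro borel_measurable_continuous_onI continuous_intros)
  have 2: "(\<lambda>r. (fst r, fst (snd r), proc_of (0, r))) \<in> measurable borel (borel :: (real \<times> real \<times> point_measure) measure)"
  proof -
    have [measurable]: "fst \<in> borel_measurable (borel :: (real \<times> real \<times> point_measure \<times> point_measure) measure)"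
      "(\<lambda>r. fst (snd r)) \<in> borel_measurable (borel :: (real \<times> real \<times> point_measure \<times> point_measure) measure)"
      by (intro borel_measurable_continuous_onI continuous_intros)+
    note [measurable] = p
    have "(\<lambda>r. (fst r, fst (snd r), proc_of (0, r))) \<in> measurable borel (borel \<Otimes>\<^sub>M borel \<Otimes>\<^sub>M borel)"
      by measurable
    then show ?thesis by (simp add: borel_prod)
  qed
  show "independent_rvs Q borel fst borel (\<lambda>\<omega>. (chi_of \<omega>, exp_of \<omega>))"
    using xi_independent[OF 1] by (simp add: chi_of_def[abs_def] exp_of_def[abs_def])
  show "independent_rvs Q borel fst borel (\<lambda>\<omega>. (chi_of \<omega>, exp_of \<omega>, proc_of \<omega>))"
    using xi_independent[OF 2]
    by (simp add: chi_of_def[abs_def] exp_of_def[abs_def] proc_of_def[abs_def] proc1_def proc2_def)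
qed

text \<open>The density of \<open>\<chi>\<close> contains one factor \<open>w z\<close> for each
  process, and these cancel the normalisations of the two conditional laws.\<close>

lemma conditioned_iid: "iid_conditioned_below Q chi_of proc1 proc2 L"
proof -
  interpret Q: prob_space Q by (rule prob_limit_law)
  interpret L: prob_space L by (rule L_prob[OF bbm ext])
  have K: "0 < K" by (rule C1_pos)
  note sL = sets_L[OF bbm ext]
  note [measurable] = L_measurable_point_max wave_measurable tilt_measurable
  define U where "U z = uniform_measure L {\<mu> \<in> space L. point_max \<mu> \<le> z}" for z
  have chim [measurable]: "chi_of \<in> borel_measurable Q" "proc1 \<in> borel_measurable Q" "proc2 \<in> borel_measurable Q"
    by (rule Q_meas, measurable)+
  have main: "\<P>(\<omega> in Q. chi_of \<omega> \<in> A \<and> proc1 \<omega> \<in> A1 \<and> proc2 \<omega> \<in> A2) =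
    (\<integral>\<omega>. indicator A (chi_of \<omega>) * (measure (U (chi_of \<omega>)) A1 * measure (U (chi_of \<omega>)) A2) \<partial>Q)"
    if A [measurable]: "A \<in> sets borel" "A1 \<in> sets borel" "A2 \<in> sets borel" for A A1 A2
  proof -
    define l where "l D z = (\<integral>\<^sup>+\<mu>. indicator {..z} (point_max \<mu>) * indicator D \<mu> \<partial>L)" for D z
    have lm: "l D \<in> borel_measurable borel" if D: "D \<in> sets borel" for D
    proof -
      have s1: "sets (borel \<Otimes>\<^sub>M L) = sets (borel \<Otimes>\<^sub>M borel)" by (intro sets_pair_measure_cong sL refl)
      have "(\<lambda>x. indicator {..fst x} (point_max (snd x)) * indicator D (snd x) :: ennreal) \<in> borel_measurable (borel \<Otimes>\<^sub>M borel)"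
        using D unfolding indicator_def atMost_iff by measurable
      then have "(\<lambda>x. indicator {..fst x} (point_max (snd x)) * indicator D (snd x) :: ennreal) \<in> borel_measurable (borel \<Otimes>\<^sub>M L)"
        by (simp add: measurable_cong_sets[OF s1 refl])
      from L.borel_measurable_nn_integral_fst[OF this] show ?thesis by (simp add: l_def[abs_def])
    qed
    have le: "l D z = ennreal (measure L ({\<mu> \<in> space L. point_max \<mu> \<le> z} \<inter> D))" if D: "D \<in> sets borel" for D z
    proof -
      have DL: "D \<in> sets L" using D sL by simp
      have "l D z = (\<integral>\<^sup>+\<mu>. indicator ({\<mu> \<in> space L. point_max \<mu> \<le> z} \<inter> D) \<mu> \<partial>L)"
        unfolding l_def by (rule nn_integral_cong) (auto simp: indicator_def)
      also have "\<dots> = emeasure L ({\<mu> \<in> space L. point_max \<mu> \<le> z} \<inter> D)"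
        by (rule nn_integral_indicator) (use DL in measurable)
      finally show ?thesis by (simp add: L.emeasure_eq_measure)
    qed
    have U: "measure (U z) D = measure L ({\<mu> \<in> space L. point_max \<mu> \<le> z} \<inter> D) / w z" if D: "D \<in> sets borel" for D z
    proof -
      have DL: "D \<in> sets L" using D sL by simp
      have "{\<mu> \<in> space L. point_max \<mu> \<le> z} \<in> sets L" by measurable
      then have "emeasure (U z) D = emeasure L ({\<mu> \<in> space L. point_max \<mu> \<le> z} \<inter> D) / emeasure L {\<mu> \<in> space L. point_max \<mu> \<le> z}"
        unfolding U_def using DL by simp
      then have e: "emeasure (U z) D = ennreal (measure L ({\<mu> \<in> space L. point_max \<mu> \<le> z} \<inter> D)) / ennreal (w z)"
        by (simp add: L.emeasure_eq_measure wave_cdf)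
      show ?thesis
      proof (cases "w z = 0")
        case True
        have "measure L ({\<mu> \<in> space L. point_max \<mu> \<le> z} \<inter> D) \<le> w z"
          unfolding wave_cdf by (rule L.finite_measure_mono) auto
        then have "measure L ({\<mu> \<in> space L. point_max \<mu> \<le> z} \<inter> D) = 0"
          using True by (simp add: measure_le_0_iff)
        then show ?thesis using e True by (simp add: measure_def)
      next
        case False
        then have "0 < w z" by (simp add: wave_cdf zero_less_measure_iff)
        then show ?thesis using e by (simp add: measure_def divide_ennreal)
      qed
    qed
    have w0: "0 \<le> w z" for z by (simp add: wave_cdf)
    have Um: "(\<lambda>z. measure (U z) D) \<in> borel_measurable borel" if D: "D \<in> sets borel" for D
    proof -
      have "measure (U z) D = enn2real (l D z) / w z" for z
        by (simp add: U[OF D] le[OF D])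
      then show ?thesis using lm[OF D] by simp
    qed
    note [measurable] = Um[OF A(2)] Um[OF A(3)]
    \<comment> \<open>Where \<open>w z = 0\<close> the conditional law is degenerate, but both sides
      are 0.\<close>
    have Ul: "ennreal (measure (U z) D) * ennreal (w z) = l D z" if D: "D \<in> sets borel" for D z
    proof (cases "w z = 0")
      case True
      have "measure L ({\<mu> \<in> space L. point_max \<mu> \<le> z} \<inter> D) \<le> w z"
        unfolding wave_cdf by (rule L.finite_measure_mono) auto
      then show ?thesis using True by (simp add: le[OF D] measure_le_0_iff)
    next
      case False
      then show ?thesis by (simp add: U[OF D] le[OF D] w0 flip: ennreal_mult)
    qed
    define S where "S = {\<omega> \<in> space Q. chi_of \<omega> \<in> A \<and> proc1 \<omega> \<in> A1 \<and> proc2 \<omega> \<in> A2}"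
    have Ss: "S \<in> sets Q" unfolding S_def by measurable
    have "emeasure Q S = (\<integral>\<^sup>+\<omega>. indicator S \<omega> \<partial>Q)" using Ss by simp
    also have "\<dots> = (\<integral>\<^sup>+\<omega>. (\<lambda>r. indicator A (fst r) * (indicator A1 (fst (snd (snd r))) * indicator A2 (snd (snd (snd r))))) (snd \<omega>) \<partial>Q)"
      by (rule nn_integral_cong) (auto simp: S_def chi_of_def proc1_def proc2_def indicator_def)
    also have "\<dots> = (\<integral>\<^sup>+r. indicator A (fst (limit_map r)) * (indicator A1 (fst (snd (snd (limit_map r)))) * indicator A2 (snd (snd (snd (limit_map r))))) \<partial>limit_pre L K)"
      by (rule nn_Q_snd, rule measurable_borel_rest, measurable)
    also have "\<dots> = (\<integral>\<^sup>+r. indicator A (fst r) * ((\<lambda>z \<mu>. indicator A1 \<mu>) (fst r) (fst (snd r)) * (\<lambda>z \<mu>. indicator A2 \<mu>) (fst r) (snd (snd r))) \<partial>limit_pre L K)"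
      by (simp add: limit_map_def)
    also have "\<dots> = (\<integral>\<^sup>+z. ennreal (1 / (2 * K) * tilt z) * indicator A z * (l A1 z * l A2 z) \<partial>lborel)"
      unfolding l_def by (rule pre_int) measurable
    also have "\<dots> = (\<integral>\<^sup>+z. ennreal (1 / (2 * K) * tilt z) * (indicator A z * ennreal (measure (U z) A1 * measure (U z) A2)) * (ennreal (w z) * ennreal (w z)) \<partial>lborel)"
      by (rule nn_integral_cong) (simp add: Ul[OF A(2), symmetric] Ul[OF A(3), symmetric] ennreal_mult mult_ac)
    \<comment> \<open>Each factor \<open>w z\<close> is written back as an integral over one
      process, so that \<open>pre_int\<close> can be read from right to left.\<close>
    also have "\<dots> = (\<integral>\<^sup>+z. ennreal (1 / (2 * K) * tilt z) * (indicator A z * ennreal (measure (U z) A1 * measure (U z) A2)) *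
        ((\<integral>\<^sup>+\<mu>. indicator {..z} (point_max \<mu>) * indicator {..z} (point_max \<mu>) \<partial>L) *
         (\<integral>\<^sup>+\<mu>. indicator {..z} (point_max \<mu>) * indicator {..z} (point_max \<mu>) \<partial>L)) \<partial>lborel)"
      by (simp add: nn_integral_cdf(1))
    also have "\<dots> = (\<integral>\<^sup>+r. (indicator A (fst r) * ennreal (measure (U (fst r)) A1 * measure (U (fst r)) A2)) *
        ((\<lambda>z \<mu>. indicator {..z} (point_max \<mu>)) (fst r) (fst (snd r)) * (\<lambda>z \<mu>. indicator {..z} (point_max \<mu>)) (fst r) (snd (snd r))) \<partial>limit_pre L K)"
      by (rule pre_int[symmetric]) (measurable, (unfold indicator_def atMost_iff, measurable)+)
    also have "\<dots> = (\<integral>\<^sup>+r. (indicator A (fst (limit_map r)) * ennreal (measure (U (fst (limit_map r))) A1 * measure (U (fst (limit_map r))) A2)) \<partial>limit_pre L K)"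
    proof (rule nn_integral_cong_AE)
      have "AE r in limit_pre L K. point_max (fst (snd r)) \<le> fst r \<and> point_max (snd (snd r)) \<le> fst r"
      proof -
        have dm: "(\<lambda>x. ennreal (1 / (2 * K) * tilt (fst x)) * (indicator {..fst x} (point_max (fst (snd x))) * indicator {..fst x} (point_max (snd (snd x)))))
          \<in> borel_measurable (lborel \<Otimes>\<^sub>M L \<Otimes>\<^sub>M L)"
          unfolding indicator_def atMost_iff by measurable
        show ?thesis
          unfolding limit_pre_def
          by (subst AE_density[OF dm]) (auto simp: indicator_def split: if_splits)
      qed
      then show "AE r in limit_pre L K. (indicator A (fst r) * ennreal (measure (U (fst r)) A1 * measure (U (fst r)) A2)) *
        ((\<lambda>z \<mu>. indicator {..z} (point_max \<mu>)) (fst r) (fst (snd r)) * (\<lambda>z \<mu>. indicator {..z} (point_max \<mu>)) (fst r) (snd (snd r))) =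
        indicator A (fst (limit_map r)) * ennreal (measure (U (fst (limit_map r))) A1 * measure (U (fst (limit_map r))) A2)"
        by eventually_elim (simp add: limit_map_def)
    qed
    also have "\<dots> = (\<integral>\<^sup>+\<omega>. (\<lambda>r. indicator A (fst r) * ennreal (measure (U (fst r)) A1 * measure (U (fst r)) A2)) (snd \<omega>) \<partial>Q)"
      by (rule nn_Q_snd[symmetric], rule measurable_borel_rest, measurable)
    also have "\<dots> = (\<integral>\<^sup>+\<omega>. ennreal (indicator A (chi_of \<omega>) * (measure (U (chi_of \<omega>)) A1 * measure (U (chi_of \<omega>)) A2)) \<partial>Q)"
      by (rule nn_integral_cong) (auto simp: chi_of_def indicator_def)
    also have "\<dots> = ennreal (\<integral>\<omega>. indicator A (chi_of \<omega>) * (measure (U (chi_of \<omega>)) A1 * measure (U (chi_of \<omega>)) A2) \<partial>Q)"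
    proof (rule nn_integral_eq_integral)
      have U1: "measure (U z) D \<le> 1" if D: "D \<in> sets borel" for z D
      proof -
        have "measure L ({\<mu> \<in> space L. point_max \<mu> \<le> z} \<inter> D) \<le> w z"
          unfolding wave_cdf by (rule L.finite_measure_mono) auto
        then show ?thesis using w0[of z] by (auto simp: U[OF D] divide_le_eq_1)
      qed
      show "integrable Q (\<lambda>\<omega>. indicator A (chi_of \<omega>) * (measure (U (chi_of \<omega>)) A1 * measure (U (chi_of \<omega>)) A2))"
      proof (rule Q.integrable_const_bound[where B = 1])
        show "(\<lambda>\<omega>. indicator A (chi_of \<omega>) * (measure (U (chi_of \<omega>)) A1 * measure (U (chi_of \<omega>)) A2)) \<in> borel_measurable Q"
          using measurable_compose[OF chim(1) Um[OF A(2)]] measurable_compose[OF chim(1) Um[OF A(3)]] by measurable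
      qed (use U1[OF A(2)] U1[OF A(3)] in \<open>auto simp: indicator_def mult_le_one\<close>)
    qed auto
    finally have "ennreal (measure Q S) = ennreal (\<integral>\<omega>. indicator A (chi_of \<omega>) * (measure (U (chi_of \<omega>)) A1 * measure (U (chi_of \<omega>)) A2) \<partial>Q)"
      by (simp add: Q.emeasure_eq_measure)
    then show ?thesis
      unfolding S_def by (subst (asm) ennreal_inj) (auto intro!: integral_nonneg_AE)
  qed
  show ?thesis
    unfolding iid_conditioned_below_def Let_def
    using chim main by (auto simp: U_def)
qed

text \<open>Almost surely both processes have a largest atom, so the maximum of the shifted union is
  the larger maximum minus \<open>\<chi>\<close>, which is minus the gap built into
  \<open>limit_map\<close>.\<close>

lemma exp_of_max: "AE \<omega> in Q. exp_of \<omega> = - point_max (proc_of \<omega>)"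
proof -
  interpret R: prob_space "limit_rest L K" by (rule prob_limit_rest)
  interpret L: prob_space L by (rule L_prob[OF bbm ext])
  interpret LL: pair_prob_space L L ..
  note [measurable] = L_measurable_point_max tilt_measurable
  define p where "p r = (fst (snd r) = - point_max (point_shift (- fst r) (point_union (fst (snd (snd r))) (snd (snd (snd r))))))"
    for r :: "real \<times> real \<times> point_measure \<times> point_measure"
  have pm: "{r. p r} \<in> sets borel"
  proof -
    have "Measurable.pred borel p"
      unfolding p_def by (rule measurable_borel_rest) measurable
    then show ?thesis by simp
  qed
  have dm: "(\<lambda>x. ennreal (1 / (2 * K) * tilt (fst x)) * (indicator {..fst x} (point_max (fst (snd x))) * indicator {..fst x} (point_max (snd (snd x)))))
    \<in> borel_measurable (lborel \<Otimes>\<^sub>M L \<Otimes>\<^sub>M L)"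
    unfolding indicator_def atMost_iff by measurable
  have "AE x in lborel \<Otimes>\<^sub>M L \<Otimes>\<^sub>M L. has_max (fst (snd x))"
    by (rule AE_pair_snd[OF LL.sigma_finite_measure_axioms AE_pair_fst[OF L.sigma_finite_measure_axioms extremal_has_max[OF bbm ext]]])
  moreover have "AE x in lborel \<Otimes>\<^sub>M L \<Otimes>\<^sub>M L. has_max (snd (snd x))"
    by (rule AE_pair_snd[OF LL.sigma_finite_measure_axioms AE_pair_snd[OF L.sigma_finite_measure_axioms extremal_has_max[OF bbm ext]]])
  ultimately have "AE x in lborel \<Otimes>\<^sub>M L \<Otimes>\<^sub>M L. p (limit_map x)"
    by eventually_elim (simp add: p_def limit_map_def point_max_shift_union)
  then have "AE x in limit_pre L K. p (limit_map x)"
    unfolding limit_pre_def by (subst AE_density[OF dm]) (auto elim: eventually_mono)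
  then have "AE r in limit_rest L K. p r"
    unfolding limit_rest_def using pm by (subst AE_distr_iff[OF limit_map_measurable]) auto
  then have "AE \<omega> in Q. p (snd \<omega>)"
    unfolding limit_law_def by (rule AE_pair_snd[OF R.sigma_finite_measure_axioms])
  then show ?thesis
    by eventually_elim (simp add: p_def exp_of_def proc_of_def chi_of_def proc1_def proc2_def)
qed

section \<open>Conditional convergence\<close>

abbreviation (input) "hit_event t \<equiv> {\<omega> \<in> space P. max_position T B t \<omega> \<le> sqrt 2 * \<alpha> * t}"
abbreviation (input) "normal_mass A \<equiv> \<integral>\<^sup>+k. ennreal (std_normal_density k * indicator A k) \<partial>lborel"

lemma measurable_bbm_obs: "0 \<le> t \<Longrightarrow> bbm_obs T B \<alpha> t \<in> measurable P borel"
proof -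
  assume t: "0 \<le> t"
  note [measurable] = measurable_tau_std[OF bbm ext] measurable_pos_std[OF bbm ext]
    measurable_max_position[OF bbm t] measurable_particles[OF bbm t]
  show ?thesis unfolding bbm_obs_def[abs_def] by (rule measurable_obs) measurable
qed

lemma measurable_limit_obs: "limit_obs \<in> measurable Q borel"
proof -
  note [measurable] = Q_meas[OF lim_obs_measurable(1)] Q_meas[OF lim_obs_measurable(2)]
    Q_meas[OF lim_obs_measurable(5)]
  have [measurable]: "fst \<in> borel_measurable Q"
    by (intro Q_meas measurable_borel_tuple) measurable
  show ?thesis unfolding limit_obs_def[abs_def] by (rule measurable_obs) measurable
qed

text \<open>Once the maximum is at most \<open>z\<close>, only the part of \<open>S\<close> on the
  nonpositive half-line matters, so \<open>S\<close> may be replaced by the half-line ending at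
  \<open>q\<close>.\<close>

lemma nn_integral_hit_lim:
  assumes q: "q \<le> 0" "S \<in> sets borel" "\<And>x. x \<le> 0 \<Longrightarrow> x \<in> S \<longleftrightarrow> x \<le> q"
    and \<phi>: "test_fun \<phi>" "\<And>x. 0 \<le> \<phi> x"
  shows "(\<integral>\<^sup>+\<mu>. indicator {..z} (point_max \<mu>) *
      ennreal (indicator S (point_max \<mu> - z) * exp (- point_integral \<mu> (\<lambda>y. \<phi> (y - z)))) \<partial>L) = ennreal (hit_lim L q \<phi> z)"
proof -
  interpret L: prob_space L by (rule L_prob[OF bbm ext])
  note [measurable] = L_measurable_point_max
  have "test_fun (\<lambda>y. \<phi> (y - z))" using test_fun_shift[OF \<phi>(1), of "- z"] by simp
  then have "(\<lambda>\<mu>. point_integral \<mu> (\<lambda>y. \<phi> (y - z))) \<in> borel_measurable borel"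
    by (rule measurable_point_integral)
  then have [measurable]: "(\<lambda>\<mu>. point_integral \<mu> (\<lambda>y. \<phi> (y - z))) \<in> borel_measurable L"
    by (simp add: measurable_L_iff[OF bbm ext])
  have "(\<integral>\<^sup>+\<mu>. indicator {..z} (point_max \<mu>) *
      ennreal (indicator S (point_max \<mu> - z) * exp (- point_integral \<mu> (\<lambda>y. \<phi> (y - z)))) \<partial>L) =
      (\<integral>\<^sup>+\<mu>. ennreal (indicator {..z + q} (point_max \<mu>) * exp (- point_integral \<mu> (\<lambda>y. \<phi> (y - z)))) \<partial>L)"
    by (rule nn_integral_cong) (use q in \<open>auto simp: indicator_def\<close>)
  also have "\<dots> = ennreal (hit_lim L q \<phi> z)"
    unfolding hit_lim_def
    by (intro nn_integral_eq_integral L.integrable_const_bound[where B = 1])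
       (auto simp: indicator_def point_integral_nonneg \<phi>(2))
  finally show ?thesis .
qed

lemma base_fun_limit_obs:
  assumes S: "\<And>a b. max a b \<in> S \<longleftrightarrow> a \<in> S \<and> b \<in> S" and \<phi>: "test_fun \<phi>"
  shows "base_fun A D S \<phi> (limit_obs (k, limit_map (z, \<mu>, \<nu>))) = indicator A k * (indicator D (- z) *
    ((indicator S (point_max \<mu> - z) * exp (- point_integral \<mu> (\<lambda>y. \<phi> (y - z)))) *
     (indicator S (point_max \<nu> - z) * exp (- point_integral \<nu> (\<lambda>y. \<phi> (y - z))))))"
proof -
  have "max (point_max \<mu>) (point_max \<nu>) - z = max (point_max \<mu> - z) (point_max \<nu> - z)" by simp
  then have "indicator S (- (z - max (point_max \<mu>) (point_max \<nu>))) =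
      (indicator S (point_max \<mu> - z) * indicator S (point_max \<nu> - z) :: real)"
    using S[of "point_max \<mu> - z" "point_max \<nu> - z"] by (simp add: indicator_def)
  moreover have "point_integral (point_shift (- z) (point_union \<mu> \<nu>)) \<phi> =
      point_integral \<mu> (\<lambda>y. \<phi> (y - z)) + point_integral \<nu> (\<lambda>y. \<phi> (y - z))"
    using point_integral_union[OF test_fun_shift[OF \<phi>, of "- z"]] by (simp add: point_integral_shift)
  ultimately show ?thesis
    by (simp add: base_fun_def limit_obs_def limit_map_def chi_of_def exp_of_def proc_of_def proc1_def proc2_def
        exp_add[symmetric] exp_diff exp_minus field_simps)
qed

text \<open>The counterpart of \<open>class_limit\<close> for the limit law: given \<open>z\<close>
  the two processes are independent and each contributes \<open>hit_lim L q \<phi> z\<close>, which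
  gives the same \<open>lim_z\<close> up to the normalisation.\<close>

lemma limit_expectation:
  assumes q: "q \<le> 0" "S \<in> sets borel" "\<And>x. x \<le> 0 \<Longrightarrow> x \<in> S \<longleftrightarrow> x \<le> q"
    and S: "\<And>a b. max a b \<in> S \<longleftrightarrow> a \<in> S \<and> b \<in> S"
    and \<phi>: "test_fun \<phi>" "\<And>x. 0 \<le> \<phi> x" and A [measurable]: "A \<in> sets borel" and D [measurable]: "D \<in> sets borel"
  shows "(\<integral>\<^sup>+\<omega>. ennreal (base_fun A D S \<phi> (limit_obs \<omega>)) \<partial>Q) =
    normal_mass A * (ennreal (1 / (2 * K)) * lim_z L q \<phi> (indicator D))"
proof -
  note [measurable] = q(2) wave_measurable tilt_measurable hit_lim_measurable[OF \<phi> q(1)]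
  define h where "h z \<mu> = indicator S (point_max \<mu> - z) * exp (- point_integral \<mu> (\<lambda>y. \<phi> (y - z)))" for z \<mu>
  have h0: "0 \<le> h z \<mu>" for z \<mu> by (simp add: h_def)
  have hm: "(\<lambda>x. ennreal (h (fst x) (snd x))) \<in> borel_measurable (borel \<Otimes>\<^sub>M borel)"
  proof -
    have "(\<lambda>x. (- fst x, snd x)) \<in> measurable (borel \<Otimes>\<^sub>M borel) (borel \<Otimes>\<^sub>M borel :: (real \<times> point_measure) measure)"
      by measurable
    from measurable_compose[OF this measurable_point_integral_shift[OF \<phi>(1)]]
    have [measurable]: "(\<lambda>x. point_integral (snd x) (\<lambda>y. \<phi> (y - fst x))) \<in> borel_measurable (borel \<Otimes>\<^sub>M borel)" by simp
    show ?thesis unfolding h_def by measurable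
  qed
  define g where "g r = ennreal (indicator D (- chi_of (0, r)) * (indicator S (- exp_of (0, r)) *
    exp (- point_integral (proc_of (0, r)) \<phi>)))" for r
  have gm: "g \<in> borel_measurable borel"
  proof -
    have [measurable]: "Pair 0 \<in> measurable borel (borel :: lim_obs measure)"
      by (intro borel_measurable_continuous_onI continuous_intros)
    note [measurable] = measurable_compose[OF this lim_obs_measurable(1)] measurable_compose[OF this lim_obs_measurable(2)]
      measurable_compose[OF measurable_compose[OF this lim_obs_measurable(5)] measurable_point_integral[OF \<phi>(1)]]
    show ?thesis unfolding g_def by measurable
  qed
  have gb: "ennreal (base_fun A D S \<phi> (limit_obs \<omega>)) = indicator A (fst \<omega>) * g (snd \<omega>)" for \<omega>
    by (cases \<omega>) (auto simp: base_fun_def limit_obs_def g_def chi_of_def exp_of_def proc_of_def proc1_def proc2_def indicator_def)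
  have gl: "g (limit_map x) = indicator D (- fst x) * (ennreal (h (fst x) (fst (snd x))) * ennreal (h (fst x) (snd (snd x))))" for x
  proof -
    obtain z \<mu> \<nu> where x: "x = (z, \<mu>, \<nu>)" by (cases x) auto
    have "g (limit_map x) = ennreal (base_fun UNIV D S \<phi> (limit_obs (0, limit_map x)))" by (simp add: gb[of "(0, limit_map x)", simplified] base_fun_def limit_obs_def g_def)
    also have "\<dots> = ennreal (indicator D (- z) * (h z \<mu> * h z \<nu>))"
      using base_fun_limit_obs[OF S \<phi>(1), of UNIV D 0 z \<mu> \<nu>] by (simp add: x h_def)
    also have "\<dots> = indicator D (- z) * (ennreal (h z \<mu>) * ennreal (h z \<nu>))"
      using h0 by (auto simp: indicator_def ennreal_mult)
    finally show ?thesis by (simp add: x)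
  qed
  have hl0: "0 \<le> hit_lim L q \<phi> z" for z
    unfolding hit_lim_def by (intro integral_nonneg_AE) auto
  have K: "0 < K" by (rule C1_pos)
  have "(\<integral>\<^sup>+\<omega>. ennreal (base_fun A D S \<phi> (limit_obs \<omega>)) \<partial>Q) = (\<integral>\<^sup>+\<omega>. indicator A (fst \<omega>) * g (snd \<omega>) \<partial>Q)"
    by (simp add: gb)
  also have "\<dots> = (\<integral>\<^sup>+k. ennreal (std_normal_density k) * indicator A k \<partial>lborel) * (\<integral>\<^sup>+x. g (limit_map x) \<partial>limit_pre L K)"
    by (rule nn_integral_limit_law[OF _ gm]) measurable
  also have "(\<integral>\<^sup>+k. ennreal (std_normal_density k) * indicator A k \<partial>lborel) = normal_mass A"
    by (rule nn_integral_cong) (auto simp: indicator_def)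
  also have "(\<integral>\<^sup>+x. g (limit_map x) \<partial>limit_pre L K) =
      (\<integral>\<^sup>+x. (\<lambda>z. indicator D (- z)) (fst x) * ((\<lambda>z \<mu>. ennreal (h z \<mu>)) (fst x) (fst (snd x)) * (\<lambda>z \<mu>. ennreal (h z \<mu>)) (fst x) (snd (snd x))) \<partial>limit_pre L K)"
    by (simp add: gl)
  also have "\<dots> = (\<integral>\<^sup>+z. ennreal (1 / (2 * K) * tilt z) * indicator D (- z) *
      ((\<integral>\<^sup>+\<mu>. indicator {..z} (point_max \<mu>) * ennreal (h z \<mu>) \<partial>L) * (\<integral>\<^sup>+\<mu>. indicator {..z} (point_max \<mu>) * ennreal (h z \<mu>) \<partial>L)) \<partial>lborel)"
    by (rule pre_int[OF _ hm hm]) measurable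
  also have "\<dots> = (\<integral>\<^sup>+z. ennreal (1 / (2 * K)) * ennreal (indicator D (- z) * (tilt z * (hit_lim L q \<phi> z)\<^sup>2)) \<partial>lborel)"
  proof (rule nn_integral_cong)
    fix z
    have "(\<integral>\<^sup>+\<mu>. indicator {..z} (point_max \<mu>) * ennreal (h z \<mu>) \<partial>L) = ennreal (hit_lim L q \<phi> z)"
      unfolding h_def by (rule nn_integral_hit_lim[OF q \<phi>])
    then show "ennreal (1 / (2 * K) * tilt z) * indicator D (- z) *
      ((\<integral>\<^sup>+\<mu>. indicator {..z} (point_max \<mu>) * ennreal (h z \<mu>) \<partial>L) * (\<integral>\<^sup>+\<mu>. indicator {..z} (point_max \<mu>) * ennreal (h z \<mu>) \<partial>L)) =
      ennreal (1 / (2 * K)) * ennreal (indicator D (- z) * (tilt z * (hit_lim L q \<phi> z)\<^sup>2))"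
      using hl0[of z] tilt_pos[of z] K
      by (auto simp: indicator_def power2_eq_square mult_ac less_imp_le simp flip: ennreal_mult)
  qed
  also have "\<dots> = ennreal (1 / (2 * K)) * lim_z L q \<phi> (indicator D)"
    unfolding lim_z_def tilt_def[symmetric] by (rule nn_integral_cmult) measurable
  finally show ?thesis .
qed

lemma normal_mass_UNIV: "normal_mass UNIV = 1"
  by (simp add: nn_integral_normal_density)

lemma normal_mass_finite: "normal_mass A < \<infinity>"
proof -
  have "normal_mass A \<le> normal_mass UNIV"
    by (intro nn_integral_mono ennreal_leI) (auto simp: indicator_def)
  then show ?thesis unfolding normal_mass_UNIV by (rule le_less_trans) simp
qed

lemma v_coeff_range: "v_coeff \<alpha> \<in> {0<..<1}"
  using \<alpha> by (auto simp: v_coeff_def gam_def)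

lemma main_rate_pos: "0 < t \<Longrightarrow> 0 < main_rate \<alpha> t"
  using v_coeff_range by (simp add: main_rate_def)

lemma hit_event_sets: "0 \<le> t \<Longrightarrow> hit_event t \<in> sets P"
proof -
  assume "0 \<le> t"
  note [measurable] = measurable_max_position[OF bbm this]
  show ?thesis by measurable
qed

lemma joint_limit:
  assumes \<phi>: "test_fun \<phi>" "\<And>x. 0 \<le> \<phi> x" and q: "q \<le> 0" and A: "A \<in> sets borel" and D: "D \<in> sets borel"
  shows "((\<lambda>t. (\<integral>\<omega>. base_fun A D {..q} \<phi> (bbm_obs T B \<alpha> t \<omega>) \<partial>P) / main_rate \<alpha> t) \<longlongrightarrow>
    enn2real (normal_mass A * lim_z L q \<phi> (indicator D)) / 2) at_top"
proof -
  define X where "X = enn2real (normal_mass A * lim_z L q \<phi> (indicator D))"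
  have fin: "lim_z L q \<phi> (indicator D) < \<infinity>"
    by (rule class_limit(2)[OF bbm ext \<alpha> \<phi> q, where A = "indicator A"]) (use A D in \<open>auto simp: indicator_def\<close>)
  have X: "normal_mass A * lim_z L q \<phi> (indicator D) = ennreal X"
    unfolding X_def using fin normal_mass_finite[of A] by (simp add: ennreal_mult_less_top)
  have "((\<lambda>t. ennreal ((\<integral>\<omega>. base_fun A D {..q} \<phi> (bbm_obs T B \<alpha> t \<omega>) \<partial>P) / main_rate \<alpha> t)) \<longlongrightarrow>
    ennreal (1 / 2) * normal_mass A * lim_z L q \<phi> (indicator D)) at_top"
    unfolding base_fun_def bbm_obs_def fst_conv snd_conv
    by (rule class_limit(1)[OF bbm ext \<alpha> \<phi> q]) (use A D in \<open>auto simp: indicator_def\<close>)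
  also have "ennreal (1 / 2) * normal_mass A * lim_z L q \<phi> (indicator D) = ennreal (1 / 2) * ennreal X"
    by (simp only: X mult.assoc)
  also have "\<dots> = ennreal (X / 2)" using ennreal_mult[of "1 / 2" X] by (simp add: X_def)
  finally have "((\<lambda>t. ennreal ((\<integral>\<omega>. base_fun A D {..q} \<phi> (bbm_obs T B \<alpha> t \<omega>) \<partial>P) / main_rate \<alpha> t)) \<longlongrightarrow> ennreal (X / 2)) at_top" .
  then show ?thesis
    unfolding X_def[symmetric]
  proof (subst (asm) tendsto_ennreal_iff)
    show "0 \<le> X / 2" by (simp add: X_def)
    show "\<forall>\<^sub>F t in at_top. 0 \<le> (\<integral>\<omega>. base_fun A D {..q} \<phi> (bbm_obs T B \<alpha> t \<omega>) \<partial>P) / main_rate \<alpha> t"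
      using eventually_gt_at_top[of 0]
    proof eventually_elim
      case (elim t)
      then show ?case
        using base_fun_bounds[OF \<phi>(2)] main_rate_pos[of t] by (intro divide_nonneg_pos integral_nonneg_AE) auto
    qed
  qed
qed

text \<open>The case of trivial weights and \<open>q = 0\<close>, where the limit in
  \<open>joint_limit\<close> is half of \<open>2 * K\<close>.\<close>

lemma hit_event_limit: "((\<lambda>t. measure P (hit_event t) / main_rate \<alpha> t) \<longlongrightarrow> K) at_top"
proof -
  have eq: "(\<integral>\<omega>. base_fun UNIV UNIV {..0} (\<lambda>_. 0) (bbm_obs T B \<alpha> t \<omega>) \<partial>P) = measure P (hit_event t)" if "0 \<le> t" for t
  proof -
    have "(\<integral>\<omega>. base_fun UNIV UNIV {..0} (\<lambda>_. 0) (bbm_obs T B \<alpha> t \<omega>) \<partial>P) = (\<integral>\<omega>. indicator (hit_event t) \<omega> \<partial>P)"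
      by (rule Bochner_Integration.integral_cong) (auto simp: base_fun_def bbm_obs_def indicator_def)
    then show ?thesis using hit_event_sets[OF that] by simp
  qed
  have ev: "\<forall>\<^sub>F t in at_top. (\<integral>\<omega>. base_fun UNIV UNIV {..0} (\<lambda>_. 0) (bbm_obs T B \<alpha> t \<omega>) \<partial>P) / main_rate \<alpha> t = measure P (hit_event t) / main_rate \<alpha> t"
    using eventually_ge_at_top[of 0] by (rule eventually_mono) (simp only: eq)
  have lim: "((\<lambda>t. (\<integral>\<omega>. base_fun UNIV UNIV {..0} (\<lambda>_. 0) (bbm_obs T B \<alpha> t \<omega>) \<partial>P) / main_rate \<alpha> t) \<longlongrightarrow>
      enn2real (normal_mass UNIV * lim_z L 0 (\<lambda>_. 0) (indicator UNIV)) / 2) at_top"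
    by (rule joint_limit[OF test_fun_zero]) auto
  have "enn2real (normal_mass UNIV * lim_z L 0 (\<lambda>_. 0) (indicator UNIV)) / 2 = K"
  proof -
    have "lim_z L 0 (\<lambda>_. 0) (indicator UNIV) = ennreal (2 * K)"
      using nn_wave nn_wave_C1 by (simp add: lim_z_def)
    then show ?thesis using C1_pos unfolding normal_mass_UNIV by simp
  qed
  then show ?thesis using Lim_transform_eventually[OF lim ev] by simp
qed

lemma hit_event_pos: "\<forall>\<^sub>F t in at_top. 0 < measure P (hit_event t)"
  using order_tendstoD(1)[OF hit_event_limit C1_pos] eventually_gt_at_top[of 0]
proof eventually_elim
  case (elim t)
  then show ?case using main_rate_pos[of t] by (simp add: zero_less_divide_iff)
qed

lemma hit_event_asymp: "(\<lambda>t. measure P (hit_event t)) \<sim>[at_top] (\<lambda>t. K * main_rate \<alpha> t)"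
proof (rule asymp_equivI')
  have "((\<lambda>t. measure P (hit_event t) / main_rate \<alpha> t / K) \<longlongrightarrow> K / K) at_top"
    by (intro tendsto_intros hit_event_limit) (use C1_pos in auto)
  then show "((\<lambda>t. measure P (hit_event t) / (K * main_rate \<alpha> t)) \<longlongrightarrow> 1) at_top"
    using C1_pos by (simp add: mult.commute)
qed

text \<open>A quotient of two asymptotics of the same order: \<open>main_rate\<close> cancels, and
  what remains is the expectation found in \<open>limit_expectation\<close>.\<close>

lemma conditional_limit:
  assumes g: "g \<in> base_class"
  shows "((\<lambda>t. \<integral>\<omega>. g (bbm_obs T B \<alpha> t \<omega>) \<partial>uniform_measure P (hit_event t)) \<longlongrightarrow> (\<integral>\<omega>. g (limit_obs \<omega>) \<partial>Q)) at_top"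
proof -
  interpret Q: prob_space Q by (rule prob_limit_law)
  obtain A D S \<phi> where gd: "g = base_fun A D S \<phi>" and A: "A \<in> sets borel" and D: "D \<in> sets borel"
    and S: "S \<in> insert UNIV (range atMost)" and \<phi>: "test_fun \<phi>" "\<And>x. 0 \<le> \<phi> x"
    using g unfolding base_class_def by blast
  have Sb: "S \<in> sets borel" using S by auto
  \<comment> \<open>On the conditioning event the recentred maximum is nonpositive, so a threshold
    \<open>c\<close> may be lowered to \<open>min c 0\<close>. This brings every member of the class
    into the range \<open>q \<le> 0\<close>, where the tail bound holds.\<close>
  obtain q where q: "q \<le> 0" "\<And>x. x \<le> 0 \<Longrightarrow> x \<in> S \<longleftrightarrow> x \<le> q"
  proof (cases "S = UNIV")
    case True then show ?thesis by (intro that[of 0]) auto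
  next
    case False
    then obtain c where "S = {..c}" using S by auto
    then show ?thesis by (intro that[of "min c 0"]) auto
  qed
  have Smax: "max a b \<in> S \<longleftrightarrow> a \<in> S \<and> b \<in> S" for a b using S by auto
  have K: "0 < K" by (rule C1_pos)
  define X where "X = enn2real (normal_mass A * lim_z L q \<phi> (indicator D))"
  have gm: "g \<in> borel_measurable borel" by (rule base_class_measurable[OF g])
  have "(\<integral>\<omega>. g (limit_obs \<omega>) \<partial>Q) = enn2real (\<integral>\<^sup>+\<omega>. ennreal (g (limit_obs \<omega>)) \<partial>Q)"
    by (rule integral_eq_nn_integral)
      (use measurable_compose[OF measurable_limit_obs gm] base_fun_bounds[OF \<phi>(2)] in \<open>auto simp: gd\<close>)
  also have "\<dots> = enn2real (ennreal (1 / (2 * K)) * (normal_mass A * lim_z L q \<phi> (indicator D)))"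
  proof -
    have "(\<integral>\<^sup>+\<omega>. ennreal (g (limit_obs \<omega>)) \<partial>Q) = normal_mass A * (ennreal (1 / (2 * K)) * lim_z L q \<phi> (indicator D))"
      unfolding gd by (rule limit_expectation[OF q(1) Sb q(2) Smax \<phi> A D])
    then show ?thesis by (simp only: mult.left_commute)
  qed
  also have "\<dots> = X / 2 / K" using K by (simp add: X_def enn2real_mult)
  finally have eq: "(\<integral>\<omega>. g (limit_obs \<omega>) \<partial>Q) = X / 2 / K" .
  have "((\<lambda>t. (\<integral>\<omega>. base_fun A D {..q} \<phi> (bbm_obs T B \<alpha> t \<omega>) \<partial>P) / main_rate \<alpha> t / (measure P (hit_event t) / main_rate \<alpha> t)) \<longlongrightarrow> X / 2 / K) at_top"
    unfolding X_def by (intro tendsto_divide joint_limit[OF \<phi> q(1) A D] hit_event_limit) (use K in auto)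
  moreover have "\<forall>\<^sub>F t in at_top. (\<integral>\<omega>. base_fun A D {..q} \<phi> (bbm_obs T B \<alpha> t \<omega>) \<partial>P) / main_rate \<alpha> t / (measure P (hit_event t) / main_rate \<alpha> t) =
      (\<integral>\<omega>. g (bbm_obs T B \<alpha> t \<omega>) \<partial>uniform_measure P (hit_event t))"
    using hit_event_pos eventually_gt_at_top[of 0]
  proof eventually_elim
    case (elim t)
    have t: "0 \<le> t" using elim by simp
    have "(\<integral>\<omega>. g (bbm_obs T B \<alpha> t \<omega>) \<partial>uniform_measure P (hit_event t)) =
        (\<integral>\<omega>. indicator (hit_event t) \<omega> * g (bbm_obs T B \<alpha> t \<omega>) \<partial>P) / measure P (hit_event t)"
      by (rule integral_uniform_measure[OF bbm_prob[OF bbm] hit_event_sets[OF t] elim(1)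
          measurable_compose[OF measurable_bbm_obs[OF t] gm]])
    also have "(\<integral>\<omega>. indicator (hit_event t) \<omega> * g (bbm_obs T B \<alpha> t \<omega>) \<partial>P) = (\<integral>\<omega>. base_fun A D {..q} \<phi> (bbm_obs T B \<alpha> t \<omega>) \<partial>P)"
      by (rule Bochner_Integration.integral_cong)
        (use q in \<open>auto simp: gd base_fun_def bbm_obs_def indicator_def\<close>)
    finally show ?case using main_rate_pos[OF elim(2)] by simp
  qed
  ultimately show ?thesis unfolding eq by (simp add: tendsto_cong)
qed

lemma conditional_prob_space:
  assumes "0 \<le> t" "0 < measure P (hit_event t)"
  shows "prob_space (uniform_measure P (hit_event t))"
proof -
  interpret P: prob_space P by (rule bbm_prob[OF bbm])
  show ?thesis using assms by (intro prob_space_uniform_measure) (auto simp: P.emeasure_eq_measure)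
qed

text \<open>\<open>portmanteau\<close> is applied to the image laws on the space of observables,
  where the class and the bump functions live.\<close>

lemma conditional_convergence: "converges_in_law (\<lambda>t. uniform_measure P (hit_event t)) (bbm_obs T B \<alpha>) Q limit_obs"
  unfolding converges_in_law_def
proof (intro conjI allI impI)
  show "\<forall>\<^sub>F t in at_top. bbm_obs T B \<alpha> t \<in> uniform_measure P (hit_event t) \<rightarrow>\<^sub>M borel"
    using eventually_ge_at_top[of 0] by eventually_elim (simp add: measurable_cong_sets[OF sets_uniform_measure refl] measurable_bbm_obs)
  show "limit_obs \<in> Q \<rightarrow>\<^sub>M borel" by (rule measurable_limit_obs)
  fix f :: "obs \<Rightarrow> real" assume f: "continuous_on UNIV f" "bounded (range f)"
  define M where "M t = distr (uniform_measure P (hit_event t)) borel (bbm_obs T B \<alpha> t)" for t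
  define N where "N = distr Q borel limit_obs"
  have fm: "f \<in> borel_measurable borel" by (rule borel_measurable_continuous_onI[OF f(1)])
  have Mint: "(\<integral>x. g x \<partial>M t) = (\<integral>\<omega>. g (bbm_obs T B \<alpha> t \<omega>) \<partial>uniform_measure P (hit_event t))"
    if "0 \<le> t" "g \<in> borel_measurable borel" for t and g :: "obs \<Rightarrow> real"
    unfolding M_def using that measurable_bbm_obs[OF that(1)] by (intro integral_distr) simp_all
  have Nint: "(\<integral>x. g x \<partial>N) = (\<integral>\<omega>. g (limit_obs \<omega>) \<partial>Q)" if "g \<in> borel_measurable borel" for g :: "obs \<Rightarrow> real"
    unfolding N_def by (rule integral_distr[OF measurable_limit_obs that])
  have "((\<lambda>t. \<integral>x. f x \<partial>M t) \<longlongrightarrow> (\<integral>x. f x \<partial>N)) at_top"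
  proof (rule portmanteau[where C = base_class])
    show "\<forall>\<^sub>F t in at_top. prob_space (M t) \<and> sets (M t) = sets borel"
      using hit_event_pos eventually_ge_at_top[of 0]
    proof eventually_elim
      case (elim t)
      then show ?case
        unfolding M_def
        using prob_space.prob_space_distr[OF conditional_prob_space, of t "bbm_obs T B \<alpha> t" borel] measurable_bbm_obs[of t] by simp
    qed
    show "prob_space N" unfolding N_def by (rule prob_space.prob_space_distr[OF prob_limit_law measurable_limit_obs])
    show "sets N = sets borel" by (simp add: N_def)
    show "((\<lambda>t. \<integral>x. g x \<partial>M t) \<longlongrightarrow> (\<integral>x. g x \<partial>N)) at_top" if g: "g \<in> base_class" for g
    proof -
      have gm: "g \<in> borel_measurable borel" by (rule base_class_measurable[OF g])
      have "\<forall>\<^sub>F t in at_top. (\<integral>x. g x \<partial>M t) = (\<integral>\<omega>. g (bbm_obs T B \<alpha> t \<omega>) \<partial>uniform_measure P (hit_event t))"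
        using eventually_ge_at_top[of 0] by eventually_elim (simp add: Mint gm)
      then show ?thesis using conditional_limit[OF g] by (simp add: tendsto_cong Nint gm)
    qed
  qed (use f base_class_bounded base_class_measurable base_class_mult obs_bump_sequence in auto)
  moreover have "\<forall>\<^sub>F t in at_top. (\<integral>x. f x \<partial>M t) = (\<integral>\<omega>. f (bbm_obs T B \<alpha> t \<omega>) \<partial>uniform_measure P (hit_event t))"
    using eventually_ge_at_top[of 0] by eventually_elim (simp add: Mint fm)
  ultimately show "((\<lambda>t. \<integral>\<omega>. f (bbm_obs T B \<alpha> t \<omega>) \<partial>uniform_measure P (hit_event t)) \<longlongrightarrow> (\<integral>\<omega>. f (limit_obs \<omega>) \<partial>Q)) at_top"
    by (simp add: tendsto_cong Nint fm)
qed

end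

theorem theorem1p2:
  fixes P :: "'a measure"
    and T :: "bool list \<Rightarrow> 'a \<Rightarrow> real"
    and B :: "bool list \<Rightarrow> real \<Rightarrow> 'a \<Rightarrow> real"
    and L :: "point_measure measure"
    and \<alpha> :: real
  assumes bbm: "binary_bbm P T B"
    and extremal: "is_extremal_process P T B L"
    and \<alpha>: "\<alpha> \<in> {- gam<..<1}"
  shows "v_coeff \<alpha> \<in> {0<..<1}
    \<and> integrable lborel (\<lambda>z. exp (- (sqrt 2 * gam * z)) * (wave P T B z)\<^sup>2)
    \<and> C1 (wave P T B) > 0
    \<and> (\<lambda>t. \<P>(\<omega> in P. max_position T B t \<omega> \<le> sqrt 2 * \<alpha> * t))
        \<sim>[at_top]
      (\<lambda>t. C1 (wave P T B) * (v_coeff \<alpha> * t) powr (3 * gam / 2) * exp (- (2 * gam * (1 - \<alpha>) * t)))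
    \<and> (\<exists>(Q :: (real \<times> real \<times> real \<times> point_measure \<times> point_measure) measure) \<xi> chi E \<E>\<^sub>1 \<E>\<^sub>2 \<E>.
        prob_space Q
        \<and> distributed Q lborel \<xi> std_normal_density
        \<and> distributed Q lborel E (exponential_density (sqrt 2 * gam))
        \<and> (\<forall>x. \<forall>y\<ge>0. \<P>(\<omega> in Q. chi \<omega> \<le> x \<and> E \<omega> \<ge> y) =
              1 / (2 * C1 (wave P T B)) * exp (- (sqrt 2 * gam * y)) *
              (LINT z:{..x - y}|lborel. exp (- (sqrt 2 * gam * z)) * (wave P T B z)\<^sup>2))
        \<and> iid_conditioned_below Q chi \<E>\<^sub>1 \<E>\<^sub>2 L
        \<and> (\<forall>\<omega>\<in>space Q. \<E> \<omega> = point_shift (- chi \<omega>) (point_union (\<E>\<^sub>1 \<omega>) (\<E>\<^sub>2 \<omega>)))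
        \<and> (AE \<omega> in Q. E \<omega> = - point_max (\<E> \<omega>))
        \<and> independent_rvs Q borel \<xi> borel (\<lambda>\<omega>. (chi \<omega>, E \<omega>))
        \<and> independent_rvs Q borel \<xi> borel (\<lambda>\<omega>. (chi \<omega>, E \<omega>, \<E> \<omega>))
        \<and> converges_in_law
            (\<lambda>t. uniform_measure P {\<omega> \<in> space P. max_position T B t \<omega> \<le> sqrt 2 * \<alpha> * t})
            (\<lambda>t \<omega>. ((first_branching T \<omega> - (1 - \<alpha>) / sqrt 2 * t)
                        / sqrt (t * ((1 - \<alpha>) / (4 * sqrt 2))),
                      position T B [] (first_branching T \<omega>) \<omega>
                        - (sqrt 2 * \<alpha> * t - centering (t - first_branching T \<omega>)),
                      max_position T B t \<omega> - sqrt 2 * \<alpha> * t,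
                      particles T B t (sqrt 2 * \<alpha> * t) \<omega>))
            Q (\<lambda>\<omega>. (\<xi> \<omega>, - chi \<omega>, - E \<omega>, \<E> \<omega>)))"
proof -
  let ?Q = "limit_law L (C1 (wave P T B))"
  let ?A = "\<lambda>t. {\<omega> \<in> space P. max_position T B t \<omega> \<le> sqrt 2 * \<alpha> * t}"
  note ctx = bbm extremal \<alpha>
  \<comment> \<open>\<open>bbm_obs\<close> is written with the lifetime and the path of the root. It
    agrees with the quantities of the statement on \<open>space P\<close>, which is also the space
    of the conditional laws.\<close>
  have obs: "bbm_obs T B \<alpha> t \<omega> = ((first_branching T \<omega> - (1 - \<alpha>) / sqrt 2 * t) / sqrt (t * ((1 - \<alpha>) / (4 * sqrt 2))),
      position T B [] (first_branching T \<omega>) \<omega> - (sqrt 2 * \<alpha> * t - centering (t - first_branching T \<omega>)),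
      max_position T B t \<omega> - sqrt 2 * \<alpha> * t, particles T B t (sqrt 2 * \<alpha> * t) \<omega>)" if "\<omega> \<in> space P" for t \<omega>
    unfolding bbm_obs_def tau_std_def pos_std_def position_first_branching[OF bbm that]
    unfolding first_branching_eq[OF bbm that] ..
  have conv: "converges_in_law (\<lambda>t. uniform_measure P (?A t))
      (\<lambda>t \<omega>. ((first_branching T \<omega> - (1 - \<alpha>) / sqrt 2 * t) / sqrt (t * ((1 - \<alpha>) / (4 * sqrt 2))),
        position T B [] (first_branching T \<omega>) \<omega> - (sqrt 2 * \<alpha> * t - centering (t - first_branching T \<omega>)),
        max_position T B t \<omega> - sqrt 2 * \<alpha> * t, particles T B t (sqrt 2 * \<alpha> * t) \<omega>))
      ?Q (\<lambda>\<omega>. (fst \<omega>, - chi_of \<omega>, - exp_of \<omega>, proc_of \<omega>))"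
    using conditional_convergence[OF ctx] unfolding limit_obs_def[abs_def]
    by (rule converges_in_law_cong) (simp add: obs)
  show ?thesis
  proof (intro conjI exI)
    show "(\<lambda>t. \<P>(\<omega> in P. max_position T B t \<omega> \<le> sqrt 2 * \<alpha> * t)) \<sim>[at_top]
      (\<lambda>t. C1 (wave P T B) * (v_coeff \<alpha> * t) powr (3 * gam / 2) * exp (- (2 * gam * (1 - \<alpha>) * t)))"
      using hit_event_asymp[OF ctx] by (simp add: main_rate_def mult.assoc)
    show "\<forall>\<omega>\<in>space ?Q. proc_of \<omega> = point_shift (- chi_of \<omega>) (point_union (proc1 \<omega>) (proc2 \<omega>))"
      by (simp add: proc_of_def)
    show "\<forall>x. \<forall>y\<ge>0. \<P>(\<omega> in ?Q. chi_of \<omega> \<le> x \<and> exp_of \<omega> \<ge> y) =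
        1 / (2 * C1 (wave P T B)) * exp (- (sqrt 2 * gam * y)) *
        (LINT z:{..x - y}|lborel. exp (- (sqrt 2 * gam * z)) * (wave P T B z)\<^sup>2)"
      using joint_law[OF ctx] by blast
  qed (rule v_coeff_range[OF ctx] wave_integrable[OF ctx] C1_pos[OF ctx] prob_limit_law[OF ctx] xi_normal[OF ctx]
      exp_of_exponential[OF ctx] conditioned_iid[OF ctx] exp_of_max[OF ctx] xi_independent_obs[OF ctx] conv)+
qed

end
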